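(* Let $\mu$ be a non-homogeneous Gibbs capacity on $[0,1]^d$, let $0<\eta<1$ be a sampling index, and let $\mathsf{M}_\mu$ be the associated random capacity. Define $H_\ell(\eta_\ell)$, $q_{\eta_\ell}$, $H_\ell(\widetilde\eta)$, $q_{\widetilde\eta}$ and $\widetilde H_\ell(\widetilde\eta)$ as in the context. Then, with probability 1: (1) For every $H\in\mathbb R$, $$D_{\mathsf{M}_\mu}(H)=\begin{cases} D_\mu(H)-d(1-\eta) & \text{if } H_\ell(\eta_\ell)\le H\le H_\ell(\widetilde\eta),\\ q_{\widetilde\eta}\, H & \text{if } H_\ell(\widetilde\eta)\le H\le H_\ell(\widetilde\eta)+\widetilde H_\ell(\widetilde\eta),\\ D_\mu\big(H-\widetilde H_\ell(\widetilde\eta)\big) & \text{if } H_\ell(\widetilde\eta)+\widetilde H_\ell(\widetilde\eta)\le H\le H_{\max}+\widetilde H_\ell(\widetilde\eta),\\ -\infty & \text{otherwise.}\end{cases}$$ (2) For every $q\in\mathbb R$ the limit $\tau_{\mathsf{M}_\mu}(q)=\lim_{j\to\infty}\tau_{\mathsf{M}_\mu,j}(q)$ exists, $D_{\mathsf{M}_\mu}(H)=\tau_{\mathsf{M}_\mu}^*(H):=\inf_{q\in\mathbb R}(qH-\tau_{\mathsf{M}_\mu}(q))$ for all $H\in\mathbb R$ (i.e. $\tau_{\mathsf{M}_\mu}$ and $D_{\mathsf{M}_\mu}$ form a Legendre pair), and $$\tau_{\mathsf{M}_\mu}(q)=\begin{cases}\tau_\mu(q)+\widetilde H_\ell(\widetilde\eta)\,q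 & \text{if } q\le q_{\widetilde\eta},\\ \tau_\mu(q)+d(1-\eta) & \text{if } q_{\widetilde\eta}<q<q_{\eta_\ell},\\ H_\ell(\eta_\ell)\, q & \text{if } q_{\eta_\ell}<+\infty \text{ and } q\ge q_{\eta_\ell}.\end{cases}$$ (3) For all $H\ge H_\ell(\widetilde\eta)+\widetilde H_\ell(\widetilde\eta)$, $$\dim E_{\mathsf{M}_\mu}(H)=\dim\overline E_{\mathsf{M}_\mu}(H)=\begin{cases} D_\mu\big(H-\widetilde H_\ell(\widetilde\eta)\big)& \text{if } H\le H_{\max}+\widetilde H_\ell(\widetilde\eta),\\ -\infty & \text{if } H>H_{\max}+\widetilde H_\ell(\widetilde\eta).\end{cases}$$
   Context: Fix an integer $d\ge1$. For $j\ge1$, $\Sigma_j$ is the set of words $w=w_1\cdots w_j$ of length $|w|=j$ over the alphabet $\{0,1\}^d$, with $w_k=(w_k^{(1)},\dots,w_k^{(d)})$; $\Sigma^*=\bigcup_{j\ge1}\Sigma_j$; $\Sigma=(\{0,1\}^d)^{\mathbb N_+}$ is the set of infinite words with its standard ultrametric and left shift $\sigma$; $wv$ denotes concatenation, $w_{|j}$ the prefix of length $j$, and $[W]=\{w\in\Sigma:w_{|\,|W|}=W\}$ the cylinder of $W\in\Sigma^*$. To $w\in\Sigma_j$ associate $x_w=(\sum_{k=1}^j w_k^{(i)}2^{-k})_{1\le i\le d}$ and the dyadic cube $I_w=\prod_{i=1}^d[x_w^{(i)},x_w^{(i)}+2^{-j}]$. A point $x\in[0,1]^d$ is coded by the word whose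 $i$-th coordinate sequence is the binary expansion of $x^{(i)}$ (for a dyadic $x^{(i)}$ one takes the lexicographically largest expansion), and $x_{|j}$ denotes the prefix of length $j$ of this code. Gibbs capacity: let $\psi:\Sigma\to\mathbb R$ be Hölder continuous, $\Psi([w])=\sup_{t\in[w]}\sum_{i=0}^{|w|-1}\psi(\sigma^i t)$, $P(\sigma,\psi)=\lim_{j}\frac1j\log\sum_{w\in\Sigma_j}e^{\Psi([w])}$, and $\nu$ a Borel probability measure on $\Sigma$ such that for some $C_2>0$, $C_2^{-1}e^{\Psi([w])-|w|P(\sigma,\psi)}\le\nu([w])\le C_2e^{\Psi([w])-|w|P(\sigma,\psi)}$ for all $w\in\Sigma^*$. A Gibbs capacity is the function $\mu(I_w)=K\nu([w])^\alpha e^{-\beta|w|}$, $w\in\Sigma^*$, with $K>0$ and $(\alpha,\beta)\in[0,\infty)^2\setminus\{(0,0)\}$. It is non-homogeneous if $\alpha>0$ and $\psi$ is not cohomologous to a constant (no continuous $\varphi:\Sigma\to\mathbb R$ and $c\in\mathbb R$ satisfy $\psi=c+\varphi-\varphi\circ\sigma$). Spectra of $\mu$: $\tau_\mu(q)=\liminf_{j\to\infty}-\frac1j\log_2\sum_{w\in\Sigma_j}\mu(I_w)^q$; for a non-homogeneous Gibbs capacity this is a limit, analytic and strictly concave. Set $H_{\min}=\lim_{q\to+\infty}\tau_\mu'(q)$, $H_s=\tau_\mu'(0)$, $H_{\max}=\lim_{q\to-\infty}\tau_\mu'(q)$, and $D_\mu(H)=\tau_\mu^*(H)=\inf_{q}(qH-\tau_\mu(q))$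 (the singularity spectrum of $\mu$); $D_\mu$ is finite exactly on $[H_{\min},H_{\max}]\subset(0,\infty)$, strictly concave, analytic in the interior, maximal with value $d$ at $H_s$, and $D_\mu'(H_{\min}^+)=+\infty$. Exponents: $H_\ell(\eta_\ell)=\min\{H\ge0: D_\mu(H)\ge d(1-\eta)\}$ and $q_{\eta_\ell}=D_\mu'(H_\ell(\eta_\ell))$ (equal to $+\infty$ when $H_\ell(\eta_\ell)=H_{\min}$ with infinite slope); $H_\ell(\widetilde\eta)$ is the unique real number such that the tangent to the graph of $D_\mu$ at $(H_\ell(\widetilde\eta),D_\mu(H_\ell(\widetilde\eta)))$ passes through $(0,d(1-\eta))$, $q_{\widetilde\eta}=D_\mu'(H_\ell(\widetilde\eta))$, and $\widetilde H_\ell(\widetilde\eta)=-\tau_\mu(q_{\widetilde\eta})/q_{\widetilde\eta}$. Sampling: $(p_w)_{w\in\Sigma^*}$ are independent Bernoulli variables with $\mathbb P(p_w=1)=2^{-d(1-\eta)|w|}$. The random capacity is $\mathsf{M}_\mu(I_w)=\max\{\mu(I_{wv}): v\in\Sigma^*,\ p_{wv}=1\}$. Local dimensions and spectra of $\mathsf{M}_\mu$: $\underline\dim(\mathsf{M}_\mu,x)=\liminf_{j}\frac{\log_2\mathsf{M}_\mu(I_{x_{|j}})}{-j}$, $\overline\dim(\mathsf{M}_\mu,x)$ the corresponding limsup; $\underline E_{\mathsf{M}_\mu}(H)$, $\overline E_{\mathsf{M}_\mu}(H)$ are the sets of $x\in[0,1]^d$ where these equal $H$, $E_{\mathsf{M}_\mu}(H)=\underline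 E_{\mathsf{M}_\mu}(H)\cap\overline E_{\mathsf{M}_\mu}(H)$, and $D_{\mathsf{M}_\mu}(H)=\dim\underline E_{\mathsf{M}_\mu}(H)$, with $\dim$ the Hausdorff dimension and $\dim\emptyset=-\infty$. Also $\tau_{\mathsf{M}_\mu,j}(q)=-\frac1j\log_2\sum_{w\in\Sigma_j}\mathsf{M}_\mu(I_w)^q$ and $\tau_{\mathsf{M}_\mu}=\liminf_j\tau_{\mathsf{M}_\mu,j}$. *)

theory Defs
  imports "HOL-Analysis.Analysis" "HOL-Probability.Probability"
begin

(* Letters of the alphabet {0,1}^d are functions 'n => bool, with d = CARD('n).
   Finite words are lists of letters; infinite words are functions nat => letter
   (position k+1 of the word is the value at k). *)

type_synonym 'n letter = "'n \<Rightarrow> bool"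
type_synonym 'n word = "'n letter list"
type_synonym 'n iword = "nat \<Rightarrow> 'n letter"

definition shift :: "'n iword \<Rightarrow> 'n iword" where
  "shift t = (\<lambda>k. t (Suc k))"

definition sym_dist :: "'n iword \<Rightarrow> 'n iword \<Rightarrow> real" where
  "sym_dist s t = (if s = t then 0 else 2 powr (- real (LEAST n. s n \<noteq> t n)))"

definition cyl :: "'n word \<Rightarrow> 'n iword set" where
  "cyl w = {t. \<forall>k < length w. t k = w ! k}"

definition holder_continuous :: "('n iword \<Rightarrow> real) \<Rightarrow> bool" where
  "holder_continuous f \<longleftrightarrow>
     (\<exists>C \<gamma>. \<gamma> > 0 \<and> (\<forall>s t. \<bar>f s - f t\<bar> \<le> C * sym_dist s t powr \<gamma>))"

definition sym_continuous :: "('n iword \<Rightarrow> real) \<Rightarrow> bool" where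
  "sym_continuous f \<longleftrightarrow>
     (\<forall>t. \<forall>\<epsilon>>0. \<exists>\<delta>>0. \<forall>s. sym_dist s t < \<delta> \<longrightarrow> \<bar>f s - f t\<bar> < \<epsilon>)"

definition cohomologous_to_const :: "('n iword \<Rightarrow> real) \<Rightarrow> bool" where
  "cohomologous_to_const \<psi> \<longleftrightarrow>
     (\<exists>\<phi> c. sym_continuous \<phi> \<and> (\<forall>t. \<psi> t = c + \<phi> t - \<phi> (shift t)))"

definition Psi :: "('n iword \<Rightarrow> real) \<Rightarrow> 'n word \<Rightarrow> real" where
  "Psi \<psi> w = (SUP t\<in>cyl w. (\<Sum>i<length w. \<psi> ((shift ^^ i) t)))"

definition words :: "nat \<Rightarrow> 'n word set" where
  "words j = {w. length w = j}"

definition pressure :: "('n::finite iword \<Rightarrow> real) \<Rightarrow> real" where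
  "pressure \<psi> = lim (\<lambda>j. (1 / real j) * ln (\<Sum>w\<in>words j. exp (Psi \<psi> w)))"

(* nu is a Gibbs measure for psi: a Borel probability measure on Sigma
   (the Borel sigma-algebra of Sigma is generated by the cylinders) *)
definition gibbs_measure :: "('n::finite iword \<Rightarrow> real) \<Rightarrow> 'n iword measure \<Rightarrow> bool" where
  "gibbs_measure \<psi> \<nu> \<longleftrightarrow>
     prob_space \<nu> \<and> space \<nu> = UNIV \<and>
     sets \<nu> = sigma_sets UNIV {cyl w | w. w \<noteq> []} \<and>
     (\<exists>C2>0. \<forall>w. w \<noteq> [] \<longrightarrow>
        (1 / C2) * exp (Psi \<psi> w - real (length w) * pressure \<psi>) \<le> measure \<nu> (cyl w) \<and>
        measure \<nu> (cyl w) \<le> C2 * exp (Psi \<psi> w - real (length w) * pressure \<psi>))"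

(* Gibbs capacity: mu(I_w) as a function of the word w *)
definition gibbs_cap :: "'n iword measure \<Rightarrow> real \<Rightarrow> real \<Rightarrow> real \<Rightarrow> 'n word \<Rightarrow> real" where
  "gibbs_cap \<nu> K \<alpha> \<beta> w = K * (measure \<nu> (cyl w)) powr \<alpha> * exp (- \<beta> * real (length w))"

(* L^q spectrum of a capacity m (given on dyadic cubes I_w, i.e. on words w) *)
definition tau_j :: "('n::finite word \<Rightarrow> real) \<Rightarrow> nat \<Rightarrow> real \<Rightarrow> real" where
  "tau_j m j q = - (1 / real j) * log 2 (\<Sum>w\<in>words j. m w powr q)"

definition tau_cap :: "('n::finite word \<Rightarrow> real) \<Rightarrow> real \<Rightarrow> real" where
  "tau_cap m q = real_of_ereal (liminf (\<lambda>j. ereal (tau_j m j q)))"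

definition legendre :: "(real \<Rightarrow> real) \<Rightarrow> real \<Rightarrow> ereal" where
  "legendre f H = (INF q. ereal (q * H - f q))"

definition Dspec :: "('n::finite word \<Rightarrow> real) \<Rightarrow> real \<Rightarrow> ereal" where
  "Dspec m H = legendre (tau_cap m) H"

definition Dreal :: "('n::finite word \<Rightarrow> real) \<Rightarrow> real \<Rightarrow> real" where
  "Dreal m H = real_of_ereal (Dspec m H)"

definition Hmin :: "('n::finite word \<Rightarrow> real) \<Rightarrow> real" where
  "Hmin m = Lim at_top (\<lambda>q. deriv (tau_cap m) q)"

definition Hmax :: "('n::finite word \<Rightarrow> real) \<Rightarrow> real" where
  "Hmax m = Lim at_bot (\<lambda>q. deriv (tau_cap m) q)"

(* exponents; c stands for d(1-eta) *)
definition H_ell :: "('n::finite word \<Rightarrow> real) \<Rightarrow> real \<Rightarrow> real" where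
  "H_ell m c = Inf {H. H \<ge> 0 \<and> Dspec m H \<ge> ereal c}"

definition q_ell :: "('n::finite word \<Rightarrow> real) \<Rightarrow> real \<Rightarrow> ereal" where
  "q_ell m c = (if H_ell m c = Hmin m then \<infinity> else ereal (deriv (Dreal m) (H_ell m c)))"

definition H_tilde :: "('n::finite word \<Rightarrow> real) \<Rightarrow> real \<Rightarrow> real" where
  "H_tilde m c = (THE H. Hmin m < H \<and> H < Hmax m \<and>
                      Dreal m H + deriv (Dreal m) H * (0 - H) = c)"

definition q_tilde :: "('n::finite word \<Rightarrow> real) \<Rightarrow> real \<Rightarrow> real" where
  "q_tilde m c = deriv (Dreal m) (H_tilde m c)"

definition Htilde_tilde :: "('n::finite word \<Rightarrow> real) \<Rightarrow> real \<Rightarrow> real" where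
  "Htilde_tilde m c = - tau_cap m (q_tilde m c) / q_tilde m c"

definition Mcap :: "('n word \<Rightarrow> real) \<Rightarrow> ('n word \<Rightarrow> bool) \<Rightarrow> 'n word \<Rightarrow> real" where
  "Mcap m p w = Sup {m (w @ v) | v. v \<noteq> [] \<and> p (w @ v)}"

(* coding of points of [0,1]^d: binary expansions, the lexicographically largest one
   (i.e. the finite one) for dyadic coordinates; position k+1 is stored at index k *)
definition code :: "real ^ 'n \<Rightarrow> 'n iword" where
  "code x = (\<lambda>k i. if x $ i = 1 then True else odd \<lfloor>2 ^ (Suc k) * x $ i\<rfloor>)"

definition prefix_code :: "real ^ 'n \<Rightarrow> nat \<Rightarrow> 'n word" where
  "prefix_code x j = map (code x) [0..<j]"

definition unit_cube :: "(real ^ 'n) set" where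
  "unit_cube = {x. \<forall>i. 0 \<le> x $ i \<and> x $ i \<le> 1}"

definition lower_dim :: "('n::finite word \<Rightarrow> real) \<Rightarrow> real ^ 'n \<Rightarrow> ereal" where
  "lower_dim m x = liminf (\<lambda>j. ereal (log 2 (m (prefix_code x j)) / - real j))"

definition upper_dim :: "('n::finite word \<Rightarrow> real) \<Rightarrow> real ^ 'n \<Rightarrow> ereal" where
  "upper_dim m x = limsup (\<lambda>j. ereal (log 2 (m (prefix_code x j)) / - real j))"

definition lowerE :: "('n::finite word \<Rightarrow> real) \<Rightarrow> real \<Rightarrow> (real ^ 'n) set" where
  "lowerE m H = {x \<in> unit_cube. lower_dim m x = ereal H}"

definition upperE :: "('n::finite word \<Rightarrow> real) \<Rightarrow> real \<Rightarrow> (real ^ 'n) set" where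
  "upperE m H = {x \<in> unit_cube. upper_dim m x = ereal H}"

definition levelE :: "('n::finite word \<Rightarrow> real) \<Rightarrow> real \<Rightarrow> (real ^ 'n) set" where
  "levelE m H = lowerE m H \<inter> upperE m H"

definition hausdorff_pre :: "real \<Rightarrow> real \<Rightarrow> 'a::metric_space set \<Rightarrow> ennreal" where
  "hausdorff_pre s \<delta> E = (INF U\<in>{U :: nat \<Rightarrow> 'a set. E \<subseteq> (\<Union>i. U i) \<and>
        (\<forall>i. bounded (U i) \<and> diameter (U i) \<le> \<delta>)}.
      (\<Sum>i. ennreal (diameter (U i) powr s)))"

definition hausdorff_measure :: "real \<Rightarrow> 'a::metric_space set \<Rightarrow> ennreal" where
  "hausdorff_measure s E = (SUP \<delta>\<in>{0<..}. hausdorff_pre s \<delta> E)"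

definition hdim :: "'a::metric_space set \<Rightarrow> ereal" where
  "hdim E = (if E = {} then - \<infinity>
             else (INF s\<in>{s. s \<ge> 0 \<and> hausdorff_measure s E = 0}. ereal s))"

definition sampling :: "'w measure \<Rightarrow> ('n::finite word \<Rightarrow> 'w \<Rightarrow> bool) \<Rightarrow> real \<Rightarrow> bool" where
  "sampling P p \<eta> \<longleftrightarrow> prob_space P \<and>
     prob_space.indep_vars P (\<lambda>_. count_space UNIV) p {w. w \<noteq> []} \<and>
     (\<forall>w. w \<noteq> [] \<longrightarrow>
        measure P {\<omega>\<in>space P. p w \<omega>} = 2 powr (- real CARD('n) * (1 - \<eta>) * real (length w)))"

end

theory Submission imports Defs "HOL-Real_Asymp.Real_Asymp" begin

text \<open>The function \<open>g = - log\<^sub>2 \<mu>\<close> is quasi-additive on words, which alone yields a concave differentiable \<open>T = \<tau>\<^sub>\<mu>\<close>,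
with about \<open>2\<^bsup>n (q T' q - T q)\<^esup>\<close> words of length \<open>n\<close> of type \<open>g w \<approx> n T' q\<close>; strictness of the concavity is a Livsic argument. The capacity
of \<open>w\<close> is governed by its best surviving descendant, and costs \<open>f w - g w\<close>, whose maximal size \<open>HHt * length w\<close> is attained for the type
of \<open>qt\<close>, where \<open>T qt = - c\<close> (here \<open>c = d (1 - \<eta>)\<close>, and \<open>qt\<close>, \<open>HHt\<close> are the constants so named in the theorem). First moments bound the number of words with a smaller cost. Hence a typical point of
\<open>g\<close>-exponent \<open>h\<close> has exponent \<open>h + HHt\<close>, and prescribing the cost \<open>r \<le> HHt\<close> along a sparse sequence of scales changes the dimension \<open>D h\<close> to
\<open>D h + r qt - c\<close>; Cantor sets built from steps whose length exceeds the past realise these values, and the moments give the matching upper bounds.\<close>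

text \<open>The constants come from one trade-off. Below a word of length \<open>l\<close> there are
  about \<open>2 powr (y*l*D h)\<close> words of exponent \<open>h\<close> and relative depth
  \<open>y\<close>, each sampled with probability \<open>2 powr (- c*(1 + y)*l)\<close>; some
  survive once \<open>y*(D h - c) > c\<close>, at cost \<open>y*h*l\<close>. The cheapest exponent
  therefore maximises \<open>(D h - c)/h\<close>, the slope of the line from \<open>(0, c)\<close>,
  which is the tangency defining \<open>qt\<close>, and the least cost is \<open>l*c/qt\<close>. A
  cost below \<open>r*l\<close> has probability about \<open>2 powr (- (c - r*qt)*l)\<close>, hence
  the loss of dimension \<open>c - r*qt\<close>. The obstacle is dependence: one survivor serves all
  its ancestors, so a cheap descendant prepared for one scale can spoil the cost at others. The
  estimates therefore count explicit witnesses, distinct words whose samples are independent. The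
  almost sure events are imposed for countably many parameters, and continuity and monotonicity
  carry them to the rest. Gibbs measures enter through finite weighted sums, with a variational
  inequality in the place of ergodic theorems.\<close>

abbreviation ev :: "(nat => bool) => bool" where "ev P \<equiv> eventually P sequentially"

section \<open>Sums over words\<close>

lemma finite_words [simp]: "finite (words n :: 'n::finite word set)"
proof -
 have "words n = {w :: 'n word. set w \<subseteq> UNIV & length w = n}" by (auto simp: words_def)
 thus ?thesis using finite_lists_length_eq[of "UNIV :: 'n letter set" n] by simp
qed

lemma card_words: "card (words n :: 'n::finite word set) = 2 ^ (CARD('n)*n)"
proof -
 have "words n = {w :: 'n word. set w \<subseteq> UNIV & length w = n}" by (auto simp: words_def)
 thus ?thesis using card_lists_length_eq[of "UNIV :: 'n letter set" n]
  by (simp add: card_UNIV_bool card_fun power_mult)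
qed

lemma words_0 [simp]: "words 0 = {[]}" by (auto simp: words_def)

lemma words_ne [simp]: "words n ~= {}"
proof -
 have "replicate n undefined \<in> words n" by (simp add: words_def)
 thus ?thesis by blast
qed

lemma bij_words_append: "bij_betw (%(u, v). u @ v) (words m \<times> words n) (words (m + n))"
proof (rule bij_betwI[where g = "\<lambda>w. (take m w, drop m w)"])
qed (auto simp: words_def)

lemma sum_words_append:
 fixes f :: "'n::finite word => real"
 shows "(\<Sum>w\<in>words (m + n). f w) = (\<Sum>u\<in>words m. \<Sum>v\<in>words n. f (u @ v))"
proof -
 have "(\<Sum>w\<in>words (m + n). f w) = (\<Sum>x\<in>words m \<times> words n. f (case x of (u, v) => u @ v))"
  by (rule sum.reindex_bij_betw[OF bij_words_append, symmetric])
 also have "... = (\<Sum>u\<in>words m. \<Sum>v\<in>words n. f (u @ v))"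
  by (simp add: sum.cartesian_product case_prod_unfold)
 finally show ?thesis .
qed

section \<open>Quasi-additive functions of words\<close>

text \<open>Both \<open>a m/m\<close> and \<open>a n/n\<close> are close to
  \<open>a (m*n)/(m*n)\<close>, which gives the Cauchy property. The two-sided hypothesis leaves an
  error \<open>c\<close> that does not grow with \<open>n\<close>; this makes partition functions
  exponential up to a constant factor.\<close>

lemma almost_additive_limit:
 fixes a :: "nat => real"
 assumes a: "!!m n. \<bar>a (m + n) - a m - a n\<bar> <= c"
 shows "\<exists>L. (%n. a n/n) \<longlonglongrightarrow> L & (\<forall>n. \<bar>a n - n*L\<bar> <= c)"
proof -
 have c0: "c >= 0" using a[of 0 0] by linarith
 have mult: "\<bar>a (Suc m*n) - Suc m*a n\<bar> <= m*c" for m n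
 proof (induction m)
  case 0 show ?case by simp
 next
  case (Suc m)
  have "\<bar>a (n + Suc m*n) - a n - a (Suc m*n)\<bar> <= c" by (rule a)
  thus ?case using Suc by (simp add: algebra_simps)
 qed
 have mult': "\<bar>a (m*n)/(m*n) - a n/n\<bar> <= c/n" if mn: "m > 0" "n > 0" for m n :: nat
 proof -
  obtain k where k: "m = Suc k" using mn by (cases m) auto
  have "\<bar>a (m*n) - m*a n\<bar> <= m*c"
   using mult[of k n] c0 k by (simp add: algebra_simps)
  hence "\<bar>a (m*n) - m*a n\<bar>/(m*n) <= m*c/(m*n)"
   by (intro divide_right_mono) auto
  moreover have "a (m*n)/(m*n) - a n/n = (a (m*n) - m*a n)/(m*n)"
   using mn by (simp add: field_simps)
  ultimately show ?thesis using mn by (simp add: abs_divide)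
 qed
 have cau: "\<bar>a m/m - a n/n\<bar> <= c/n + c/m" if mn: "m > 0" "n > 0" for m n :: nat
  using mult'[OF mn] mult'[OF mn(2,1)] by (simp add: mult.commute)
 have "Cauchy (%n. a n/n)"
 proof (rule CauchyI)
  fix e :: real assume e: "e > 0"
  obtain M :: nat where M: "2*c/e < M" using reals_Archimedean2 by blast
  have "norm (a m/m - a n/n) < e" if "m >= Suc M" "n >= Suc M" for m n
  proof -
   have s: "c/k < e/2" if "k >= Suc M" for k :: nat
   proof -
    have "2*c < e*k"
    proof -
     have "2*c < e*M" using M e by (simp add: field_simps)
     also have "... <= e*k" using that e by (intro mult_left_mono) auto
     finally show ?thesis .
    qed
    thus ?thesis using that by (simp add: field_simps)
   qed
   have "\<bar>a m/m - a n/n\<bar> <= c/n + c/m" by (rule cau) (use that in auto)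
   thus ?thesis using s[OF that(1)] s[OF that(2)] unfolding real_norm_def by linarith
  qed
  thus "\<exists>M. \<forall>m\<ge>M. \<forall>n\<ge>M. norm (a m/m - a n/n) < e" by blast
 qed
 then obtain L where L: "(%n. a n/n) \<longlonglongrightarrow> L"
  using Cauchy_convergent_iff convergent_def by blast
 have "\<bar>a n - n*L\<bar> <= c" for n
 proof (cases "n = 0")
  case True thus ?thesis using a[of 0 0] by simp
 next
  case False
  have l1: "(%m. \<bar>a m/m - a n/n\<bar>) \<longlonglongrightarrow> \<bar>L - a n/n\<bar>" by (intro tendsto_intros L)
  have "(%m. c/n + c/real m) \<longlonglongrightarrow> c/n + 0"
   by (intro tendsto_intros lim_const_over_n)
  hence "\<bar>L - a n/n\<bar> <= c/n + 0"
   using l1 cau False by (intro LIMSEQ_le[OF l1]) (auto intro!: exI[of _ 1])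
  hence "\<bar>L - a n/n\<bar>*n <= c" using False by (simp add: field_simps)
  moreover have "\<bar>L - a n/n\<bar>*n = \<bar>(L - a n/n)*n\<bar>" by (simp add: abs_mult)
  moreover have "(L - a n/n)*n = - (a n - n*L)" using False by (simp add: field_simps)
  ultimately show ?thesis by (simp only: abs_minus_cancel)
 qed
 thus ?thesis using L by blast
qed

lemma append_image_set: "{x @ u |x u. x \<in> A & u \<in> B} = (%(x, u). x @ u) ` (A \<times> B)"
 by auto

lemma inj_on_append:
 assumes "!!x. x \<in> A ==> length x = m"
 shows "inj_on (%(x, u). x @ u) (A \<times> B)"
proof (rule inj_onI)
 fix y z assume "y \<in> A \<times> B" "z \<in> A \<times> B" "(case y of (x, u) => x @ u) = (case z of (x, u) => x @ u)"
 thus "y = z" using assms[of "fst y"] assms[of "fst z"] by (cases y; cases z) auto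
qed

text \<open>Removes bounded errors: an inequality proved at scale \<open>n\<close> with error
  \<open>K\<close> becomes exact after division by \<open>n\<close>.\<close>

lemma bounded_by_over_n:
 fixes x y :: real
 assumes "!!n::nat. n > 0 ==> n*x <= n*y + K"
 shows "x <= y"
proof (rule ccontr)
 assume "\<not> x <= y"
 then obtain n :: nat where n: "n*(x - y) > \<bar>K\<bar>"
  using ex_less_of_nat_mult[of "x - y" "\<bar>K\<bar>"] by auto
 hence "n > 0" by (cases n) auto
 with assms[of n] n show False by (simp add: algebra_simps)
qed

text \<open>Here \<open>g\<close> is minus the binary logarithm of the capacity. The empty word is
  included, and a single \<open>c0\<close> absorbs both the defect of additivity and the
  multiplicative constant of the capacity; \<open>\<delta> > 0\<close> expresses exponential decay
  along every branch.\<close>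

locale quasi_additive =
 fixes g :: "'n::finite word => real" and c0 \<delta> G :: real
 assumes qa: "\<bar>g (u @ v) - g u - g v\<bar> <= c0"
  and g_ge: "\<delta>*length w - c0 <= g w"
  and g_le: "g w <= G*length w + c0"
  and \<delta>_pos: "\<delta> > 0"
begin

lemma c0_nonneg: "c0 >= 0" using qa[of "[]" "[]"] by linarith

lemma \<delta>_le_G: "\<delta> <= G"
proof (rule ccontr)
 assume "\<not> \<delta> <= G"
 then obtain n :: nat where "n*(\<delta> - G) > 2*c0"
  using ex_less_of_nat_mult[of "\<delta> - G" "2*c0"] by (auto simp: mult.commute)
 moreover have "\<delta>*n - c0 <= G*n + c0"
  using g_ge[of "replicate n undefined"] g_le[of "replicate n undefined"] by simp
 ultimately show False by (simp add: algebra_simps)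
qed

lemma G_pos: "G > 0" using \<delta>_pos \<delta>_le_G by linarith

text \<open>\<open>W q\<close> is the \<open>q\<close>-th power of the capacity, \<open>Z q\<close>
  its partition function, and \<open>C q\<close> bounds the failure of \<open>W q\<close> to be
  multiplicative under concatenation.\<close>

definition W :: "real => 'n word => real" where "W q w = 2 powr (- q*g w)"
definition Z :: "real => nat => real" where "Z q n = (\<Sum>w\<in>words n. W q w)"
definition C :: "real => real" where "C q = 2 powr (\<bar>q\<bar>*c0)"

lemma W_pos [simp]: "W q w > 0" "W q w >= 0" by (auto simp: W_def)

lemma Z_pos [simp]: "Z q n > 0" unfolding Z_def by (intro sum_pos) auto

lemma Z_pos' [simp]: "Z q n >= 0" "Z q n ~= 0" using Z_pos[of q n] by linarith+

lemma C_ge_1: "C q >= 1"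
 unfolding C_def by (intro ge_one_powr_ge_zero) (auto simp: c0_nonneg)

lemma C_pos [simp]: "C q > 0" "C q >= 0" by (auto simp: C_def)

lemma C_nonzero: "C q ~= 0" using C_pos(1)[of q] by linarith

lemma W_append:
 "W q (u @ v) <= C q*(W q u*W q v)" "W q u*W q v <= C q*W q (u @ v)"
proof -
 have "\<bar>q*(g (u @ v) - g u - g v)\<bar> <= \<bar>q\<bar>*c0"
  unfolding abs_mult by (intro mult_left_mono qa) auto
 hence "q*g (u @ v) - q*g u - q*g v <= \<bar>q\<bar>*c0" "- (q*g (u @ v) - q*g u - q*g v) <= \<bar>q\<bar>*c0"
  by (simp_all add: algebra_simps)
 thus "W q (u @ v) <= C q*(W q u*W q v)" "W q u*W q v <= C q*W q (u @ v)"
  unfolding W_def C_def by (simp_all flip: powr_add)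
qed

lemma Z_append: "Z q (m + n) <= C q*(Z q m*Z q n)" "Z q m*Z q n <= C q*Z q (m + n)"
proof -
 have p: "Z q m*Z q n = (\<Sum>u\<in>words m. \<Sum>v\<in>words n. W q u*W q v)"
  unfolding Z_def by (simp add: sum_product)
 have a: "Z q (m + n) = (\<Sum>u\<in>words m. \<Sum>v\<in>words n. W q (u @ v))"
  unfolding Z_def by (rule sum_words_append)
 show "Z q (m + n) <= C q*(Z q m*Z q n)"
  unfolding p a sum_distrib_left by (intro sum_mono W_append)
 show "Z q m*Z q n <= C q*Z q (m + n)"
  unfolding p a sum_distrib_left by (intro sum_mono W_append)
qed

definition T :: "real => real" where "T q = - lim (%n. log 2 (Z q n)/n)"

lemma log_Z: "(%n. log 2 (Z q n)/n) \<longlonglongrightarrow> - T q" "\<bar>log 2 (Z q n) + n*T q\<bar> <= \<bar>q\<bar>*c0"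
proof -
 have "\<bar>log 2 (Z q (m + n)) - log 2 (Z q m) - log 2 (Z q n)\<bar> <= \<bar>q\<bar>*c0" for m n
 proof -
  have "log 2 (Z q (m + n)) <= log 2 (C q*(Z q m*Z q n))"
   by (rule log_mono) (use Z_append in auto)
  hence 1: "log 2 (Z q (m + n)) <= \<bar>q\<bar>*c0 + log 2 (Z q m) + log 2 (Z q n)"
   by (simp add: log_mult C_def)
  have "log 2 (Z q m*Z q n) <= log 2 (C q*Z q (m + n))"
   by (rule log_mono) (use Z_append in auto)
  hence 2: "log 2 (Z q m) + log 2 (Z q n) <= \<bar>q\<bar>*c0 + log 2 (Z q (m + n))"
   by (simp add: log_mult C_def)
  show ?thesis using 1 2 by linarith
 qed
 from almost_additive_limit[OF this] obtain L where
  L: "(%n. log 2 (Z q n)/n) \<longlonglongrightarrow> L" "\<forall>n. \<bar>log 2 (Z q n) - n*L\<bar> <= \<bar>q\<bar>*c0" by auto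
 have "T q = - L" using limI[OF L(1)] by (simp add: T_def)
 thus "(%n. log 2 (Z q n)/n) \<longlonglongrightarrow> - T q" "\<bar>log 2 (Z q n) + n*T q\<bar> <= \<bar>q\<bar>*c0"
  using L by auto
qed

lemma Z_bounds:
 fixes n :: nat
 shows "Z q n <= C q*2 powr (- n*T q)" "2 powr (- n*T q) <= C q*Z q n"
proof -
 have z: "Z q n = 2 powr (log 2 (Z q n))" by simp
 have "2 powr (log 2 (Z q n)) <= 2 powr (\<bar>q\<bar>*c0 + - n*T q)"
  by (rule powr_mono) (use log_Z(2)[of q n] in auto)
 thus "Z q n <= C q*2 powr (- n*T q)" unfolding powr_add C_def by simp
 have "2 powr (- n*T q) <= 2 powr (\<bar>q\<bar>*c0 + log 2 (Z q n))"
  by (rule powr_mono) (use log_Z(2)[of q n] in auto)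
 thus "2 powr (- n*T q) <= C q*Z q n" unfolding powr_add C_def by simp
qed

lemma T_0: "T 0 = - real CARD('n)"
proof -
 have "\<bar>log 2 (Z 0 1) + T 0\<bar> <= 0" using log_Z(2)[of 0 1] by simp
 moreover have "Z 0 1 = 2 ^ CARD('n)" by (simp add: Z_def W_def card_words)
 ultimately show ?thesis by (simp add: log_nat_power)
qed

text \<open>The finite variational principle: entropy minus \<open>q\<close> times the mean energy
  is at most the logarithm of the partition function. Termwise it is \<open>ln x <= x - 1\<close>
  with \<open>x\<close> the ratio of the Gibbs probability to \<open>p w\<close>; the linear
  remainders sum to zero.\<close>

lemma gibbs_inequality:
 assumes p: "!!w. w \<in> words n ==> p w >= 0" "(\<Sum>w\<in>words n. p w) = 1"
 shows "(\<Sum>w\<in>words n. p w*(- log 2 (p w) - q*g w)) <= log 2 (Z q n)"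
proof -
 have "p w*(- log 2 (p w) - q*g w) <= p w*log 2 (Z q n) + (W q w/Z q n - p w)/ln 2"
  if w: "w \<in> words n" for w
 proof (cases "p w = 0")
  case True thus ?thesis by (simp add: less_imp_le)
 next
  case False
  hence pw: "p w > 0" using p(1)[OF w] by linarith
  define x where "x = W q w/(Z q n*p w)"
  have x: "x > 0" using pw by (simp add: x_def)
  have "log 2 x <= (x - 1)/ln 2" using ln_le_minus_one[OF x] by (simp add: log_def divide_right_mono)
  hence "p w*log 2 x <= p w*((x - 1)/ln 2)" using pw by (intro mult_left_mono) auto
  moreover have "p w*((x - 1)/ln 2) = (W q w/Z q n - p w)/ln 2"
   using pw by (simp add: x_def field_simps)
  moreover have "log 2 x = - q*g w - log 2 (Z q n) - log 2 (p w)"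
   using pw by (simp add: x_def log_divide log_mult W_def)
  ultimately show ?thesis by (simp add: algebra_simps)
 qed
 hence "(\<Sum>w\<in>words n. p w*(- log 2 (p w) - q*g w))
   <= (\<Sum>w\<in>words n. p w*log 2 (Z q n) + (W q w/Z q n - p w)/ln 2)"
  by (intro sum_mono) auto
 also have "... = log 2 (Z q n)"
  by (simp add: sum.distrib p(2) sum_subtractf diff_divide_distrib flip: sum_distrib_right sum_divide_distrib Z_def)
 finally show ?thesis .
qed

text \<open>Domination by the Gibbs weights at \<open>q\<close> bounds the entropy of
  \<open>p\<close> from below, up to \<open>log 2 C1\<close>. Inserting this into the variational
  inequality at another parameter \<open>q'\<close> confines the mean of \<open>g\<close> by the
  increment of \<open>T\<close> between \<open>q\<close> and \<open>q'\<close>. The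
  differentiability proof and the deviation bounds rest on this estimate.\<close>

lemma mean_bound:
 assumes p: "!!w. w \<in> words n ==> p w >= 0" "(\<Sum>w\<in>words n. p w) = 1"
  and C1: "C1 > 0" "!!w. w \<in> words n ==> p w <= C1*(W q w*2 powr (n*T q))"
 shows "(q - q')*(\<Sum>w\<in>words n. p w*g w) <= n*(T q - T q') + log 2 C1 + \<bar>q'\<bar>*c0"
proof -
 have "p w*(- log 2 C1 + (q - q')*g w - n*T q) <= p w*(- log 2 (p w) - q'*g w)"
  if w: "w \<in> words n" for w
 proof (cases "p w = 0")
  case False
  hence pw: "p w > 0" using p(1)[OF w] by linarith
  have "log 2 (p w) <= log 2 (C1*(W q w*2 powr (n*T q)))"
   using C1 pw w by (intro log_mono) auto
  also have "... = log 2 C1 - q*g w + n*T q"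
   using C1 by (simp add: log_mult W_def)
  finally show ?thesis using pw by (intro mult_left_mono) (auto simp: algebra_simps)
 qed simp
 hence "(\<Sum>w\<in>words n. p w*(- log 2 C1 + (q - q')*g w - n*T q))
   <= (\<Sum>w\<in>words n. p w*(- log 2 (p w) - q'*g w))" by (intro sum_mono) auto
 also have "... <= log 2 (Z q' n)" by (rule gibbs_inequality[OF p])
 also have "... <= - (n*T q') + \<bar>q'\<bar>*c0" using log_Z(2)[of q' n] by linarith
 finally have "(\<Sum>w\<in>words n. p w*(- log 2 C1 + (q - q')*g w - n*T q)) <= - (n*T q') + \<bar>q'\<bar>*c0" .
 moreover have "(\<Sum>w\<in>words n. p w*(- log 2 C1 + (q - q')*g w - n*T q))
   = (\<Sum>w\<in>words n. p w)*(- log 2 C1 - n*T q) + (q - q')*(\<Sum>w\<in>words n. p w*g w)"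
  by (simp add: sum_distrib_left sum_distrib_right flip: sum.distrib) (simp add: algebra_simps)
 ultimately show ?thesis using p(2) by (simp add: algebra_simps)
qed

definition mean :: "real => nat => real" where
 "mean q n = (\<Sum>w\<in>words n. W q w/Z q n*g w)"

lemma gibbs_sum: "(\<Sum>w\<in>words n. W q w/Z q n) = 1"
 by (simp flip: sum_divide_distrib Z_def)

lemma gibbs_le: "W q w/Z q n <= C q*(W q w*2 powr (n*T q))"
proof -
 have "1 <= C q*Z q n*2 powr (n*T q)"
  using Z_bounds(2)[where q=q and n=n] by (simp add: powr_minus field_simps)
 hence "W q w*1 <= W q w*(C q*Z q n*2 powr (n*T q))" by (intro mult_left_mono) auto
 thus ?thesis by (simp add: field_simps)
qed

lemma mean_ineq: "(q - q')*mean q n <= n*(T q - T q') + (\<bar>q\<bar> + \<bar>q'\<bar>)*c0"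
proof -
 have "(q - q')*(\<Sum>w\<in>words n. W q w/Z q n*g w)
   <= n*(T q - T q') + log 2 (C q) + \<bar>q'\<bar>*c0"
  by (rule mean_bound) (auto simp: gibbs_sum intro: gibbs_le)
 thus ?thesis by (simp add: mean_def C_def algebra_simps)
qed

lemma expectation_bounds:
 assumes p: "!!w. w \<in> words n ==> p w >= 0" "(\<Sum>w\<in>words n. p w) = 1"
 shows "\<delta>*n - c0 <= (\<Sum>w\<in>words n. p w*g w)" "(\<Sum>w\<in>words n. p w*g w) <= G*n + c0"
proof -
 have "(\<Sum>w\<in>words n. p w)*(\<delta>*n - c0) <= (\<Sum>w\<in>words n. p w*g w)"
  unfolding sum_distrib_right
  by (intro sum_mono mult_left_mono p) (use g_ge in \<open>auto simp: words_def\<close>)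
 thus "\<delta>*n - c0 <= (\<Sum>w\<in>words n. p w*g w)" by (simp add: p(2))
 have "(\<Sum>w\<in>words n. p w*g w) <= (\<Sum>w\<in>words n. p w)*(G*n + c0)"
  unfolding sum_distrib_right
  by (intro sum_mono mult_left_mono p) (use g_le in \<open>auto simp: words_def\<close>)
 thus "(\<Sum>w\<in>words n. p w*g w) <= G*n + c0" by (simp add: p(2))
qed

lemma mean_bounds: "\<delta>*n - c0 <= mean q n" "mean q n <= G*n + c0"
 unfolding mean_def by (rule expectation_bounds; simp add: gibbs_sum)+

lemma T_diff_ge: "q' <= q ==> \<delta>*(q - q') <= T q - T q'"
proof (rule bounded_by_over_n)
 fix n :: nat assume q: "q' <= q"
 have "(q - q')*(\<delta>*n - c0) <= (q - q')*mean q n"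
  using q mean_bounds by (intro mult_left_mono) auto
 with mean_ineq[of q q' n]
 show "n*(\<delta>*(q - q')) <= n*(T q - T q') + ((\<bar>q\<bar> + \<bar>q'\<bar>)*c0 + (q - q')*c0)"
  by (simp add: algebra_simps)
qed

lemma T_diff_le: "q' <= q ==> T q - T q' <= G*(q - q')"
proof (rule bounded_by_over_n)
 fix n :: nat assume q: "q' <= q"
 have "(q - q')*mean q' n <= (q - q')*(G*n + c0)"
  using q mean_bounds by (intro mult_left_mono) auto
 with mean_ineq[of q' q n]
 show "n*(T q - T q') <= n*(G*(q - q')) + ((\<bar>q\<bar> + \<bar>q'\<bar>)*c0 + (q - q')*c0)"
  by (simp add: algebra_simps)
qed

text \<open>\<open>mean q n\<close> serves as an approximate supergradient at \<open>q\<close>: the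
  inequalities \<open>mean_ineq\<close> towards \<open>x\<close> and \<open>y\<close>, weighted by
  \<open>u\<close> and \<open>v\<close>, have left sides that cancel.\<close>

lemma T_concave: "concave_on UNIV T"
 unfolding concave_on_iff
proof (intro conjI ballI allI impI)
 fix u v x y :: real assume uv: "u >= 0" "v >= 0" "u + v = 1"
 define q where "q = u *\<^sub>R x + v *\<^sub>R y"
 show "T (u *\<^sub>R x + v *\<^sub>R y) >= u*T x + v * T y"
  unfolding q_def[symmetric]
 proof (rule bounded_by_over_n)
  fix n :: nat
  have "u*((q - x)*mean q n) + v * ((q - y)*mean q n)
   <= u*(n*(T q - T x) + (\<bar>q\<bar> + \<bar>x\<bar>)*c0) + v * (n*(T q - T y) + (\<bar>q\<bar> + \<bar>y\<bar>)*c0)"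
   by (intro add_mono mult_left_mono mean_ineq uv)
  moreover have "u*((q - x)*mean q n) + v * ((q - y)*mean q n) = ((u + v)*q - (u*x + v * y))*mean q n"
   by (simp add: algebra_simps)
  moreover have "((u + v)*q - (u*x + v * y))*mean q n = 0" by (simp add: uv q_def)
  moreover have "u*(n*(T q - T x) + (\<bar>q\<bar> + \<bar>x\<bar>)*c0) + v * (n*(T q - T y) + (\<bar>q\<bar> + \<bar>y\<bar>)*c0)
    = (u + v)*(n*T q) - n*(u*T x + v * T y) + (u*((\<bar>q\<bar> + \<bar>x\<bar>)*c0) + v * ((\<bar>q\<bar> + \<bar>y\<bar>)*c0))"
   by (simp add: algebra_simps)
  moreover have "(u + v)*(n*T q) = n*T q" by (simp add: uv)
  ultimately show "n*(u*T x + v * T y) <= n*T q + (u*((\<bar>q\<bar> + \<bar>x\<bar>)*c0) + v * ((\<bar>q\<bar> + \<bar>y\<bar>)*c0))"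
   by linarith
 qed
qed auto

end

section \<open>Differentiability of the spectrum\<close>

lemma concave_slopes:
 fixes f :: "real => real"
 assumes f: "concave_on UNIV f" and st: "0 < s" "s <= t"
 shows "(f (q + t) - f q)/t <= (f (q + s) - f q)/s"
  "(f q - f (q - s))/s <= (f q - f (q - t))/t"
  "(f (q + s) - f q)/s <= (f q - f (q - s))/s"
proof -
 have *: "f (q + s*e) >= (1 - s/t)*f q + s/t*f (q + t*e)" for e
 proof -
  have "f ((1 - s/t) *\<^sub>R q + (s/t) *\<^sub>R (q + t*e)) >= (1 - s/t)*f q + s/t*f (q + t*e)"
   using st by (intro concave_onD[OF f]) auto
  moreover have "(1 - s/t) *\<^sub>R q + (s/t) *\<^sub>R (q + t*e) = q + s*e" using st by (simp add: field_simps)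
  ultimately show ?thesis by simp
 qed
 have **: "(f (q + t*e) - f q)/t <= (f (q + s*e) - f q)/s" for e
  using *[of e] st by (simp add: field_simps)
 show "(f (q + t) - f q)/t <= (f (q + s) - f q)/s" using **[of 1] by simp
 show "(f q - f (q - s))/s <= (f q - f (q - t))/t"
  using **[of "-1"] st by (simp add: field_simps)
 have "f ((1 - 1/2) *\<^sub>R (q - s) + (1/2) *\<^sub>R (q + s)) >= (1 - 1/2)*f (q - s) + 1/2*f (q + s)"
  by (intro concave_onD[OF f]) auto
 moreover have "(1 - 1/2) *\<^sub>R (q - s) + (1/2) *\<^sub>R (q + s) = q" by (simp add: field_simps)
 ultimately show "(f (q + s) - f q)/s <= (f q - f (q - s))/s"
  using st by (intro divide_right_mono) auto
qed

lemma concave_right_le_left: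
 fixes f :: "real => real"
 assumes f: "concave_on UNIV f" and st: "0 < s" "0 < t"
 shows "(f (q + s) - f q)/s <= (f q - f (q - t))/t"
proof -
 define r where "r = min s t"
 have r: "0 < r" "r <= s" "r <= t" using st by (auto simp: r_def)
 show ?thesis
  using concave_slopes(1)[OF f r(1,2), of q] concave_slopes(2)[OF f r(1,3), of q]
   concave_slopes(3)[OF f r(1,2), of q] by linarith
qed

text \<open>Difference quotients of a concave function are monotone, so one good quotient on each
  side of \<open>q\<close> controls all shorter ones.\<close>

lemma concave_has_real_derivative:
 fixes f :: "real => real"
 assumes f: "concave_on UNIV f"
  and R: "!!e. e > 0 ==> \<exists>t>0. A - e <= (f (q + t) - f q)/t"
  and L: "!!e. e > 0 ==> \<exists>t>0. (f q - f (q - t))/t <= A + e"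
 shows "(f has_real_derivative A) (at q)"
proof -
 have RA: "(f (q + s) - f q)/s <= A" if "s > 0" for s
 proof (rule field_le_epsilon)
  fix e :: real assume "e > 0"
  then obtain t where "t > 0" "(f q - f (q - t))/t <= A + e" using L by blast
  thus "(f (q + s) - f q)/s <= A + e" using concave_right_le_left[OF f that, of t q] by linarith
 qed
 have LA: "A <= (f q - f (q - s))/s" if "s > 0" for s
 proof (rule field_le_epsilon)
  fix e :: real assume "e > 0"
  then obtain t where "t > 0" "A - e <= (f (q + t) - f q)/t" using R by blast
  thus "A <= (f q - f (q - s))/s + e" using concave_right_le_left[OF f _ that, of t q] by linarith
 qed
 have "(%h. (f (q + h) - f q)/h) \<midarrow>0\<rightarrow> A"
 proof (rule LIM_I)
  fix e :: real assume e: "e > 0"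
  hence e2: "e/2 > 0" by simp
  obtain t1 where t1: "t1 > 0" "A - e/2 <= (f (q + t1) - f q)/t1" using R[OF e2] by blast
  obtain t2 where t2: "t2 > 0" "(f q - f (q - t2))/t2 <= A + e/2" using L[OF e2] by blast
  have "norm ((f (q + x) - f q)/x - A) < e" if x: "x ~= 0 & norm (x - 0) < min t1 t2" for x
  proof (cases "x > 0")
   case True
   have "(f (q + t1) - f q)/t1 <= (f (q + x) - f q)/x"
    using concave_slopes(1)[OF f True, of t1 q] x True by simp
   with RA[OF True] t1 e show ?thesis by (simp add: abs_le_iff)
  next
   case False
   hence x': "- x > 0" using x by linarith
   have "(f q - f (q - (- x)))/(- x) <= (f q - f (q - t2))/t2"
    by (rule concave_slopes(2)[OF f x']) (use x x' in simp)
   moreover have "(f q - f (q - (- x)))/(- x) = (f (q + x) - f q)/x"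
    by (simp add: divide_simps)
   ultimately show ?thesis using LA[OF x'] t2 e by (simp add: abs_le_iff)
  qed
  thus "\<exists>s>0. \<forall>x. x ~= 0 & norm (x - 0) < s --> norm ((f (q + x) - f q)/x - A) < e"
   using t1(1) t2(1) by (intro exI[of _ "min t1 t2"]) auto
 qed
 thus ?thesis by (simp add: DERIV_def)
qed

section \<open>Laws on blocks and equality of the one-sided derivatives\<close>

context quasi_additive
begin

definition block :: "nat => nat => 'n word => 'n word" where "block k i w = take k (drop (i*k) w)"

lemma block_append: "length u = i*k ==> length v = k ==> block k i (u @ v @ y) = v"
 by (simp add: block_def)

lemma g_blocks: "length w = M*k ==> \<bar>g w - (\<Sum>i<M. g (block k i w))\<bar> <= (M + 1)*c0"
proof (induction M arbitrary: w)
 case 0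
 thus ?case using qa[of "[]" "[]"] by simp
next
 case (Suc M)
 define u v where "u = take (M*k) w" and "v = drop (M*k) w"
 have w: "w = u @ v" and l: "length u = M*k" "length v = k" using Suc.prems by (auto simp: u_def v_def)
 have b: "block k i w = block k i u" if "i < M" for i
 proof -
  have "Suc i*k <= M*k" using that by (intro mult_right_mono) auto
  thus ?thesis unfolding block_def w using l by simp
 qed
 have "block k M w = v" using block_append[OF l, of "[]"] w by simp
 with b have "(\<Sum>i<Suc M. g (block k i w)) = (\<Sum>i<M. g (block k i u)) + g v" by simp
 with Suc.IH[OF l(1)] qa[of u v] w show ?case by (simp add: algebra_simps)
qed

lemma W_append3:
 "W q (x @ v @ y) <= (C q)\<^sup>2*(W q x*W q v * W q y)"
 "W q x*W q v * W q y <= (C q)\<^sup>2*W q (x @ v @ y)"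
proof -
 have "W q (x @ v @ y) <= C q*(W q x*W q (v @ y))" by (rule W_append)
 also have "... <= C q*(W q x*(C q*(W q v * W q y)))" by (intro mult_left_mono W_append) auto
 finally show "W q (x @ v @ y) <= (C q)\<^sup>2*(W q x*W q v * W q y)" by (simp add: power2_eq_square mult_ac)
 have "W q x*(W q v * W q y) <= W q x*(C q*W q (v @ y))" by (intro mult_left_mono W_append) auto
 also have "... = C q*(W q x*W q (v @ y))" by simp
 also have "... <= C q*(C q*W q (x @ v @ y))" by (intro mult_left_mono W_append) auto
 finally show "W q x*W q v * W q y <= (C q)\<^sup>2*W q (x @ v @ y)" by (simp add: power2_eq_square mult_ac)
qed

lemma Z_append3:
 "Z q (l + (m + n)) <= (C q)\<^sup>2*(Z q l*Z q m*Z q n)"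
 "Z q l*Z q m*Z q n <= (C q)\<^sup>2*Z q (l + (m + n))"
proof -
 have "Z q (l + (m + n)) <= C q*(Z q l*Z q (m + n))" by (rule Z_append)
 also have "... <= C q*(Z q l*(C q*(Z q m*Z q n)))" by (intro mult_left_mono Z_append) auto
 finally show "Z q (l + (m + n)) <= (C q)\<^sup>2*(Z q l*Z q m*Z q n)" by (simp add: power2_eq_square mult_ac)
 have "Z q l*(Z q m*Z q n) <= Z q l*(C q*Z q (m + n))" by (intro mult_left_mono Z_append) auto
 also have "... = C q*(Z q l*Z q (m + n))" by simp
 also have "... <= C q*(C q*Z q (l + (m + n)))" by (intro mult_left_mono Z_append) auto
 finally show "Z q l*Z q m*Z q n <= (C q)\<^sup>2*Z q (l + (m + n))" by (simp add: power2_eq_square mult_ac)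
qed

text \<open>The law of the \<open>i\<close>-th block of length \<open>k\<close> under the finite Gibbs measure on words of length \<open>M*k\<close>.\<close>

definition win :: "real => nat => nat => nat => 'n word => real" where
 "win q M k i v = (\<Sum>x\<in>words (i*k). \<Sum>y\<in>words ((M - 1 - i)*k). W q (x @ v @ y))/Z q (M*k)"

lemma win_split: "(i::nat) < M ==> M*k = i*k + (k + (M - 1 - i)*k)"
proof -
 assume "i < M"
 then obtain j where "M = i + 1 + j" using less_imp_Suc_add[of i M] by auto
 thus ?thesis by (simp add: algebra_simps)
qed

lemma win_nonneg: "win q M k i v >= 0"
 unfolding win_def by (intro divide_nonneg_nonneg sum_nonneg) auto

lemma win_sum:
 assumes "i < M"
 shows "(\<Sum>v\<in>words k. win q M k i v * f v) = (\<Sum>w\<in>words (M*k). W q w/Z q (M*k)*f (block k i w))"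
proof -
 have "(\<Sum>w\<in>words (M*k). W q w/Z q (M*k)*f (block k i w))
  = (\<Sum>x\<in>words (i*k). \<Sum>v\<in>words k. \<Sum>y\<in>words ((M - 1 - i)*k). W q (x @ v @ y)/Z q (M*k)*f (block k i (x @ v @ y)))"
  by (subst win_split[OF assms], subst sum_words_append, subst sum_words_append)
    (simp add: win_split[OF assms, symmetric])
 also have "... = (\<Sum>x\<in>words (i*k). \<Sum>v\<in>words k. \<Sum>y\<in>words ((M - 1 - i)*k). W q (x @ v @ y)/Z q (M*k)*f v)"
  by (intro sum.cong refl) (auto simp: words_def block_append)
 also have "... = (\<Sum>v\<in>words k. \<Sum>x\<in>words (i*k). \<Sum>y\<in>words ((M - 1 - i)*k). W q (x @ v @ y)/Z q (M*k)*f v)"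
  by (rule sum.swap)
 also have "... = (\<Sum>v\<in>words k. win q M k i v * f v)"
  by (simp add: win_def sum_divide_distrib sum_distrib_right)
 finally show ?thesis ..
qed

text \<open>The five factors \<open>C q\<close> are two for splitting the word into three parts, two
  for splitting the partition function, and one for comparing \<open>Z q k\<close> with its
  exponential.\<close>

lemma win_bounds:
 assumes i: "i < M"
 shows "win q M k i v <= (C q) ^ 5*(W q v * 2 powr (k*T q))"
  "W q v * 2 powr (k*T q) <= (C q) ^ 5*win q M k i v"
proof -
 define a b where "a = Z q (i*k)" and "b = Z q ((M - 1 - i)*k)"
 have ab: "a > 0" "b > 0" by (auto simp: a_def b_def)
 define S where "S = (\<Sum>x\<in>words (i*k). \<Sum>y\<in>words ((M - 1 - i)*k). W q (x @ v @ y))"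
 have e: "a*W q v * b = (\<Sum>x\<in>words (i*k). \<Sum>y\<in>words ((M - 1 - i)*k). W q x*W q v * W q y)"
  by (simp add: a_def b_def Z_def sum_distrib_left sum_distrib_right mult_ac sum_product)
 have S1: "S <= (C q)\<^sup>2*(a*W q v * b)"
  unfolding S_def e sum_distrib_left by (intro sum_mono W_append3)
 have S2: "a*W q v * b <= (C q)\<^sup>2*S"
  unfolding S_def e sum_distrib_left by (intro sum_mono W_append3)
 have Z1: "Z q (M*k) <= (C q)\<^sup>2*(a*Z q k*b)" "a*Z q k*b <= (C q)\<^sup>2*Z q (M*k)"
  unfolding a_def b_def by (subst win_split[OF i], rule Z_append3)+
 define N where "N = Z q (M*k)"
 have N: "N > 0" by (simp add: N_def)
 define t where "t = 2 powr (k*T q)"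
 have t: "t > 0" by (simp add: t_def)
 have zt: "1 <= C q*Z q k*t" "Z q k*t <= C q"
  using Z_bounds[where q=q and n=k] by (simp_all add: t_def powr_minus field_simps)
 have w: "win q M k i v = S/N" by (simp add: win_def S_def N_def)
 have "S*1 <= S*(C q*Z q k*t)" using zt(1)
  by (intro mult_left_mono) (auto simp: S_def intro!: sum_nonneg)
 also have "... <= ((C q)\<^sup>2*(a*W q v * b))*(C q*Z q k*t)"
  using t by (intro mult_right_mono S1) (auto intro!: mult_nonneg_nonneg)
 also have "... = (C q)^3*W q v * t*(a*Z q k*b)" by (simp add: power2_eq_square power3_eq_cube)
 also have "... <= (C q)^3*W q v * t*((C q)\<^sup>2*N)"
  using t Z1(2) by (intro mult_left_mono) (auto simp: N_def intro!: mult_nonneg_nonneg)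
 also have "... = (C q)^5*(W q v * t)*N" by (simp add: power2_eq_square power3_eq_cube eval_nat_numeral)
 finally show "win q M k i v <= (C q) ^ 5*(W q v * 2 powr (k*T q))"
  unfolding w t_def[symmetric] using N by (simp add: field_simps)
 have "W q v * t*N <= W q v * t*((C q)\<^sup>2*(a*Z q k*b))"
  using t Z1(1) by (intro mult_left_mono) (auto simp: N_def intro!: mult_nonneg_nonneg)
 also have "... = (C q)\<^sup>2*(a*W q v * b)*(Z q k*t)" by simp
 also have "... <= (C q)\<^sup>2*((C q)\<^sup>2*S)*C q"
 proof (intro mult_mono[OF _ zt(2)] mult_left_mono S2)
  show "0 <= (C q)\<^sup>2*((C q)\<^sup>2*S)" by (intro mult_nonneg_nonneg) (auto simp: S_def intro!: sum_nonneg)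
 qed (use t in auto)
 also have "... = (C q)^5*S" by (simp add: power2_eq_square eval_nat_numeral)
 finally show "W q v * 2 powr (k*T q) <= (C q) ^ 5*win q M k i v"
  unfolding w t_def[symmetric] using N by (simp add: field_simps)
qed

text \<open>A shift of the parameter by at most \<open>1/k\<close> changes the exponent
  \<open>q*g v\<close> of a word of length \<open>k\<close> by a bounded amount, because
  \<open>g\<close> grows at most linearly. Hence laws tilted at \<open>q1\<close> remain comparable
  to those at \<open>q\<close> with a constant independent of \<open>k\<close>.\<close>

lemma W_2_powr_close:
 assumes k: "k > 0" and q1: "\<bar>q1 - q\<bar> <= 1/k" and v: "v \<in> words k"
 shows "W q1 v * 2 powr (k*T q1) <= 2 powr (2*G + c0)*(W q v * 2 powr (k*T q))"
  "W q v * 2 powr (k*T q) <= 2 powr (2*G + c0)*(W q1 v * 2 powr (k*T q1))"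
proof -
 have g: "\<bar>g v\<bar> <= G*k + c0"
  using g_ge[of v] g_le[of v] \<delta>_pos G_pos v k by (auto simp: words_def abs_le_iff)
   (smt (verit) mult_nonneg_nonneg of_nat_0_le_iff)
 have k1: "real k >= 1" using k by simp
 have "\<bar>(q1 - q)*g v\<bar> <= 1/k*(G*k + c0)"
  unfolding abs_mult using g q1 by (intro mult_mono) auto
 also have "... = G + c0/k" using k by (simp add: field_simps)
 also have "... <= G + c0" using mult_left_mono[OF k1 c0_nonneg] k by (simp add: field_simps)
 finally have 1: "\<bar>(q1 - q)*g v\<bar> <= G + c0" .
 have "\<bar>T q1 - T q\<bar> <= G*\<bar>q1 - q\<bar>"
 proof (cases "q <= q1")
  case True
  have "0 <= \<delta>*(q1 - q)" using True \<delta>_pos by simp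
  thus ?thesis using T_diff_le[OF True] T_diff_ge[OF True] True by simp
 next
  case False
  hence F: "q1 <= q" by simp
  have "0 <= \<delta>*(q - q1)" using F \<delta>_pos by simp
  thus ?thesis using T_diff_le[OF F] T_diff_ge[OF F] F by simp
 qed
 also have "... <= G*(1/k)" using q1 G_pos by (intro mult_left_mono) auto
 finally have "k*\<bar>T q1 - T q\<bar> <= k*(G*(1/k))" by (intro mult_left_mono) auto
 hence 2: "\<bar>k*T q1 - k*T q\<bar> <= G" using k by (simp add: abs_mult flip: right_diff_distrib)
 show "W q1 v * 2 powr (k*T q1) <= 2 powr (2*G + c0)*(W q v * 2 powr (k*T q))"
  "W q v * 2 powr (k*T q) <= 2 powr (2*G + c0)*(W q1 v * 2 powr (k*T q1))"
  using 1 2 unfolding W_def by (simp_all add: algebra_simps abs_le_iff flip: powr_add)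
qed

definition Cwin :: "real => real" where
 "Cwin q = 2 powr (5*(\<bar>q\<bar> + 1)*c0)*2 powr (2*G + c0)"

lemma Cwin_pos: "Cwin q > 0" by (simp add: Cwin_def)

lemma Cwin_ge_1: "Cwin q >= 1"
 using c0_nonneg G_pos unfolding Cwin_def powr_add[symmetric] by (intro ge_one_powr_ge_zero) auto

text \<open>Averaging over the windows of a long word gives laws on words of length \<open>k\<close> that are comparable
 to the Gibbs weights at \<open>q\<close>, uniformly in \<open>k\<close>, but whose means see the slopes at \<open>q1\<close>.\<close>

lemma exists_win:
 assumes k: "k > 0" and q1: "\<bar>q1 - q\<bar> <= 1/k" and M: "M > 0"
  and s: "\<bar>s\<bar> = 1" and m: "s*mean q1 (M*k) <= M*x"
 shows "\<exists>p. (\<forall>v\<in>words k. p v >= 0 & p v <= Cwin q*(W q v * 2 powr (k*T q))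
    & W q v * 2 powr (k*T q) <= Cwin q*p v)
   & (\<Sum>v\<in>words k. p v) = 1 & s*(\<Sum>v\<in>words k. p v * g v) <= x + 2*c0"
proof -
 \<comment> \<open>\<open>E i\<close> is the mean of \<open>g\<close> over the \<open>i\<close>-th
   window. Up to \<open>(M + 1)*c0\<close> these means add up to \<open>mean q1 (M*k)\<close>, so
   some window is no worse than their average. The sign \<open>s\<close> treats upper and lower
   bounds together.\<close>
 define E where "E i = (\<Sum>v\<in>words k. win q1 M k i v * g v)" for i
 define L :: "'n word set" where "L = words (M*k)"
 have "\<bar>mean q1 (M*k) - (\<Sum>i<M. E i)\<bar> <= (M + 1)*c0"
 proof -
  have e: "(\<Sum>i<M. E i) = (\<Sum>w\<in>L. W q1 w/Z q1 (M*k)*(\<Sum>i<M. g (block k i w)))"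
   unfolding E_def L_def by (simp add: win_sum sum_distrib_left) (rule sum.swap)
  have "\<bar>mean q1 (M*k) - (\<Sum>i<M. E i)\<bar>
    = \<bar>\<Sum>w\<in>L. W q1 w/Z q1 (M*k)*(g w - (\<Sum>i<M. g (block k i w)))\<bar>"
   unfolding e mean_def L_def by (simp add: right_diff_distrib sum_subtractf)
  also have "... <= (\<Sum>w\<in>L. \<bar>W q1 w/Z q1 (M*k)*(g w - (\<Sum>i<M. g (block k i w)))\<bar>)" by (rule sum_abs)
  also have "... <= (\<Sum>w\<in>L. W q1 w/Z q1 (M*k)*((M + 1)*c0))"
   unfolding L_def abs_mult
  proof (intro sum_mono mult_mono)
   fix w :: "'n word" assume "w \<in> words (M*k)"
   hence "length w = M*k" by (simp add: words_def)
   from g_blocks[OF this] show "\<bar>g w - (\<Sum>i<M. g (block k i w))\<bar> <= (M + 1)*c0" by (simp add: add.commute)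
  qed auto
  also have "... = (\<Sum>w\<in>L. W q1 w/Z q1 (M*k))*((M + 1)*c0)" by (rule sum_distrib_right[symmetric])
  also have "... = (M + 1)*c0" by (simp add: L_def gibbs_sum)
  finally show ?thesis .
 qed
 hence "s*(\<Sum>i<M. E i) <= s*mean q1 (M*k) + (M + 1)*c0"
  using s by (cases "s >= 0") (auto simp: abs_le_iff)
 also have "... <= M*(x + 2*c0)"
  using m M c0_nonneg mult_right_mono[of 1 "real M" c0] by (simp add: algebra_simps)
 finally have sum: "(\<Sum>i<M. s*E i) <= (\<Sum>i<M. x + 2*c0)" by (simp add: sum_distrib_left)
 have "\<exists>i<M. s*E i <= x + 2*c0"
 proof (rule ccontr)
  assume "\<not> ?thesis"
  hence "(\<Sum>i<M. x + 2*c0) < (\<Sum>i<M. s*E i)" using M by (intro sum_strict_mono) (auto simp: not_le)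
  with sum show False by linarith
 qed
 then obtain i where i: "i < M" "s*E i <= x + 2*c0" by blast
 have "C q1 ^ 5 <= 2 powr (5*(\<bar>q\<bar> + 1)*c0)"
 proof -
  have "1/real k <= 1" using k by simp
  hence "\<bar>q1\<bar> <= \<bar>q\<bar> + 1" using q1 by linarith
  hence "5*(\<bar>q1\<bar>*c0) <= 5*((\<bar>q\<bar> + 1)*c0)" by (intro mult_left_mono mult_right_mono c0_nonneg) auto
  moreover have "C q1 ^ 5 = 2 powr (5*(\<bar>q1\<bar>*c0))"
   unfolding C_def by (simp add: powr_power mult_ac)
  ultimately show ?thesis by (simp add: mult_ac)
 qed
 note C5 = this
 have C5p: "C q1 ^ 5 > 0" by simp
 have "win q1 M k i v <= Cwin q*(W q v * 2 powr (k*T q))"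
  "W q v * 2 powr (k*T q) <= Cwin q*win q1 M k i v" if v: "v \<in> words k" for v
 proof -
  have "win q1 M k i v <= C q1 ^ 5*(W q1 v * 2 powr (k*T q1))" by (rule win_bounds[OF i(1)])
  also have "... <= 2 powr (5*(\<bar>q\<bar> + 1)*c0)*(2 powr (2*G + c0)*(W q v * 2 powr (k*T q)))"
   by (intro mult_mono C5 W_2_powr_close k q1 v) (auto intro!: mult_nonneg_nonneg)
  finally show "win q1 M k i v <= Cwin q*(W q v * 2 powr (k*T q))" by (simp add: Cwin_def mult_ac)
  have "W q v * 2 powr (k*T q) <= 2 powr (2*G + c0)*(W q1 v * 2 powr (k*T q1))"
   by (intro W_2_powr_close k q1 v)
  also have "... <= 2 powr (2*G + c0)*(C q1 ^ 5*win q1 M k i v)"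
   by (intro mult_left_mono win_bounds[OF i(1)]) auto
  also have "... <= 2 powr (2*G + c0)*(2 powr (5*(\<bar>q\<bar> + 1)*c0)*win q1 M k i v)"
   by (intro mult_left_mono mult_right_mono C5 win_nonneg) auto
  finally show "W q v * 2 powr (k*T q) <= Cwin q*win q1 M k i v" by (simp add: Cwin_def mult_ac)
 qed
 moreover have "(\<Sum>v\<in>words k. win q1 M k i v) = 1"
  using win_sum[OF i(1), of q1 k "\<lambda>_. 1"] by (simp add: gibbs_sum)
 ultimately show ?thesis using i(2) by (intro exI[of _ "win q1 M k i"]) (auto simp: win_nonneg E_def)
qed

text \<open>The right and left derivatives of \<open>T\<close>, as a supremum and an infimum of
  slopes. Concavity gives \<open>sR q <= sL q\<close>; the converse is the hard inequality.\<close>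

definition sR :: "real => real" where "sR q = (SUP t\<in>{0<..}. (T (q + t) - T q)/t)"
definition sL :: "real => real" where "sL q = (INF t\<in>{0<..}. (T q - T (q - t))/t)"

lemma sR_ge: "t > 0 ==> (T (q + t) - T q)/t <= sR q"
 unfolding sR_def
proof (rule cSUP_upper)
 show "bdd_above ((%t. (T (q + t) - T q)/t) ` {0<..})"
  using T_diff_le[of q "q + t" for t] by (intro bdd_aboveI[of _ G]) (auto simp: field_simps)
qed simp

lemma sL_le: "t > 0 ==> sL q <= (T q - T (q - t))/t"
 unfolding sL_def
proof (rule cINF_lower)
 show "bdd_below ((%t. (T q - T (q - t))/t) ` {0<..})"
  using T_diff_ge[of "q - t" q for t] by (intro bdd_belowI[of _ \<delta>]) (auto simp: field_simps)
qed simp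

lemma sR_approx: "e > 0 ==> \<exists>t>0. sR q - e < (T (q + t) - T q)/t"
proof (rule ccontr)
 assume e: "e > 0" and "\<not> ?thesis"
 hence "sR q <= sR q - e" by (subst (1) sR_def, intro cSUP_least) (force simp: not_less)+
 with e show False by simp
qed

lemma sL_approx: "e > 0 ==> \<exists>t>0. (T q - T (q - t))/t < sL q + e"
proof (rule ccontr)
 assume e: "e > 0" and "\<not> ?thesis"
 hence "sL q + e <= sL q" by (subst (2) sL_def, intro cINF_greatest) (force simp: not_less)+
 with e show False by simp
qed

text \<open>At a corner, windows at \<open>q + 1/k\<close> give a law \<open>p1\<close> of mean at
  most about \<open>k * sR q\<close>, and windows at \<open>q - 1/k\<close> a law \<open>p2\<close>
  of mean at least about \<open>k * sL q\<close>, both comparable to the Gibbs weights at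
  \<open>q\<close>. A small multiple of \<open>p2\<close> can then be subtracted from
  \<open>p1\<close>: the result is still dominated by these weights, but its mean falls below
  \<open>k * sR q\<close> by a fixed proportion of \<open>k\<close>, which \<open>mean_bound\<close>
  forbids.\<close>

lemma sL_le_sR: "sL q <= sR q"
proof (rule ccontr)
 assume "\<not> ?thesis"
 hence gap: "sL q - sR q > 0" by simp
 define D where "D = Cwin q"
 have D: "D >= 1" "D > 0" using Cwin_ge_1 Cwin_pos by (auto simp: D_def)
 \<comment> \<open>Comparability of both laws with the same weights, up to the factor
   \<open>D\<close> each, turns this choice into \<open>c*p2 <= p1/2\<close>, so the difference
   \<open>p\<close> below is nonnegative.\<close>
 define c where "c = 1/(2*D\<^sup>2)"
 have c: "c > 0" "c <= 1/2" using D one_le_power[of D 2] by (auto simp: c_def field_simps)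
 define e where "e = c*(sL q - sR q)/2"
 have e: "e > 0" using c gap by (simp add: e_def)
 obtain t where t: "t > 0" "sR q - e < (T (q + t) - T q)/t" using sR_approx[OF e] by blast
 define K where "K = (log 2 (2*D) + \<bar>q + t\<bar>*c0)/t"
 define K0 where "K0 = 2*c0 + 1"
 have main: "k*(c*(sL q - sR q)) <= k*e + (K0*(1 + c) + \<bar>K\<bar>)" if k: "k > 0" for k :: nat
 proof -
  \<comment> \<open>So many windows that the error of \<open>mean_ineq\<close>, once multiplied by
    \<open>k\<close>, costs at most one unit per window.\<close>
  define M where "M = Suc (nat \<lceil>(2*\<bar>q\<bar> + 1)*c0*k\<rceil>)"
  have M: "M > 0" "(2*\<bar>q\<bar> + 1)*c0*k <= M"
   unfolding M_def by (auto, linarith)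
  have kk: "1/real k > 0" "1/real k <= 1" using k by auto
  have mb: "(\<bar>q\<bar> + \<bar>q1\<bar>)*c0*k <= M" if "\<bar>q1 - q\<bar> <= 1/k" for q1
  proof -
   have "\<bar>q\<bar> + \<bar>q1\<bar> <= 2*\<bar>q\<bar> + 1" using that kk by linarith
   hence "(\<bar>q\<bar> + \<bar>q1\<bar>)*(c0*k) <= (2*\<bar>q\<bar> + 1)*(c0*k)" by (intro mult_right_mono) (auto simp: c0_nonneg)
   thus ?thesis using M by (simp add: mult_ac)
  qed
  have R: "T (q + 1/k) - T q <= sR q/k" using sR_ge[OF kk(1), of q] k by (simp add: field_simps)
  have "(1/k)*mean (q + 1/k) (M*k) <= (M*k)*(sR q/k) + (\<bar>q + 1/k\<bar> + \<bar>q\<bar>)*c0"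
   using mean_ineq[of "q + 1/k" q "M*k"] mult_left_mono[OF R, of "M*k"] by simp
  from mult_left_mono[OF this, of k]
  have "1*mean (q + 1/k) (M*k) <= M*(k * sR q) + (\<bar>q\<bar> + \<bar>q + 1/k\<bar>)*c0*k"
   using k by (simp add: distrib_left distrib_right mult_ac add.commute)
  also have "... <= M*(k * sR q) + M" using mb[of "q + 1/k"] by simp
  finally have m1: "1*mean (q + 1/k) (M*k) <= M*(k * sR q + 1)" by (simp add: algebra_simps)
  have L: "sL q/k <= T q - T (q - 1/k)" using sL_le[OF kk(1), of q] k by (simp add: field_simps)
  have "- ((1/k)*mean (q - 1/k) (M*k)) <= (M*k)*(- (sL q/k)) + (\<bar>q - 1/k\<bar> + \<bar>q\<bar>)*c0"
   using mean_ineq[of "q - 1/k" q "M*k"] mult_left_mono[OF L, of "M*k"] by (simp add: algebra_simps)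
  from mult_left_mono[OF this, of k]
  have "- 1*mean (q - 1/k) (M*k) <= M*(k*(- sL q)) + (\<bar>q\<bar> + \<bar>q - 1/k\<bar>)*c0*k"
   using k by (simp add: distrib_left distrib_right right_diff_distrib mult_ac add.commute)
  also have "... <= M*(k*(- sL q)) + M" using mb[of "q - 1/k"] by simp
  finally have m2: "- 1*mean (q - 1/k) (M*k) <= M*(k*(- sL q) + 1)" by (simp add: algebra_simps)
  obtain p1 where p1: "\<forall>v\<in>words k. p1 v >= 0 & p1 v <= D*(W q v * 2 powr (k*T q))
    & W q v * 2 powr (k*T q) <= D*p1 v" "(\<Sum>v\<in>words k. p1 v) = 1"
    "(\<Sum>v\<in>words k. p1 v * g v) <= k * sR q + K0"
   using exists_win[OF k _ M(1) _ m1, of q] kk by (auto simp: D_def K0_def)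
  obtain p2 where p2: "\<forall>v\<in>words k. p2 v >= 0 & p2 v <= D*(W q v * 2 powr (k*T q))
    & W q v * 2 powr (k*T q) <= D*p2 v" "(\<Sum>v\<in>words k. p2 v) = 1"
    "- (\<Sum>v\<in>words k. p2 v * g v) <= k*(- sL q) + K0"
   using exists_win[OF k _ M(1) _ m2, of q] kk by (auto simp: D_def K0_def)
  define p where "p v = (p1 v - c*p2 v)/(1 - c)" for v
  have p21: "c*p2 v <= p1 v/2" if v: "v \<in> words k" for v :: "'n word"
  proof -
   have "p2 v <= D*(W q v * 2 powr (k*T q))" using p2(1) v by blast
   also have "... <= D*(D*p1 v)" using p1(1) v D by (intro mult_left_mono) auto
   finally have "c*p2 v <= c*(D*(D*p1 v))" using c by (intro mult_left_mono) auto
   also have "... = p1 v/2" using D by (simp add: c_def power2_eq_square)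
   finally show ?thesis .
  qed
  have "(q - (q + t))*(\<Sum>v\<in>words k. p v * g v) <= k*(T q - T (q + t)) + log 2 (2*D) + \<bar>q + t\<bar>*c0"
  proof (rule mean_bound)
   show "p w >= 0" if "w \<in> words k" for w :: "'n word"
    using p21[OF that] p1(1) that c by (auto simp: p_def intro!: divide_nonneg_nonneg)
   show "(\<Sum>v\<in>words k. p v) = 1"
    using p1(2) p2(2) c by (simp add: p_def sum_subtractf flip: sum_divide_distrib sum_distrib_left)
   fix v :: "'n word" assume v: "v \<in> words k"
   have "p1 v - c*p2 v <= p1 v" using p2(1) v c by simp
   also have "... <= (1 - c)*(2*p1 v)" using p1(1) v c mult_right_mono[of c "1/2" "p1 v"] by (simp add: algebra_simps)
   finally have "p v <= 2*p1 v" using c by (simp add: p_def field_simps)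
   also have "... <= 2*(D*(W q v * 2 powr (k*T q)))" using p1(1) v by (intro mult_left_mono) auto
   finally show "p v <= 2*D*(W q v * 2 powr (k*T q))" by simp
  qed (use D in auto)
  hence "(k*(T (q + t) - T q) - (log 2 (2*D) + \<bar>q + t\<bar>*c0)) <= (\<Sum>v\<in>words k. p v * g v)*t"
   by (simp add: algebra_simps)
  hence "(k*(T (q + t) - T q) - (log 2 (2*D) + \<bar>q + t\<bar>*c0))/t <= (\<Sum>v\<in>words k. p v * g v)"
   using t(1) by (simp add: pos_divide_le_eq)
  moreover have "k*((T (q + t) - T q)/t) - K = (k*(T (q + t) - T q) - (log 2 (2*D) + \<bar>q + t\<bar>*c0))/t"
   unfolding K_def by (subst diff_divide_distrib) simp
  ultimately have "k*((T (q + t) - T q)/t) - K <= (\<Sum>v\<in>words k. p v * g v)" by simp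
  moreover have "k*(sR q - e) <= k*((T (q + t) - T q)/t)" using t(2) by (intro mult_left_mono) auto
  ultimately have "k*(sR q - e) - K <= (\<Sum>v\<in>words k. p v * g v)" by linarith
  moreover have "(\<Sum>v\<in>words k. p v * g v) = ((\<Sum>v\<in>words k. p1 v * g v) - c*(\<Sum>v\<in>words k. p2 v * g v))/(1 - c)"
  proof -
   have "(\<Sum>v\<in>words k. p v * g v) = (\<Sum>v\<in>words k. (p1 v * g v - c*(p2 v * g v))/(1 - c))"
    by (intro sum.cong refl) (simp add: p_def algebra_simps)
   also have "... = ((\<Sum>v\<in>words k. p1 v * g v) - c*(\<Sum>v\<in>words k. p2 v * g v))/(1 - c)"
    by (simp add: sum_subtractf flip: sum_divide_distrib sum_distrib_left)
   finally show ?thesis .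
  qed
  ultimately have m: "k*(sR q - e) - K <= ((\<Sum>v\<in>words k. p1 v * g v) - c*(\<Sum>v\<in>words k. p2 v * g v))/(1 - c)"
   by linarith
  have "(1 - c)*(k*(sR q - e) - K) <= (1 - c)*(((\<Sum>v\<in>words k. p1 v * g v) - c*(\<Sum>v\<in>words k. p2 v * g v))/(1 - c))"
   by (rule mult_left_mono[OF m]) (use c in linarith)
  also have "... = (\<Sum>v\<in>words k. p1 v * g v) - c*(\<Sum>v\<in>words k. p2 v * g v)"
   using c by (subst nonzero_mult_div_cancel_left[symmetric, of "1 - c"]) (linarith, rule times_divide_eq_right)
  also have "... <= k * sR q + K0 + c*(K0 - k * sL q)"
   using p1(3) mult_left_mono[OF p2(3), of c] c by (simp add: algebra_simps)
  finally have "k*(c*(sL q - sR q)) <= (1 - c)*(k*e) + (1 - c)*K + K0*(1 + c)"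
   by (simp add: algebra_simps)
  also have "(1 - c)*(k*e) <= 1*(k*e)" using c e by (intro mult_right_mono) auto
  also have "(1 - c)*K <= (1 - c)*\<bar>K\<bar>" using c by (intro mult_left_mono) auto
  also have "(1 - c)*\<bar>K\<bar> <= 1*\<bar>K\<bar>" using c by (intro mult_right_mono) auto
  finally show ?thesis by simp
 qed
 have "c*(sL q - sR q) <= e" by (rule bounded_by_over_n, rule main) simp
 thus False using e by (simp add: e_def)
qed

definition T' :: "real => real" where "T' q = sR q"

lemma sR_le_sL: "sR q <= sL q"
proof (rule field_le_epsilon)
 fix e :: real assume "e > 0"
 hence e: "e/2 > 0" by simp
 obtain t where t: "t > 0" "sR q - e/2 < (T (q + t) - T q)/t" using sR_approx[OF e] by blast
 obtain s where s: "s > 0" "(T q - T (q - s))/s < sL q + e/2" using sL_approx[OF e] by blast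
 show "sR q <= sL q + e" using concave_right_le_left[OF T_concave t(1) s(1), of q] t(2) s(2) by linarith
qed

lemma T_deriv: "(T has_real_derivative T' q) (at q)"
proof -
 have eq: "sL q = T' q" using sL_le_sR[of q] sR_le_sL[of q] by (simp add: T'_def)
 show ?thesis
 proof (rule concave_has_real_derivative[OF T_concave])
  fix e :: real assume "e > 0"
  show "\<exists>t>0. T' q - e <= (T (q + t) - T q)/t"
   using sR_approx[OF \<open>e > 0\<close>, of q] unfolding T'_def by (meson less_imp_le)
  show "\<exists>t>0. (T q - T (q - t))/t <= T' q + e"
   using sL_approx[OF \<open>e > 0\<close>, of q] unfolding eq by (meson less_imp_le)
 qed
qed

lemma T_tangent: "T x <= T q + T' q*(x - q)"
proof -
 have eq: "sL q = T' q" using sL_le_sR[of q] sR_le_sL[of q] by (simp add: T'_def)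
 consider "x = q" | "x > q" | "x < q" by linarith
 thus ?thesis
 proof cases
  case 2 thus ?thesis using sR_ge[of "x - q" q] by (simp add: T'_def field_simps)
 next
  case 3 thus ?thesis using sL_le[of "q - x" q] by (simp add: eq field_simps)
 qed simp
qed

lemma T'_ge: "\<delta> <= T' q" using T_tangent[of "q + 1" q] T_diff_ge[of q "q + 1"] by simp
lemma T'_le: "T' q <= G" using T_tangent[of "q - 1" q] T_diff_le[of "q - 1" q] by simp

lemma T'_antimono: "q <= r ==> T' r <= T' q"
proof (cases "q = r")
 case False
 assume "q <= r"
 hence qr: "r - q > 0" using False by simp
 have "T' r*(r - q) <= T' q*(r - q)" using T_tangent[of r q] T_tangent[of q r] by (simp add: algebra_simps)
 thus ?thesis using qr by simp
qed simp

text \<open>Conditioning the Gibbs measure on a set of mass at least \<open>y\<close> costs only \<open>log (1/y)\<close>.\<close>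

lemma tail_bound:
 assumes A: "A \<subseteq> words n" and y: "y > 0" "y*Z q n <= (\<Sum>w\<in>A. W q w)"
  and s: "!!w. w \<in> A ==> (q - q')*g w >= x"
 shows "x <= n*(T q - T q') + log 2 (C q/y) + \<bar>q'\<bar>*c0"
proof -
 define S where "S = (\<Sum>w\<in>A. W q w)"
 have fA: "finite A" using A finite_subset finite_words by blast
 have yZ: "y*Z q n > 0" using y by simp
 hence S: "S > 0" using y unfolding S_def by linarith
 define p where "p w = (if w \<in> A then W q w/S else 0)" for w
 have ps: "(\<Sum>w\<in>words n. p w*f w) = (\<Sum>w\<in>A. W q w/S*f w)" for f
 proof -
  have "(\<Sum>w\<in>words n. p w*f w) = (\<Sum>w\<in>A. p w*f w)"
   using A by (intro sum.mono_neutral_right) (auto simp: p_def)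
  thus ?thesis by (simp add: p_def)
 qed
 have p1: "(\<Sum>w\<in>words n. p w) = 1" using ps[of "\<lambda>_. 1"] S by (simp add: S_def flip: sum_divide_distrib)
 have "(q - q')*(\<Sum>w\<in>words n. p w*g w) <= n*(T q - T q') + log 2 (C q/y) + \<bar>q'\<bar>*c0"
 proof (rule mean_bound[OF _ p1])
  fix w :: "'n word" assume "w \<in> words n"
  show "p w >= 0" using S by (simp add: p_def)
  have "W q w/S <= W q w/(y*Z q n)" using y yZ S unfolding S_def by (intro divide_left_mono mult_pos_pos) auto
  also have "... = (W q w/Z q n)/y" using y by simp
  also have "... <= C q*(W q w*2 powr (n*T q))/y" using y by (intro divide_right_mono gibbs_le) auto
  finally show "p w <= C q/y*(W q w*2 powr (n*T q))" using y by (auto simp: p_def)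
 qed (use y in auto)
 moreover have "(q - q')*(\<Sum>w\<in>words n. p w*g w) = (\<Sum>w\<in>A. W q w/S*((q - q')*g w))"
  unfolding ps by (simp add: sum_distrib_left mult_ac)
 moreover have "(\<Sum>w\<in>A. W q w/S*x) <= (\<Sum>w\<in>A. W q w/S*((q - q')*g w))"
  using S s by (intro sum_mono mult_left_mono) auto
 moreover have "(\<Sum>w\<in>A. W q w/S*x) = x"
  using S by (simp add: S_def flip: sum_distrib_right sum_divide_distrib)
 ultimately show ?thesis by linarith
qed

lemma T_near:
 assumes "e > 0"
 shows "\<exists>t>0. T q - T (q - t) <= t*(T' q + e) & t*(T' q - e) <= T (q + t) - T q"
proof -
 obtain t1 where t1: "t1 > 0" "T' q - e < (T (q + t1) - T q)/t1"
  using sR_approx[OF assms, of q] unfolding T'_def by blast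
 obtain t2 where t2: "t2 > 0" "(T q - T (q - t2))/t2 < T' q + e"
  using sL_approx[OF assms, of q] sL_le_sR[of q] unfolding T'_def by (meson add_mono_thms_linordered_field(1) le_less_trans not_le order_less_le_trans add_le_cancel_right)
 define t where "t = min t1 t2"
 have t: "t > 0" "t <= t1" "t <= t2" using t1 t2 by (auto simp: t_def)
 have "T' q - e < (T (q + t) - T q)/t"
  using concave_slopes(1)[OF T_concave t(1,2), of q] t1 by linarith
 moreover have "(T q - T (q - t))/t < T' q + e"
  using concave_slopes(2)[OF T_concave t(1,3), of q] t2 by linarith
 ultimately show ?thesis using t(1) by (intro exI[of _ t]) (auto simp: field_simps)
qed

section \<open>Words of a given type: law of large numbers and entropy\<close>

definition typed :: "nat => real => real => 'n word set" where
 "typed n h e = {w \<in> words n. \<bar>g w - n*h\<bar> <= e*n}"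

lemma finite_typed [simp]: "finite (typed n h e)" by (simp add: typed_def)

text \<open>If a quarter of the Gibbs mass had \<open>g\<close> above \<open>n*(T' q + e)\<close>,
  conditioning on it would cost only \<open>log 2 4\<close>, and \<open>tail_bound\<close> at
  \<open>q - t\<close> would contradict the slope of \<open>T\<close> between \<open>q - t\<close>
  and \<open>q\<close>. The lower tail uses \<open>q + t\<close>.\<close>

lemma law_of_large_numbers:
 assumes e: "e > 0"
 shows "ev (%n. (\<Sum>w\<in>typed n (T' q) e. W q w) >= Z q n/2)"
proof -
 have e2: "e/2 > 0" using e by simp
 obtain t where t: "t > 0" "T q - T (q - t) <= t*(T' q + e/2)" "t*(T' q - e/2) <= T (q + t) - T q"
  using T_near[OF e2] by blast
 define K where "K = log 2 (C q/(1/4)) + (\<bar>q - t\<bar> + \<bar>q + t\<bar>)*c0"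
 have "ev (%n. real n*(t*(e/2)) > K)"
  using t e by real_asymp
 thus ?thesis
 proof eventually_elim
  case (elim n)
  define A where "A = {w \<in> words n. g w > n*T' q + e*n}"
  define B where "B = {w \<in> words n. g w < n*T' q - e*n}"
  have A: "(\<Sum>w\<in>A. W q w) < 1/4*Z q n"
  proof (rule ccontr)
   assume "\<not> ?thesis"
   hence a: "1/4*Z q n <= (\<Sum>w\<in>A. W q w)" by linarith
   have "t*(n*T' q + e*n) <= n*(T q - T (q - t)) + log 2 (C q/(1/4)) + \<bar>q - t\<bar>*c0"
   proof (rule tail_bound[OF _ _ a])
    fix w assume "w \<in> A"
    thus "t*(n*T' q + e*n) <= (q - (q - t))*g w"
     using t(1) by (auto simp: A_def intro!: mult_left_mono)
   qed (auto simp: A_def)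
   also have "n*(T q - T (q - t)) <= n*(t*(T' q + e/2))" using t by (intro mult_left_mono) auto
   finally have "n*(t*(e/2)) <= K - \<bar>q + t\<bar>*c0" by (simp add: K_def algebra_simps)
   moreover have "\<bar>q + t\<bar>*c0 >= 0" using c0_nonneg by simp
   ultimately show False using elim by linarith
  qed
  have B: "(\<Sum>w\<in>B. W q w) < 1/4*Z q n"
  proof (rule ccontr)
   assume "\<not> ?thesis"
   hence a: "1/4*Z q n <= (\<Sum>w\<in>B. W q w)" by linarith
   have "(- t)*(n*T' q - e*n) <= n*(T q - T (q + t)) + log 2 (C q/(1/4)) + \<bar>q + t\<bar>*c0"
   proof (rule tail_bound[OF _ _ a])
    fix w assume "w \<in> B"
    thus "(- t)*(n*T' q - e*n) <= (q - (q + t))*g w"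
     using t(1) by (auto simp: B_def intro!: mult_left_mono)
   qed (auto simp: B_def)
   also have "n*(T q - T (q + t)) <= n*(- (t*(T' q - e/2)))" using t by (intro mult_left_mono) auto
   finally have "n*(t*(e/2)) <= K - \<bar>q - t\<bar>*c0" by (simp add: K_def algebra_simps)
   moreover have "\<bar>q - t\<bar>*c0 >= 0" using c0_nonneg by simp
   ultimately show False using elim by linarith
  qed
  have "words n = typed n (T' q) e \<union> (A \<union> B)" by (auto simp: typed_def A_def B_def abs_le_iff)
  hence "Z q n <= (\<Sum>w\<in>typed n (T' q) e. W q w) + (\<Sum>w\<in>A \<union> B. W q w)"
   unfolding Z_def using sum_Un_nat
   by (metis (no_types, lifting) finite_Un finite_words finite_typed sum.union_inter W_pos(2) add_increasing2 le_add_same_cancel1 sum_nonneg order_refl)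
  also have "(\<Sum>w\<in>A \<union> B. W q w) = (\<Sum>w\<in>A. W q w) + (\<Sum>w\<in>B. W q w)"
   using e by (intro sum.union_disjoint) (auto simp: A_def B_def, smt (verit) mult_nonneg_nonneg of_nat_0_le_iff)
  finally show ?case using A B by linarith
 qed
qed

definition ent :: "real => real" where "ent q = q*T' q - T q"

text \<open>A word of type \<open>T' q\<close> has weight at most \<open>2 powr (- n*q*T' q)\<close>
  up to the tolerance, and together such words carry at least half of \<open>Z q n\<close>, so
  dividing counts them. The spare \<open>e\<close> in the exponent absorbs the factor
  \<open>2*C q\<close>.\<close>

lemma card_typed:
 assumes e: "e > 0"
 shows "ev (%n. real (card (typed n (T' q) e)) >= 2 powr (n*(ent q - (\<bar>q\<bar> + 1)*e)))"
proof -
 have "ev (%n. 2 powr (real n*e) >= 2*C q)"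
  using e C_pos[of q] by real_asymp
 with law_of_large_numbers[OF e, of q] show ?thesis
 proof eventually_elim
  case (elim n)
  have "W q w <= 2 powr (- (q*(n*T' q)) + \<bar>q\<bar>*(e*n))" if w: "w \<in> typed n (T' q) e" for w
  proof -
   have "\<bar>q*(g w - n*T' q)\<bar> <= \<bar>q\<bar>*(e*n)"
    unfolding abs_mult using w by (intro mult_left_mono) (auto simp: typed_def)
   thus ?thesis unfolding W_def by (intro powr_mono) (auto simp: algebra_simps abs_le_iff)
  qed
  hence "(\<Sum>w\<in>typed n (T' q) e. W q w) <= card (typed n (T' q) e)*2 powr (- (q*(n*T' q)) + \<bar>q\<bar>*(e*n))"
   by (intro sum_bounded_above)
  hence "Z q n/2 <= card (typed n (T' q) e)*2 powr (- (q*(n*T' q)) + \<bar>q\<bar>*(e*n))"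
   using elim by linarith
  hence "Z q n <= 2*(card (typed n (T' q) e)*2 powr (- (q*(n*T' q)) + \<bar>q\<bar>*(e*n)))" by simp
  hence z: "C q*Z q n <= C q*(2*(card (typed n (T' q) e)*2 powr (- (q*(n*T' q)) + \<bar>q\<bar>*(e*n))))"
   by (rule mult_left_mono) auto
  have "2 powr (- n*T q) <= C q*Z q n" by (rule Z_bounds)
  also note z
  also have "C q*(2*(card (typed n (T' q) e)*2 powr (- (q*(n*T' q)) + \<bar>q\<bar>*(e*n))))
   = (2*C q)*(card (typed n (T' q) e)*2 powr (- (q*(n*T' q)) + \<bar>q\<bar>*(e*n)))" by simp
  also have "... <= 2 powr (n*e)*(card (typed n (T' q) e)*2 powr (- (q*(n*T' q)) + \<bar>q\<bar>*(e*n)))"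
   using elim by (intro mult_right_mono) auto
  also have "... = card (typed n (T' q) e)*2 powr (n*e - q*(n*T' q) + \<bar>q\<bar>*(e*n))"
   by (simp add: powr_add powr_diff powr_minus field_simps)
  finally have "2 powr (- n*T q)*2 powr (- (n*e - q*(n*T' q) + \<bar>q\<bar>*(e*n)))
    <= card (typed n (T' q) e)*2 powr (n*e - q*(n*T' q) + \<bar>q\<bar>*(e*n))*2 powr (- (n*e - q*(n*T' q) + \<bar>q\<bar>*(e*n)))"
   by (rule mult_right_mono) auto
  also have "... = card (typed n (T' q) e)" by (subst mult.assoc, subst powr_add[symmetric]) simp
  finally have "2 powr (- n*T q)*2 powr (- (n*e - q*(n*T' q) + \<bar>q\<bar>*(e*n))) <= card (typed n (T' q) e)" .
  thus ?case by (simp add: ent_def algebra_simps flip: powr_add)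
 qed
qed

text \<open>A typed word exists, and its single weight is at most the whole partition function;
  comparing exponents gives the claim.\<close>

lemma ent_nonneg: "ent q >= 0"
proof (rule ccontr)
 assume "\<not> ?thesis"
 hence n: "- ent q > 0" by simp
 define e where "e = - ent q/(2*(\<bar>q\<bar> + 1))"
 have e: "e > 0" using n by (simp add: e_def divide_neg_pos)
 have e': "(\<bar>q\<bar> + 1)*e = - ent q/2" by (simp add: e_def field_simps)
 obtain n where nn: "n > 0" "(\<Sum>w\<in>typed n (T' q) e. W q w) >= Z q n/2"
  using eventually_conj[OF law_of_large_numbers[OF e, of q] eventually_gt_at_top[of 0]]
  by (auto dest!: eventually_happens)
 obtain m where m: "(\<Sum>w\<in>typed m (T' q) e. W q w) >= Z q m/2" "real m*(- ent q/2) > \<bar>q\<bar>*c0 + 1"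
 proof -
  have "ev (%m. real m*d > \<bar>q\<bar>*c0 + 1)" if "d > 0" for d using that by real_asymp
  from this[of "- ent q/2"] n have "ev (%m. real m*(- ent q/2) > \<bar>q\<bar>*c0 + 1)" by simp
  from eventually_conj[OF law_of_large_numbers[OF e, of q] this] show ?thesis
   using that by (auto dest!: eventually_happens)
 qed
 have "typed m (T' q) e ~= {}"
 proof
  assume "typed m (T' q) e = {}"
  hence "Z q m/2 <= 0" using m by simp
  thus False using Z_pos[of q m] by linarith
 qed
 then obtain w where w: "w \<in> typed m (T' q) e" by blast
 hence wm: "w \<in> words m" by (simp add: typed_def)
 have "W q w <= Z q m" unfolding Z_def using wm by (intro member_le_sum) auto
 hence "log 2 (W q w) <= log 2 (Z q m)" by (intro log_mono) auto
 hence "- q*g w <= \<bar>q\<bar>*c0 - m*T q" using log_Z(2)[of q m] by (simp add: W_def)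
 moreover have "\<bar>q*(g w - m*T' q)\<bar> <= \<bar>q\<bar>*(e*m)"
  unfolding abs_mult using w by (intro mult_left_mono) (auto simp: typed_def)
 moreover have "\<bar>q\<bar>*(e*m) <= (- ent q/2)*m" using e unfolding e'[symmetric] by (simp add: algebra_simps)
 moreover have "- (m*ent q) = m*T q - q*(m*T' q)" by (simp add: ent_def algebra_simps)
 moreover have "q*(g w - m*T' q) = q*g w - q*(m*T' q)" by (simp add: algebra_simps)
 ultimately have "- (m*ent q) <= \<bar>q\<bar>*c0 + (- ent q/2)*m" by linarith
 moreover have "(- ent q/2)*m*2 = - (m*ent q)" by simp
 moreover have "m*(- ent q/2) = (- ent q/2)*m" by simp
 ultimately show False using m(2) by linarith
qed

section \<open>Strict concavity: an affine piece forces bounded deviations\<close>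

lemma tightness:
 assumes s: "s > 0" and aff: "T (q - s) = T q - s*H" "T (q + s) = T q + s*H" and y: "y > 0"
 shows "\<exists>L\<ge>0. \<forall>n. (\<Sum>w\<in>{w \<in> words n. \<bar>g w - n*H\<bar> > L}. W q w) <= 2*y*Z q n"
proof -
 define K where "K = \<bar>log 2 (C q/y)\<bar> + (\<bar>q - s\<bar> + \<bar>q + s\<bar>)*c0"
 define L where "L = K/s + 1"
 have K: "K >= 0" using c0_nonneg by (simp add: K_def)
 have Ls: "s*L > K" using s by (simp add: L_def field_simps)
 have "(\<Sum>w\<in>{w \<in> words n. \<bar>g w - n*H\<bar> > L}. W q w) <= 2*y*Z q n" for n
 proof -
  define A where "A = {w \<in> words n. g w > n*H + L}"
  define B where "B = {w \<in> words n. g w < n*H - L}"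
  have A: "(\<Sum>w\<in>A. W q w) < y*Z q n"
  proof (rule ccontr)
   assume "\<not> ?thesis"
   hence a: "y*Z q n <= (\<Sum>w\<in>A. W q w)" by linarith
   have "s*(n*H + L) <= n*(T q - T (q - s)) + log 2 (C q/y) + \<bar>q - s\<bar>*c0"
   proof (rule tail_bound[OF _ y a])
    fix w assume "w \<in> A"
    thus "s*(n*H + L) <= (q - (q - s))*g w"
     using s by (auto simp: A_def intro!: mult_left_mono)
   qed (auto simp: A_def)
   \<comment> \<open>On an affine piece the terms linear in \<open>n\<close> cancel exactly, so the
     tail is controlled beyond a bounded distance \<open>L\<close> instead of
     \<open>e*n\<close>.\<close>
   moreover have "n*(T q - T (q - s)) = s*(n*H)" by (simp add: aff)
   moreover have "\<bar>q + s\<bar>*c0 >= 0" using c0_nonneg by simp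
   moreover have "log 2 (C q/y) <= \<bar>log 2 (C q/y)\<bar>" by simp
   ultimately have "s*L <= K" by (simp add: K_def algebra_simps)
   thus False using Ls by simp
  qed
  have B: "(\<Sum>w\<in>B. W q w) < y*Z q n"
  proof (rule ccontr)
   assume "\<not> ?thesis"
   hence a: "y*Z q n <= (\<Sum>w\<in>B. W q w)" by linarith
   have "(- s)*(n*H - L) <= n*(T q - T (q + s)) + log 2 (C q/y) + \<bar>q + s\<bar>*c0"
   proof (rule tail_bound[OF _ y a])
    fix w assume "w \<in> B"
    thus "(- s)*(n*H - L) <= (q - (q + s))*g w"
     using s by (auto simp: B_def intro!: mult_left_mono)
   qed (auto simp: B_def)
   moreover have "n*(T q - T (q + s)) = - (s*(n*H))" by (simp add: aff)
   moreover have "\<bar>q - s\<bar>*c0 >= 0" using c0_nonneg by simp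
   moreover have "log 2 (C q/y) <= \<bar>log 2 (C q/y)\<bar>" by simp
   ultimately have "s*L <= K" by (simp add: K_def algebra_simps)
   thus False using Ls by simp
  qed
  have "{w \<in> words n. \<bar>g w - n*H\<bar> > L} \<subseteq> A \<union> B" by (auto simp: A_def B_def)
  hence "(\<Sum>w\<in>{w \<in> words n. \<bar>g w - n*H\<bar> > L}. W q w) <= (\<Sum>w\<in>A \<union> B. W q w)"
   by (intro sum_mono2) (auto simp: A_def B_def)
  also have "... <= (\<Sum>w\<in>A. W q w) + (\<Sum>w\<in>B. W q w)"
   by (subst sum.union_inter[symmetric]) (auto simp: A_def B_def intro!: sum_nonneg)
  finally show ?thesis using A B by linarith
 qed
 moreover have "L >= 0" using K s by (simp add: L_def)
 ultimately show ?thesis by blast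
qed

text \<open>If \<open>T\<close> were affine around \<open>q\<close>, the sums \<open>g w - H*length w\<close> would be tight under the Gibbs
 measures at \<open>q\<close>. An Ottaviani-type inequality upgrades this to the whole path of a long word, while an
 exceptional block, which is met almost surely, makes the path jump out of the tight range.\<close>

lemma affine_imp_bounded:
 assumes s: "s > 0" and aff: "T (q - s) = T q - s*H" "T (q + s) = T q + s*H"
 shows "\<exists>B. \<forall>w. \<bar>g w - H*length w\<bar> <= B"
proof -
 \<comment> \<open>Chosen so that the tail bound \<open>2*y\<close>, multiplied by the constant
   \<open>2*(C q)\<^sup>2\<close> of the exit estimate \<open>exitb\<close>, gives
   \<open>1/4\<close>.\<close>
 define y where "y = 1/(16*(C q)\<^sup>2)"
 have C2: "(C q)\<^sup>2 >= 1" using C_ge_1[of q] by simp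
 have y: "y > 0" by (simp add: y_def C_nonzero)
 have "y*16 <= y*(16*(C q)\<^sup>2)" using C2 y by (intro mult_left_mono) linarith+
 moreover have "y*(16*(C q)\<^sup>2) = 1" by (simp add: y_def C_nonzero)
 ultimately have y2: "2*y <= 1/2" by linarith
 obtain L where L: "L >= 0" "!!n. (\<Sum>w\<in>{w \<in> words n. \<bar>g w - n*H\<bar> > L}. W q w) <= 2*y*Z q n"
  using tightness[OF s aff y] by blast
 define L1 where "L1 = 2*L + c0 + 1"
 have L1: "L1 > 0" "L1 - L - c0 > L" using L(1) c0_nonneg by (auto simp: L1_def)
 have good: "(\<Sum>w\<in>{w \<in> words n. \<bar>g w - n*H\<bar> <= L}. W q w) >= Z q n/2" for n
 proof -
  have "Z q n = (\<Sum>w\<in>{w \<in> words n. \<bar>g w - n*H\<bar> <= L} \<union> {w \<in> words n. \<bar>g w - n*H\<bar> > L}. W q w)"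
   unfolding Z_def by (intro sum.cong) auto
  also have "... = (\<Sum>w\<in>{w \<in> words n. \<bar>g w - n*H\<bar> <= L}. W q w) + (\<Sum>w\<in>{w \<in> words n. \<bar>g w - n*H\<bar> > L}. W q w)"
   by (intro sum.union_disjoint) auto
  moreover have "2*y*Z q n <= 1/2*Z q n" by (intro mult_right_mono y2) auto
  ultimately show ?thesis using L(2)[of n] by linarith
 qed
 have "\<bar>g v - H*length v\<bar> <= 2*L1 + 2*c0" for v
 proof (rule ccontr)
  assume v: "\<not> ?thesis"
  define k where "k = length v"
  have vk: "v \<in> words k" by (simp add: k_def words_def)
  have jump: "\<bar>g v - k*H\<bar> > 2*L1 + 2*c0" using v by (simp add: k_def mult.commute)
  \<comment> \<open>\<open>P i\<close> consists of the paths of \<open>i\<close> blocks that have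
    stayed within \<open>L1\<close> at all block ends; \<open>F i\<close> below collects those that
    leave this range for the first time at block \<open>i + 1\<close>.\<close>
  define P where "P i = {w \<in> words (i*k). \<forall>i'\<le>i. \<bar>g (take (i'*k) w) - i'*(k*H)\<bar> <= L1}" for i
  have fP: "finite (P i)" for i by (auto simp: P_def)
  have PS: "P (Suc i) = {x @ u |x u. x \<in> P i & u \<in> words k & \<bar>g (x @ u) - Suc i*(k*H)\<bar> <= L1}" for i
  proof (intro set_eqI iffI)
   fix w assume w: "w \<in> P (Suc i)"
   define x u where "x = take (i*k) w" and "u = drop (i*k) w"
   have lw: "length w = Suc i*k" using w by (simp add: P_def words_def)
   have "w = x @ u" by (simp add: x_def u_def)
   moreover have "u \<in> words k" using lw by (simp add: u_def words_def)
   moreover have "x \<in> P i"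
    unfolding P_def
   proof (intro CollectI conjI allI impI)
    show "x \<in> words (i*k)" using lw by (simp add: x_def words_def)
    fix i' assume i': "i' <= i"
    hence "i'*k <= i*k" by (rule mult_right_mono) simp
    hence "take (i'*k) x = take (i'*k) w" by (simp add: x_def min_absorb1)
    thus "\<bar>g (take (i'*k) x) - i'*(k*H)\<bar> <= L1" using w i' by (auto simp: P_def)
   qed
   moreover have "\<bar>g (x @ u) - Suc i*(k*H)\<bar> <= L1"
   proof -
    have "\<bar>g (take (Suc i*k) w) - Suc i*(k*H)\<bar> <= L1"
     using w unfolding P_def by blast
    thus ?thesis using lw \<open>w = x @ u\<close> by simp
   qed
   ultimately show "w \<in> {x @ u |x u. x \<in> P i & u \<in> words k & \<bar>g (x @ u) - Suc i*(k*H)\<bar> <= L1}" by blast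
  next
   fix w assume "w \<in> {x @ u |x u. x \<in> P i & u \<in> words k & \<bar>g (x @ u) - Suc i*(k*H)\<bar> <= L1}"
   then obtain x u where w: "w = x @ u" "x \<in> P i" "u \<in> words k" "\<bar>g (x @ u) - Suc i*(k*H)\<bar> <= L1" by blast
   have l: "length x = i*k" "length u = k" using w by (auto simp: P_def words_def)
   show "w \<in> P (Suc i)"
    unfolding P_def
   proof (intro CollectI conjI allI impI)
    show "w \<in> words (Suc i*k)" using w l by (simp add: words_def)
    fix i' assume i': "i' <= Suc i"
    show "\<bar>g (take (i'*k) w) - i'*(k*H)\<bar> <= L1"
    proof (cases "i' = Suc i")
     case True thus ?thesis using w l by simp
    next
     case False
     hence "i'*k <= i*k" using i' by (intro mult_right_mono) auto
     hence "take (i'*k) w = take (i'*k) x" using w l by simp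
     thus ?thesis using w(2) False i' by (auto simp: P_def)
    qed
   qed
  qed
  define R where "R X n = (\<Sum>x\<in>X. \<Sum>z\<in>words n. W q (x @ z))" for X :: "'n word set" and n
  define F where "F i = {x @ u |x u. x \<in> P i & u \<in> words k & \<not> \<bar>g (x @ u) - Suc i*(k*H)\<bar> <= L1}" for i
  have PF: "P (Suc i) \<union> F i = (%(x, u). x @ u) ` (P i \<times> words k)" "P (Suc i) \<inter> F i = {}" for i
  proof -
   have "P (Suc i) \<union> F i = {x @ u |x u. x \<in> P i & u \<in> words k}"
    unfolding PS F_def by blast
   thus "P (Suc i) \<union> F i = (%(x, u). x @ u) ` (P i \<times> words k)" unfolding append_image_set .
   show "P (Suc i) \<inter> F i = {}"
   proof (rule equals0I)
    fix w assume w: "w \<in> P (Suc i) \<inter> F i"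
    have "\<bar>g w - Suc i*(k*H)\<bar> <= L1" using IntD1[OF w] unfolding PS by blast
    moreover have "\<not> \<bar>g w - Suc i*(k*H)\<bar> <= L1" using IntD2[OF w] unfolding F_def by blast
    ultimately show False by blast
   qed
  qed
  have fF: "finite (F i)" for i
  proof -
   have "finite (P (Suc i) \<union> F i)" unfolding PF(1) using fP by (intro finite_imageI finite_SigmaI) auto
   thus ?thesis by simp
  qed
  have inj: "inj_on (%(x, u). x @ u) (P i \<times> words k)" for i
   by (rule inj_on_append[where m = "i*k"]) (simp add: P_def words_def)
  have split: "R (P i) (k + n) = R (P (Suc i)) n + R (F i) n" for i n
  proof -
   have "R (P (Suc i)) n + R (F i) n = R (P (Suc i) \<union> F i) n"
    unfolding R_def using fP fF PF(2) by (intro sum.union_disjoint[symmetric]) auto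
   also have "... = (\<Sum>(x, u)\<in>P i \<times> words k. \<Sum>z\<in>words n. W q ((x @ u) @ z))"
    unfolding PF(1) R_def by (subst sum.reindex[OF inj]) (simp add: case_prod_unfold)
   also have "... = (\<Sum>x\<in>P i. \<Sum>u\<in>words k. \<Sum>z\<in>words n. W q ((x @ u) @ z))"
    by (rule sum.cartesian_product[symmetric])
   also have "... = R (P i) (k + n)"
    unfolding R_def sum_words_append append_assoc ..
   finally show ?thesis ..
  qed
  have Rnn: "R X n >= 0" for X n by (auto simp: R_def intro!: sum_nonneg)
  have P0: "P 0 = {[]}"
  proof -
   have "\<bar>g []\<bar> <= L1" using qa[of "[]" "[]"] L(1) unfolding L1_def by simp
   thus ?thesis unfolding P_def by auto
  qed
  \<comment> \<open>A lower bound for the share of the mass whose next block is the exceptional word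
    \<open>v\<close>. Appending \<open>v\<close> always forces an exit, because its deviation
    exceeds the width \<open>2*L1\<close> plus the errors.\<close>
  define th where "th = W q v/(Z q k*(C q*C q*(C q*C q)))"
  have th: "th > 0" by (simp add: th_def)
  have vF: "x @ v \<in> F i" if x: "x \<in> P i" for x i
  proof -
   have "\<bar>g (take (i*k) x) - i*(k*H)\<bar> <= L1" using x unfolding P_def by blast
   hence 1: "\<bar>g x - i*(k*H)\<bar> <= L1" using x by (auto simp: P_def words_def)
   have e: "Suc i*(k*H) = i*(k*H) + k*H" by (simp add: algebra_simps)
   have "\<bar>g (x @ v) - Suc i*(k*H)\<bar> > L1"
    using 1 qa[of x v] jump L1 unfolding e by linarith
   hence "\<not> \<bar>g (x @ v) - Suc i*(k*H)\<bar> <= L1" by simp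
   thus ?thesis using x vk unfolding F_def by blast
  qed
  have dec: "R (P (Suc i)) n <= (1 - th)*R (P i) (k + n)" for i n
  proof -
   have "th*R (P i) (k + n) = (\<Sum>x\<in>P i. th*(\<Sum>z\<in>words (k + n). W q (x @ z)))"
    by (simp add: R_def sum_distrib_left)
   also have "... <= (\<Sum>x\<in>P i. \<Sum>z\<in>words n. W q ((x @ v) @ z))"
   proof (rule sum_mono)
    fix x assume "x \<in> P i"
    have "(\<Sum>z\<in>words (k + n). W q (x @ z)) <= (\<Sum>z\<in>words (k + n). C q*(W q x*W q z))"
     by (intro sum_mono W_append)
    also have "... = C q*W q x*Z q (k + n)" by (simp add: Z_def sum_distrib_left mult_ac)
    also have "... <= C q*W q x*(C q*(Z q k*Z q n))" by (intro mult_left_mono Z_append) auto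
    finally have "th*(\<Sum>z\<in>words (k + n). W q (x @ z)) <= th*(C q*W q x*(C q*(Z q k*Z q n)))"
     using th by (intro mult_left_mono) auto
    also have "... = W q x*W q v * Z q n/(C q*C q)"
     by (simp add: th_def C_nonzero)
    also have "... = (\<Sum>z\<in>words n. W q x*W q v * W q z)/(C q)\<^sup>2"
     by (simp add: Z_def sum_distrib_left power2_eq_square)
    also have "... <= (\<Sum>z\<in>words n. (C q)\<^sup>2*W q (x @ v @ z))/(C q)\<^sup>2"
     by (intro divide_right_mono sum_mono W_append3) auto
    also have "... = (\<Sum>z\<in>words n. W q ((x @ v) @ z))"
     by (simp add: C_nonzero sum_divide_distrib)
    finally show "th*(\<Sum>z\<in>words (k + n). W q (x @ z)) <= (\<Sum>z\<in>words n. W q ((x @ v) @ z))" by simp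
   qed
   also have "... = R ((%x. x @ v) ` P i) n"
    unfolding R_def by (subst sum.reindex) (auto simp: inj_on_def)
   also have "... <= R (F i) n"
    unfolding R_def by (intro sum_mono2 fF) (auto simp: vF intro!: sum_nonneg)
   finally show ?thesis using split[of i n] by (simp add: algebra_simps)
  qed
  have th1: "th <= 1"
  proof -
   have "W q v <= Z q k" unfolding Z_def using vk by (intro member_le_sum) auto
   also have "... <= Z q k*(C q*C q*(C q*C q))"
   proof -
    have "1*1*(1*1) <= C q*C q*(C q*C q)" using C_ge_1[of q] by (intro mult_mono) auto
    thus ?thesis using mult_left_mono[of 1 "C q*C q*(C q*C q)" "Z q k"] by simp
   qed
   finally show ?thesis unfolding th_def by (subst pos_divide_le_eq) auto
  qed
  have small: "R (P i) (j*k) <= (1 - th) ^ i*Z q ((i + j)*k)" for i j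
  proof (induction i arbitrary: j)
   case 0 show ?case by (simp add: P0 R_def Z_def)
  next
   case (Suc i)
   have "R (P (Suc i)) (j*k) <= (1 - th)*R (P i) (Suc j*k)" using dec[of i "j*k"] by simp
   also have "... <= (1 - th)*((1 - th) ^ i*Z q ((i + Suc j)*k))" using th1 by (intro mult_left_mono Suc) auto
   finally show ?case by simp
  qed
  \<comment> \<open>Ottaviani: after an exit at least half of the continuations deviate by at most
    \<open>L\<close>, so the mass of the exits is controlled by the mass of words ending outside the
    tight range.\<close>
  have exitb: "R (F i) (j*k) <= 2*(C q)\<^sup>2*(\<Sum>x\<in>F i. \<Sum>z\<in>{z \<in> words (j*k). \<bar>g z - (j*k)*H\<bar> <= L}. W q (x @ z))" for i j
   unfolding R_def
  proof (subst sum_distrib_left, rule sum_mono)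
   fix x assume "x \<in> F i"
   have "(\<Sum>z\<in>words (j*k). W q (x @ z)) <= (\<Sum>z\<in>words (j*k). C q*(W q x*W q z))"
    by (intro sum_mono W_append)
   also have "... = C q*W q x*Z q (j*k)" by (simp add: Z_def sum_distrib_left mult_ac)
   also have "... <= C q*W q x*(2*(\<Sum>z\<in>{z \<in> words (j*k). \<bar>g z - (j*k)*H\<bar> <= L}. W q z))"
    using good[of "j*k"] by (intro mult_left_mono) (auto intro!: mult_nonneg_nonneg)
   also have "... = 2*C q*(\<Sum>z\<in>{z \<in> words (j*k). \<bar>g z - (j*k)*H\<bar> <= L}. W q x*W q z)"
    by (simp add: sum_distrib_left mult_ac)
   also have "... <= 2*C q*(\<Sum>z\<in>{z \<in> words (j*k). \<bar>g z - (j*k)*H\<bar> <= L}. C q*W q (x @ z))"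
    by (intro mult_left_mono sum_mono W_append) auto
   also have "... = 2*(C q)\<^sup>2*(\<Sum>z\<in>{z \<in> words (j*k). \<bar>g z - (j*k)*H\<bar> <= L}. W q (x @ z))"
    by (simp add: sum_distrib_left power2_eq_square mult_ac)
   finally show "(\<Sum>z\<in>words (j*k). W q (x @ z)) <= 2*(C q)\<^sup>2*(\<Sum>z\<in>{z \<in> words (j*k). \<bar>g z - (j*k)*H\<bar> <= L}. W q (x @ z))" .
  qed
  define Q where "Q i j = (%(x, z). x @ z) ` (F i \<times> {z \<in> words (j*k). \<bar>g z - (j*k)*H\<bar> <= L})" for i j
  have FlenL: "x \<in> F i ==> length x = Suc i*k & \<bar>g x - Suc i*(k*H)\<bar> > L1" for x i
  proof -
   assume "x \<in> F i"
   then obtain y u where "x = y @ u" "y \<in> P i" "u \<in> words k" "\<not> \<bar>g (y @ u) - Suc i*(k*H)\<bar> <= L1"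
    unfolding F_def by blast
   moreover from this have "length y = i*k" "length u = k" unfolding P_def words_def by blast+
   ultimately show ?thesis by simp
  qed
  have Qsum: "(\<Sum>x\<in>F i. \<Sum>z\<in>{z \<in> words (j*k). \<bar>g z - (j*k)*H\<bar> <= L}. W q (x @ z)) = (\<Sum>w\<in>Q i j. W q w)" for i j
  proof -
   have "inj_on (%(x, z). x @ z) (F i \<times> {z \<in> words (j*k). \<bar>g z - (j*k)*H\<bar> <= L})"
    by (rule inj_on_append[where m = "Suc i*k"]) (use FlenL in blast)
   from sum.reindex[OF this, of "W q"] show ?thesis
    by (simp add: Q_def sum.cartesian_product case_prod_unfold)
  qed
  have QE: "\<exists>x z. w = x @ z & x \<in> F i & z \<in> words (j*k) & \<bar>g z - (j*k)*H\<bar> <= L" if "w \<in> Q i j" for w i j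
  proof -
   have "w \<in> (%(x, z). x @ z) ` (F i \<times> {z \<in> words (j*k). \<bar>g z - (j*k)*H\<bar> <= L})"
    using that unfolding Q_def .
   then obtain p where p: "w = (case p of (x, z) => x @ z)" "p \<in> F i \<times> {z \<in> words (j*k). \<bar>g z - (j*k)*H\<bar> <= L}"
    by (rule imageE)
   show ?thesis by (rule exI[of _ "fst p"], rule exI[of _ "snd p"]) (use p in \<open>simp add: case_prod_unfold mem_Times_iff\<close>)
  qed
  have Qsub: "Q i j \<subseteq> {w \<in> words ((Suc i + j)*k). \<bar>g w - ((Suc i + j)*k)*H\<bar> > L}" for i j
  proof
   fix w assume "w \<in> Q i j"
   then obtain x z where w: "w = x @ z" "x \<in> F i" "z \<in> words (j*k)" "\<bar>g z - (j*k)*H\<bar> <= L"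
    using QE by blast
   define s where "s = Suc i*(k*H)"
   define t where "t = real (j*k)*H"
   have e: "real ((Suc i + j)*k)*H = s + t" unfolding s_def t_def by (simp add: distrib_right)
   have "\<bar>g x - s\<bar> > L1" using conjunct2[OF FlenL[OF w(2)]] unfolding s_def .
   moreover have "\<bar>g z - t\<bar> <= L" using w(4) unfolding t_def .
   ultimately have "\<bar>g (x @ z) - (s + t)\<bar> > L" using qa[of x z] L1(2) by linarith
   hence "\<bar>g w - ((Suc i + j)*k)*H\<bar> > L" unfolding e w(1) .
   moreover have "w \<in> words ((Suc i + j)*k)"
    using conjunct1[OF FlenL[OF w(2)]] w(3) unfolding w(1) words_def by (simp add: distrib_right)
   ultimately show "w \<in> {w \<in> words ((Suc i + j)*k). \<bar>g w - ((Suc i + j)*k)*H\<bar> > L}" by blast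
  qed
  have Qdisj: "Q i j \<inter> Q i' j' = {}" if ii: "i < i'" "Suc i + j = Suc i' + j'" for i i' j j'
  proof (rule ccontr)
   assume "Q i j \<inter> Q i' j' ~= {}"
   then obtain w where wQ: "w \<in> Q i j" "w \<in> Q i' j'" by blast
   obtain x z where 1: "w = x @ z" "x \<in> F i" using QE[OF wQ(1)] by blast
   obtain x' z' where 2: "w = x' @ z'" "x' \<in> F i'" using QE[OF wQ(2)] by blast
   have w: "x @ z = x' @ z'" "x \<in> F i" "x' \<in> F i'" using 1 2 by auto
   obtain y u where y: "x' = y @ u" "y \<in> P i'" "u \<in> words k" using w(3) unfolding F_def by blast
   have "Suc i*k <= i'*k" using ii by (intro mult_right_mono) auto
   moreover have "length y = i'*k" using y(2) unfolding P_def words_def by blast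
   ultimately have "take (Suc i*k) (x' @ z') = take (Suc i*k) y" unfolding y(1) by simp
   moreover have "take (Suc i*k) (x @ z) = x" using conjunct1[OF FlenL[OF w(2)]] by simp
   ultimately have xy: "x = take (Suc i*k) y" unfolding w(1) by simp
   have "\<bar>g (take (Suc i*k) y) - Suc i*(k*H)\<bar> <= L1"
    using y(2) Suc_leI[OF ii(1)] unfolding P_def by blast
   thus False using conjunct2[OF FlenL[OF w(2)]] unfolding xy[symmetric] unfolding not_le[symmetric] by (rule notE[rotated])
  qed
  have tot: "Z q (M*k) = R (P i) ((M - i)*k) + (\<Sum>i'<i. R (F i') ((M - Suc i')*k))" if "i <= M" for M i
   using that
  proof (induction i)
   case 0 thus ?case by (simp add: P0 R_def Z_def)
  next
   case (Suc i)
   hence "M - i = Suc (M - Suc i)" by simp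
   hence "(M - i)*k = k + (M - Suc i)*k" by (metis mult_Suc)
   with split[of i "(M - Suc i)*k"] have "R (P i) ((M - i)*k) = R (P (Suc i)) ((M - Suc i)*k) + R (F i) ((M - Suc i)*k)"
    by simp
   with Suc show ?case by simp
  qed
  \<comment> \<open>The mass either never leaves, which has a geometrically small proportion, or
    leaves for the first time at some block; the latter total is at most a quarter. For large
    \<open>M\<close> this is impossible.\<close>
  have main: "Z q (M*k) <= (1 - th) ^ M*Z q (M*k) + 1/4*Z q (M*k)" for M
  proof -
   have "(\<Sum>i<M. R (F i) ((M - Suc i)*k)) <= (\<Sum>i<M. 2*(C q)\<^sup>2*(\<Sum>w\<in>Q i (M - Suc i). W q w))"
    unfolding Qsum[symmetric] by (intro sum_mono exitb)
   also have "... = 2*(C q)\<^sup>2*(\<Sum>w\<in>(\<Union>i<M. Q i (M - Suc i)). W q w)"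
   proof (subst sum.UNION_disjoint)
    show "\<forall>i\<in>{..<M}. finite (Q i (M - Suc i))"
    proof
     fix i
     show "finite (Q i (M - Suc i))" by (rule finite_subset[OF Qsub]) simp
    qed
    show "\<forall>i\<in>{..<M}. \<forall>j\<in>{..<M}. i ~= j --> Q i (M - Suc i) \<inter> Q j (M - Suc j) = {}"
    proof (intro ballI impI)
     fix i j assume "i \<in> {..<M}" "j \<in> {..<M}" "i ~= j"
     thus "Q i (M - Suc i) \<inter> Q j (M - Suc j) = {}"
      using Qdisj[of i j "M - Suc i" "M - Suc j"] Qdisj[of j i "M - Suc j" "M - Suc i"]
      by (cases "i < j") auto
    qed
   qed (auto simp: sum_distrib_left)
   also have "... <= 2*(C q)\<^sup>2*(\<Sum>w\<in>{w \<in> words (M*k). \<bar>g w - (M*k)*H\<bar> > L}. W q w)"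
   proof (intro mult_left_mono sum_mono2)
    show "(\<Union>i<M. Q i (M - Suc i)) \<subseteq> {w \<in> words (M*k). \<bar>g w - (M*k)*H\<bar> > L}"
    proof (rule UN_least)
     fix i assume "i \<in> {..<M}"
     hence "Suc i + (M - Suc i) = M" by simp
     thus "Q i (M - Suc i) \<subseteq> {w \<in> words (M*k). \<bar>g w - (M*k)*H\<bar> > L}" using Qsub[of i "M - Suc i"] by simp
    qed
   qed auto
   also have "... <= 2*(C q)\<^sup>2*(2*y*Z q (M*k))" by (intro mult_left_mono L) auto
   also have "... = 1/4*Z q (M*k)" by (simp add: y_def C_nonzero)
   finally have "(\<Sum>i<M. R (F i) ((M - Suc i)*k)) <= 1/4*Z q (M*k)" .
   moreover have "R (P M) (0*k) <= (1 - th) ^ M*Z q (M*k)" using small[of M 0] by (simp only: add_0_right)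
   moreover have "Z q (M*k) = R (P M) (0*k) + (\<Sum>i'<M. R (F i') ((M - Suc i')*k))"
    using tot[OF order_refl[of M]] by (simp only: diff_self_eq_0)
   ultimately show ?thesis by linarith
  qed
  have "(%M. (1 - th) ^ M) \<longlonglongrightarrow> 0" using th th1 by (intro LIMSEQ_realpow_zero) auto
  hence "ev (%M. (1 - th) ^ M < 1/2)" by (rule order_tendstoD) simp
  then obtain M where "(1 - th) ^ M < 1/2" by (auto dest!: eventually_happens)
  hence "(1 - th) ^ M*Z q (M*k) < 1/2*Z q (M*k)" by (intro mult_strict_right_mono) auto
  with main[of M] have "1/4*Z q (M*k) < 0" by linarith
  with Z_pos[of q "M*k"] show False by linarith
 qed
 thus ?thesis by blast
qed

text \<open>Equality of two derivatives makes \<open>T'\<close> constant in between, hence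
  \<open>T\<close> affine around the midpoint, and \<open>affine_imp_bounded\<close> contradicts
  \<open>nb\<close>.\<close>

lemma T'_strict_antimono:
 assumes nb: "!!(H::real) B. \<exists>w. \<bar>g w - H*length w\<bar> > B" and qr: "q < r"
 shows "T' r < T' q"
proof (rule ccontr)
 assume "\<not> T' r < T' q"
 hence eq: "T' x = T' q" if "q <= x" "x <= r" for x
  using T'_antimono[of q x] T'_antimono[of x r] that by linarith
 define m s where "m = (q + r)/2" and "s = (r - q)/2"
 have ms: "m - s = q" "m + s = r" "s > 0" using qr by (auto simp: m_def s_def field_simps)
 have "T r <= T m + T' q * s" "T m <= T r - T' q * s" "T q <= T m - T' q * s" "T m <= T q + T' q * s"
  using T_tangent[of r m] T_tangent[of m r] T_tangent[of q m] T_tangent[of m q] eq[of m] eq[of r] eq[of q] qr ms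
  by (auto simp: m_def s_def field_simps)
 hence "T (m - s) = T m - s*T' q" "T (m + s) = T m + s*T' q" unfolding ms by (auto simp: mult.commute)
 from affine_imp_bounded[OF ms(3) this] obtain B where "!!w. \<bar>g w - T' q*length w\<bar> <= B" by blast
 moreover obtain w where "\<bar>g w - T' q*length w\<bar> > B" using nb by blast
 ultimately show False by (metis not_le)
qed

end

section \<open>Legendre transforms\<close>

lemma max_divide_mult: "(p::real) > 0 ==> y <= max x (y/p)*p"
 using mult_right_mono[of "y/p" "max x (y/p)" p] by simp

text \<open>The deterministic convex analysis, stated for an abstract \<open>T\<close>. The bounds
  on \<open>T'\<close> keep the range of exponents bounded and away from zero, and
  \<open>ent_nn\<close> makes the spectrum nonnegative on that range.\<close>

locale spectrum =
 fixes T T' :: "real => real" and d \<delta> G c :: real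
 assumes T_has_deriv: "!!q. (T has_real_derivative T' q) (at q)"
  and tangent: "!!x q. T x <= T q + T' q*(x - q)"
  and T'_lower: "!!q. \<delta> <= T' q" and T'_upper: "!!q. T' q <= G" and \<delta>0: "\<delta> > 0"
  and T'_strict: "!!q r. q < r ==> T' r < T' q"
  and T0: "T 0 = - d"
  and ent_nn: "!!q. q*T' q - T q >= 0"
  and c0: "0 < c" and cd: "c < d"
begin

definition en :: "real => real" where "en q = q*T' q - T q"
definition hmin :: real where "hmin = Inf (range T')"
definition hmax :: real where "hmax = Sup (range T')"

abbreviation D :: "real => ereal" where "D \<equiv> legendre T"
definition Dr :: "real => real" where "Dr H = real_of_ereal (D H)"

lemma en_0: "en 0 = d" by (simp add: en_def T0)
lemma en_nonneg: "en q >= 0" using ent_nn by (simp add: en_def)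

lemma deriv_T: "deriv T = T'" using T_has_deriv by (intro ext DERIV_imp_deriv)

lemma hmin_less: "hmin < T' q"
proof -
 have "hmin <= T' (q + 1)" unfolding hmin_def
  by (rule cInf_lower) (auto intro!: bdd_belowI2[of _ \<delta>] T'_lower)
 thus ?thesis using T'_strict[of q "q + 1"] by simp
qed

lemma less_hmax: "T' q < hmax"
proof -
 have "T' (q - 1) <= hmax" unfolding hmax_def
  by (rule cSup_upper) (auto intro!: bdd_aboveI2[of _ _ G] T'_upper)
 thus ?thesis using T'_strict[of "q - 1" q] by simp
qed

lemma hmin_pos: "hmin > 0"
proof -
 have "\<delta> <= hmin" unfolding hmin_def by (rule cInf_greatest) (auto intro: T'_lower)
 thus ?thesis using \<delta>0 by linarith
qed

lemma T'_below: "hmin < x ==> \<exists>q. T' q < x"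
 unfolding hmin_def by (drule cInf_lessD[rotated]) auto

lemma T'_above: "x < hmax ==> \<exists>q. x < T' q"
 unfolding hmax_def by (drule less_cSupD[rotated]) auto

lemma T'_mono: "q <= r ==> T' r <= T' q" using T'_strict[of q r] by (cases "q = r") auto

lemma T'_lim_top: "(T' \<longlongrightarrow> hmin) at_top"
proof (rule decreasing_tendsto)
 show "eventually (%q. hmin <= T' q) at_top" using hmin_less by (intro always_eventually) (auto intro: less_imp_le)
 fix x assume "hmin < x"
 then obtain q where "T' q < x" using T'_below by blast
 thus "eventually (%q. T' q < x) at_top"
  unfolding eventually_at_top_linorder using T'_mono by (metis le_less_trans)
qed

lemma T'_lim_bot: "(T' \<longlongrightarrow> hmax) at_bot"
proof (rule increasing_tendsto)
 show "eventually (%q. T' q <= hmax) at_bot" using less_hmax by (intro always_eventually) (auto intro: less_imp_le)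
 fix x assume "x < hmax"
 then obtain q where "x < T' q" using T'_above by blast
 thus "eventually (%q. x < T' q) at_bot"
  unfolding eventually_at_bot_linorder using T'_mono by (metis less_le_trans)
qed

lemma isCont_T: "isCont T q" using T_has_deriv DERIV_isCont by blast

lemma T_slope_lim: "((%y. (T y - T q)/(y - q)) \<longlongrightarrow> T' q) (at q)"
 using T_has_deriv[of q] by (simp add: has_field_derivative_iff)

text \<open>Secants to a fixed nearby point bound \<open>T'\<close> on one side and depend
  continuously on the other endpoint.\<close>

lemma isCont_T': "isCont T' q"
 unfolding isCont_def
proof (rule order_tendstoI)
 fix a assume a: "a < T' q"
 have "eventually (%y. a < (T y - T q)/(y - q)) (at q)" by (rule order_tendstoD(1)[OF T_slope_lim a])
 then obtain e where e: "e > 0" "!!y. y ~= q ==> dist y q < e ==> a < (T y - T q)/(y - q)"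
  unfolding eventually_at by auto
 define y where "y = q + e/2"
 have y: "y > q" "a < (T y - T q)/(y - q)" using e(2)[of y] e(1) by (auto simp: y_def dist_real_def)
 have "((%x. (T y - T x)/(y - x)) \<longlongrightarrow> (T y - T q)/(y - q)) (at q)"
  using y isCont_T[of q] unfolding isCont_def by (intro tendsto_intros) auto
 from order_tendstoD(1)[OF this y(2)] have "eventually (%x. a < (T y - T x)/(y - x)) (at q)" .
 moreover have "eventually (%x. x < y) (at q)" using order_tendstoD(2)[OF tendsto_ident_at y(1)] .
 ultimately show "eventually (%x. a < T' x) (at q)"
 proof eventually_elim
  case (elim x)
  have "T y - T x <= T' x*(y - x)" using tangent[of y x] by simp
  hence "(T y - T x)/(y - x) <= T' x" using elim by (simp add: pos_divide_le_eq)
  thus ?case using elim by linarith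
 qed
next
 fix a assume a: "T' q < a"
 have "eventually (%y. (T y - T q)/(y - q) < a) (at q)" by (rule order_tendstoD(2)[OF T_slope_lim a])
 then obtain e where e: "e > 0" "!!y. y ~= q ==> dist y q < e ==> (T y - T q)/(y - q) < a"
  unfolding eventually_at by auto
 define y where "y = q - e/2"
 have y: "y < q" "(T y - T q)/(y - q) < a" using e(2)[of y] e(1) by (auto simp: y_def dist_real_def)
 have "((%x. (T y - T x)/(y - x)) \<longlongrightarrow> (T y - T q)/(y - q)) (at q)"
  using y isCont_T[of q] unfolding isCont_def by (intro tendsto_intros) auto
 from order_tendstoD(2)[OF this y(2)] have "eventually (%x. (T y - T x)/(y - x) < a) (at q)" .
 moreover have "eventually (%x. y < x) (at q)" using order_tendstoD(1)[OF tendsto_ident_at y(1)] .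
 ultimately show "eventually (%x. T' x < a) (at q)"
 proof eventually_elim
  case (elim x)
  have "T' x*(x - y) <= T x - T y" using tangent[of y x] by (simp add: algebra_simps)
  hence "T' x <= (T x - T y)/(x - y)" using elim by (simp add: pos_le_divide_eq)
  also have "... = (T y - T x)/(y - x)" using elim by (simp add: field_simps)
  finally show ?case using elim by linarith
 qed
qed

lemma isCont_en: "isCont en q"
 unfolding en_def using isCont_T isCont_T' by (intro continuous_intros) auto

lemma T'_onto:
 assumes "hmin < H" "H < hmax"
 shows "\<exists>q. T' q = H"
proof -
 obtain b where b: "T' b < H" using T'_below assms by blast
 obtain a where a: "H < T' a" using T'_above assms by blast
 have "a <= b" using a b T'_mono[of b a] by (cases "a <= b") auto
 with a b IVT2[of T' b H a] isCont_T' show ?thesis by auto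
qed

lemma D_le: "D H <= ereal (q*H - T q)"
 unfolding legendre_def by (rule INF_lower) simp

lemma D_ge: "(!!q. x <= ereal (q*H - T q)) ==> x <= D H"
 unfolding legendre_def by (rule INF_greatest)

lemma D_T': "D (T' q) = ereal (en q)"
proof (rule antisym)
 show "D (T' q) <= ereal (en q)" using D_le[of "T' q" q] by (simp add: en_def)
 show "ereal (en q) <= D (T' q)"
 proof (rule D_ge)
  fix r show "ereal (en q) <= ereal (r*T' q - T r)"
   using tangent[of r q] by (simp add: en_def algebra_simps)
 qed
qed

lemma Dr_T': "Dr (T' q) = en q" by (simp add: Dr_def D_T')

lemma en_le: "en r <= q*T' r - T q" using D_le[of "T' r" q] by (simp add: D_T')

lemma T_ge_pos: "q >= 0 ==> T q >= - d + q*hmin"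
 using tangent[of 0 q] hmin_less[of q] mult_left_mono[of hmin "T' q" q] by (simp add: T0 algebra_simps)

lemma T_ge_neg: "q <= 0 ==> T q >= - d + q*hmax"
 using tangent[of 0 q] less_hmax[of q] mult_left_mono_neg[of "T' q" hmax q] by (simp add: T0 algebra_simps)

lemma D_below: "H < hmin ==> D H = - \<infinity>"
proof (rule ereal_bot)
 fix B :: real assume H: "H < hmin"
 define q where "q = max 0 ((d - B)/(hmin - H))"
 have q: "q >= 0" "q*(hmin - H) >= d - B" using H max_divide_mult[of "hmin - H" "d - B" 0] by (auto simp: q_def)
 have "D H <= ereal (q*H - T q)" by (rule D_le)
 also have "q*H - T q <= B" using T_ge_pos[OF q(1)] q(2) by (simp add: algebra_simps)
 finally show "D H <= ereal B" by simp
qed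

lemma hmin_line_antimono: "q <= r ==> r*hmin - T r <= q*hmin - T q"
 using tangent[of q r] hmin_less[of r] mult_right_mono[of hmin "T' r" "r - q"] by (simp add: algebra_simps)

lemma hmax_line_mono: "q <= r ==> q*hmax - T q <= r*hmax - T r"
 using tangent[of r q] less_hmax[of q] mult_right_mono[of "T' q" hmax "r - q"] by (simp add: algebra_simps)

text \<open>Each line \<open>q*H - T q\<close> is nonnegative at every \<open>H = T' r\<close>,
  hence by a limit at both endpoints, hence between them.\<close>

lemma D_nonneg: "hmin <= H ==> H <= hmax ==> 0 <= D H"
proof (rule D_ge)
 fix q assume H: "hmin <= H" "H <= hmax"
 have "0 <= q*hmin - T q"
 proof (rule tendsto_lowerbound)
  show "((%r. q*T' r - T q) \<longlongrightarrow> q*hmin - T q) at_top" by (intro tendsto_intros T'_lim_top)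
  show "eventually (%r. 0 <= q*T' r - T q) at_top"
   using en_le en_nonneg by (intro always_eventually allI) (meson order_trans)
 qed simp
 moreover have "0 <= q*hmax - T q"
 proof (rule tendsto_lowerbound)
  show "((%r. q*T' r - T q) \<longlongrightarrow> q*hmax - T q) at_bot" by (intro tendsto_intros T'_lim_bot)
  show "eventually (%r. 0 <= q*T' r - T q) at_bot"
   using en_le en_nonneg by (intro always_eventually allI) (meson order_trans)
 qed simp
 moreover have "q*hmin <= q*H \<or> q*hmax <= q*H"
  using H by (cases "q >= 0") (auto intro: mult_left_mono mult_left_mono_neg)
 ultimately show "0 <= ereal (q*H - T q)" by auto
qed

lemma D_real: "hmin <= H ==> H <= hmax ==> D H = ereal (Dr H)"
 using D_nonneg[of H] D_le[of H 0] by (cases "D H") (auto simp: Dr_def)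

lemma Dr_nonneg: "hmin <= H ==> H <= hmax ==> Dr H >= 0"
 using D_nonneg[of H] D_real[of H] by simp

text \<open>With \<open>H = T' r\<close>, the supporting lines of parameters \<open>q\<close> and
  \<open>r\<close> squeeze the increment of \<open>Dr\<close> between \<open>q*(H - T' q)\<close>
  and \<open>r*(H - T' q)\<close>, and \<open>r\<close> tends to \<open>q\<close>. No second
  derivative of \<open>T\<close> enters.\<close>

lemma Dr_has_deriv: "(Dr has_real_derivative q) (at (T' q))"
proof -
 have "((%H. (Dr H - Dr (T' q))/(H - T' q)) \<longlongrightarrow> q) (at (T' q))"
 proof (rule tendstoI)
  fix e :: real assume e: "e > 0"
  define I where "I = {T' (q + e) <..< T' (q - e)}"
  have "open I" "T' q \<in> I" using T'_strict e by (auto simp: I_def)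
  hence "eventually (%H. H \<in> I) (at (T' q))" using eventually_at_topological by blast
  moreover have "eventually (%H. H ~= T' q) (at (T' q))" by (simp add: eventually_at_filter)
  ultimately show "eventually (%H. dist ((Dr H - Dr (T' q))/(H - T' q)) q < e) (at (T' q))"
  proof eventually_elim
   case (elim H)
   obtain r where r: "T' r = H"
    using T'_onto[of H] elim hmin_less[of "q + e"] less_hmax[of "q - e"] by (auto simp: I_def)
   have re: "\<bar>r - q\<bar> < e"
   proof -
    have "T' (q + e) < T' r" "T' r < T' (q - e)" using elim r by (auto simp: I_def)
    hence "\<not> q + e <= r" "\<not> r <= q - e" using T'_mono[of "q + e" r] T'_mono[of r "q - e"] by auto
    thus ?thesis by linarith
   qed
   have 1: "en r - en q - q*(H - T' q) <= 0" using en_le[of r q] r by (simp add: en_def algebra_simps)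
   have 2: "en r - en q - q*(H - T' q) >= (r - q)*(H - T' q)"
    using en_le[of q r] r by (simp add: en_def algebra_simps)
   have "\<bar>en r - en q - q*(H - T' q)\<bar> <= \<bar>r - q\<bar>*\<bar>H - T' q\<bar>"
    using 1 2 by (simp flip: abs_mult)
   moreover have "(Dr H - Dr (T' q))/(H - T' q) - q = (en r - en q - q*(H - T' q))/(H - T' q)"
    using elim by (simp add: Dr_T' flip: r) (simp add: field_simps)
   ultimately have "\<bar>(Dr H - Dr (T' q))/(H - T' q) - q\<bar> <= \<bar>r - q\<bar>"
    using elim by (simp add: abs_divide pos_divide_le_eq)
   thus ?case using re by (simp add: dist_real_def)
  qed
 qed
 thus ?thesis by (simp add: has_field_derivative_iff)
qed

lemma T_strict: "q < r ==> T q < T r"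
proof -
 assume "q < r"
 hence "0 < T' r*(r - q)" using T'_lower[of r] \<delta>0 by (intro mult_pos_pos) auto
 moreover have "T' r*(q - r) = - (T' r*(r - q))" by (simp add: algebra_simps)
 ultimately show ?thesis using tangent[of q r] by linarith
qed

section \<open>The exponents of the theorem\<close>

lemma qt_exists: "\<exists>q>0. T q = - c"
proof -
 define b where "b = d/\<delta>"
 have b: "b > 0" using c0 cd \<delta>0 by (simp add: b_def)
 have "\<delta> <= T' b" by (rule T'_lower)
 hence "b*\<delta> <= b*T' b" using b by (intro mult_left_mono) auto
 hence "T b >= 0" using tangent[of 0 b] \<delta>0 by (simp add: T0 b_def algebra_simps)
 hence "\<exists>x\<ge>0. x <= b & T x = - c" using IVT[of T 0 "- c" b] isCont_T b c0 cd T0 by auto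
 then obtain x where "x >= 0" "T x = - c" by blast
 moreover have "x ~= 0" using calculation T0 cd by auto
 ultimately show ?thesis by (intro exI[of _ x]) auto
qed

text \<open>By \<open>en q - q*T' q = - T q\<close>, the tangent to the spectrum at
  \<open>T' q\<close> meets the vertical axis at height \<open>- T q\<close>. So the tangent through
  \<open>(0, c)\<close> is the one with \<open>T q = - c\<close>.\<close>

definition qt :: real where "qt = (SOME q. q > 0 & T q = - c)"

lemma qt: "qt > 0" "T qt = - c"
 using someI_ex[OF qt_exists[unfolded Bex_def]] unfolding qt_def by blast+

definition Ht :: real where "Ht = T' qt"
definition HHt :: real where "HHt = c/qt"

lemma HHt_pos: "HHt > 0" using qt c0 by (simp add: HHt_def)
lemma HHt_qt: "HHt*qt = c" using qt by (simp add: HHt_def)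

lemma Ht_the: "(THE H. hmin < H & H < hmax & Dr H + deriv Dr H*(0 - H) = c) = Ht"
proof -
 have d: "Dr (T' q) + deriv Dr (T' q)*(0 - T' q) = - T q" for q
  using DERIV_imp_deriv[OF Dr_has_deriv[of q]] by (simp add: Dr_T' en_def)
 show ?thesis
 proof (rule the_equality)
  show "hmin < Ht & Ht < hmax & Dr Ht + deriv Dr Ht*(0 - Ht) = c"
   unfolding Ht_def d using hmin_less less_hmax qt by simp
  fix H assume H: "hmin < H & H < hmax & Dr H + deriv Dr H*(0 - H) = c"
  then obtain q where q: "T' q = H" using T'_onto by blast
  with H d[of q] have "T q = T qt" using qt by simp
  hence "q = qt" using T_strict[of q qt] T_strict[of qt q] by (cases q qt rule: linorder_cases) auto
  thus "H = Ht" using q by (simp add: Ht_def)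
 qed
qed

lemma deriv_Dr_Ht: "deriv Dr Ht = qt"
 unfolding Ht_def by (rule DERIV_imp_deriv[OF Dr_has_deriv])

definition Hl :: real where "Hl = Inf {H. H >= 0 & D H >= ereal c}"
definition ql :: ereal where "ql = (if Hl = hmin then \<infinity> else ereal (deriv Dr Hl))"

lemma en_strict: "0 < q ==> q < r ==> en r < en q"
proof -
 assume q: "0 < q" "q < r"
 have "q*T' r < q*T' q" by (rule mult_strict_left_mono[OF T'_strict[OF q(2)] q(1)])
 thus ?thesis using en_le[of r q] by (simp add: en_def)
qed

lemma en_qt: "en qt > c" using qt hmin_less[of qt] hmin_pos by (simp add: en_def)

text \<open>Either the spectrum is already at least \<open>c\<close> at its left end, and
  \<open>ql\<close> is infinite, or \<open>en\<close> decreases through the value \<open>c\<close>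
  at some \<open>q > qt\<close>. In the second case \<open>F\<close> below becomes linear from this
  \<open>q\<close> on.\<close>

lemma Hl_cases:
 obtains "Hl = hmin" "ql = \<infinity>" "ereal c <= D hmin"
 | q where "qt < q" "en q = c" "Hl = T' q" "ql = ereal q"
proof (cases "ereal c <= D hmin")
 case True
 have "Hl = hmin" unfolding Hl_def
 proof (rule cInf_eq_minimum)
  show "hmin \<in> {H. H >= 0 & D H >= ereal c}" using True hmin_pos by auto
  fix H assume "H \<in> {H. H >= 0 & D H >= ereal c}"
  thus "hmin <= H" using D_below[of H] by (cases "H < hmin") auto
 qed
 thus ?thesis using True that(1) by (simp add: ql_def)
next
 case False
 have "\<exists>q0. q0*hmin - T q0 < c"
 proof (rule ccontr)
  assume "\<not> ?thesis"
  hence "ereal c <= D hmin" by (intro D_ge) (auto simp: not_less)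
  thus False using False by simp
 qed
 then obtain q0 where q0: "q0*hmin - T q0 < c" by blast
 have "((%r. q0*T' r - T q0) \<longlongrightarrow> q0*hmin - T q0) at_top" by (intro tendsto_intros T'_lim_top)
 from order_tendstoD(2)[OF this q0] eventually_gt_at_top[of qt]
 have "eventually (%r. q0*T' r - T q0 < c & qt < r) at_top" by (rule eventually_conj)
 then obtain r where r: "q0*T' r - T q0 < c" "qt < r" by (auto dest!: eventually_happens)
 have "en r < c" using r(1) en_le[of r q0] by linarith
 hence "\<exists>x\<ge>qt. x <= r & en x = c" using IVT2[of en r c qt] en_qt isCont_en r by auto
 then obtain q where q: "qt <= q" "en q = c" by blast
 have "q ~= qt" using q en_qt by auto
 hence q': "qt < q" using q by simp
 have "Hl = T' q" unfolding Hl_def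
 proof (rule cInf_eq_minimum)
  show "T' q \<in> {H. H >= 0 & D H >= ereal c}"
   using q hmin_less[of q] hmin_pos by (auto simp: D_T')
  fix H assume "H \<in> {H. H >= 0 & D H >= ereal c}"
  hence "c <= q*H - T q" using D_le[of H q] by (auto dest: order_trans)
  hence "q*T' q <= q*H" using q by (simp add: en_def)
  thus "T' q <= H" using q' qt by simp
 qed
 moreover have "ql = ereal q" using calculation hmin_less[of q] DERIV_imp_deriv[OF Dr_has_deriv[of q]]
  by (simp add: ql_def)
 ultimately show ?thesis using that(2) q q' by blast
qed

lemma Hl_less_Ht: "Hl < Ht"
 by (rule Hl_cases) (auto simp: Ht_def hmin_less T'_strict)

lemma hmin_le_Hl: "hmin <= Hl"
 by (rule Hl_cases) (auto intro: less_imp_le hmin_less)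

lemma Ht_less_hmax: "Ht < hmax" unfolding Ht_def by (rule less_hmax)

lemma qt_less_ql: "ereal qt < ql" by (rule Hl_cases) auto

section \<open>The candidate spectrum \<open>F\<close> and its Legendre transform\<close>

definition F :: "real => real" where
 "F q = (if q <= qt then T q + HHt*q else if ereal q < ql then T q + c else Hl*q)"

lemma F_le: "F q <= T q + HHt*q" if "ereal q < ql"
 using that qt HHt_qt HHt_pos mult_left_mono[of qt q HHt] by (auto simp: F_def)

lemma F_le_c: "F q <= T q + c" if "ereal q < ql"
 using that qt HHt_qt HHt_pos mult_left_mono[of q qt HHt] by (auto simp: F_def)

text \<open>The pieces are glued by writing \<open>F\<close> with \<open>min\<close> and
  \<open>max\<close> of continuous functions. Continuity later extends the estimates from rational
  to real \<open>q\<close>.\<close>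

lemma isCont_F: "isCont F q"
proof (rule Hl_cases)
 assume "ql = \<infinity>"
 hence "F = (%q. T q + min (HHt*q) c)"
 proof (intro ext)
  fix q assume ql: "ql = \<infinity>"
  show "F q = T q + min (HHt*q) c"
   using HHt_qt HHt_pos mult_left_mono[of qt q HHt] mult_left_mono[of q qt HHt] ql by (auto simp: F_def min_def)
 qed
 thus ?thesis using isCont_T[of q] by (simp add: continuous_intros)
next
 fix r assume r: "qt < r" "en r = c" "Hl = T' r" "ql = ereal r"
 have "F = (%q. T (min q r) + Hl*max (q - r) 0 + min (HHt*q) c)"
 proof (intro ext)
  fix q
  have m: "q <= qt ==> HHt*q <= c" "qt <= q ==> c <= HHt*q"
   using HHt_qt HHt_pos mult_left_mono[of qt q HHt] mult_left_mono[of q qt HHt] by auto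
  show "F q = T (min q r) + Hl*max (q - r) 0 + min (HHt*q) c"
   using m r by (auto simp: F_def min_def max_def en_def algebra_simps)
 qed
 moreover have "isCont (%q. T (min q r) + Hl*max (q - r) 0 + min (HHt*q) c) q"
  unfolding isCont_def
  by (intro tendsto_add tendsto_mult tendsto_min tendsto_max tendsto_diff tendsto_const tendsto_ident_at
    isCont_tendsto_compose[OF isCont_T])
 ultimately show ?thesis by simp
qed

lemma LF_le: "legendre F H <= ereal (q*H - F q)"
 unfolding legendre_def by (rule INF_lower) simp

lemma LF_ge: "(!!q. x <= ereal (q*H - F q)) ==> x <= legendre F H"
 unfolding legendre_def by (rule INF_greatest)

lemma F_beyond: "ql <= ereal q ==> \<exists>r. qt < r & r <= q & en r = c & Hl = T' r & F q = Hl*q & T r + c = Hl*r"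
 by (rule Hl_cases) (auto simp: F_def en_def mult.commute)

text \<open>Beyond \<open>ql\<close> the function \<open>F\<close> is linear with slope
  \<open>Hl <= H\<close>, so the lines \<open>q*H - F q\<close> increase there and it suffices to
  check them up to \<open>ql\<close>.\<close>

lemma F_line:
 assumes H: "Hl <= H" and le: "!!q. ereal q < ql ==> x <= q*H - F q"
  and le2: "!!r. ql = ereal r ==> x <= r*H - (T r + c)"
 shows "ereal x <= legendre F H"
proof (rule LF_ge)
 fix q
 show "ereal x <= ereal (q*H - F q)"
 proof (cases "ereal q < ql")
  case True thus ?thesis using le by simp
 next
  case False
  show ?thesis
  proof (rule Hl_cases)
   assume "ql = \<infinity>" thus ?thesis using False by simp
  next
   fix r assume r: "qt < r" "en r = c" "Hl = T' r" "ql = ereal r"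
   have rq: "r <= q" using False r by simp
   have "T r + c = Hl*r" using r by (simp add: en_def mult.commute)
   hence "x <= r*(H - Hl)" using le2[OF r(4)] by (simp add: algebra_simps)
   also have "... <= q*(H - Hl)" using rq H by (intro mult_right_mono) auto
   also have "... = q*H - F q" using rq r by (simp add: F_def algebra_simps)
   finally show ?thesis by simp
  qed
 qed
qed

lemma LF_1:
 assumes H: "Hl <= H" "H <= Ht"
 shows "legendre F H = D H - ereal c"
proof -
 have Hm: "hmin <= H" "H <= hmax" using H hmin_le_Hl Ht_less_hmax by linarith+
 have Dle: "Dr H <= q*H - T q" for q using D_le[of H q] D_real[OF Hm] by simp
 have "ereal (Dr H - c) <= legendre F H"
 proof (rule F_line[OF H(1)])
  fix q assume "ereal q < ql"
  thus "Dr H - c <= q*H - F q" using F_le_c[of q] Dle[of q] by linarith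
 next
  fix r show "Dr H - c <= r*H - (T r + c)" using Dle[of r] by linarith
 qed
 moreover have "legendre F H <= ereal (Dr H - c)"
 proof (cases "hmin < H")
  case True
  then obtain q where q: "T' q = H" using T'_onto Hm H Ht_less_hmax by (metis le_less_trans)
  have qq: "q >= qt" using T'_strict[of q qt] q H by (cases "q >= qt") (auto simp: Ht_def)
  have Fq: "F q = T q + c"
  proof (rule Hl_cases)
   assume "ql = \<infinity>" thus ?thesis using qq HHt_qt by (cases "q = qt") (auto simp: F_def)
  next
   fix r assume r: "qt < r" "en r = c" "Hl = T' r" "ql = ereal r"
   have "q <= r" using T'_strict[of r q] q H r by (cases "q <= r") auto
   thus ?thesis using qq HHt_qt r by (cases "q = qt"; cases "q = r") (auto simp: F_def en_def algebra_simps)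
  qed
  have "legendre F H <= ereal (q*H - F q)" by (rule LF_le)
  also have "q*H - F q = Dr H - c" using Fq Dr_T'[of q] q by (simp add: en_def)
  finally show ?thesis .
 next
  \<comment> \<open>The endpoint \<open>hmin\<close> is not a value of \<open>T'\<close>. There the
    infimum is approached as \<open>q\<close> tends to infinity, along which
    \<open>F q = T q + c\<close>.\<close>
  case False
  hence Heq: "H = hmin" "Hl = hmin" using Hm H hmin_le_Hl by auto
  have qli: "ql = \<infinity>" using Heq(2) by (simp add: ql_def)
  have "legendre F H + ereal c <= D H"
  proof (rule D_ge)
   fix q
   define r where "r = max q (qt + 1)"
   have "legendre F H <= ereal (r*H - F r)" by (rule LF_le)
   also have "r*H - F r = r*H - T r - c"
   proof -
    have "qt < r" by (simp add: r_def)
    thus ?thesis using qli by (simp add: F_def)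
   qed
   also have "... <= q*H - T q - c" using hmin_line_antimono[of q r] Heq by (simp add: r_def)
   finally have "legendre F H <= ereal (q*H - T q - c)" by (simp only: ereal_less_eq)
   hence "legendre F H + ereal c <= ereal (q*H - T q - c) + ereal c" by (rule add_right_mono)
   thus "legendre F H + ereal c <= ereal (q*H - T q)" by simp
  qed
  thus ?thesis unfolding D_real[OF Hm] by (cases "legendre F H") auto
 qed
 ultimately show ?thesis using D_real[OF Hm] by simp
qed

text \<open>\<open>F\<close> has a corner at \<open>qt\<close>, with left slope
  \<open>Ht + HHt\<close> and right slope \<open>Ht\<close>; on this interval of slopes the infimum
  is attained at \<open>qt\<close>, where \<open>F\<close> vanishes.\<close>

lemma LF_2:
 assumes H: "Ht <= H" "H <= Ht + HHt"
 shows "legendre F H = ereal (qt*H)"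
proof (rule antisym)
 have tg: "T q <= - c + Ht*(q - qt)" for q using tangent[of q qt] qt by (simp add: Ht_def)
 have below: "qt*H <= q*H - (T q + c)" if "qt <= q" for q
  using tg[of q] mult_right_mono[of Ht H "q - qt"] H that by (simp add: algebra_simps)
 show "ereal (qt*H) <= legendre F H"
 proof (rule F_line)
  fix q assume q: "ereal q < ql"
  show "qt*H <= q*H - F q"
  proof (cases "q <= qt")
   case True
   have "0 <= (qt - q)*(Ht + HHt - H)" using True H by (intro mult_nonneg_nonneg) auto
   also have "... = q*H - qt*H - (- c + Ht*(q - qt) + HHt*q)" using HHt_qt by (simp add: algebra_simps)
   also have "... <= q*H - qt*H - (T q + HHt*q)" using tg[of q] by simp
   finally show ?thesis using True by (simp add: F_def)
  next
   case False
   thus ?thesis using below[of q] q by (simp add: F_def)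
  qed
 next
  fix r assume "ql = ereal r"
  thus "qt*H <= r*H - (T r + c)" using below[of r] qt_less_ql by simp
 qed (use H Hl_less_Ht in simp)
 have "legendre F H <= ereal (qt*H - F qt)" by (rule LF_le)
 thus "legendre F H <= ereal (qt*H)" using qt HHt_qt by (simp add: F_def)
qed

text \<open>For these slopes the relevant parameters are at most \<open>qt\<close>, where
  \<open>F\<close> is \<open>T\<close> plus a linear term, so the transform is that of
  \<open>T\<close> translated by \<open>HHt\<close>.\<close>

lemma LF_3:
 assumes H: "Ht + HHt <= H" "H <= hmax + HHt"
 shows "legendre F H = D (H - HHt)"
proof -
 define h where "h = H - HHt"
 have Hm: "hmin <= h" "h <= hmax" using H hmin_le_Hl Hl_less_Ht by (auto simp: h_def)
 have Dle: "Dr h <= q*h - T q" for q using D_le[of h q] D_real[OF Hm] by simp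
 have "ereal (Dr h) <= legendre F H"
 proof (rule F_line)
  fix q assume "ereal q < ql"
  thus "Dr h <= q*H - F q" using F_le[of q] Dle[of q] by (simp add: h_def algebra_simps)
 next
  fix r assume "ql = ereal r"
  hence "HHt*qt <= HHt*r" using qt_less_ql HHt_pos by (intro mult_left_mono) auto
  thus "Dr h <= r*H - (T r + c)" using Dle[of r] HHt_qt by (simp add: h_def algebra_simps)
 qed (use H Hl_less_Ht HHt_pos in simp)
 moreover have "legendre F H <= ereal (Dr h)"
 proof (cases "h < hmax")
  case True
  moreover have "hmin < h" using H hmin_less[of qt] by (simp add: h_def Ht_def)
  ultimately obtain q where q: "T' q = h" using T'_onto by blast
  have qq: "q <= qt" using T'_strict[of qt q] q H by (cases "q <= qt") (auto simp: Ht_def h_def)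
  have "legendre F H <= ereal (q*H - F q)" by (rule LF_le)
  also have "q*H - F q = Dr h" using qq Dr_T'[of q] q by (simp add: F_def h_def en_def algebra_simps)
  finally show ?thesis .
 next
  case False
  hence h: "h = hmax" using Hm by simp
  have "legendre F H <= D h"
  proof (rule D_ge)
   fix q
   define r where "r = min q qt"
   have "legendre F H <= ereal (r*H - F r)" by (rule LF_le)
   also have "r*H - F r = r*h - T r" by (simp add: F_def r_def h_def algebra_simps)
   also have "... <= q*h - T q" using hmax_line_mono[of r q] h by (simp add: r_def)
   finally show "legendre F H <= ereal (q*h - T q)" by simp
  qed
  thus ?thesis using D_real[OF Hm] by simp
 qed
 ultimately show ?thesis using D_real[OF Hm] by (simp add: h_def)
qed

lemma LF_below: "H < Hl ==> legendre F H = - \<infinity>"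
proof (rule ereal_bot)
 fix B :: real assume H: "H < Hl"
 show "legendre F H <= ereal B"
 proof (rule Hl_cases)
  assume a: "Hl = hmin" "ql = \<infinity>"
  define q where "q = max (qt + 1) ((d - B)/(hmin - H))"
  have q: "q >= 0" "q > qt" "q*(hmin - H) >= d - B" using H a qt max_divide_mult[of "hmin - H" "d - B" "qt + 1"] by (auto simp: q_def le_max_iff_disj less_max_iff_disj)
  have "legendre F H <= ereal (q*H - F q)" by (rule LF_le)
  also have "q*H - F q <= B" using T_ge_pos[OF q(1)] q a c0 by (simp add: F_def algebra_simps)
  finally show ?thesis by simp
 next
  fix r assume r: "qt < r" "ql = ereal r"
  define q where "q = max r (- B/(Hl - H))"
  have q: "q >= r" "q*(Hl - H) >= - B" using H max_divide_mult[of "Hl - H" "- B" r] by (auto simp: q_def)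
  have "legendre F H <= ereal (q*H - F q)" by (rule LF_le)
  also have "q*H - F q <= B" using q r by (simp add: F_def algebra_simps)
  finally show ?thesis by simp
 qed
qed

lemma LF_above: "H > hmax + HHt ==> legendre F H = - \<infinity>"
proof (rule ereal_bot)
 fix B :: real assume H: "H > hmax + HHt"
 define q where "q = - max 0 ((d - B)/(H - HHt - hmax))"
 have q: "q <= 0" "- q*(H - HHt - hmax) >= d - B" using H max_divide_mult[of "H - HHt - hmax" "d - B" 0] by (auto simp: q_def)
 have "legendre F H <= ereal (q*H - F q)" by (rule LF_le)
 also have "q*H - F q <= B" using T_ge_neg[OF q(1)] q(2) q(1) qt by (simp add: F_def algebra_simps)
 finally show "legendre F H <= ereal B" by simp
qed

lemma Dr_le_d: "hmin <= h ==> h <= hmax ==> Dr h <= d"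
 using D_le[of h 0] D_real[of h] by (simp add: T0)

text \<open>Every level \<open>H\<close> splits as \<open>h + r\<close>: the exponent \<open>h\<close> of the underlying capacity, and the loss \<open>r\<close>
 caused by the sampling.\<close>

lemma level_split:
 assumes H: "Hl <= H" "H <= hmax + HHt"
 obtains h r where "H = h + r" "hmin <= h" "h <= hmax" "0 <= r" "r <= HHt" "0 <= Dr h + r*qt - c"
  "legendre F H = ereal (Dr h + r*qt - c)" "H >= Ht + HHt ==> r = HHt"
proof -
 \<comment> \<open>The three regimes take \<open>r = 0\<close>, then \<open>h = Ht\<close>, then
   \<open>r = HHt\<close>.\<close>
 consider "H <= Ht" | "Ht <= H" "H < Ht + HHt" | "Ht + HHt <= H" by linarith
 thus ?thesis
 proof cases
  case 1
  have Hm: "hmin <= H" "H <= hmax" using 1 H hmin_le_Hl Ht_less_hmax by linarith+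
  have "Dr H >= c"
  proof (rule Hl_cases)
   assume a: "Hl = hmin" "ereal c <= D hmin"
   show ?thesis
   proof -
    have "Dr H >= min (Dr hmin) (Dr Ht)"
    proof -
     have "ereal (min (Dr hmin) (Dr Ht)) <= D H"
     proof (rule D_ge)
      fix q
      have "Dr hmin <= q*hmin - T q" "Dr Ht <= q*Ht - T q"
       using D_le[of hmin q] D_le[of Ht q] D_real[of hmin] D_real[of Ht] hmin_le_Hl Hl_less_Ht Ht_less_hmax by auto
      moreover have "q*hmin <= q*H \<or> q*Ht <= q*H"
       using Hm 1 by (cases "q >= 0") (auto intro: mult_left_mono mult_left_mono_neg)
      ultimately show "ereal (min (Dr hmin) (Dr Ht)) <= ereal (q*H - T q)" by (simp add: min_def) linarith
     qed
     thus ?thesis unfolding D_real[OF Hm] by (simp only: ereal_less_eq)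
    qed
    moreover have "Dr Ht >= c" using en_qt by (simp add: Ht_def Dr_T')
    moreover have "Dr hmin >= c" using a D_real[of hmin] Ht_less_hmax Hl_less_Ht by simp
    ultimately show ?thesis by simp
   qed
  next
   fix q assume r: "qt < q" "en q = c" "Hl = T' q"
   have "hmin < H" using H r hmin_less[of q] by simp
   then obtain p where p: "T' p = H" using T'_onto 1 Ht_less_hmax by (metis le_less_trans)
   have "qt <= p" using T'_strict[of p qt] p 1 by (cases "qt <= p") (auto simp: Ht_def)
   moreover have "p <= q" using T'_strict[of q p] p H r by (cases "p <= q") auto
   ultimately have "en q <= en p" using en_strict[of p q] qt by (cases "p = q") auto
   thus ?thesis using r p Dr_T'[of p] by simp
  qed
  thus ?thesis using that[of H 0] Hm LF_1[OF H(1) 1] D_real[OF Hm] HHt_pos 1 by simp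
 next
  case 2
  have Hm: "hmin <= Ht" "Ht <= hmax" using hmin_le_Hl Hl_less_Ht Ht_less_hmax by linarith+
  have "Dr Ht = qt*Ht + c" using qt Dr_T'[of qt] by (simp add: Ht_def en_def)
  hence e: "Dr Ht + (H - Ht)*qt - c = qt*H" by (simp add: algebra_simps)
  have "qt*H >= 0" using qt 2 hmin_pos Hm by auto
  thus ?thesis using that[of Ht "H - Ht"] Hm e 2 LF_2 by simp
 next
  case 3
  have Hm: "hmin <= H - HHt" "H - HHt <= hmax" using 3 H hmin_le_Hl Hl_less_Ht by linarith+
  thus ?thesis using that[of "H - HHt" HHt] HHt_qt Dr_nonneg[OF Hm] LF_3[OF 3 H(2)] D_real[OF Hm] HHt_pos by simp
 qed
qed

text \<open>The almost sure statements are available for countably many parameters. Moving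
  \<open>(h, r)\<close> slightly towards \<open>(T' 0, HHt)\<close>, where the value of the spectrum
  plus \<open>r*qt - c\<close> is the maximal \<open>d > 0\<close>, concavity keeps this value from
  dropping and makes it strictly positive, which leaves room to round.\<close>

lemma rational_approximation:
 assumes h: "hmin <= h" "h <= hmax" and r: "0 <= r" "r <= HHt" and s: "0 <= Dr h + r*qt - c" and e: "e > 0"
 shows "\<exists>q'\<in>\<rat>. \<exists>r'\<in>\<rat>. 0 <= r' & r' <= HHt & \<bar>T' q' - h\<bar> < e & \<bar>r' - r\<bar> < e
  & 0 < en q' + r'*qt - c & Dr h + r*qt - c - e < en q' + r'*qt - c"
proof -
 define s0 where "s0 = Dr h + r*qt - c"
 define h0 where "h0 = T' 0"
 define \<theta> where "\<theta> = min (1/2) (e/(2*(\<bar>h0 - h\<bar> + HHt + 1)))"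
 have den: "\<bar>h0 - h\<bar> + HHt + 1 > 0" using HHt_pos by linarith
 have \<theta>: "0 < \<theta>" "\<theta> < 1" using e den by (auto simp: \<theta>_def min_def)
 have "\<theta>*(2*(\<bar>h0 - h\<bar> + HHt + 1)) <= e/(2*(\<bar>h0 - h\<bar> + HHt + 1))*(2*(\<bar>h0 - h\<bar> + HHt + 1))"
  using den by (intro mult_right_mono) (auto simp: \<theta>_def)
 also have "... = e" using den by simp
 finally have "2*(\<theta>*(\<bar>h0 - h\<bar> + HHt + 1)) <= e" by (simp only: mult.left_commute)
 hence \<theta>e: "\<theta>*(\<bar>h0 - h\<bar> + HHt + 1) <= e/2" by linarith
 define h1 where "h1 = (1 - \<theta>)*h + \<theta>*h0"
 define r1 where "r1 = (1 - \<theta>)*r + \<theta>*HHt"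
 have h0: "hmin < h0" "h0 < hmax" by (auto simp: h0_def hmin_less less_hmax)
 have h1: "hmin < h1" "h1 < hmax"
 proof -
  have "(1 - \<theta>)*hmin + \<theta>*hmin < h1" unfolding h1_def
   using \<theta> h h0 by (intro add_le_less_mono mult_left_mono mult_strict_left_mono) auto
  thus "hmin < h1" by (simp add: algebra_simps)
  have "h1 < (1 - \<theta>)*hmax + \<theta>*hmax" unfolding h1_def
   using \<theta> h h0 by (intro add_le_less_mono mult_left_mono mult_strict_left_mono) auto
  thus "h1 < hmax" by (simp add: algebra_simps)
 qed
 have r1: "0 < r1" "r1 <= HHt"
 proof -
  show "0 < r1" unfolding r1_def using \<theta> r HHt_pos by (intro add_nonneg_pos) auto
  have "r1 <= (1 - \<theta>)*HHt + \<theta>*HHt" unfolding r1_def using \<theta> r by (intro add_mono mult_left_mono) auto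
  thus "r1 <= HHt" by (simp add: algebra_simps)
 qed
 have hh: "\<bar>h1 - h\<bar> <= e/2" "\<bar>r1 - r\<bar> <= e/2"
 proof -
  have "h1 - h = \<theta>*(h0 - h)" by (simp add: h1_def algebra_simps)
  hence "\<bar>h1 - h\<bar> = \<theta>*\<bar>h0 - h\<bar>" using \<theta> by (simp add: abs_mult)
  also have "... <= \<theta>*(\<bar>h0 - h\<bar> + HHt + 1)" using \<theta> HHt_pos by (intro mult_left_mono) auto
  finally show "\<bar>h1 - h\<bar> <= e/2" using \<theta>e by linarith
  have "r1 - r = \<theta>*(HHt - r)" by (simp add: r1_def algebra_simps)
  hence "\<bar>r1 - r\<bar> = \<theta>*(HHt - r)" using \<theta> r by (simp add: abs_mult)
  also have "... <= \<theta>*(\<bar>h0 - h\<bar> + HHt + 1)" using \<theta> r by (intro mult_left_mono) auto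
  finally show "\<bar>r1 - r\<bar> <= e/2" using \<theta>e by linarith
 qed
 obtain q where q: "T' q = h1" using T'_onto h1 by blast
 have D1: "en q >= (1 - \<theta>)*Dr h + \<theta>*d"
 proof -
  have "Dr h <= q*h - T q" using D_le[of h q] D_real[OF h] by simp
  moreover have "d <= q*h0 - T q" using en_le[of 0 q] by (simp add: h0_def en_0)
  ultimately have "(1 - \<theta>)*Dr h + \<theta>*d <= (1 - \<theta>)*(q*h - T q) + \<theta>*(q*h0 - T q)"
   using \<theta> by (intro add_mono mult_left_mono) auto
  also have "... = q*h1 - T q" by (simp add: h1_def algebra_simps)
  finally show ?thesis using q by (simp add: en_def)
 qed
 have v: "en q + r1*qt - c >= (1 - \<theta>) * s0 + \<theta>*d"
 proof -
  have "r1*qt - c = (1 - \<theta>)*(r*qt - c)" unfolding r1_def using HHt_qt by (simp add: algebra_simps)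
  thus ?thesis using D1 by (simp add: s0_def algebra_simps)
 qed
 have s0d: "s0 <= d" using Dr_le_d[OF h] mult_right_mono[OF r(2), of qt] qt HHt_qt by (simp add: s0_def)
 have d0: "d > 0" using c0 cd by simp
 define v0 where "v0 = (1 - \<theta>) * s0 + \<theta>*d"
 have v0: "v0 > 0" "v0 >= s0"
 proof -
  show "v0 > 0" unfolding v0_def using \<theta> s d0 by (intro add_nonneg_pos) (auto simp: s0_def)
  have "\<theta> * s0 <= \<theta>*d" using \<theta> s0d by (intro mult_left_mono) auto
  thus "v0 >= s0" unfolding v0_def by (simp add: algebra_simps)
 qed
 define \<eta> where "\<eta> = min (e/2) (v0/2)"
 have \<eta>: "\<eta> > 0" "\<eta> <= e/2" "\<eta> < v0" using e v0 by (auto simp: \<eta>_def min_def)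
 have "eventually (%x. \<bar>T' x - h1\<bar> < e/2) (nhds q)"
 proof -
  have "(T' \<longlongrightarrow> T' q) (nhds q)" using isCont_T'[of q] by (simp add: isCont_def tendsto_at_iff_tendsto_nhds)
  hence "(T' \<longlongrightarrow> h1) (nhds q)" by (simp only: q)
  from tendstoD[OF this, of "e/2"] e show ?thesis by (simp add: dist_real_def)
 qed
 moreover have "eventually (%x. en x > en q - \<eta>/2) (nhds q)"
 proof -
  have "(en \<longlongrightarrow> en q) (nhds q)" using isCont_en[of q] by (simp add: isCont_def tendsto_at_iff_tendsto_nhds)
  from order_tendstoD(1)[OF this, of "en q - \<eta>/2"] \<eta> show ?thesis by simp
 qed
 ultimately have "eventually (%x. \<bar>T' x - h1\<bar> < e/2 & en x > en q - \<eta>/2) (nhds q)" by (rule eventually_conj)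
 then obtain t where t: "t > 0" "!!x. dist x q < t ==> \<bar>T' x - h1\<bar> < e/2 & en x > en q - \<eta>/2"
  unfolding eventually_nhds_metric by blast
 obtain q' where q': "q' \<in> \<rat>" "q < q'" "q' < q + t" using Rats_dense_in_real[of q "q + t"] t by auto
 have q'2: "\<bar>T' q' - h1\<bar> < e/2" "en q' > en q - \<eta>/2" using t(2)[of q'] q' by (auto simp: dist_real_def)
 obtain r' where r': "r' \<in> \<rat>" "max 0 (r1 - min (e/2) (\<eta>/(2*qt))) < r'" "r' < r1"
  using Rats_dense_in_real[of "max 0 (r1 - min (e/2) (\<eta>/(2*qt)))" r1] r1 e \<eta> qt by auto
 have "r1 - r' < \<eta>/(2*qt)" using r' by auto
 hence "(r1 - r')*qt < \<eta>/(2*qt)*qt" using qt by (intro mult_strict_right_mono) auto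
 hence "r'*qt > r1*qt - \<eta>/2" using qt by (simp add: algebra_simps)
 hence "en q' + r'*qt - c > v0 - \<eta>" using q'2 v by (simp add: v0_def)
 moreover have "\<bar>r' - r\<bar> < e"
 proof -
  have "min (e/2) (\<eta>/(2*qt)) <= e/2" by simp
  moreover have "r1 - min (e/2) (\<eta>/(2*qt)) < r'" using r'(2) by simp
  ultimately show ?thesis using hh(2) r'(3) e by linarith
 qed
 moreover have "\<bar>T' q' - h\<bar> < e" using hh q'2 by linarith
 ultimately show ?thesis using q' r' r1 v0 \<eta> e
  by (intro bexI[of _ q'] bexI[of _ r']) (auto simp: s0_def)
qed

end

section \<open>Dyadic cubes and Hausdorff dimension\<close>

definition dnum :: "'n word => 'n => int" where
 "dnum w i = foldl (%N a. 2*N + of_bool (a i)) 0 w"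

lemma dnum_Nil [simp]: "dnum [] i = 0" by (simp add: dnum_def)
lemma dnum_snoc [simp]: "dnum (w @ [a]) i = 2*dnum w i + of_bool (a i)" by (simp add: dnum_def)

lemma dnum_append: "dnum (w @ v) i = 2 ^ length v * dnum w i + dnum v i"
 by (induction v rule: rev_induct) (simp_all flip: append_assoc add: algebra_simps)

lemma dnum_bounds: "0 <= dnum w i" "dnum w i < 2 ^ length w"
 by (induction w rule: rev_induct) (auto simp: of_bool_def)

lemma dnum_inj: "length v = length w ==> dnum v = dnum w ==> v = w"
proof (induction v arbitrary: w rule: rev_induct)
 case Nil thus ?case by simp
next
 case (snoc a v)
 obtain w' b where w: "w = w' @ [b]" using snoc.prems(1) by (cases w rule: rev_cases) auto
 have e: "2*dnum v i + of_bool (a i) = 2*dnum w' i + of_bool (b i)" for i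
  using fun_cong[OF snoc.prems(2), of i] w by simp
 have "a i = b i & dnum v i = dnum w' i" for i
  using e[of i] by (cases "a i"; cases "b i") (auto, presburger+)
 hence "a = b" "dnum v = dnum w'" by auto
 thus ?case using snoc.IH[of w'] snoc.prems(1) w by simp
qed

definition cube :: "'n::finite word => (real ^ 'n) set" where
 "cube w = {x. \<forall>i. dnum w i <= 2 ^ length w*x $ i & 2 ^ length w*x $ i <= dnum w i + 1}"

definition corner :: "'n::finite word => real ^ 'n" where
 "corner w = (\<chi> i. dnum w i/2 ^ length w)"

lemma corner_in_cube: "corner w \<in> cube w" by (simp add: corner_def cube_def)

lemma cube_eq_cbox: "cube w = cbox (corner w) (corner w + (\<chi> i. 1/2 ^ length w))"
 by (auto simp: cube_def corner_def mem_box_cart field_simps)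

lemma compact_cube: "compact (cube w)" unfolding cube_eq_cbox by (rule compact_cbox)

lemma cube_append: "cube (w @ v) \<subseteq> cube w"
proof
 fix x assume x: "x \<in> cube (w @ v)"
 show "x \<in> cube w" unfolding cube_def
 proof (intro CollectI allI)
  fix i
  let ?a = "2 ^ length v :: real" and ?y = "2 ^ length w*x $ i"
  have a: "?a > 0" by simp
  have "of_int (dnum v i) >= (0::real)" using dnum_bounds(1)[of v i] by simp
  moreover have "of_int (dnum v i) + 1 <= ?a"
  proof -
   have "dnum v i + 1 <= 2 ^ length v" using dnum_bounds(2)[of v i] by simp
   hence "of_int (dnum v i + 1) <= (of_int (2 ^ length v) :: real)" by (simp only: of_int_le_iff)
   thus ?thesis by simp
  qed
  moreover have "of_int (dnum (w @ v) i) <= 2 ^ length (w @ v)*x $ i" "2 ^ length (w @ v)*x $ i <= of_int (dnum (w @ v) i) + 1"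
   using x by (auto simp: cube_def)
  moreover have "2 ^ length (w @ v)*x $ i = ?a*?y" by (simp add: power_add)
  moreover have "of_int (dnum (w @ v) i) = ?a * of_int (dnum w i) + (of_int (dnum v i) :: real)" by (simp add: dnum_append)
  moreover have "?a*(of_int (dnum w i) + 1) = ?a * of_int (dnum w i) + ?a" by (simp add: distrib_left)
  ultimately have "?a * of_int (dnum w i) <= ?a*?y" "?a*?y <= ?a*(of_int (dnum w i) + 1)" by linarith+
  thus "dnum w i <= ?y & ?y <= dnum w i + 1" using a by (simp add: mult_le_cancel_left_pos)
 qed
qed

lemma prefix_code_Suc: "prefix_code x (Suc j) = prefix_code x j @ [code x j]"
 by (simp add: prefix_code_def)

lemma length_prefix_code [simp]: "length (prefix_code x j) = j" by (simp add: prefix_code_def)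

lemma prefix_code_words: "prefix_code x j \<in> words j" by (simp add: words_def)

lemma take_prefix_code: "k <= j ==> take k (prefix_code x j) = prefix_code x k"
 by (simp add: prefix_code_def take_map min_def)

lemma floor_double: "\<lfloor>2*y\<rfloor> = 2*\<lfloor>y\<rfloor> + of_bool (odd \<lfloor>2*y\<rfloor>)" for y :: real
proof -
 have "2*\<lfloor>y\<rfloor> <= \<lfloor>2*y\<rfloor>" "\<lfloor>2*y\<rfloor> <= 2*\<lfloor>y\<rfloor> + 1" by linarith+
 thus ?thesis by (auto simp: of_bool_def, presburger+)
qed

lemma dnum_prefix_code:
 assumes "0 <= x $ i" "x $ i < 1"
 shows "dnum (prefix_code x j) i = \<lfloor>2 ^ j*x $ i\<rfloor>"
proof (induction j)
 case 0 thus ?case using assms by (simp add: prefix_code_def floor_eq_iff)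
next
 case (Suc j)
 have "code x j i \<longleftrightarrow> odd \<lfloor>2*(2 ^ j*x $ i)\<rfloor>" using assms by (simp add: code_def mult.assoc)
 thus ?case using Suc floor_double[of "2 ^ j*x $ i"] by (simp add: prefix_code_Suc mult.assoc)
qed

lemma dnum_prefix_code_1: "x $ i = 1 ==> dnum (prefix_code x j) i = 2 ^ j - 1"
 by (induction j) (auto simp: prefix_code_Suc code_def prefix_code_def)

lemma in_cube_prefix_code: "x \<in> unit_cube ==> x \<in> cube (prefix_code x j)"
 unfolding cube_def
proof (intro CollectI allI)
 fix i assume "x \<in> unit_cube"
 hence x: "0 <= x $ i" "x $ i <= 1" by (auto simp: unit_cube_def)
 show "dnum (prefix_code x j) i <= 2 ^ length (prefix_code x j)*x $ i
   & 2 ^ length (prefix_code x j)*x $ i <= dnum (prefix_code x j) i + 1"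
 proof (cases "x $ i = 1")
  case True thus ?thesis by (simp add: dnum_prefix_code_1)
 next
  case False
  hence "dnum (prefix_code x j) i = \<lfloor>2 ^ j*x $ i\<rfloor>" using x by (intro dnum_prefix_code) auto
  moreover have "of_int \<lfloor>2 ^ j*x $ i\<rfloor> <= 2 ^ j*x $ i" "2 ^ j*x $ i <= of_int \<lfloor>2 ^ j*x $ i\<rfloor> + 1"
   by linarith+
  ultimately show ?thesis by simp
 qed
qed

lemma prefix_code_eqI:
 assumes "!!i. dnum w i <= 2 ^ length w*x $ i & 2 ^ length w*x $ i < dnum w i + 1"
 shows "prefix_code x (length w) = w"
proof (rule dnum_inj)
 show "dnum (prefix_code x (length w)) = dnum w"
 proof
  fix i
  have "of_int (dnum w i) + 1 <= (2 ^ length w :: real)"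
  proof -
   have "dnum w i + 1 <= 2 ^ length w" using dnum_bounds(2)[of w i] by simp
   hence "of_int (dnum w i + 1) <= (of_int (2 ^ length w) :: real)" by (simp only: of_int_le_iff)
   thus ?thesis by simp
  qed
  moreover have "of_int (dnum w i) >= (0::real)" using dnum_bounds(1)[of w i] by simp
  ultimately have "0 <= 2 ^ length w*x $ i" "2 ^ length w*x $ i < 2 ^ length w*1" using assms[of i] by linarith+
  hence x1: "x $ i < 1" by simp
  have "0 <= x $ i"
  proof (rule ccontr)
   assume "\<not> 0 <= x $ i"
   hence "2 ^ length w*x $ i < 0" by (intro mult_pos_neg) auto
   thus False using \<open>0 <= 2 ^ length w*x $ i\<close> by linarith
  qed
  note this x1
  hence "dnum (prefix_code x (length w)) i = \<lfloor>2 ^ length w*x $ i\<rfloor>" by (rule dnum_prefix_code)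
  also have "... = dnum w i" using assms[of i] by (simp add: floor_eq_iff)
  finally show "dnum (prefix_code x (length w)) i = dnum w i" .
 qed
qed simp

definition ltr0 :: "'n letter" where "ltr0 = (%_. False)"
definition ltr1 :: "'n letter" where "ltr1 = (%_. True)"

text \<open>The two letters place the cube strictly inside \<open>cube w\<close>, so its points have a code extending \<open>w\<close>.\<close>

lemma prefix_code_inner: "x \<in> cube (w @ ltr0 # ltr1 # v) ==> prefix_code x (length w) = w"
proof (rule prefix_code_eqI)
 fix i assume x: "x \<in> cube (w @ ltr0 # ltr1 # v)"
 have "x \<in> cube ((w @ [ltr0, ltr1]) @ v)" using x by simp
 hence "x \<in> cube (w @ [ltr0, ltr1])" using cube_append by blast
 moreover have "dnum (w @ [ltr0, ltr1]) i = 4*dnum w i + 1"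
  unfolding dnum_append by (simp add: dnum_def ltr0_def ltr1_def)
 ultimately have "4*dnum w i + 1 <= 4*(2 ^ length w*x $ i)" "4*(2 ^ length w*x $ i) <= 4*dnum w i + 2"
  by (auto simp: cube_def power_add dest!: spec[of _ i])
 thus "dnum w i <= 2 ^ length w*x $ i & 2 ^ length w*x $ i < dnum w i + 1" by linarith
qed

lemma cube_subset_unit_cube: "cube w \<subseteq> unit_cube"
proof
 fix x :: "(real, 'a) vec" assume "x \<in> cube w"
 hence "x \<in> cube ([] @ w)" by simp
 hence "x \<in> cube []" using cube_append by blast
 thus "x \<in> unit_cube" by (simp add: cube_def unit_cube_def)
qed

section \<open>Covers by dyadic cubes and mass distributions\<close>

lemma diameter_cube: "diameter (cube (w :: 'n::finite word)) <= CARD('n)/2 ^ length w"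
proof (rule diameter_le)
 fix x y assume xy: "x \<in> cube w" "y \<in> cube w"
 have "norm (x - y) <= (\<Sum>i\<in>UNIV. \<bar>(x - y) $ i\<bar>)" by (rule norm_le_l1_cart)
 also have "... <= (\<Sum>i\<in>(UNIV :: 'n set). 1/2 ^ length w)"
 proof (rule sum_mono)
  fix i
  have "\<bar>2 ^ length w*x $ i - 2 ^ length w*y $ i\<bar> <= 1" using xy by (auto simp: cube_def abs_le_iff) (smt (verit))+
  hence "2 ^ length w*\<bar>x $ i - y $ i\<bar> <= 1" by (simp add: abs_mult flip: right_diff_distrib)
  thus "\<bar>(x - y) $ i\<bar> <= 1/2 ^ length w" by (simp add: field_simps)
 qed
 finally show "norm (x - y) <= CARD('n)/2 ^ length w" by simp
qed simp

text \<open>Each point of \<open>E\<close> lies in cubes of the families \<open>V j\<close> for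
  arbitrarily large \<open>j\<close>, so the families beyond \<open>J\<close> form a cover by small
  sets, and the tail of the convergent series bounds its \<open>s\<close>-sum.\<close>

lemma hdim_le:
 fixes E :: "(real ^ 'n::finite) set" and s :: real
 assumes E: "E \<subseteq> unit_cube" and V: "!!j. V j \<subseteq> words j"
  and inf: "!!x J. x \<in> E ==> \<exists>j\<ge>J. prefix_code x j \<in> V j"
  and s: "s >= 0" and sm: "summable (%j. card (V j)*2 powr (- s*j))"
 shows "hdim E <= ereal s"
proof (cases "E = {}")
 case False
 have "hausdorff_pre s e E = 0" if e: "e > 0" for e
 proof -
  have small: "hausdorff_pre s e E <= ennreal x" if x: "x > 0" for x
  proof -
   define A where "A j = card (V j)*2 powr (- s*j)" for j
   define K where "K = real CARD('n) powr s"
   have K: "K > 0" by (simp add: K_def)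
   have "(%J. \<Sum>j. A (j + J)) \<longlonglongrightarrow> 0" using sm unfolding A_def by (rule suminf_exist_split2)
   hence "ev (%J. (\<Sum>j. A (j + J)) < x/K)" using x K by (intro order_tendstoD) auto
   moreover have "ev (%J. CARD('n)/2 ^ J < e)" using e by real_asymp
   ultimately have "ev (%J. (\<Sum>j. A (j + J)) < x/K & CARD('n)/2 ^ J < e)" by (rule eventually_conj)
   then obtain J where J: "(\<Sum>j. A (j + J)) < x/K" "CARD('n)/2 ^ J < e" by (auto dest!: eventually_happens)
   define B where "B = (\<Union>j\<in>{J..}. V j)"
   \<comment> \<open>Covers are indexed by \<open>nat\<close>. Words are enumerated by
     \<open>to_nat\<close>, and the other indices get the empty set, whose term is zero since
     \<open>0 powr s = 0\<close> even for \<open>s = 0\<close>.\<close>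
   define U where "U i = (if i \<in> to_nat ` B then cube (from_nat i :: 'n word) else {})" for i
   have Bl: "w \<in> B ==> length w >= J & w \<in> V (length w)" for w using V by (auto simp: B_def words_def)
   have "E \<subseteq> (\<Union>i. U i)"
   proof
    fix y assume y: "y \<in> E"
    obtain j where "j >= J" "prefix_code y j \<in> V j" using inf[OF y] by blast
    hence "prefix_code y j \<in> B" by (auto simp: B_def)
    moreover have "y \<in> cube (prefix_code y j)" using y E in_cube_prefix_code by blast
    ultimately show "y \<in> (\<Union>i. U i)" by (intro UN_I[of "to_nat (prefix_code y j)"]) (auto simp: U_def)
   qed
   moreover have "bounded (U i) & diameter (U i) <= e" for i
   proof (cases "i \<in> to_nat ` B")
    case True
    then obtain w where w: "w \<in> B" "i = to_nat w" by blast
    have "diameter (cube w) <= CARD('n)/2 ^ length w" by (rule diameter_cube)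
    also have "... <= CARD('n)/2 ^ J" using Bl[OF w(1)] by (intro divide_left_mono) auto
    finally show ?thesis using w J compact_cube[of w] by (auto simp: U_def compact_imp_bounded)
   qed (use e in \<open>auto simp: U_def\<close>)
   ultimately have "hausdorff_pre s e E <= (\<Sum>i. ennreal (diameter (U i) powr s))"
    unfolding hausdorff_pre_def by (intro INF_lower) auto
   also have "... <= ennreal x"
   proof (rule suminf_le_const[OF summableI])
    fix n
    define I where "I = {i\<in>{..<n}. i \<in> to_nat ` B}"
    define W :: "'n word set" where "W = from_nat ` I"
    have W: "finite W" "W \<subseteq> B" by (auto simp: W_def I_def)
    have injI: "inj_on (from_nat :: nat => 'n word) I"
     by (rule inj_onI) (auto simp: I_def)
    have d: "diameter (cube w) powr s <= K*2 powr (- s*length w)" for w :: "'n word"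
    proof -
     have "diameter (cube w) powr s <= (CARD('n)/2 ^ length w) powr s"
      using s diameter_cube[of w] diameter_ge_0[OF compact_imp_bounded[OF compact_cube[of w]]] by (intro powr_mono2) auto
     also have "... = K*2 powr (- s*length w)"
      by (simp add: K_def powr_divide powr_minus field_simps powr_powr flip: powr_realpow)
     finally show ?thesis .
    qed
    obtain N where N: "\<forall>w\<in>W. length w < N + J"
     using W(1) finite_nat_set_iff_bounded[of "length ` W"] by (metis finite_imageI imageI trans_less_add1)
    have "(\<Sum>i<n. ennreal (diameter (U i) powr s)) = (\<Sum>i\<in>I. ennreal (diameter (cube (from_nat i :: 'n word)) powr s))"
     by (rule sum.mono_neutral_cong_right) (auto simp: I_def U_def)
    also have "... = (\<Sum>w\<in>W. ennreal (diameter (cube w) powr s))"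
     unfolding W_def by (simp add: sum.reindex[OF injI])
    also have "... = ennreal (\<Sum>w\<in>W. diameter (cube w) powr s)" by (simp add: sum_ennreal)
    also have "(\<Sum>w\<in>W. diameter (cube w) powr s) <= (\<Sum>w\<in>W. K*2 powr (- s*length w))"
     by (intro sum_mono d)
    also have "... <= (\<Sum>w\<in>(\<Union>j<N. V (j + J)). K*2 powr (- s*length w))"
    proof (rule sum_mono2)
     show "finite (\<Union>j<N. V (j + J))"
      using V by (intro finite_UN_I) (auto intro: finite_subset[OF V] simp: words_def finite_lists_length_eq[of UNIV, simplified])
     show "W \<subseteq> (\<Union>j<N. V (j + J))"
     proof
      fix w assume w: "w \<in> W"
      hence "length w >= J" "w \<in> V (length w)" "length w < N + J" using W(2) Bl N by blast+
      thus "w \<in> (\<Union>j<N. V (j + J))" by (intro UN_I[of "length w - J"]) auto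
     qed
    qed (use K in auto)
    also have "... = (\<Sum>j<N. \<Sum>w\<in>V (j + J). K*2 powr (- s*length w))"
    proof (rule sum.UNION_disjoint)
     show "\<forall>i\<in>{..<N}. finite (V (i + J))"
      using V by (auto intro: finite_subset[OF V] simp: words_def finite_lists_length_eq[of UNIV, simplified])
     show "\<forall>i\<in>{..<N}. \<forall>j\<in>{..<N}. i ~= j --> V (i + J) \<inter> V (j + J) = {}"
     proof (intro ballI impI)
      fix i j :: nat assume "i ~= j"
      moreover have "w \<in> V k ==> length w = k" for w k using V[of k] by (auto simp: words_def)
      ultimately show "V (i + J) \<inter> V (j + J) = {}" by (metis add_right_cancel disjoint_iff)
     qed
    qed simp
    also have "... = (\<Sum>j<N. K*A (j + J))"
    proof (rule sum.cong[OF refl])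
     fix j
     have "(\<Sum>w\<in>V (j + J). K*2 powr (- s*length w)) = (\<Sum>w\<in>V (j + J). K*2 powr (- s*real (j + J)))"
     proof (intro sum.cong refl)
      fix w assume "w \<in> V (j + J)"
      hence "length w = j + J" using V[of "j + J"] by (auto simp: words_def)
      thus "K*2 powr (- s*length w) = K*2 powr (- s*real (j + J))" by simp
     qed
     thus "(\<Sum>w\<in>V (j + J). K*2 powr (- s*length w)) = K*A (j + J)" by (simp add: A_def)
    qed
    also have "... = K*(\<Sum>j<N. A (j + J))" by (simp add: sum_distrib_left)
    also have "... <= K*(\<Sum>j. A (j + J))"
    proof (intro mult_left_mono sum_le_suminf)
     have "summable A" using sm unfolding A_def .
     thus "summable (%j. A (j + J))" by (rule summable_ignore_initial_segment)
    qed (use K in \<open>auto simp: A_def\<close>)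
    also have "... <= x" using J(1) K by (simp add: field_simps)
    finally show "(\<Sum>i<n. ennreal (diameter (U i) powr s)) <= ennreal x" by (simp add: ennreal_leI)
   qed
   finally show ?thesis .
  qed
  have "hausdorff_pre s e E <= 0"
  proof (rule ennreal_le_epsilon)
   fix x :: real assume "x > 0"
   thus "hausdorff_pre s e E <= 0 + ennreal x" using small[of x] by (simp only: add_0)
  qed
  thus ?thesis by (simp only: le_zero_eq)
 qed
 hence "hausdorff_measure s E = 0" unfolding hausdorff_measure_def by (simp add: image_constant_conv SUP_constant)
 hence "(INF t\<in>{t. t >= 0 & hausdorff_measure t E = 0}. ereal t) <= ereal s" using s by (intro INF_lower) auto
 thus ?thesis using False by (simp add: hdim_def)
qed (simp add: hdim_def)

text \<open>In each coordinate the corner of such a cube differs from the rounded centre by at most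
  two units, whence the \<open>5\<close>.\<close>

lemma card_cubes_meeting_ball:
 fixes x :: "real ^ 'n::finite"
 assumes r: "r <= 1/2 ^ k"
 shows "card {v \<in> words k. cube v \<inter> ball x r ~= {}} <= 5 ^ CARD('n)"
proof -
 define f where "f i = \<lfloor>2 ^ k*x $ i\<rfloor>" for i
 let ?B = "{v \<in> words k. cube v \<inter> ball x r ~= {}}"
 let ?P = "PiE (UNIV :: 'n set) (%i. {f i - 2..f i + 2})"
 have sub: "dnum ` ?B \<subseteq> ?P"
 proof
  fix h assume "h \<in> dnum ` ?B"
  then obtain v y where v: "v \<in> words k" "y \<in> cube v" "y \<in> ball x r" "h = dnum v" by blast
  have "f i - 2 <= h i & h i <= f i + 2" for i
  proof -
   have "\<bar>(x - y) $ i\<bar> <= norm (x - y)" by (rule component_le_norm_cart)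
   also have "... < 1/2 ^ k" using v(3) r by (simp add: dist_norm)
   finally have "2 ^ k*\<bar>x $ i - y $ i\<bar> < 1" by (simp add: field_simps)
   hence "\<bar>2 ^ k*x $ i - 2 ^ k*y $ i\<bar> < 1" by (simp add: abs_mult flip: right_diff_distrib)
   moreover have "dnum v i <= 2 ^ k*y $ i" "2 ^ k*y $ i <= dnum v i + 1"
    using v(1,2) by (auto simp: cube_def words_def)
   ultimately have "real_of_int (dnum v i) < 2 ^ k*x $ i + 1" "2 ^ k*x $ i < dnum v i + 2" by linarith+
   thus ?thesis unfolding f_def v(4) by linarith
  qed
  thus "h \<in> ?P" by auto
 qed
 have "inj_on dnum ?B" by (rule inj_onI) (auto simp: words_def intro: dnum_inj)
 hence "card ?B = card (dnum ` ?B)" by (rule card_image[symmetric])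
 also have "... <= card ?P" by (rule card_mono[OF _ sub]) (intro finite_PiE, auto)
 also have "card ?P = 5 ^ CARD('n)" by (simp add: card_PiE)
 finally show ?thesis .
qed

lemma exists_dyadic_scale:
 fixes r :: real
 assumes "0 < r" "r <= 1"
 shows "\<exists>k. r <= 1/2 ^ k & 1/2 ^ k <= 2*r"
proof -
 define P where "P k \<longleftrightarrow> 1/2 ^ k <= 2*r" for k :: nat
 have "\<exists>k. P k"
 proof -
  have "ev (%k. 1/2 ^ k <= 2*r)" using assms by real_asymp
  thus ?thesis by (auto simp: P_def dest: eventually_happens)
 qed
 hence L: "P (LEAST k. P k)" by (rule LeastI_ex)
 define k where "k = (LEAST k. P k)"
 have "r <= 1/2 ^ k"
 proof (cases k)
  case 0 thus ?thesis using assms by simp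
 next
  case (Suc j)
  hence "\<not> P j" using not_less_Least[of j P] by (simp add: k_def)
  thus ?thesis using Suc by (simp add: P_def field_simps)
 qed
 thus ?thesis using L by (auto simp: P_def k_def)
qed

text \<open>The mass distribution principle for a tree of cubes, in a form that avoids measures on the limit set:
 by compactness finitely many members of an open cover already cover the cubes of some generation.\<close>

lemma hdim_ge:
 fixes N :: "nat => 'n::finite word set" and m :: "nat => 'n word => real" and l :: "nat => nat" and s :: real
 assumes N: "!!n. N n \<subseteq> words (l n)" and l: "filterlim l at_top sequentially"
  and child: "!!n w. w \<in> N (Suc n) ==> take (l n) w \<in> N n"
  and m0: "!!n w. m n w >= 0" and m1: "!!n. (\<Sum>w\<in>N n. m n w) = 1"
  and C: "C > 0"
  and frost: "!!n k v. k <= l n ==> v \<in> words k ==> (\<Sum>w\<in>{w \<in> N n. take k w = v}. m n w) <= C*2 powr (- s*k)"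
  and E: "(\<Inter>n. \<Union>w\<in>N n. cube w) \<subseteq> E"
 shows "ereal s <= hdim E"
proof -
 define F where "F n = (\<Union>w\<in>N n. cube w)" for n
 have fin: "finite (N n)" for n
  using N[of n] by (rule finite_subset) (simp add: words_def finite_lists_length_eq[of UNIV, simplified])
 have cF: "compact (F n)" for n unfolding F_def using fin compact_cube by (intro compact_UN) auto
 have neN: "N n ~= {}" for n using m1[of n] by auto
 have neF: "F n ~= {}" for n using neN[of n] corner_in_cube by (fastforce simp: F_def)
 have sub: "cube w \<subseteq> cube (take k w)" for w :: "'n word" and k
  using cube_append[of "take k w" "drop k w"] by simp
 have "F (Suc n) \<subseteq> F n" for n
  unfolding F_def using child sub by (fastforce intro!: UN_least)
 hence dF: "m <= n ==> F n \<subseteq> F m" for m n by (rule lift_Suc_antimono_le)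
 have E': "\<Inter> (range F) \<subseteq> E" using E by (simp add: F_def)
 have "\<Inter> (range F) ~= {}" by (rule compact_nest[OF cF neF dF])
 hence neE: "E ~= {}" using E' by (metis subset_empty)
 have main: "s <= t" if t: "t >= 0" "hausdorff_measure t E = 0" for t
 proof (rule ccontr)
  assume "\<not> s <= t"
  \<comment> \<open>An exponent strictly between \<open>t\<close> and \<open>s\<close>, in
    particular positive: the sets of the cover are enlarged to open balls, whose radii must be
    positive with summable \<open>t'\<close>-powers even when \<open>t = 0\<close> or a diameter
    vanishes.\<close>
  define t' where "t' = (t + s)/2"
  have t': "t < t'" "t' < s" "t' > 0" using \<open>\<not> s <= t\<close> t by (auto simp: t'_def)
  have frost': "(\<Sum>w\<in>{w \<in> N n. take k w = v}. m n w) <= C*2 powr (- t'*k)" if "k <= l n" "v \<in> words k" for n k v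
  proof -
   have "t'*k <= s*k" using t' by (intro mult_right_mono) auto
   hence "C*2 powr (- s*k) <= C*2 powr (- t'*k)" using C by (intro mult_left_mono powr_mono) auto
   thus ?thesis using frost[OF that] by linarith
  qed
  define K where "K = 5 ^ CARD('n)*C*2 powr t'"
  have K: "K > 0" using C by (simp add: K_def)
  define b where "b = 2 powr t' + 1"
  have b: "b > 0" by (simp add: b_def add_pos_pos)
  define ep where "ep = min 1 (1/(2*K*b))"
  have ep: "ep > 0" "ep <= 1" "K*(b*ep) < 1"
  proof -
   show "ep > 0" "ep <= 1" using K b by (auto simp: ep_def)
   have "K*b*ep <= K*b*(1/(2*K*b))" using K b by (intro mult_left_mono) (auto simp: ep_def)
   also have "... < 1" using K b by simp
   finally show "K*(b*ep) < 1" by (simp add: mult.assoc)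
  qed
  have "hausdorff_pre t (1/2) E <= hausdorff_measure t E" unfolding hausdorff_measure_def by (rule SUP_upper) simp
  hence "hausdorff_pre t (1/2) E < ennreal ep" using t(2) ep(1) by simp
  then obtain U :: "nat => (real ^ 'n) set" where U0: "U \<in> {U. E \<subseteq> (\<Union>i. U i) & (\<forall>i. bounded (U i) & diameter (U i) <= 1/2)}"
   "(\<Sum>i. ennreal (diameter (U i) powr t)) < ennreal ep"
   unfolding hausdorff_pre_def INF_less_iff by (elim bexE)
  have U: "E \<subseteq> (\<Union>i. U i)" "bounded (U i)" "diameter (U i) <= 1/2" "(\<Sum>i. ennreal (diameter (U i) powr t)) < ennreal ep" for i
   using U0 by simp_all
  have d0: "diameter (U i) >= 0" for i by (rule diameter_ge_0[OF U(2)])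
  define a where "a i = (ep/2 ^ Suc i) powr (1/t')" for i
  define r where "r i = max (2*diameter (U i)) (a i)" for i
  have a: "a i > 0" "a i <= 1" "a i powr t' = ep/2 ^ Suc i" for i
  proof -
   have p: "ep/2 ^ Suc i > 0" using ep by simp
   have "(1::real) <= 2 ^ Suc i" by (rule one_le_power) simp
   hence q: "ep/2 ^ Suc i <= 1" using ep by (simp add: divide_le_eq)
   show "a i > 0" using p ep(1) unfolding a_def by simp
   show "a i <= 1" unfolding a_def
   proof (rule powr_le1)
    show "\<bar>ep/2 ^ Suc i\<bar> <= 1" using p q by linarith
   qed (use t' in simp)
   have "1/t'*t' = 1" using t' by simp
   thus "a i powr t' = ep/2 ^ Suc i" unfolding a_def powr_powr by (simp only: powr_one[OF less_imp_le[OF p]])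
  qed
  have r: "r i > 0" "r i <= 1" "diameter (U i) < r i" for i
   using a[of i] U(3)[of i] d0[of i] by (auto simp: r_def less_max_iff_disj)
  have rt: "r i powr t' <= 2 powr t'*diameter (U i) powr t + ep/2 ^ Suc i" for i
  proof (cases "2*diameter (U i) <= a i")
   case True
   thus ?thesis using a(3)[of i] by (simp add: r_def max_absorb2)
  next
   case False
   hence "r i = 2*diameter (U i)" by (simp add: r_def)
   hence "r i powr t' = 2 powr t'*diameter (U i) powr t'" using d0 by (simp add: powr_mult)
   also have "... <= 2 powr t'*diameter (U i) powr t"
    using t' U(3)[of i] d0[of i] by (intro mult_left_mono powr_mono') auto
   finally show ?thesis using ep(1) by (simp add: add_increasing2)
  qed
  have rsum: "(\<Sum>i\<in>I. r i powr t') <= b*ep" if I: "finite I" for I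
  proof -
   have "ennreal (\<Sum>i\<in>I. diameter (U i) powr t) = (\<Sum>i\<in>I. ennreal (diameter (U i) powr t))" by (simp add: sum_ennreal)
   also have "... <= (\<Sum>i. ennreal (diameter (U i) powr t))" using I by (intro sum_le_suminf summableI) auto
   also have "... < ennreal ep" by (rule U(4))
   finally have 1: "(\<Sum>i\<in>I. diameter (U i) powr t) <= ep" using ep by (simp add: ennreal_less_iff sum_nonneg)
   obtain M where M: "I \<subseteq> {..<M}" using I finite_nat_iff_bounded by blast
   have geo: "(\<Sum>i<M. ep/2 ^ Suc i) = ep*(1 - 1/2 ^ M)" by (induction M) (auto simp: field_simps)
   have "(\<Sum>i\<in>I. ep/2 ^ Suc i) <= (\<Sum>i<M. ep/2 ^ Suc i)" using M ep by (intro sum_mono2) auto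
   also have "... <= ep" unfolding geo using ep by (simp add: mult_left_le)
   finally have 2: "(\<Sum>i\<in>I. ep/2 ^ Suc i) <= ep" .
   have "(\<Sum>i\<in>I. r i powr t') <= (\<Sum>i\<in>I. 2 powr t'*diameter (U i) powr t + ep/2 ^ Suc i)" by (intro sum_mono rt)
   also have "... = 2 powr t'*(\<Sum>i\<in>I. diameter (U i) powr t) + (\<Sum>i\<in>I. ep/2 ^ Suc i)"
    by (simp add: sum.distrib sum_distrib_left)
   also have "... <= 2 powr t'*ep + ep" using 1 2 by (intro add_mono mult_left_mono) auto
   finally show ?thesis by (simp add: b_def algebra_simps)
  qed
  define x where "x i = (SOME y. y \<in> U i)" for i
  define Q where "Q i = (if U i = {} then {} else ball (x i) (r i))" for i
  have Qo: "open (Q i)" for i by (simp add: Q_def)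
  have UQ: "U i \<subseteq> Q i" for i
  proof
   fix y assume y: "y \<in> U i"
   hence "x i \<in> U i" unfolding x_def by (rule someI)
   hence "dist (x i) y <= diameter (U i)" using y by (intro diameter_bounded_bound U)
   thus "y \<in> Q i" using y r(3)[of i] by (auto simp: Q_def)
  qed
  have "\<exists>n. F n \<subseteq> (\<Union>i. Q i)"
  proof (rule ccontr)
   assume ne: "\<not> ?thesis"
   define L where "L n = F n - (\<Union>i. Q i)" for n
   have "\<Inter> (range L) ~= {}"
   proof (rule compact_nest)
    show "compact (L n)" for n unfolding L_def using cF Qo by (intro compact_diff) auto
    show "L n ~= {}" for n using ne by (auto simp: L_def)
    show "L n \<subseteq> L m" if "m <= n" for m n using dF[OF that] by (auto simp: L_def)
   qed
   then obtain z where z: "!!n. z \<in> L n" by blast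
   hence "z \<in> \<Inter> (range F)" by (auto simp: L_def)
   hence "z \<in> E" using E' by (rule subsetD[rotated])
   then obtain i where "z \<in> U i" using U(1) by blast
   hence "z \<in> (\<Union>i. Q i)" using UQ[of i] by blast
   thus False using z[of 0] by (auto simp: L_def)
  qed
  then obtain n where n: "F n \<subseteq> (\<Union>i. Q i)" by blast
  obtain I where I: "finite I" "F n \<subseteq> (\<Union>i\<in>I. Q i)"
   using compactE_image[OF cF, of UNIV Q n] Qo n by auto
  have "\<forall>i. \<exists>k. r i <= 1/2 ^ k & 1/2 ^ k <= 2*r i" using exists_dyadic_scale[OF r(1,2)] by blast
  then obtain ka where ka: "!!i. r i <= 1/2 ^ ka i" "!!i. 1/2 ^ ka i <= 2*r i" by metis
  have "ev (%n'. n <= n' & (\<forall>i\<in>I. ka i <= l n'))"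
   using I(1) l by (intro eventually_conj eventually_ge_at_top eventually_ball_finite ballI) (auto simp: filterlim_at_top)
  then obtain n' where n': "n <= n'" "!!i. i \<in> I ==> ka i <= l n'" by (auto dest!: eventually_happens)
  define B where "B i = {v \<in> words (ka i). cube v \<inter> Q i ~= {}}" for i
  have fB: "finite (B i)" for i unfolding B_def by (simp add: words_def finite_lists_length_eq[of UNIV, simplified])
  have cB: "card (B i) <= 5 ^ CARD('n)" for i
   using card_cubes_meeting_ball[OF ka(1)[of i], of "x i"] by (auto simp: B_def Q_def)
  \<comment> \<open>Every cube of generation \<open>n'\<close> has its corner in a ball of the
    finite subcover, hence a prefix in the matching \<open>B i\<close>. Its mass is charged to that
    prefix and bounded by the Frostman estimate.\<close>
  have "1 = (\<Sum>w\<in>N n'. m n' w)" by (simp add: m1)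
  also have "... <= (\<Sum>w\<in>N n'. \<Sum>i\<in>I. \<Sum>v\<in>B i. if take (ka i) w = v then m n' w else 0)"
  proof (rule sum_mono)
   fix w assume w: "w \<in> N n'"
   have "corner w \<in> F n'" using w corner_in_cube by (auto simp: F_def)
   hence "corner w \<in> F n" using dF[OF n'(1)] by blast
   then obtain i where i: "i \<in> I" "corner w \<in> Q i" using I(2) by blast
   have lw: "length w = l n'" using w N by (auto simp: words_def)
   have v: "take (ka i) w \<in> B i"
    using i n'(2)[OF i(1)] lw sub[of w "ka i"] corner_in_cube[of w] by (auto simp: B_def words_def)
   have "m n' w = (if take (ka i) w = take (ka i) w then m n' w else 0)" by simp
   also have "... <= (\<Sum>v\<in>B i. if take (ka i) w = v then m n' w else 0)"
    by (rule member_le_sum[where f = "\<lambda>v. if take (ka i) w = v then m n' w else 0", OF v _ fB]) (simp add: m0)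
   also have "... <= (\<Sum>i\<in>I. \<Sum>v\<in>B i. if take (ka i) w = v then m n' w else 0)"
    by (rule member_le_sum[where f = "\<lambda>i. \<Sum>v\<in>B i. if take (ka i) w = v then m n' w else 0", OF i(1) _ I(1)])
     (auto intro!: sum_nonneg simp: m0)
   finally show "m n' w <= (\<Sum>i\<in>I. \<Sum>v\<in>B i. if take (ka i) w = v then m n' w else 0)" .
  qed
  also have "... = (\<Sum>i\<in>I. \<Sum>v\<in>B i. \<Sum>w\<in>N n'. if take (ka i) w = v then m n' w else 0)"
  proof -
   have "(\<Sum>w\<in>N n'. \<Sum>i\<in>I. \<Sum>v\<in>B i. if take (ka i) w = v then m n' w else 0)
    = (\<Sum>i\<in>I. \<Sum>w\<in>N n'. \<Sum>v\<in>B i. if take (ka i) w = v then m n' w else 0)" by (rule sum.swap)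
   also have "... = (\<Sum>i\<in>I. \<Sum>v\<in>B i. \<Sum>w\<in>N n'. if take (ka i) w = v then m n' w else 0)"
    by (intro sum.cong refl sum.swap)
   finally show ?thesis .
  qed
  also have "... = (\<Sum>i\<in>I. \<Sum>v\<in>B i. \<Sum>w\<in>{w \<in> N n'. take (ka i) w = v}. m n' w)"
   using fin by (intro sum.cong refl sum.inter_filter[symmetric])
  also have "... <= (\<Sum>i\<in>I. K*r i powr t')"
  proof (rule sum_mono)
   fix i assume i: "i \<in> I"
   have "(\<Sum>v\<in>B i. \<Sum>w\<in>{w \<in> N n'. take (ka i) w = v}. m n' w) <= card (B i)*(C*2 powr (- t'*ka i))"
    using n'(2)[OF i] by (intro sum_bounded_above frost') (auto simp: B_def)
   also have "... <= 5 ^ CARD('n)*(C*2 powr (- t'*ka i))"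
   proof (rule mult_right_mono)
    have "real (card (B i)) <= real (5 ^ CARD('n))" using cB[of i] by (simp only: of_nat_le_iff)
    thus "real (card (B i)) <= 5 ^ CARD('n)" by simp
   qed (use C in auto)
   also have "2 powr (- t'*ka i) = (1/2 ^ ka i) powr t'"
    by (simp add: powr_divide powr_minus field_simps powr_powr flip: powr_realpow)
   also have "5 ^ CARD('n)*(C*(1/2 ^ ka i) powr t') <= 5 ^ CARD('n)*(C*(2*r i) powr t')"
    using C t' ka(2)[of i] by (intro mult_left_mono powr_mono2) auto
   also have "... = K*r i powr t'" using r(1)[of i] by (simp add: K_def powr_mult)
   finally show "(\<Sum>v\<in>B i. \<Sum>w\<in>{w \<in> N n'. take (ka i) w = v}. m n' w) <= K*r i powr t'" .
  qed
  also have "... = K*(\<Sum>i\<in>I. r i powr t')" by (simp add: sum_distrib_left)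
  also have "... <= K*(b*ep)" using K by (intro mult_left_mono rsum I) auto
  finally show False using ep(3) by simp
 qed
 have "ereal s <= (INF t\<in>{t. t >= 0 & hausdorff_measure t E = 0}. ereal t)"
  by (rule INF_greatest) (use main in auto)
 thus ?thesis using neE by (simp add: hdim_def)
qed

section \<open>Concatenations of blocks\<close>

primrec pw :: "'n word set => nat => 'n word set" where
 "pw B 0 = {[]}"
| "pw B (Suc r) = (%(u, v). u @ v) ` (pw B r \<times> B)"

lemma pw_SucE:
 assumes "t \<in> pw B (Suc r)"
 obtains u v where "t = u @ v" "u \<in> pw B r" "v \<in> B"
 using assms by auto

lemma pw_length: "B \<subseteq> words b ==> t \<in> pw B r ==> length t = r*b"
proof (induction r arbitrary: t)
 case (Suc r)
 from Suc.prems(2) obtain u v where "t = u @ v" "u \<in> pw B r" "v \<in> B" by (rule pw_SucE)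
 moreover have "length v = b" using \<open>v \<in> B\<close> Suc.prems(1) by (auto simp: words_def)
 ultimately show ?case using Suc.IH[OF Suc.prems(1), of u] by simp
qed simp

lemma finite_pw: "finite B ==> finite (pw B r)" by (induction r) auto

lemma card_pw: "B \<subseteq> words b ==> card (pw B r) = card B ^ r"
proof (induction r)
 case (Suc r)
 have "inj_on (%(u, v). u @ v) (pw B r \<times> B)"
  by (rule inj_on_append[where m = "r*b"]) (rule pw_length[OF Suc.prems])
 hence "card (pw B (Suc r)) = card (pw B r \<times> B)" by (simp add: card_image)
 also have "... = card (pw B r)*card B" by (rule card_cartesian_product)
 finally show ?case using Suc by simp
qed simp

lemma pw_append: "u \<in> pw B i ==> v \<in> pw B j ==> u @ v \<in> pw B (i + j)"
proof (induction j arbitrary: v)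
 case (Suc j)
 from Suc.prems(2) obtain x y where v: "v = x @ y" "x \<in> pw B j" "y \<in> B" by (rule pw_SucE)
 have "u @ x \<in> pw B (i + j)" using Suc.IH Suc.prems(1) v(2) by blast
 hence "(%(u, v). u @ v) (u @ x, y) \<in> (%(u, v). u @ v) ` (pw B (i + j) \<times> B)" using v(3) by (intro imageI) simp
 thus ?case using v(1) by simp
qed simp

lemma pw_split:
 assumes B: "B \<subseteq> words b"
 shows "t \<in> pw B (i + j) ==> take (i*b) t \<in> pw B i & drop (i*b) t \<in> pw B j"
proof (induction j arbitrary: t)
 case 0
 thus ?case using pw_length[OF B, of t i] by simp
next
 case (Suc j)
 have "t \<in> pw B (Suc (i + j))" using Suc.prems by simp
 then obtain x y where t: "t = x @ y" "x \<in> pw B (i + j)" "y \<in> B" by (rule pw_SucE)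
 have l: "length x = (i + j)*b" using pw_length[OF B t(2)] .
 hence le: "i*b <= length x" by (simp add: distrib_right)
 have IH: "take (i*b) x \<in> pw B i" "drop (i*b) x \<in> pw B j" using Suc.IH[OF t(2)] by auto
 have "(%(u, v). u @ v) (drop (i*b) x, y) \<in> (%(u, v). u @ v) ` (pw B j \<times> B)" using IH t(3) by (intro imageI) simp
 thus ?case using IH le t(1) by simp
qed

lemma card_pw_prefix:
 assumes B: "B \<subseteq> words b" and fB: "finite B" and X: "X \<subseteq> pw B i"
 shows "card {t \<in> pw B (i + j). take (i*b) t \<in> X} <= card X*card B ^ j"
proof -
 let ?S = "{t \<in> pw B (i + j). take (i*b) t \<in> X}"
 let ?f = "\<lambda>t. (take (i*b) t, drop (i*b) t)"
 have "inj_on ?f ?S" by (rule inj_onI) (metis append_take_drop_id prod.inject)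
 moreover have "?f ` ?S \<subseteq> X \<times> pw B j" using pw_split[OF B] by auto
 moreover have "finite (X \<times> pw B j)" using finite_subset[OF X finite_pw[OF fB]] finite_pw[OF fB] by simp
 ultimately have "card ?S <= card (X \<times> pw B j)" by (rule card_inj_on_le)
 thus ?thesis by (simp add: card_cartesian_product card_pw[OF B])
qed

lemma power_le_fact_exp: "(x::real) >= 0 ==> x ^ n <= fact n*exp x"
proof -
 assume x: "x >= 0"
 have s: "(%n. x ^ n /\<^sub>R fact n) sums exp x" by (rule exp_converges)
 have "(\<Sum>k\<in>{n}. x ^ k /\<^sub>R fact k) <= (\<Sum>k. x ^ k /\<^sub>R fact k)"
  using x s by (intro sum_le_suminf) (auto simp: sums_iff)
 also have "... = exp x" using s by (simp add: sums_iff)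
 finally have "x ^ n/fact n <= exp x" by (simp add: field_simps)
 thus ?thesis by (simp add: divide_le_eq mult.commute)
qed

text \<open>Lets the doubly exponentially small probability that no candidate survives beat an
  exponential number of words: \<open>exp x\<close> dominates a sufficiently high power of
  \<open>x\<close>.\<close>

lemma superexponential_decay:
 fixes a ka :: real
 assumes k: "ka > 0"
 obtains C where "C > 0" "!!y. y >= 0 ==> 2 powr (a*y)*exp (- (2 powr (ka*y))) <= C*2 powr (- y)"
proof -
 define n where "n = nat \<lceil>(a + 1)/ka\<rceil>"
 have n: "(a + 1) <= ka*n"
 proof -
  have "(a + 1)/ka <= n" unfolding n_def by linarith
  thus ?thesis using k by (simp add: pos_divide_le_eq mult.commute)
 qed
 have "2 powr (a*y)*exp (- (2 powr (ka*y))) <= fact n*2 powr (- y)" if y: "y >= 0" for y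
 proof -
  define x where "x = 2 powr (ka*y)"
  have "x ^ n <= fact n*exp x" by (rule power_le_fact_exp) (simp add: x_def)
  hence "exp (- x) <= fact n/x ^ n" by (simp add: exp_minus field_simps x_def)
  also have "x ^ n = 2 powr (ka*n*y)" by (simp add: x_def powr_power mult_ac)
  finally have "2 powr (a*y)*exp (- x) <= 2 powr (a*y)*(fact n/2 powr (ka*n*y))"
   by (intro mult_left_mono) auto
  also have "... = fact n*2 powr (a*y - ka*n*y)" by (simp add: powr_diff)
  also have "... <= fact n*2 powr (- y)"
  proof (intro mult_left_mono powr_mono)
   have "(a + 1)*y <= ka*n*y" using n y by (intro mult_right_mono) auto
   thus "a*y - ka*n*y <= - y" by (simp add: algebra_simps)
  qed auto
  finally show ?thesis by (simp add: x_def)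
 qed
 thus ?thesis using that[of "fact n"] by simp
qed

lemma powr_minus_nat: "2 powr (- real m) = (1/2 :: real) ^ m"
 by (induction m) (simp_all add: powr_diff field_simps powr_minus powr_add)

lemma summable_powr_minus: "summable (%m. K*2 powr (- real m))"
proof -
 have "(%m. K*2 powr (- real m)) = (%m. K*(1/2) ^ m)"
  unfolding powr_minus_nat ..
 thus ?thesis by (simp add: summable_mult summable_geometric)
qed

text \<open>Linear growth of \<open>g\<close> leaves finitely many descendants in competition, so
  the best survivor is a minimum over a finite set and the bad events below are finite
  unions.\<close>

lemma (in quasi_additive) finite_g_less: "finite {v. g (w @ v) <= x}"
proof -
 obtain n :: nat where "x + c0 < real n*\<delta>" using reals_Archimedean3[OF \<delta>_pos] by blast
 hence n: "x + c0 < \<delta>*n" by (simp only: mult.commute)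
 have "{v. g (w @ v) <= x} \<subseteq> {v. set v \<subseteq> UNIV & length v <= n}"
 proof
  fix v assume "v \<in> {v. g (w @ v) <= x}"
  hence "\<delta>*length (w @ v) <= x + c0" using g_ge[of "w @ v"] by simp
  hence "\<delta>*length (w @ v) < \<delta>*n" using n by linarith
  hence "real (length (w @ v)) < real n" using \<delta>_pos by (simp only: mult_less_cancel_left_pos)
  thus "v \<in> {v. set v \<subseteq> UNIV & length v <= n}" by simp
 qed
 moreover have "finite {v :: 'n word. set v \<subseteq> UNIV & length v <= n}" by (rule finite_lists_length_le) simp
 ultimately show ?thesis by (rule finite_subset)
qed

section \<open>The random sampling\<close>

locale sampled_tree = quasi_additive g c0 \<delta> G
 for g :: "'n::finite word => real" and c0 \<delta> G :: real +
 fixes P :: "'w measure" and p :: "'n word => 'w => bool" and \<eta> :: real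
 assumes not_bounded: "!!(H::real) B. \<exists>w. \<bar>g w - H*length w\<bar> > B"
  and eta: "0 < \<eta>" "\<eta> < 1"
  and samp: "sampling P p \<eta>"
begin

definition c :: real where "c = real CARD('n)*(1 - \<eta>)"

lemma c_bounds: "0 < c" "c < real CARD('n)"
proof -
 have "real CARD('n) > 0" by simp
 thus "0 < c" "c < real CARD('n)" using eta by (simp_all add: c_def algebra_simps)
qed

sublocale spectrum T T' "real CARD('n)" \<delta> G c
proof
 show "(T has_real_derivative T' q) (at q)" for q by (rule T_deriv)
 show "T x <= T q + T' q*(x - q)" for x q by (rule T_tangent)
 show "\<delta> <= T' q" for q by (rule T'_ge)
 show "T' q <= G" for q by (rule T'_le)
 show "\<delta> > 0" by (rule \<delta>_pos)
 show "q < r ==> T' r < T' q" for q r by (rule T'_strict_antimono[OF not_bounded])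
 show "T 0 = - real CARD('n)" by (rule T_0)
 show "q*T' q - T q >= 0" for q using ent_nonneg[of q] by (simp add: ent_def)
 show "0 < c" "c < real CARD('n)" by (rule c_bounds)+
qed

lemma ent_eq_en: "ent = en" by (intro ext) (simp add: ent_def en_def)

lemma prob_space_P: "prob_space P" using samp by (simp add: sampling_def)

sublocale prob_space P by (rule prob_space_P)

lemma indep: "indep_vars (%_. count_space UNIV) p {w. w ~= []}" using samp by (simp add: sampling_def)

abbreviation A :: "'n word => 'w set" where "A w \<equiv> {om \<in> space P. p w om}"
definition pr :: "'n word => real" where "pr w = 2 powr (- c*length w)"

lemma pr_bounds: "0 < pr w" "pr w <= 1"
 using powr_mono[of "- c*length w" 0 "2::real"] c_bounds by (auto simp: pr_def)

lemma pr_append: "pr (u @ v) = pr u*pr v"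
 by (simp add: pr_def algebra_simps flip: powr_add)

lemma A_sets [measurable]: "w ~= [] ==> A w \<in> sets P"
proof -
 assume w: "w ~= []"
 have "p w \<in> measurable P (count_space UNIV)" using indep w by (simp add: indep_vars_def2)
 hence "p w -` {True} \<inter> space P \<in> sets P" by (rule measurable_sets) simp
 moreover have "p w -` {True} \<inter> space P = A w" by auto
 ultimately show ?thesis by simp
qed

lemma prob_A: "w ~= [] ==> prob (A w) = pr w"
 using samp by (simp add: sampling_def pr_def c_def algebra_simps)

lemma prob_all:
 assumes S: "finite S" "[] \<notin> S"
 shows "{om \<in> space P. \<forall>z\<in>S. p z om} \<in> sets P" "prob {om \<in> space P. \<forall>z\<in>S. p z om} = (\<Prod>z\<in>S. pr z)"
proof -
 have ne: "z \<in> S ==> z ~= []" for z using S by auto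
 have e: "S ~= {} ==> {om \<in> space P. \<forall>z\<in>S. p z om} = (\<Inter>z\<in>S. p z -` {True} \<inter> space P)" by auto
 have f: "p z -` {True} \<inter> space P = A z" for z by auto
 show "{om \<in> space P. \<forall>z\<in>S. p z om} \<in> sets P"
 proof (cases "S = {}")
  case False thus ?thesis unfolding e[OF False] f using S(1) ne by (intro sets.finite_INT A_sets) auto
 qed simp
 show "prob {om \<in> space P. \<forall>z\<in>S. p z om} = (\<Prod>z\<in>S. pr z)"
 proof (cases "S = {}")
  case True thus ?thesis by (simp add: prob_space)
 next
  case False
  have "prob (\<Inter>z\<in>S. p z -` {True} \<inter> space P) = (\<Prod>z\<in>S. prob (p z -` {True} \<inter> space P))"
   by (rule indep_varsD[OF indep False S(1)]) (use ne in auto)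
  also have "... = (\<Prod>z\<in>S. pr z)" unfolding f using ne by (intro prod.cong refl prob_A) auto
  finally show ?thesis unfolding e[OF False] .
 qed
qed

lemma prob_none:
 assumes S: "S \<subseteq> words L" "L > 0"
 shows "{om \<in> space P. \<forall>z\<in>S. \<not> p z om} \<in> sets P"
  "prob {om \<in> space P. \<forall>z\<in>S. \<not> p z om} <= exp (- (card S*2 powr (- c*L)))"
proof -
 have fS: "finite S" using S(1) finite_words finite_subset by blast
 have ne: "z ~= []" "pr z = 2 powr (- c*L)" if "z \<in> S" for z using S that by (auto simp: words_def pr_def)
 define \<pi> where "\<pi> = 2 powr (- c*L)"
 have e: "S ~= {} ==> {om \<in> space P. \<forall>z\<in>S. \<not> p z om} = (\<Inter>z\<in>S. p z -` {False} \<inter> space P)" by auto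
 have f: "p z -` {False} \<inter> space P = space P - A z" for z by auto
 show "{om \<in> space P. \<forall>z\<in>S. \<not> p z om} \<in> sets P"
 proof (cases "S = {}")
  case False thus ?thesis unfolding e[OF False] f using fS ne by (intro sets.finite_INT sets.compl_sets A_sets) auto
 qed simp
 show "prob {om \<in> space P. \<forall>z\<in>S. \<not> p z om} <= exp (- (card S*2 powr (- c*L)))"
 proof (cases "S = {}")
  case True thus ?thesis by simp
 next
  case False
  have "prob (\<Inter>z\<in>S. p z -` {False} \<inter> space P) = (\<Prod>z\<in>S. prob (p z -` {False} \<inter> space P))"
   by (rule indep_varsD[OF indep False fS]) (use ne in auto)
  also have "... = (\<Prod>z\<in>S. 1 - \<pi>)" unfolding f
   using ne by (intro prod.cong refl) (simp add: prob_compl A_sets prob_A \<pi>_def)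
  also have "... = (1 - \<pi>) ^ card S" by simp
  also have "... <= exp (- \<pi>) ^ card S"
  proof (rule power_mono)
   show "1 - \<pi> <= exp (- \<pi>)" using exp_ge_add_one_self[of "- \<pi>"] by simp
   obtain z where "z \<in> S" using False by blast
   thus "0 <= 1 - \<pi>" using pr_bounds(2)[of z] ne(2) by (simp add: \<pi>_def)
  qed
  also have "... = exp (- (card S*\<pi>))" by (simp flip: exp_of_nat_mult)
  finally show ?thesis unfolding e[OF False] \<pi>_def .
 qed
qed

lemma Z_upper: "Z q n <= C q*2 powr (- real n*T q)"
 using Z_bounds(1)[where q = q and n = n] by simp

lemma AE_eventually_not:
 assumes E: "!!j. E j \<in> sets P" and b: "!!j. j >= J ==> prob (E j) <= b j" and s: "summable b"
 shows "AE om in P. \<exists>j0. \<forall>j\<ge>j0. om \<notin> E j"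
proof -
 have "summable (%j. measure P (E j))"
  by (rule summable_comparison_test'[OF s, of J]) (use b in simp)
 hence "AE om in P. ev (%j. om \<in> space P - E j)"
  by (intro borel_cantelli_AE1 E) (auto simp: emeasure_eq_measure)
 thus ?thesis by eventually_elim (auto simp: eventually_sequentially)
qed

text \<open>For large \<open>m\<close>, a word of length at most \<open>m/y\<close> has at least
  \<open>2 powr (m*E)\<close> typed descendants \<open>m\<close> levels below, each sampled with
  probability at least \<open>2 powr (- c*(m/y + m))\<close>. The hypothesis on \<open>y\<close>
  makes the expected number of survivors exponentially large, so failure is doubly exponentially
  unlikely and a union bound over all these words suffices.\<close>

lemma AE_descendants:
 fixes q e y :: real
 assumes e: "e > 0" and y: "y > 0" "y*(en q - (\<bar>q\<bar> + 1)*e - c) > c"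
 shows "AE om in P. \<exists>m0. \<forall>m\<ge>m0. \<forall>w. y*length w <= m --> (\<exists>v\<in>typed m (T' q) e. p (w @ v) om)"
proof -
 define E where "E = en q - (\<bar>q\<bar> + 1)*e"
 define ka where "ka = E - c - c/y"
 have k: "ka > 0" using y by (simp add: ka_def E_def field_simps)
 define d where "d = real CARD('n)"
 obtain K where K: "K > 0" "!!x. x >= 0 ==> 2 powr ((d + 1)/y*x)*exp (- (2 powr (ka*x))) <= K*2 powr (- x)"
  using superexponential_decay[OF k] by metis
 define L where "L m = nat \<lfloor>real m/y\<rfloor>" for m
 have L: "real (L m) <= m/y" for m using y by (simp add: L_def)
 define Bad where "Bad m w = {om \<in> space P. \<forall>z\<in>(%v. w @ v) ` typed m (T' q) e. \<not> p z om}" for m w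
 define Ev where "Ev m = (if m = 0 then {} else (\<Union>l\<in>{..L m}. \<Union>w\<in>words l. Bad m w))" for m
 obtain M where M: "!!m. m >= M ==> real (card (typed m (T' q) e)) >= 2 powr (m*E)"
  using card_typed[OF e, of q] unfolding eventually_sequentially E_def ent_eq_en by blast
 have sub: "(%v. w @ v) ` typed m (T' q) e \<subseteq> words (length w + m)" for w m
  by (auto simp: typed_def words_def)
 have Bs: "Bad m w \<in> sets P" if "m > 0" for m w
  unfolding Bad_def by (rule prob_none(1)[OF sub]) (use that in simp)
 have Bp: "prob (Bad m w) <= exp (- (2 powr (ka*m)))" if m: "m >= M" "m > 0" and w: "length w <= L m" for m w
 proof -
  have "prob (Bad m w) <= exp (- (card ((%v. w @ v) ` typed m (T' q) e)*2 powr (- c*real (length w + m))))"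
   unfolding Bad_def by (rule prob_none(2)[OF sub]) (use m in simp)
  also have "card ((%v. w @ v) ` typed m (T' q) e) = card (typed m (T' q) e)"
   by (rule card_image) (simp add: inj_on_def)
  also have "exp (- (card (typed m (T' q) e)*2 powr (- c*real (length w + m)))) <= exp (- (2 powr (ka*m)))"
  proof -
   have "real (length w) <= m/y" using L[of m] w by linarith
   hence "c*real (length w) <= c*(m/y)" using c_bounds by (intro mult_left_mono) auto
   hence "ka*m <= m*E - c*real (length w + m)" by (simp add: ka_def algebra_simps)
   hence "2 powr (ka*m) <= 2 powr (m*E - c*real (length w + m))" by (intro powr_mono) auto
   also have "... = 2 powr (m*E)*2 powr (- c*real (length w + m))" by (simp flip: powr_add)
   also have "... <= card (typed m (T' q) e)*2 powr (- c*real (length w + m))"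
    by (intro mult_right_mono M m) auto
   finally show ?thesis by simp
  qed
  finally show ?thesis .
 qed
 have "AE om in P. \<exists>j0. \<forall>j\<ge>j0. om \<notin> Ev j"
 proof (rule AE_eventually_not)
  show "Ev m \<in> sets P" for m unfolding Ev_def using Bs by (auto intro!: sets.finite_UN)
  show "prob (Ev m) <= K*2 powr (- real m)" if "m >= max M 1" for m
  proof -
   have m: "m >= M" "m > 0" using that by auto
   have "prob (Ev m) = prob (\<Union>l\<in>{..L m}. \<Union>w\<in>words l. Bad m w)" using m by (simp add: Ev_def)
   also have "... <= (\<Sum>l\<in>{..L m}. prob (\<Union>w\<in>words l. Bad m w))"
    using m Bs by (intro finite_measure_subadditive_finite) (auto intro!: sets.finite_UN)
   also have "... <= (\<Sum>l\<in>{..L m}. \<Sum>w\<in>words l. prob (Bad m w))"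
    using m Bs by (intro sum_mono finite_measure_subadditive_finite) auto
   also have "... <= (\<Sum>l\<in>{..L m}. \<Sum>w\<in>(words l :: 'n word set). exp (- (2 powr (ka*m))))"
    using m by (intro sum_mono Bp) (auto simp: words_def)
   also have "... = (\<Sum>l\<in>{..L m}. 2 ^ (CARD('n)*l)*exp (- (2 powr (ka*m))))" by (simp add: card_words)
   also have "... <= (\<Sum>l\<in>{..L m}. 2 ^ (CARD('n)*L m)*exp (- (2 powr (ka*m))))"
    by (intro sum_mono mult_right_mono power_increasing) auto
   also have "... = real (Suc (L m))*(2 ^ (CARD('n)*L m)*exp (- (2 powr (ka*m))))" by simp
   also have "... <= 2 ^ (L m)*(2 ^ (CARD('n)*L m)*exp (- (2 powr (ka*m))))"
   proof (rule mult_right_mono)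
    have "Suc (L m) <= 2 ^ L m" by (rule Suc_leI[OF less_exp])
    hence "real (Suc (L m)) <= real (2 ^ L m)" by (simp only: of_nat_le_iff)
    thus "real (Suc (L m)) <= 2 ^ L m" by simp
   qed auto
   also have "... = 2 powr ((d + 1)*L m)*exp (- (2 powr (ka*m)))"
    by (simp add: d_def algebra_simps powr_add flip: powr_realpow)
   also have "... <= 2 powr ((d + 1)/y*m)*exp (- (2 powr (ka*m)))"
   proof (intro mult_right_mono powr_mono)
    have "(d + 1)*L m <= (d + 1)*(m/y)" using L[of m] by (intro mult_left_mono) (auto simp: d_def)
    thus "(d + 1)*L m <= (d + 1)/y*m" by simp
   qed auto
   also have "... <= K*2 powr (- real m)" by (rule K) simp
   finally show ?thesis .
  qed
  show "summable (%m. K*2 powr (- real m))" by (rule summable_powr_minus)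
 qed
 with AE_space show ?thesis
 proof eventually_elim
  case (elim om)
  then obtain j0 where j0: "!!j. j >= j0 ==> om \<notin> Ev j" by blast
  show ?case
  proof (intro exI[of _ "max j0 1"] allI impI)
   fix m and w :: "'n word" assume m: "m >= max j0 1" and w: "y*length w <= m"
   have "real (length w) <= m/y" using w y by (simp add: pos_le_divide_eq mult.commute)
   hence "length w <= L m" unfolding L_def by linarith
   hence "Bad m w \<subseteq> Ev m" using m unfolding Ev_def by (auto simp: words_def intro!: bexI[of _ "length w"])
   hence "om \<notin> Bad m w" using j0[of m] m by auto
   thus "\<exists>v\<in>typed m (T' q) e. p (w @ v) om" using elim(1) by (auto simp: Bad_def)
  qed
 qed
qed

text \<open>The sum weighs \<open>u\<close> by \<open>W q\<close> and the cost of the chosen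
  descendant with exponent \<open>q'\<close>. Replacing the choice \<open>V\<close> by the sum over
  all sampled descendants makes the bound uniform in \<open>V\<close>; its expectation is a
  geometric series in the depth, convergent because \<open>T q' + c > 0\<close> beyond
  \<open>qt\<close>. Markov and Borel-Cantelli finish.\<close>

lemma AE_moments:
 assumes q': "q' > qt" and e: "e > 0"
 shows "AE om in P. \<exists>j0. \<forall>j\<ge>j0. \<forall>V. (\<forall>u\<in>words j. V u ~= [] & p (u @ V u) om) -->
  (\<Sum>u\<in>words j. 2 powr (- (q - q')*g u - q'*g (u @ V u))) <= 2 powr (- real j*(T q + c - e))"
proof -
 define ka where "ka = T q' + c"
 have k: "ka > 0" using T_strict[OF q'] qt by (simp add: ka_def)
 define a where "a u v = 2 powr (- (q - q')*g u - q'*g (u @ v))" for u v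
 define b where "b j = 2 powr (j*(T q + c - e))" for j :: nat
 \<comment> \<open>The depth \<open>Suc k\<close> matches the nonempty continuations allowed in
   \<open>Mcap\<close>.\<close>
 define Y where "Y j k om = (\<Sum>u\<in>words j. \<Sum>v\<in>words (Suc k). ennreal (a u v)*indicator (A (u @ v)) om)" for j k om
 define R where "R j om = (\<Sum>k. Y j k om)" for j om
 have Ym [measurable]: "Y j k \<in> borel_measurable P" for j k
  unfolding Y_def by (intro borel_measurable_sum borel_measurable_times_ennreal borel_measurable_const borel_measurable_indicator A_sets)
   (auto simp: words_def)
 define K where "K = C q'*C q*C q'"
 have Kpos: "K > 0" by (simp add: K_def)
 have EY: "(\<integral>\<^sup>+om. Y j k om \<partial>P) <= ennreal (K*2 powr (- real j*(T q + c))*2 powr (- ka*Suc k))" for j k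
 proof -
  have "(\<integral>\<^sup>+om. Y j k om \<partial>P) = (\<Sum>u\<in>words j. \<Sum>v\<in>words (Suc k). ennreal (a u v)*emeasure P (A (u @ v)))"
   unfolding Y_def
  proof (subst nn_integral_sum)
   show "(%om. \<Sum>v\<in>words (Suc k). ennreal (a u v)*indicator (A (u @ v)) om) \<in> borel_measurable P" if "u \<in> words j" for u
    by (intro borel_measurable_sum borel_measurable_times_ennreal borel_measurable_const borel_measurable_indicator A_sets)
     (auto simp: words_def)
   have "(\<integral>\<^sup>+om. (\<Sum>v\<in>words (Suc k). ennreal (a u v)*indicator (A (u @ v)) om) \<partial>P)
     = (\<Sum>v\<in>words (Suc k). ennreal (a u v)*emeasure P (A (u @ v)))" if "u \<in> words j" for u
   proof (subst nn_integral_sum)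
    show "(%om. ennreal (a u v)*indicator (A (u @ v)) om) \<in> borel_measurable P" if "v \<in> words (Suc k)" for v
     using that by (intro borel_measurable_times_ennreal borel_measurable_const borel_measurable_indicator A_sets) (auto simp: words_def)
    show "(\<Sum>v\<in>words (Suc k). \<integral>\<^sup>+om. ennreal (a u v)*indicator (A (u @ v)) om \<partial>P)
      = (\<Sum>v\<in>words (Suc k). ennreal (a u v)*emeasure P (A (u @ v)))"
     by (intro sum.cong refl nn_integral_cmult_indicator A_sets) (auto simp: words_def)
   qed
   thus "(\<Sum>u\<in>words j. \<integral>\<^sup>+om. (\<Sum>v\<in>words (Suc k). ennreal (a u v)*indicator (A (u @ v)) om) \<partial>P)
     = (\<Sum>u\<in>words j. \<Sum>v\<in>words (Suc k). ennreal (a u v)*emeasure P (A (u @ v)))" by (intro sum.cong refl) auto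
  qed
  also have "... = (\<Sum>u\<in>words j. \<Sum>v\<in>words (Suc k). ennreal (a u v * pr (u @ v)))"
  proof (intro sum.cong refl)
   fix u v :: "'n word" assume "v \<in> words (Suc k)"
   hence "u @ v ~= []" by (auto simp: words_def)
   thus "ennreal (a u v)*emeasure P (A (u @ v)) = ennreal (a u v * pr (u @ v))"
    by (simp add: emeasure_eq_measure prob_A ennreal_mult a_def pr_bounds less_imp_le)
  qed
  also have "... = ennreal (\<Sum>u\<in>words j. \<Sum>v\<in>words (Suc k). a u v * pr (u @ v))"
   by (simp add: sum_ennreal sum_nonneg a_def pr_bounds less_imp_le)
  also have "... <= ennreal (K*2 powr (- real j*(T q + c))*2 powr (- ka*Suc k))"
  proof (rule ennreal_leI)
   have "(\<Sum>u\<in>words j. \<Sum>v\<in>words (Suc k). a u v * pr (u @ v))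
    <= (\<Sum>u\<in>words j. \<Sum>v\<in>words (Suc k). C q'*(W q u*W q' v)*2 powr (- c*real (j + Suc k)))"
   proof (intro sum_mono)
    fix u v :: "'n word" assume uv: "u \<in> words j" "v \<in> words (Suc k)"
    have "a u v = 2 powr (- (q - q')*g u)*W q' (u @ v)" by (simp add: a_def W_def flip: powr_add)
    also have "... <= 2 powr (- (q - q')*g u)*(C q'*(W q' u*W q' v))" by (intro mult_left_mono W_append) auto
    also have "... = C q'*(2 powr (- (q - q')*g u)*W q' u*W q' v)" by simp
    also have "2 powr (- (q - q')*g u)*W q' u = W q u" by (simp add: W_def algebra_simps flip: powr_add)
    finally have "a u v <= C q'*(W q u*W q' v)" .
    moreover have "pr (u @ v) = 2 powr (- c*real (j + Suc k))" using uv by (simp add: pr_def words_def)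
    ultimately show "a u v * pr (u @ v) <= C q'*(W q u*W q' v)*2 powr (- c*real (j + Suc k))"
     by (simp add: mult_right_mono)
   qed
   also have "... = C q'*(Z q j*Z q' (Suc k))*2 powr (- c*real (j + Suc k))"
    unfolding Z_def sum_product by (simp add: sum_distrib_left sum_distrib_right mult_ac)
   also have "... <= C q'*((C q*2 powr (- real j*T q))*(C q'*2 powr (- real (Suc k)*T q')))*2 powr (- c*real (j + Suc k))"
    by (intro mult_right_mono mult_left_mono mult_mono Z_upper) auto
   also have "... = K*(2 powr (- real j*T q)*2 powr (- real (Suc k)*T q')*2 powr (- c*real (j + Suc k)))"
    by (simp add: K_def)
   also have "2 powr (- real j*T q)*2 powr (- real (Suc k)*T q')*2 powr (- c*real (j + Suc k))
     = 2 powr (- real j*(T q + c))*2 powr (- ka*Suc k)"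
    by (simp add: ka_def algebra_simps flip: powr_add)
   finally show "(\<Sum>u\<in>words j. \<Sum>v\<in>words (Suc k). a u v * pr (u @ v)) <= K*2 powr (- real j*(T q + c))*2 powr (- ka*Suc k)"
    by simp
  qed
  finally show ?thesis .
 qed
 define r where "r = 2 powr (- ka)"
 have r: "0 < r" "r < 1" using k powr_less_mono[of "- ka" 0 "2::real"] by (auto simp: r_def)
 define S where "S = (\<Sum>k. r ^ Suc k)"
 have rs: "summable (%k. r ^ Suc k)" using r by (simp add: summable_mult summable_geometric)
 have rk: "2 powr (- ka*Suc k) = r ^ Suc k" for k unfolding r_def by (subst powr_power) (simp_all add: mult_ac)
 have Snn: "S >= 0" unfolding S_def using r by (intro suminf_nonneg rs) auto
 have ER: "(\<integral>\<^sup>+om. R j om \<partial>P) <= ennreal (K*S*2 powr (- real j*(T q + c)))" for j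
 proof -
  have "(\<integral>\<^sup>+om. R j om \<partial>P) = (\<Sum>k. \<integral>\<^sup>+om. Y j k om \<partial>P)" unfolding R_def by (rule nn_integral_suminf) simp
  also have "... <= (\<Sum>k. ennreal (K*2 powr (- real j*(T q + c))*2 powr (- ka*Suc k)))"
   by (intro suminf_le EY summableI)
  also have "... = (\<Sum>k. ennreal (K*2 powr (- real j*(T q + c))*r ^ Suc k))" unfolding rk ..
  also have "... = ennreal (\<Sum>k. K*2 powr (- real j*(T q + c))*r ^ Suc k)"
   using r Kpos rs by (intro suminf_ennreal2 summable_mult) auto
  also have "(\<Sum>k. K*2 powr (- real j*(T q + c))*r ^ Suc k) = K*2 powr (- real j*(T q + c))*S"
   unfolding S_def by (rule suminf_mult[OF rs])
  finally show ?thesis by (simp add: mult_ac)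
 qed
 define X where "X j = {om \<in> space P. 1 <= ennreal (b j)*R j om}" for j
 have Rm [measurable]: "R j \<in> borel_measurable P" for j unfolding R_def by simp
 have Xs: "X j \<in> sets P" for j unfolding X_def by measurable
 have Xp: "prob (X j) <= K*S*2 powr (- e*j)" for j
 proof -
  have "emeasure P (X j) <= ennreal (b j)*(\<integral>\<^sup>+om. R j om*indicator (space P) om \<partial>P)"
   unfolding X_def by (rule nn_integral_Markov_inequality) auto
  also have "(\<integral>\<^sup>+om. R j om*indicator (space P) om \<partial>P) = (\<integral>\<^sup>+om. R j om \<partial>P)"
   by (intro nn_integral_cong) simp
  also have "ennreal (b j)*(\<integral>\<^sup>+om. R j om \<partial>P) <= ennreal (b j)*ennreal (K*S*2 powr (- real j*(T q + c)))"
   by (intro mult_left_mono ER) auto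
  also have "... = ennreal (b j*(K*S*2 powr (- real j*(T q + c))))"
   using Kpos Snn by (intro ennreal_mult[symmetric]) (auto simp: b_def)
  also have "b j*(K*S*2 powr (- real j*(T q + c))) = K*S*(2 powr (j*(T q + c - e))*2 powr (- real j*(T q + c)))"
   by (simp add: b_def)
  also have "2 powr (j*(T q + c - e))*2 powr (- real j*(T q + c)) = 2 powr (- e*j)"
   by (simp add: algebra_simps flip: powr_add)
  finally show ?thesis using Kpos Snn by (simp add: emeasure_eq_measure)
 qed
 have "AE om in P. \<exists>j0. \<forall>j\<ge>j0. om \<notin> X j"
 proof (rule AE_eventually_not[OF Xs, of 0])
  show "prob (X j) <= K*S*2 powr (- e*j)" for j by (rule Xp)
  have "2 powr (- e) < 1" using e powr_less_mono[of "- e" 0 "2::real"] by simp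
  moreover have "2 powr (- e*real j) = (2 powr (- e)) ^ j" for j by (simp add: powr_power mult.commute)
  ultimately show "summable (%j. K*S*2 powr (- e*real j))" by (simp add: summable_mult summable_geometric)
 qed
 with AE_space show ?thesis
 proof eventually_elim
  case (elim om)
  then obtain j0 where j0: "!!j. j >= j0 ==> om \<notin> X j" by blast
  show ?case
  proof (intro exI[of _ j0] allI impI)
   fix j V assume j: "j >= j0" and V: "\<forall>u\<in>words j. V u ~= [] & p (u @ V u) om"
   have "\<not> 1 <= ennreal (b j)*R j om" using j0[OF j] elim(1) by (simp add: X_def)
   hence lt: "ennreal (b j)*R j om < 1" by (simp only: not_le)
   define N where "N = Suc (Max ((%u. length (V u)) ` words j))"
   have lN: "length (V u) < N" if "u \<in> words j" for u
    unfolding N_def using that by (intro le_imp_less_Suc Max_ge) auto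
   have "ennreal (\<Sum>u\<in>words j. a u (V u)) = (\<Sum>u\<in>words j. ennreal (a u (V u)))" by (simp add: sum_ennreal a_def)
   also have "... <= (\<Sum>u\<in>words j. \<Sum>k<N. \<Sum>v\<in>words (Suc k). ennreal (a u v)*indicator (A (u @ v)) om)"
   proof (rule sum_mono)
    fix u :: "'n word" assume u: "u \<in> words j"
    define k where "k = length (V u) - 1"
    have k: "length (V u) = Suc k" using V u by (cases "V u") (auto simp: k_def)
    have kN: "k \<in> {..<N}" using lN[OF u] k by simp
    have vk: "V u \<in> words (Suc k)" using k by (simp add: words_def)
    have "ennreal (a u (V u)) = ennreal (a u (V u))*indicator (A (u @ V u)) om" using V u elim(1) by simp
    also have "... <= (\<Sum>v\<in>words (Suc k). ennreal (a u v)*indicator (A (u @ v)) om)"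
     by (rule member_le_sum[where f = "\<lambda>v. ennreal (a u v)*indicator (A (u @ v)) om", OF vk]) auto
    also have "... <= (\<Sum>k<N. \<Sum>v\<in>words (Suc k). ennreal (a u v)*indicator (A (u @ v)) om)"
     by (rule member_le_sum[where f = "\<lambda>k. \<Sum>v\<in>words (Suc k). ennreal (a u v)*indicator (A (u @ v)) om", OF kN]) auto
    finally show "ennreal (a u (V u)) <= (\<Sum>k<N. \<Sum>v\<in>words (Suc k). ennreal (a u v)*indicator (A (u @ v)) om)" .
   qed
   also have "... = (\<Sum>k<N. Y j k om)" unfolding Y_def by (rule sum.swap)
   also have "... <= R j om" unfolding R_def by (intro sum_le_suminf summableI) auto
   finally have "ennreal (b j)*ennreal (\<Sum>u\<in>words j. a u (V u)) <= ennreal (b j)*R j om" by (intro mult_left_mono) auto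
   hence "ennreal (b j)*ennreal (\<Sum>u\<in>words j. a u (V u)) < 1" using lt by (rule le_less_trans)
   hence "ennreal (b j*(\<Sum>u\<in>words j. a u (V u))) < ennreal 1" by (simp add: ennreal_mult a_def b_def sum_nonneg)
   hence "b j*(\<Sum>u\<in>words j. a u (V u)) < 1" by (simp add: ennreal_less_iff a_def b_def sum_nonneg)
   hence "(\<Sum>u\<in>words j. a u (V u)) < 1/b j" by (simp add: b_def field_simps)
   also have "1/b j = 2 powr (- real j*(T q + c - e))" by (simp add: b_def powr_minus_divide)
   finally show "(\<Sum>u\<in>words j. 2 powr (- (q - q')*g u - q'*g (u @ V u))) <= 2 powr (- real j*(T q + c - e))"
    by (simp add: a_def)
  qed
 qed
qed

section \<open>Bad words\<close>

text \<open>A sampled descendant makes the capacity at \<open>x\<close> too large: the cost falls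
  below \<open>r\<close> per letter of \<open>x\<close>.\<close>

definition bad :: "real => 'w => 'n word => bool" where
 "bad r om x \<longleftrightarrow> (\<exists>v. v ~= [] & p (x @ v) om & g (x @ v) < g x + r*length x)"

definition bv :: "real => 'n word => 'n word set" where
 "bv r x = {v. v ~= [] & g (x @ v) < g x + r*length x}"

lemma finite_bv: "finite (bv r x)"
 by (rule finite_subset[OF _ finite_g_less[of x "g x + r*length x"]]) (auto simp: bv_def)

lemma bad_eq: "{om \<in> space P. bad r om x} = (\<Union>v\<in>bv r x. A (x @ v))"
 by (auto simp: bad_def bv_def)

lemma bad_sets [measurable]: "{om \<in> space P. bad r om x} \<in> sets P"
 unfolding bad_eq by (rule sets.finite_UN[OF finite_bv A_sets]) (simp add: bv_def)

text \<open>An exponential Chebyshev bound: every \<open>v\<close> in \<open>bv r x\<close>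
  satisfies \<open>1 <= 2 powr (q'*(r*length x - g v + c0))\<close>, and the resulting sum over all
  depths converges since \<open>q' > qt\<close>. What remains is the decay \<open>c - q'*r\<close>
  per letter of \<open>x\<close>.\<close>

lemma bad_sum:
 assumes q': "q' > qt" and k: "ka <= c - q'*r"
 obtains K where "K > 0" "!!x. (\<Sum>v\<in>bv r x. pr (x @ v)) <= K*2 powr (- ka*length x)"
proof -
 define t where "t = 2 powr (- (T q' + c))"
 have t: "0 < t" "t < 1" using T_strict[OF q'] qt powr_less_mono[of "- (T q' + c)" 0 "2::real"] by (auto simp: t_def)
 define K where "K = C q'*(C q'*(1/(1 - t)))"
 have K: "K > 0" using t by (simp add: K_def)
 have q0: "q' > 0" using q' qt by linarith
 have "(\<Sum>v\<in>bv r x. pr (x @ v)) <= K*2 powr (- ka*length x)" for x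
 proof -
  obtain N where N: "!!v. v \<in> bv r x ==> length v < N"
   using finite_bv[of r x] finite_nat_set_iff_bounded[of "length ` bv r x"] by (metis finite_imageI imageI)
  have "(\<Sum>v\<in>bv r x. pr (x @ v)) <= (\<Sum>v\<in>bv r x. pr x*(2 powr (q'*r*length x)*C q')*(W q' v * pr v))"
  proof (rule sum_mono)
   fix v assume v: "v \<in> bv r x"
   have "0 <= q'*(g x + r*length x - g (x @ v))" using v q0 by (intro mult_nonneg_nonneg) (auto simp: bv_def)
   also have "... <= q'*(r*length x - g v + c0)" using qa[of x v] q0 by (intro mult_left_mono) auto
   finally have "2 powr 0 <= 2 powr (q'*(r*length x - g v + c0))" by (intro powr_mono) auto
   also have "... = 2 powr (q'*r*length x)*C q'*W q' v"
    using q0 by (simp add: C_def W_def algebra_simps flip: powr_add)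
   finally have "pr (x @ v)*1 <= pr (x @ v)*(2 powr (q'*r*length x)*C q'*W q' v)"
    by (intro mult_left_mono) (auto simp: less_imp_le pr_bounds)
   thus "pr (x @ v) <= pr x*(2 powr (q'*r*length x)*C q')*(W q' v * pr v)" by (simp add: pr_append mult_ac)
  qed
  also have "... = pr x*(2 powr (q'*r*length x)*C q')*(\<Sum>v\<in>bv r x. W q' v * pr v)" by (simp add: sum_distrib_left)
  also have "(\<Sum>v\<in>bv r x. W q' v * pr v) <= (\<Sum>v\<in>(\<Union>n<N. words n). W q' v * pr v)"
  proof (rule sum_mono2)
   show "bv r x \<subseteq> (\<Union>n<N. words n)" using N by (auto simp: words_def)
  qed (auto simp: less_imp_le pr_bounds intro!: mult_nonneg_nonneg)
  also have "... = (\<Sum>n<N. \<Sum>v\<in>words n. W q' v * pr v)"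
  proof (rule sum.UNION_disjoint)
   show "\<forall>i\<in>{..<N}. \<forall>j\<in>{..<N}. i ~= j --> words i \<inter> words j = ({} :: 'n word set)" by (auto simp: words_def)
  qed auto
  also have "... = (\<Sum>n<N. Z q' n*2 powr (- c*n))"
   unfolding Z_def sum_distrib_right by (intro sum.cong refl) (auto simp: words_def pr_def)
  also have "... <= (\<Sum>n<N. C q'*t ^ n)"
  proof (rule sum_mono)
   fix n
   have "Z q' n*2 powr (- c*n) <= C q'*2 powr (- real n*T q')*2 powr (- c*n)"
    by (intro mult_right_mono Z_upper) auto
   also have "... = C q'*(2 powr (- real n*T q')*2 powr (- c*n))" by simp
   also have "2 powr (- real n*T q')*2 powr (- c*n) = 2 powr (- (T q' + c)*n)" by (simp add: algebra_simps flip: powr_add)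
   also have "... = t ^ n" unfolding t_def by (simp add: powr_power mult.commute)
   finally show "Z q' n*2 powr (- c*n) <= C q'*t ^ n" .
  qed
  also have "... = C q'*(\<Sum>n<N. t ^ n)" by (simp add: sum_distrib_left)
  also have "(\<Sum>n<N. t ^ n) <= (\<Sum>n. t ^ n)" using t by (intro sum_le_suminf summable_geometric) auto
  also have "(\<Sum>n. t ^ n) = 1/(1 - t)" using t by (intro suminf_geometric) simp
  finally have "(\<Sum>v\<in>bv r x. pr (x @ v)) <= pr x*(2 powr (q'*r*length x)*C q')*(C q'*(1/(1 - t)))"
   using pr_bounds(1)[of x] by (simp add: mult_left_mono)
  also have "... = K*(2 powr (q'*r*length x)*pr x)" by (simp add: K_def)
  also have "2 powr (q'*r*length x)*pr x = 2 powr (- (c - q'*r)*length x)"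
   by (simp add: pr_def algebra_simps flip: powr_add)
  also have "K*2 powr (- (c - q'*r)*length x) <= K*2 powr (- ka*length x)"
   using K k by (intro mult_left_mono powr_mono mult_right_mono) auto
  finally show ?thesis .
 qed
 thus ?thesis using that K by blast
qed

text \<open>Each bad word is charged to one sampled descendant. For words of one length these
  witnesses are distinct, so their joint probability is a product, and the sum over all choices of
  witnesses factors into a product of sums.\<close>

lemma prob_all_bad:
 assumes S: "S \<subseteq> words k" and b: "!!x. x \<in> S ==> (\<Sum>v\<in>bv r x. pr (x @ v)) <= \<beta>"
 shows "prob {om \<in> space P. \<forall>x\<in>S. bad r om x} <= \<beta> ^ card S"
proof -
 have fS: "finite S" using S finite_words finite_subset by blast
 define Ff where "Ff = PiE S (bv r)"
 have fF: "finite Ff" unfolding Ff_def using fS finite_bv by (intro finite_PiE) auto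
 have inj: "inj_on (%x. x @ f x) S" if "f \<in> Ff" for f
 proof (rule inj_onI)
  fix x y assume xy: "x \<in> S" "y \<in> S" "x @ f x = y @ f y"
  have "length x = k" "length y = k" using xy(1,2) S by (auto simp: words_def)
  thus "x = y" using xy(3) by simp
 qed
 have ne: "[] \<notin> (%x. x @ f x) ` S" if f: "f \<in> Ff" for f
 proof
  assume "[] \<in> (%x. x @ f x) ` S"
  then obtain x where "x \<in> S" "x @ f x = []" by auto
  moreover have "f x \<in> bv r x" using f \<open>x \<in> S\<close> unfolding Ff_def by (rule PiE_mem)
  ultimately show False by (auto simp: bv_def)
 qed
 have "{om \<in> space P. \<forall>x\<in>S. bad r om x} \<subseteq> (\<Union>f\<in>Ff. {om \<in> space P. \<forall>z\<in>(%x. x @ f x) ` S. p z om})"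
 proof
  fix om assume w: "om \<in> {om \<in> space P. \<forall>x\<in>S. bad r om x}"
  hence "\<forall>x\<in>S. \<exists>v. v \<in> bv r x & p (x @ v) om" by (auto simp: bad_def bv_def)
  then obtain f where f: "!!x. x \<in> S ==> f x \<in> bv r x & p (x @ f x) om" by metis
  have "restrict f S \<in> Ff" using f by (auto simp: Ff_def)
  moreover have "\<forall>z\<in>(%x. x @ restrict f S x) ` S. p z om" using f by auto
  ultimately show "om \<in> (\<Union>f\<in>Ff. {om \<in> space P. \<forall>z\<in>(%x. x @ f x) ` S. p z om})" using w by blast
 qed
 hence "prob {om \<in> space P. \<forall>x\<in>S. bad r om x} <= prob (\<Union>f\<in>Ff. {om \<in> space P. \<forall>z\<in>(%x. x @ f x) ` S. p z om})"
  using fF fS ne by (intro finite_measure_mono sets.finite_UN prob_all) auto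
 also have "... <= (\<Sum>f\<in>Ff. prob {om \<in> space P. \<forall>z\<in>(%x. x @ f x) ` S. p z om})"
  by (intro finite_measure_subadditive_finite fF image_subsetI prob_all(1) finite_imageI fS ne)
 also have "... = (\<Sum>f\<in>Ff. \<Prod>x\<in>S. pr (x @ f x))"
 proof (rule sum.cong[OF refl])
  fix f assume f: "f \<in> Ff"
  have "prob {om \<in> space P. \<forall>z\<in>(%x. x @ f x) ` S. p z om} = (\<Prod>z\<in>(%x. x @ f x) ` S. pr z)"
   using fS ne[OF f] by (intro prob_all) auto
  also have "... = (\<Prod>x\<in>S. pr (x @ f x))" by (subst prod.reindex[OF inj[OF f]]) simp
  finally show "prob {om \<in> space P. \<forall>z\<in>(%x. x @ f x) ` S. p z om} = (\<Prod>x\<in>S. pr (x @ f x))" .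
 qed
 also have "... = (\<Prod>x\<in>S. \<Sum>v\<in>bv r x. pr (x @ v))"
  unfolding Ff_def using fS finite_bv by (intro prod_sum_PiE[symmetric]) auto
 also have "... <= (\<Prod>x\<in>S. \<beta>)" using b by (intro prod_mono) (auto intro!: sum_nonneg simp: less_imp_le pr_bounds)
 finally show ?thesis by simp
qed

text \<open>Union bound over the \<open>m\<close>-subsets, whose number is at most
  \<open>(exp 1*card S/m) ^ m\<close>.\<close>

lemma prob_many_bad:
 assumes S: "S \<subseteq> words k" and b: "!!x. x \<in> S ==> (\<Sum>v\<in>bv r x. pr (x @ v)) <= \<beta>" and bn: "\<beta> >= 0"
  and m: "m > 0" "real (card S) <= m*M"
 shows "{om \<in> space P. card {x \<in> S. bad r om x} >= m} \<in> sets P"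
  "prob {om \<in> space P. card {x \<in> S. bad r om x} >= m} <= (exp 1*M*\<beta>) ^ m"
proof -
 have fS: "finite S" using S finite_words finite_subset by blast
 define U where "U = {X. X \<subseteq> S & card X = m}"
 have fU: "finite U" unfolding U_def using fS by simp
 have eq: "{om \<in> space P. card {x \<in> S. bad r om x} >= m} = (\<Union>X\<in>U. {om \<in> space P. \<forall>x\<in>X. bad r om x})"
 proof (intro set_eqI iffI)
  fix om assume w: "om \<in> {om \<in> space P. card {x \<in> S. bad r om x} >= m}"
  then obtain X where "X \<subseteq> {x \<in> S. bad r om x}" "card X = m" using obtain_subset_with_card_n by blast
  thus "om \<in> (\<Union>X\<in>U. {om \<in> space P. \<forall>x\<in>X. bad r om x})" using w by (intro UN_I[of X]) (auto simp: U_def)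
 next
  fix om assume "om \<in> (\<Union>X\<in>U. {om \<in> space P. \<forall>x\<in>X. bad r om x})"
  then obtain X where X: "X \<subseteq> S" "card X = m" "om \<in> space P" "\<forall>x\<in>X. bad r om x" by (auto simp: U_def)
  have "card X <= card {x \<in> S. bad r om x}" using X fS by (intro card_mono) auto
  thus "om \<in> {om \<in> space P. card {x \<in> S. bad r om x} >= m}" using X by simp
 qed
 have ms: "{om \<in> space P. \<forall>x\<in>X. bad r om x} \<in> sets P" if "X \<in> U" for X
  using that fS finite_subset by (intro sets.sets_Collect_finite_All bad_sets) (auto simp: U_def)
 show "{om \<in> space P. card {x \<in> S. bad r om x} >= m} \<in> sets P"
  unfolding eq by (intro sets.finite_UN fU ms)
 have "prob {om \<in> space P. card {x \<in> S. bad r om x} >= m} <= (\<Sum>X\<in>U. prob {om \<in> space P. \<forall>x\<in>X. bad r om x})"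
  unfolding eq using fU ms by (intro finite_measure_subadditive_finite) auto
 also have "... <= (\<Sum>X\<in>U. \<beta> ^ m)"
 proof (rule sum_mono)
  fix X assume X: "X \<in> U"
  hence "prob {om \<in> space P. \<forall>x\<in>X. bad r om x} <= \<beta> ^ card X" using S b by (intro prob_all_bad) (auto simp: U_def)
  thus "prob {om \<in> space P. \<forall>x\<in>X. bad r om x} <= \<beta> ^ m" using X by (simp add: U_def)
 qed
 also have "... = real (card S choose m)*\<beta> ^ m" using n_subsets[OF fS, of m] by (simp add: U_def)
 also have "... <= (exp 1*M) ^ m*\<beta> ^ m"
 proof (rule mult_right_mono)
  have mm: "real m ^ m <= fact m*exp m" using power_le_fact_exp[of "real m" m] by simp
  have "real (card S choose m)*fact m <= real (card S) ^ m"
   using binomial_fact_pow[of "card S" m] by (metis of_nat_fact of_nat_le_iff of_nat_mult of_nat_power)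
  also have "... <= (m*M) ^ m" using m by (intro power_mono) auto
  also have "... = real m ^ m*M ^ m" by (simp add: power_mult_distrib)
  also have "... <= (fact m*exp m)*M ^ m"
  proof (rule mult_right_mono[OF mm])
   have "0 <= m*M" using m(2) by (rule order_trans[rotated]) simp
   hence "M >= 0" using m(1) by (simp add: zero_le_mult_iff)
   thus "0 <= M ^ m" by simp
  qed
  also have "... = (exp 1*M) ^ m*fact m" by (simp add: power_mult_distrib flip: exp_of_nat_mult)
  finally show "real (card S choose m) <= (exp 1*M) ^ m" by simp
 qed (use bn in simp)
 finally show "prob {om \<in> space P. card {x \<in> S. bad r om x} >= m} <= (exp 1*M*\<beta>) ^ m"
  by (simp add: power_mult_distrib)
qed

end

context sampled_tree
begin

text \<open>Among the words \<open>w @ t\<close> of length \<open>k\<close> the allowed proportion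
  of bad ones is \<open>1/k^2\<close>, summable along the checkpoints of a step. Exceeding it
  requires about \<open>card B ^ i/k^2\<close> distinct bad words, each bad with exponentially small
  probability, and the condition \<open>ze*l <= i*b\<close> makes this number exponential in
  \<open>k\<close>.\<close>

lemma AE_few_bad:
 fixes ze r q' ka :: real
 assumes B: "B \<subseteq> words b" "card B >= 2" "b > 0" and z: "ze > 0"
  and q': "q' > qt" and k: "ka > 0" "ka <= c - q'*r"
 shows "AE om in P. \<exists>k0. \<forall>k\<ge>k0. \<forall>l i. k = l + i*b & ze*real l <= real (i*b) -->
  (\<forall>w\<in>words l. (real k)\<^sup>2*real (card {t \<in> pw B i. bad r om (w @ t)}) <= real (card B ^ i))"
proof -
 obtain K where K: "K > 0" "!!x. (\<Sum>v\<in>bv r x. pr (x @ v)) <= K*2 powr (- ka*length x)"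
  using bad_sum[OF q' k(2)] by metis
 define d where "d = real CARD('n)"
 define \<sigma> where "\<sigma> = 1/(b*(1/ze + 1))"
 have den: "real b*(1/ze + 1) > 0" using B(3) z by (intro mult_pos_pos add_pos_pos) auto
 have sg: "\<sigma> > 0" unfolding \<sigma>_def using den by simp
 have si: "\<sigma>*k <= i" if "k = l + i*b" "ze*real l <= real (i*b)" for k l i
 proof -
  have "real l <= real (i*b)/ze" using that(2) z by (simp add: pos_le_divide_eq mult.commute)
  hence "real k <= real i*(b*(1/ze + 1))" using that(1) by (simp add: algebra_simps)
  hence "real k/(b*(1/ze + 1)) <= i" using den by (simp add: pos_divide_le_eq)
  thus ?thesis by (simp add: \<sigma>_def)
 qed
 define M where "M k i = nat \<lceil>real (card B ^ i)/(real k)\<^sup>2\<rceil>" for k i :: nat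
 have "ev (%k. exp 1*(real k)\<^sup>2*(K*2 powr (- ka*real k)) <= 1/2)"
  using k(1) K(1) by real_asymp
 moreover have "ev (%k. 2 powr (\<sigma>*real k) >= (d + 3)*real k*(real k)\<^sup>2)"
  using sg by real_asymp
 ultimately have "ev (%k. exp 1*(real k)\<^sup>2*(K*2 powr (- ka*real k)) <= 1/2
  & 2 powr (\<sigma>*real k) >= (d + 3)*real k*(real k)\<^sup>2)" by (rule eventually_conj)
 \<comment> \<open>The exponent \<open>d + 3\<close> pays for the at most
   \<open>2 powr (d*k)\<close> words \<open>w\<close> and the at most \<open>2 powr (2*k)\<close>
   pairs \<open>(l, i)\<close>, leaving \<open>2 powr (- k)\<close> for Borel-Cantelli.\<close>
 then obtain k1 where k1: "!!k. k >= k1 ==> exp 1*(real k)\<^sup>2*(K*2 powr (- ka*real k)) <= 1/2"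
  "!!k. k >= k1 ==> 2 powr (\<sigma>*real k) >= (d + 3)*real k*(real k)\<^sup>2"
  unfolding eventually_sequentially by blast
 define S where "S w i = (%t. w @ t) ` pw B i" for w :: "'n word" and i
 define E where "E k l i w = {om \<in> space P. card {x \<in> S w i. bad r om x} >= M k i}" for k l i :: nat and w :: "'n word"
 define Q where "Q k = {(l, i). l <= k & i <= k & k = l + i*b & ze*real l <= real (i*b)}" for k
 have fQ: "finite (Q k)" for k by (rule finite_subset[of _ "{..k} \<times> {..k}"]) (auto simp: Q_def)
 have cQ: "card (Q k) <= (k + 1)*(k + 1)" for k
 proof -
  have "card (Q k) <= card ({..k} \<times> {..k})" by (rule card_mono) (auto simp: Q_def)
  thus ?thesis by (simp add: card_cartesian_product)
 qed
 define Ev where "Ev k = (if k < max k1 1 then {} else (\<Union>(l, i)\<in>Q k. \<Union>w\<in>words l. E k l i w))" for k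
 have fB: "finite B" using B(1) finite_words finite_subset by blast
 have SW: "S w i \<subseteq> words k" if "k = l + i*b" "w \<in> words l" for w i k l
  using that pw_length[OF B(1)] by (auto simp: S_def words_def)
 have cS: "card (S w i) = card B ^ i" for w i
  unfolding S_def by (subst card_image) (auto simp: inj_on_def card_pw[OF B(1)])
 have Mge: "real (card B ^ i)/(real k)\<^sup>2 <= M k i" for k i unfolding M_def by linarith
 have EE: "E k l i w \<in> sets P" "prob (E k l i w) <= 2 powr (- ((d + 3)*k))"
  if "k >= max k1 1" "(l, i) \<in> Q k" "w \<in> words l" for k l i w
 proof -
  have kp: "k > 0" "k >= k1" using that by auto
  have q: "k = l + i*b" "ze*real l <= real (i*b)" using that by (auto simp: Q_def)
  have "2 powr (\<sigma>*real k) <= 2 powr real i" using si[OF q] by (intro powr_mono) auto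
  also have "... = 2 ^ i" by (simp add: powr_realpow)
  also have "... <= real (card B) ^ i" using B(2) by (intro power_mono) auto
  finally have "(d + 3)*real k*(real k)\<^sup>2 <= real (card B ^ i)" using k1(2)[OF kp(2)] by simp
  hence "(d + 3)*real k <= real (card B ^ i)/(real k)\<^sup>2" using kp by (simp add: pos_le_divide_eq)
  hence Mk: "(d + 3)*real k <= M k i" using Mge[of i k] by linarith
  have "d + 3 > 0" by (simp add: d_def add_pos_pos)
  hence "0 < (d + 3)*real k" using kp by (intro mult_pos_pos) auto
  hence M0: "M k i > 0" using Mk by linarith
  have cM: "real (card (S w i)) <= M k i*(real k)\<^sup>2"
   using Mge[of i k] kp unfolding cS by (simp add: pos_divide_le_eq)
  have bd: "(\<Sum>v\<in>bv r x. pr (x @ v)) <= K*2 powr (- ka*real k)" if "x \<in> S w i" for x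
  proof -
   have "x \<in> words k" using SW[OF q(1) \<open>w \<in> words l\<close>] that by blast
   thus ?thesis using K(2)[of x] by (simp add: words_def)
  qed
  have bn: "K*2 powr (- ka*real k) >= 0" using K(1) by simp
  show "E k l i w \<in> sets P" unfolding E_def
   by (rule prob_many_bad(1)[OF SW[OF q(1) that(3)] bd bn M0 cM])
  have "prob (E k l i w) <= (exp 1*(real k)\<^sup>2*(K*2 powr (- ka*real k))) ^ M k i" unfolding E_def
   by (rule prob_many_bad(2)[OF SW[OF q(1) that(3)] bd bn M0 cM])
  also have "... <= (1/2) ^ M k i" using k1(1)[OF kp(2)] K(1) by (intro power_mono) auto
  also have "... = 2 powr (- real (M k i))" by (rule powr_minus_nat[symmetric])
  also have "... <= 2 powr (- ((d + 3)*k))" using Mk by (intro powr_mono) auto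
  finally show "prob (E k l i w) <= 2 powr (- ((d + 3)*k))" .
 qed
 have "AE om in P. \<exists>j0. \<forall>j\<ge>j0. om \<notin> Ev j"
 proof (rule AE_eventually_not)
  show "Ev k \<in> sets P" for k
  proof (cases "k < max k1 1")
   case True thus ?thesis by (simp only: Ev_def if_True sets.empty_sets)
  next
   case False
   hence k': "k >= max k1 1" by (simp only: not_less)
   show ?thesis unfolding Ev_def if_not_P[OF False] case_prod_unfold
    by (intro sets.finite_UN fQ finite_words EE(1)[OF k']) auto
  qed
  show "prob (Ev k) <= 1*2 powr (- real k)" if k: "k >= max k1 1" for k
  proof -
   have nk: "\<not> k < max k1 1" using k by (simp only: not_less)
   have "prob (Ev k) = prob (\<Union>(l, i)\<in>Q k. \<Union>w\<in>words l. E k l i w)" unfolding Ev_def if_not_P[OF nk] ..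
   also have "... <= (\<Sum>(l, i)\<in>Q k. prob (\<Union>w\<in>words l. E k l i w))"
    unfolding case_prod_unfold using EE(1)[OF k] fQ[of k]
    by (intro finite_measure_subadditive_finite) (auto intro!: sets.finite_UN)
   also have "... <= (\<Sum>(l, i)\<in>Q k. 2 powr (d*k)*2 powr (- ((d + 3)*k)))"
   proof (rule sum_mono, clarify)
    fix l i assume li: "(l, i) \<in> Q k"
    have "prob (\<Union>w\<in>words l. E k l i w) <= (\<Sum>w\<in>words l. prob (E k l i w))"
     using EE(1)[OF k li] by (intro finite_measure_subadditive_finite) auto
    also have "... <= (\<Sum>w\<in>(words l :: 'n word set). 2 powr (- ((d + 3)*k)))"
     by (intro sum_mono EE(2)[OF k li])
    also have "... = 2 ^ (CARD('n)*l)*2 powr (- ((d + 3)*k))" by (simp add: card_words)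
    also have "... <= 2 powr (d*k)*2 powr (- ((d + 3)*k))"
    proof (rule mult_right_mono)
     have "l <= k" using li by (simp add: Q_def)
     hence "(2::real) ^ (CARD('n)*l) <= 2 ^ (CARD('n)*k)" by (intro power_increasing) auto
     also have "... = 2 powr (d*k)" by (simp add: d_def flip: powr_realpow)
     finally show "(2::real) ^ (CARD('n)*l) <= 2 powr (d*k)" .
    qed simp
    finally show "prob (\<Union>w\<in>words l. E k l i w) <= 2 powr (d*k)*2 powr (- ((d + 3)*k))" .
   qed
   also have "... = card (Q k)*2 powr (- (3*real k))"
   proof -
    have "2 powr (d*k)*2 powr (- ((d + 3)*k)) = 2 powr (- (3*real k))"
     by (simp add: algebra_simps flip: powr_add)
    thus ?thesis by simp
   qed
   also have "... <= (2 ^ k*2 ^ k)*2 powr (- (3*real k))"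
   proof (rule mult_right_mono)
    have "k + 1 <= 2 ^ k" using Suc_leI[OF less_exp[of k]] by simp
    hence "(k + 1)*(k + 1) <= 2 ^ k*2 ^ k" by (intro mult_mono) auto
    hence "card (Q k) <= 2 ^ k*2 ^ k" using cQ[of k] by linarith
    hence "real (card (Q k)) <= real (2 ^ k*2 ^ k)" by (simp only: of_nat_le_iff)
    thus "real (card (Q k)) <= 2 ^ k*2 ^ k" by simp
   qed simp
   also have "... = 2 powr (- real k)" by (simp flip: powr_realpow powr_add)
   finally show ?thesis by simp
  qed
  show "summable (%m. 1*2 powr (- real m))" by (rule summable_powr_minus)
 qed
 with AE_space show ?thesis
 proof eventually_elim
  case (elim om)
  then obtain j0 where j0: "!!j. j >= j0 ==> om \<notin> Ev j" by blast
  show ?case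
  proof (intro exI[of _ "max j0 (max k1 1)"] allI impI ballI)
   fix k l i :: nat and w :: "'n word" assume k: "k >= max j0 (max k1 1)" and li: "k = l + i*b & ze*real l <= real (i*b)" and w: "w \<in> words l"
   have "i <= i*b" using B(3) by simp
   hence "l <= k" "i <= k" using li by linarith+
   hence Qi: "(l, i) \<in> Q k" using li unfolding Q_def by blast
   have nk: "\<not> k < max k1 1" using k by linarith
   have "E k l i w \<subseteq> Ev k" using Qi w unfolding Ev_def if_not_P[OF nk] by blast
   hence "om \<notin> E k l i w" using j0[of k] k by auto
   hence "card {x \<in> S w i. bad r om x} < M k i" using elim(1) by (simp add: E_def)
   hence "real (card {x \<in> S w i. bad r om x}) < real (card B ^ i)/(real k)\<^sup>2" unfolding M_def by linarith
   moreover have "{x \<in> S w i. bad r om x} = (%t. w @ t) ` {t \<in> pw B i. bad r om (w @ t)}" by (auto simp: S_def)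
   moreover have "card ((%t. w @ t) ` {t \<in> pw B i. bad r om (w @ t)}) = card {t \<in> pw B i. bad r om (w @ t)}"
    by (rule card_image) (simp add: inj_on_def)
   ultimately have "real (card {t \<in> pw B i. bad r om (w @ t)}) < real (card B ^ i)/(real k)\<^sup>2" by simp
   moreover have "(real k)\<^sup>2 > 0" using k by simp
   ultimately show "(real k)\<^sup>2*real (card {t \<in> pw B i. bad r om (w @ t)}) <= real (card B ^ i)"
    by (simp add: pos_less_divide_eq mult.commute)
  qed
 qed
qed

section \<open>Blocks of a given type and paths along them\<close>

lemma eventually_mult_ge: "(d::real) > 0 ==> ev (%n. real n*d >= K)"
 by real_asymp

text \<open>Typed words are prefixed by \<open>ltr0\<close> and \<open>ltr1\<close>, so that the
  first block after a word keeps the points strictly inside the cube of that word. The block length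
  is so large that the two extra letters and the defect \<open>c0\<close> stay within the tolerance
  per block.\<close>

lemma block_exists:
 assumes e: "e > 0" and e': "0 < e'" "e' < en q"
 obtains B b where "b > 0" "B \<subseteq> words b" "!!u. u \<in> B ==> \<exists>z. u = ltr0 # ltr1 # z"
  "!!u. u \<in> B ==> \<bar>g u - b*T' q\<bar> <= e*b" "c0 <= e*b" "real (card B) >= 2 powr (b*(en q - e'))" "card B >= 2"
proof -
 define e1 where "e1 = min (e/2) (e'/(2*(\<bar>q\<bar> + 1)))"
 have e1: "e1 > 0" using e e' by (simp add: e1_def add_nonneg_pos)
 have e1e: "e1 <= e/2" unfolding e1_def by (rule min.cobounded1)
 have "(\<bar>q\<bar> + 1)*e1 <= (\<bar>q\<bar> + 1)*(e'/(2*(\<bar>q\<bar> + 1)))" by (intro mult_left_mono) (auto simp: e1_def)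
 also have "... = e'/2"
 proof -
  have "\<bar>q\<bar> + 1 ~= 0" by linarith
  thus ?thesis by (simp add: field_simps)
 qed
 finally have e1': "(\<bar>q\<bar> + 1)*e1 <= e'/2" .
 obtain n0 where n0: "!!n. n >= n0 ==> real (card (typed n (T' q) e1)) >= 2 powr (n*(en q - (\<bar>q\<bar> + 1)*e1))"
  using card_typed[OF e1, of q] unfolding eventually_sequentially ent_eq_en by blast
 define K where "K = \<bar>g [ltr0, ltr1]\<bar> + c0 + 2*\<bar>T' q\<bar>"
 have "ev (%n. real n*(e/2) >= K + c0)" using e by real_asymp
 moreover have "ev (%n. real n*(e'/2) >= 2*en q)" using e' by (intro eventually_mult_ge) simp
 moreover have "ev (%n. real n*(en q - e') >= 1)" using e' by (intro eventually_mult_ge) simp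
 ultimately have "ev (%n. n >= n0 & real n*(e/2) >= K + c0 & real n*(e'/2) >= 2*en q & real n*(en q - e') >= 1)"
  by (intro eventually_conj eventually_ge_at_top)
 then obtain n where n: "n >= n0" "real n*(e/2) >= K + c0" "real n*(e'/2) >= 2*en q" "real n*(en q - e') >= 1"
  by (auto dest!: eventually_happens)
 define b where "b = n + 2"
 define B where "B = (%v. ltr0 # ltr1 # v) ` typed n (T' q) e1"
 have K0: "K >= 0" using c0_nonneg by (simp add: K_def)
 have cb: "real (card B) >= 2 powr (b*(en q - e'))"
 proof -
  have cB: "card B = card (typed n (T' q) e1)" unfolding B_def by (rule card_image) (simp add: inj_on_def)
  have "real n*(\<bar>q\<bar> + 1)*e1 <= real n*(e'/2)" using e1' by (simp add: mult.assoc mult_left_mono)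
  hence "b*(en q - e') <= n*(en q - (\<bar>q\<bar> + 1)*e1)"
   using n(3) e' by (simp add: b_def algebra_simps)
  hence "2 powr (b*(en q - e')) <= 2 powr (n*(en q - (\<bar>q\<bar> + 1)*e1))" by (intro powr_mono) auto
  thus ?thesis using n0[OF n(1)] unfolding cB by (rule order_trans)
 qed
 have "real (card B) >= 2"
 proof -
  have "real n*(en q - e') <= b*(en q - e')" using e' by (intro mult_right_mono) (auto simp: b_def)
  hence "2 powr 1 <= 2 powr (b*(en q - e'))" using n(4) by (intro powr_mono) auto
  thus ?thesis using cb by simp
 qed
 hence c2: "card B >= 2" by linarith
 show ?thesis
 proof (rule that[of b B])
  show "b > 0" by (simp add: b_def)
  show "B \<subseteq> words b" by (auto simp: B_def typed_def words_def b_def)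
  show "\<exists>z. u = ltr0 # ltr1 # z" if "u \<in> B" for u using that by (auto simp: B_def)
  show "\<bar>g u - b*T' q\<bar> <= e*b" if u: "u \<in> B" for u
  proof -
   obtain v where v: "u = [ltr0, ltr1] @ v" "\<bar>g v - n*T' q\<bar> <= e1*n" using u by (auto simp: B_def typed_def)
   have "b*T' q = n*T' q + 2*T' q" by (simp add: b_def algebra_simps)
   moreover have "e1*n <= e/2*n" using e1e by (intro mult_right_mono) auto
   ultimately have "\<bar>g u - b*T' q\<bar> <= e/2*n + K"
    using v(2) qa[of "[ltr0, ltr1]" v] unfolding v(1) K_def by linarith
   also have "... <= e*n" using n(2) c0_nonneg by (simp add: algebra_simps)
   also have "... <= e*b" using e by (intro mult_left_mono) (auto simp: b_def)
   finally show ?thesis .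
  qed
  show "c0 <= e*b"
  proof -
   have "c0 <= real n*(e/2)" using n(2) K0 by linarith
   also have "... <= real n*e" using e by (intro mult_left_mono) auto
   also have "... <= e*b" using e by (simp add: b_def algebra_simps)
   finally show ?thesis .
  qed
 qed (use cb c2 in auto)
qed

text \<open>In the factor \<open>2\<close>, one \<open>e*b\<close> per block is the deviation of the
  block itself, the other pays for the defect \<open>c0\<close> of each concatenation.\<close>

lemma pw_path:
 assumes B: "B \<subseteq> words b" "!!u. u \<in> B ==> \<bar>g u - b*h\<bar> <= e*b" "c0 <= e*b"
 shows "t \<in> pw B r ==> \<bar>g t - real (r*b)*h\<bar> <= 2*e*real (r*b) + c0"
proof (induction r arbitrary: t)
 case 0
 thus ?case using qa[of "[]" "[]"] by simp
next
 case (Suc r)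
 from Suc.prems obtain u v where t: "t = u @ v" "u \<in> pw B r" "v \<in> B" by (rule pw_SucE)
 have "real (Suc r*b)*h = real (r*b)*h + b*h" "2*e*real (Suc r*b) = 2*e*real (r*b) + 2*(e*b)"
  by (simp_all add: algebra_simps)
 thus ?case using Suc.IH[OF t(2)] B(2)[OF t(3)] B(3) qa[of u v] unfolding t(1) by linarith
qed

lemma pw_path_prefix:
 assumes B: "B \<subseteq> words b" "!!u. u \<in> B ==> \<bar>g u - b*h\<bar> <= e*b" "c0 <= e*b" and b: "b > 0" and e: "e >= 0"
  and h: "0 <= h" "h <= G" and t: "t \<in> pw B r" and k: "k <= r*b"
 shows "\<bar>g (take k t) - k*h\<bar> <= 2*e*k + (3*c0 + 2*G*b)"
proof -
 define i where "i = k div b"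
 have ib: "i*b <= k" "k < i*b + b" using b by (simp_all add: i_def) (metis add.commute dividend_less_times_div mult.commute mult_Suc_right)
 have ir: "i <= r" using k b unfolding i_def by (metis div_le_mono nonzero_mult_div_cancel_right not_gr_zero)
 define x where "x = drop (i*b) (take k t)"
 have split: "take k t = take (i*b) t @ x"
  using ib by (metis append_take_drop_id min.absorb1 take_take x_def)
 have "t \<in> pw B (i + (r - i))" using t ir by simp
 hence "take (i*b) t \<in> pw B i" using pw_split[OF B(1)] by blast
 from pw_path[OF B this] have 1: "\<bar>g (take (i*b) t) - real (i*b)*h\<bar> <= 2*e*real (i*b) + c0" .
 have lx: "length x = k - i*b" unfolding x_def using pw_length[OF B(1) t] k by simp
 have lb: "real (length x) <= b" using lx ib by linarith
 have "G*length x <= G*b" using lb G_pos by (intro mult_left_mono) auto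
 moreover have "0 <= \<delta>*length x" using \<delta>_pos by simp
 moreover have "0 <= G*b" using G_pos by simp
 ultimately have 2: "\<bar>g x\<bar> <= G*b + c0" using g_ge[of x] g_le[of x] by linarith
 have kk: "real k = real (i*b) + length x" using lx ib by simp
 have 3: "0 <= length x*h" "length x*h <= b*G" using h lb by (auto intro!: mult_mono)
 have 4: "2*e*real (i*b) <= 2*e*k" using ib e by (intro mult_left_mono) (auto simp flip: of_nat_mult)
 have "k*h = real (i*b)*h + length x*h" unfolding kk by (simp add: distrib_right)
 thus ?thesis using 1 2 3 4 qa[of "take (i*b) t" x] unfolding split by (simp add: algebra_simps abs_le_iff)
qed

text \<open>Markov's inequality for the number of failing indices; a quarter is the share that
  \<open>step_det\<close> can afford.\<close>

lemma card_markov: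
 assumes I: "finite I" and E: "!!t. t \<in> I ==> E t \<in> sets P" "!!t. t \<in> I ==> prob (E t) <= \<pi>" and p: "\<pi> >= 0"
 shows "{om \<in> space P. card I < 4*card {t \<in> I. om \<in> E t}} \<in> sets P"
  "prob {om \<in> space P. card I < 4*card {t \<in> I. om \<in> E t}} <= 4*\<pi>"
proof -
 define N where "N om = (\<Sum>t\<in>I. indicator (E t) om :: real)" for om
 have Nc: "N om = card {t \<in> I. om \<in> E t}" for om
  unfolding N_def using I by (simp add: indicator_def sum.If_cases Int_def)
 have Nm [measurable]: "N \<in> borel_measurable P" unfolding N_def using E(1) by (intro borel_measurable_sum borel_measurable_indicator)
 have eq: "{om \<in> space P. card I < 4*card {t \<in> I. om \<in> E t}} = {om \<in> space P. real (card I) < 4*N om}"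
 proof -
  have "(card I < 4*k) = (real (card I) < 4*real k)" for k
  proof -
   have "4*real k = real (4*k)" by simp
   thus ?thesis by (simp only: of_nat_less_iff)
  qed
  thus ?thesis unfolding Nc by blast
 qed
 show s: "{om \<in> space P. card I < 4*card {t \<in> I. om \<in> E t}} \<in> sets P" unfolding eq by measurable
 show "prob {om \<in> space P. card I < 4*card {t \<in> I. om \<in> E t}} <= 4*\<pi>"
 proof (cases "I = {}")
  case True
  thus ?thesis using p by simp
 next
  case False
  hence cI: "real (card I) > 0" using I by (simp add: card_gt_0_iff)
  have int: "integrable P N" unfolding N_def using E(1) by (intro Bochner_Integration.integrable_sum) (auto simp: emeasure_eq_measure)
  have "prob {om \<in> space P. card I < 4*card {t \<in> I. om \<in> E t}} <= prob {om \<in> space P. N om >= card I/4}"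
   unfolding eq by (intro finite_measure_mono) auto
  also have "... <= (\<integral>om. N om \<partial>P)/(card I/4)"
   using cI by (intro integral_Markov_inequality_measure[OF int, of "space P"]) (auto simp: N_def sum_nonneg)
  also have "(\<integral>om. N om \<partial>P) = (\<Sum>t\<in>I. prob (E t))"
   unfolding N_def using E(1) by (subst Bochner_Integration.integral_sum) (auto simp: emeasure_eq_measure)
  also have "(\<Sum>t\<in>I. prob (E t))/(card I/4) <= (card I*\<pi>)/(card I/4)"
   using cI by (intro divide_right_mono sum_bounded_above E(2)) auto
  also have "... = 4*\<pi>" using cI by simp
  finally show ?thesis .
 qed
qed

text \<open>Failure means that no candidate \<open>x0 @ u @ v\<close> is sampled, or that some
  sampled candidate has a bad intermediate prefix. In the second case the candidate cannot itself be
  the descendant that makes the prefix bad, because by hypothesis its \<open>g\<close> is too large.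
  The two are distinct words, so the probabilities multiply and the extra factor is exponentially
  small in \<open>j'\<close>.\<close>

lemma prob_spec_fail:
 fixes rr K ka :: real and r2 b m j' :: nat
 assumes Y: "finite Y" "!!u v. (u, v) \<in> Y ==> length u = r2*b & length v = m" and m: "m > 0"
  and x0: "x0 \<in> words j'"
  and K: "K > 0" "!!x. (\<Sum>v\<in>bv rr x. pr (x @ v)) <= K*2 powr (- ka*length x)" and k: "ka > 0"
  and g: "!!u v i. (u, v) \<in> Y ==> 0 < i ==> i <= r2 ==>
    g (x0 @ u @ v) >= g (x0 @ take (i*b) u) + rr*length (x0 @ take (i*b) u)"
 shows "{om \<in> space P. \<not> (\<exists>(u, v)\<in>Y. p (x0 @ u @ v) om & (\<forall>i. 0 < i & i <= r2 --> \<not> bad rr om (x0 @ take (i*b) u)))} \<in> sets P"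
  "prob {om \<in> space P. \<not> (\<exists>(u, v)\<in>Y. p (x0 @ u @ v) om & (\<forall>i. 0 < i & i <= r2 --> \<not> bad rr om (x0 @ take (i*b) u)))}
   <= exp (- (card Y*2 powr (- c*real (j' + r2*b + m))))
    + card Y*2 powr (- c*real (j' + r2*b + m))*(r2*(K*2 powr (- ka*real j')))"
proof -
 define L where "L = j' + r2*b + m"
 define z where "z = (%(u, v). x0 @ u @ v)"
 define x where "x = (%(u, v :: 'n word) i. x0 @ take (i*b) u)"
 have lx: "length (x y i) >= j'" for y i using x0 by (simp add: x_def words_def case_prod_unfold)
 have zL: "z y \<in> words L" if "y \<in> Y" for y
  using Y(2)[of "fst y" "snd y"] x0 that by (simp add: z_def words_def L_def case_prod_unfold)
 have zne: "z y ~= []" if "y \<in> Y" for y using zL[OF that] m by (auto simp: words_def L_def)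
 have inj: "inj_on z Y"
 proof (rule inj_onI)
  fix y y' assume "y \<in> Y" "y' \<in> Y" "z y = z y'"
  thus "y = y'" using Y(2)[of "fst y" "snd y"] Y(2)[of "fst y'" "snd y'"]
   by (simp add: z_def case_prod_unfold prod_eq_iff)
 qed
 define Ev where "Ev = {om \<in> space P. \<not> (\<exists>(u, v)\<in>Y. p (x0 @ u @ v) om & (\<forall>i. 0 < i & i <= r2 --> \<not> bad rr om (x0 @ take (i*b) u)))}"
 define Ev0 where "Ev0 = {om \<in> space P. \<forall>w\<in>z ` Y. \<not> p w om}"
 define Pr where "Pr y i v = {om \<in> space P. \<forall>w\<in>{z y, x y i @ v}. p w om}" for y i v
 have Ev_eq: "Ev = {om \<in> space P. \<forall>y\<in>Y. om \<in> A (z y) --> (\<exists>i\<in>{0<..r2}. om \<in> {om \<in> space P. bad rr om (x y i)})}"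
 proof (intro set_eqI iffI)
  fix om assume w: "om \<in> Ev"
  show "om \<in> {om \<in> space P. \<forall>y\<in>Y. om \<in> A (z y) --> (\<exists>i\<in>{0<..r2}. om \<in> {om \<in> space P. bad rr om (x y i)})}"
  proof (intro CollectI conjI ballI impI)
   show ws: "om \<in> space P" using w by (simp add: Ev_def)
   fix y assume y: "y \<in> Y" "om \<in> A (z y)"
   obtain u v where uv: "y = (u, v)" by (cases y)
   have "\<not> (p (x0 @ u @ v) om & (\<forall>i. 0 < i & i <= r2 --> \<not> bad rr om (x0 @ take (i*b) u)))"
    using w y(1) unfolding Ev_def uv by blast
   then obtain i where "0 < i" "i <= r2" "bad rr om (x0 @ take (i*b) u)" using y(2) by (auto simp: z_def uv)
   thus "\<exists>i\<in>{0<..r2}. om \<in> {om \<in> space P. bad rr om (x y i)}" using ws by (intro bexI[of _ i]) (auto simp: x_def uv)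
  qed
 next
  fix om assume w: "om \<in> {om \<in> space P. \<forall>y\<in>Y. om \<in> A (z y) --> (\<exists>i\<in>{0<..r2}. om \<in> {om \<in> space P. bad rr om (x y i)})}"
  show "om \<in> Ev" unfolding Ev_def
  proof (intro CollectI conjI notI)
   show "om \<in> space P" using w by simp
   assume "\<exists>(u, v)\<in>Y. p (x0 @ u @ v) om & (\<forall>i. 0 < i & i <= r2 --> \<not> bad rr om (x0 @ take (i*b) u))"
   then obtain u v where uv: "(u, v) \<in> Y" "p (x0 @ u @ v) om" "!!i. 0 < i ==> i <= r2 ==> \<not> bad rr om (x0 @ take (i*b) u)" by blast
   have "om \<in> A (z (u, v))" using w uv(2) by (simp add: z_def)
   then obtain i where "i \<in> {0<..r2}" "bad rr om (x (u, v) i)" using w uv(1) by blast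
   thus False using uv(3)[of i] by (simp add: x_def)
  qed
 qed
 have "Ev \<in> sets P" unfolding Ev_eq
  by (intro sets.sets_Collect_finite_All sets.sets_Collect_imp sets.sets_Collect_finite_Ex Y(1)) (auto simp: bad_sets A_sets zne)
 thus "{om \<in> space P. \<not> (\<exists>(u, v)\<in>Y. p (x0 @ u @ v) om & (\<forall>i. 0 < i & i <= r2 --> \<not> bad rr om (x0 @ take (i*b) u)))} \<in> sets P"
  unfolding Ev_def .
 have bne: "x y i @ v ~= []" if "v \<in> bv rr (x y i)" for y i v using that by (auto simp: bv_def)
 have Ps: "Pr y i v \<in> sets P" if "y \<in> Y" "v \<in> bv rr (x y i)" for y i v
  unfolding Pr_def by (rule prob_all(1)) (use zne[OF that(1)] bne[OF that(2)] in auto)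
 have Pp: "prob (Pr y i v) = pr (z y)*pr (x y i @ v)" if y: "y \<in> Y" and i: "0 < i" "i <= r2" and v: "v \<in> bv rr (x y i)" for y i v
 proof -
  have "g (x y i @ v) < g (z y)"
   using g[of "fst y" "snd y" i] y i v by (simp add: bv_def z_def x_def case_prod_unfold)
  hence ne: "z y ~= x y i @ v" by auto
  have "prob (Pr y i v) = (\<Prod>w\<in>{z y, x y i @ v}. pr w)"
   unfolding Pr_def by (rule prob_all(2)) (use zne[OF y] bne[OF v] in auto)
  thus ?thesis using ne by simp
 qed
 have sub: "Ev \<subseteq> Ev0 \<union> (\<Union>y\<in>Y. \<Union>i\<in>{0<..r2}. \<Union>v\<in>bv rr (x y i). Pr y i v)"
 proof
  fix om assume w: "om \<in> Ev"
  hence ws: "om \<in> space P" by (simp add: Ev_def)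
  show "om \<in> Ev0 \<union> (\<Union>y\<in>Y. \<Union>i\<in>{0<..r2}. \<Union>v\<in>bv rr (x y i). Pr y i v)"
  proof (cases "om \<in> Ev0")
   case False
   then obtain y where y: "y \<in> Y" "p (z y) om" using ws by (auto simp: Ev0_def)
   then obtain i where i: "i \<in> {0<..r2}" "bad rr om (x y i)" using w ws unfolding Ev_eq by blast
   then obtain v where v: "v \<in> bv rr (x y i)" "p (x y i @ v) om" by (auto simp: bad_def bv_def)
   have "om \<in> Pr y i v" using ws y v by (simp add: Pr_def)
   thus ?thesis using y i v by blast
  qed simp
 qed
 have E0: "Ev0 \<in> sets P" "prob Ev0 <= exp (- (card Y*2 powr (- c*L)))"
 proof -
  have s: "z ` Y \<subseteq> words L" using zL by blast
  have L0: "L > 0" using m by (simp add: L_def)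
  show "Ev0 \<in> sets P" unfolding Ev0_def by (rule prob_none(1)[OF s L0])
  show "prob Ev0 <= exp (- (card Y*2 powr (- c*L)))"
   using prob_none(2)[OF s L0] by (simp add: Ev0_def card_image[OF inj])
 qed
 have fi: "finite (bv rr (x y i))" for y i by (rule finite_bv)
 have U3: "(\<Union>v\<in>bv rr (x y i). Pr y i v) \<in> sets P" if "y \<in> Y" for y i
  by (intro sets.finite_UN fi Ps that)
 have U2: "(\<Union>i\<in>{0<..r2}. \<Union>v\<in>bv rr (x y i). Pr y i v) \<in> sets P" if "y \<in> Y" for y
  by (intro sets.finite_UN U3 that) auto
 have U1: "(\<Union>y\<in>Y. \<Union>i\<in>{0<..r2}. \<Union>v\<in>bv rr (x y i). Pr y i v) \<in> sets P"
  by (intro sets.finite_UN U2 Y(1))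
 have "prob Ev <= prob (Ev0 \<union> (\<Union>y\<in>Y. \<Union>i\<in>{0<..r2}. \<Union>v\<in>bv rr (x y i). Pr y i v))"
  by (intro finite_measure_mono sub sets.Un E0 U1)
 also have "... <= prob Ev0 + prob (\<Union>y\<in>Y. \<Union>i\<in>{0<..r2}. \<Union>v\<in>bv rr (x y i). Pr y i v)"
  by (intro measure_Un_le E0 U1)
 also have "prob (\<Union>y\<in>Y. \<Union>i\<in>{0<..r2}. \<Union>v\<in>bv rr (x y i). Pr y i v)
   <= (\<Sum>y\<in>Y. prob (\<Union>i\<in>{0<..r2}. \<Union>v\<in>bv rr (x y i). Pr y i v))"
  using U2 by (intro finite_measure_subadditive_finite Y(1)) auto
 also have "... <= (\<Sum>y\<in>Y. 2 powr (- c*L)*(r2*(K*2 powr (- ka*real j'))))"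
 proof (rule sum_mono)
  fix y assume y: "y \<in> Y"
  have "prob (\<Union>i\<in>{0<..r2}. \<Union>v\<in>bv rr (x y i). Pr y i v) <= (\<Sum>i\<in>{0<..r2}. prob (\<Union>v\<in>bv rr (x y i). Pr y i v))"
   using U3[OF y] by (intro finite_measure_subadditive_finite) auto
  also have "... <= (\<Sum>i\<in>{0<..r2}. 2 powr (- c*L)*(K*2 powr (- ka*real j')))"
  proof (rule sum_mono)
   fix i assume i: "i \<in> {0<..r2}"
   have "prob (\<Union>v\<in>bv rr (x y i). Pr y i v) <= (\<Sum>v\<in>bv rr (x y i). prob (Pr y i v))"
    using Ps[OF y] by (intro finite_measure_subadditive_finite fi) auto
   also have "... = (\<Sum>v\<in>bv rr (x y i). pr (z y)*pr (x y i @ v))"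
    using i by (intro sum.cong refl Pp y) auto
   also have "... = pr (z y)*(\<Sum>v\<in>bv rr (x y i). pr (x y i @ v))" by (simp add: sum_distrib_left)
   also have "... <= pr (z y)*(K*2 powr (- ka*length (x y i)))"
    by (intro mult_left_mono K) (simp add: less_imp_le pr_bounds)
   also have "... <= pr (z y)*(K*2 powr (- ka*real j'))"
   proof -
    have "real j' <= real (length (x y i))" using lx[of y i] by (simp only: of_nat_le_iff)
    hence "ka*real j' <= ka*real (length (x y i))" using k by (intro mult_left_mono) auto
    hence "2 powr (- ka*length (x y i)) <= 2 powr (- ka*real j')" by (intro powr_mono) auto
    hence "K*2 powr (- ka*length (x y i)) <= K*2 powr (- ka*real j')" using K(1) by (intro mult_left_mono) auto
    thus ?thesis by (rule mult_left_mono) (simp add: less_imp_le pr_bounds)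
   qed
   also have "pr (z y) = 2 powr (- c*L)" using zL[OF y] by (simp add: pr_def words_def)
   finally show "prob (\<Union>v\<in>bv rr (x y i). Pr y i v) <= 2 powr (- c*L)*(K*2 powr (- ka*real j'))" .
  qed
  also have "... = 2 powr (- c*L)*(r2*(K*2 powr (- ka*real j')))" by simp
  finally show "prob (\<Union>i\<in>{0<..r2}. \<Union>v\<in>bv rr (x y i). Pr y i v) <= 2 powr (- c*L)*(r2*(K*2 powr (- ka*real j')))" .
 qed
 also have "... = card Y*2 powr (- c*L)*(r2*(K*2 powr (- ka*real j')))" by simp
 finally show "prob {om \<in> space P. \<not> (\<exists>(u, v)\<in>Y. p (x0 @ u @ v) om & (\<forall>i. 0 < i & i <= r2 --> \<not> bad rr om (x0 @ take (i*b) u)))}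
   <= exp (- (card Y*2 powr (- c*real (j' + r2*b + m))))
    + card Y*2 powr (- c*real (j' + r2*b + m))*(r2*(K*2 powr (- ka*real j')))"
  using E0(2) unfolding Ev_def L_def by linarith
qed

section \<open>One step of the construction\<close>

text \<open>The length \<open>J\<close> is common to all words of length \<open>l\<close>. The
  children follow the exponent \<open>h\<close>, have cost about \<open>\<rho>*J\<close> at their
  end and at least about \<open>\<rho>\<close> per letter at the checkpoints \<open>k0\<close>;
  right after \<open>l\<close> there is no checkpoint, since the counts of bad words need
  \<open>ze*l\<close> new letters. The last clause is a Frostman bound of dimension \<open>s\<close>
  inside the step.\<close>

definition step :: "'w => real => real => real => real => nat => bool" where
 "step om h \<rho> ze s l \<longleftrightarrow> (\<exists>J\<ge>2*l. l < J & (\<forall>w\<in>words l. \<exists>Ch. Ch \<subseteq> words J & Ch ~= {} \<and>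
   (\<forall>y\<in>Ch. (\<exists>z. y = w @ ltr0 # ltr1 # z)
    & (\<forall>k. l <= k & k <= J --> \<bar>g (take k y) - g w - (real k - real l)*h\<bar> <= ze*k)
    & (\<forall>k. (1 + 2*ze)*l <= k & k <= J --> (\<exists>k0\<le>k. (1 - ze)*k <= k0 & \<not> bad (\<rho> - ze) om (take k0 y)))
    & \<not> bad (\<rho> - ze) om y
    & (\<exists>v. v ~= [] & p (y @ v) om & g (y @ v) <= g y + J*(\<rho> + ze))) \<and>
   (\<forall>k v. l < k & k <= J & v \<in> words k -->
    real (card {y \<in> Ch. take k y = v}) <= real (card Ch)*2 powr (- s*(real k - real l) + ze*l))))"

lemma sum_inverse_squares:
 assumes "l > 0"
 shows "(\<Sum>i\<in>{1..r}. 1/(real (l + i))\<^sup>2) <= 1/real l"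
proof -
 have "(\<Sum>i\<in>{1..r}. 1/(real (l + i))\<^sup>2) <= 1/real l - 1/real (l + r)"
 proof (induction r)
  case (Suc r)
  have p: "real (l + r) > 0" "real (l + Suc r) > 0" using assms by auto
  have "1/(real (l + Suc r))\<^sup>2 <= 1/(real (l + r)*real (l + Suc r))"
   unfolding power2_eq_square using p by (intro divide_left_mono mult_right_mono mult_pos_pos) auto
  also have "... = 1/real (l + r) - 1/real (l + Suc r)"
  proof -
   have "real (l + Suc r) - real (l + r) = 1" by simp
   thus ?thesis using p diff_divide_eq_iff[of "real (l + r)" "real (l + Suc r)" 1] by (simp add: diff_frac_eq)
  qed
  finally have "1/(real (l + Suc r))\<^sup>2 <= 1/real (l + r) - 1/real (l + Suc r)" .
  moreover have "(\<Sum>i\<in>{1..Suc r}. 1/(real (l + i))\<^sup>2) = (\<Sum>i\<in>{1..r}. 1/(real (l + i))\<^sup>2) + 1/(real (l + Suc r))\<^sup>2"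
   by (subst sum.cl_ivl_Suc) simp
  ultimately show ?case using Suc by linarith
 qed simp
 moreover have "1/real (l + r) >= 0" by simp
 ultimately show ?thesis by linarith
qed

text \<open>The first \<open>r1\<close> blocks are free and carry all the branching; the last
  \<open>r2\<close> blocks are a function \<open>U\<close> of them, chosen to prepare a cheap
  survivor. Since \<open>s*(r1 + r2) <= a*r1\<close>, the loss of freedom on the second part still
  leaves dimension \<open>s\<close>.\<close>

lemma step_det:
 fixes a e h s ze \<rho> :: real and l r1 r2 b :: nat
 assumes B: "B \<subseteq> words b" "b > 0" "!!u. u \<in> B ==> \<exists>z. u = ltr0 # ltr1 # z"
   "!!u. u \<in> B ==> \<bar>g u - b*h\<bar> <= e*b" "c0 <= e*b" "real (card B) >= 2 powr (b*a)"
  and z: "0 < ze" "0 <= e" "4*e <= ze" and h: "0 <= h" "h <= G"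
  and s: "0 <= s" "s <= a" "s*real (r1 + r2) <= a*r1"
  and l: "3*c0 + 2*G*b + c0 <= ze/2*l" "1 + a*b <= ze*l" "b <= ze*l" "l >= 4"
   "l <= (r1 + r2)*b" "ze*l <= real (r1*b)" and r: "r1 > 0"
  and few: "!!i w. ze*real l <= real (i*b) ==> w \<in> words l ==>
    (real (l + i*b))\<^sup>2*real (card {t \<in> pw B i. bad (\<rho> - ze) om (w @ t)}) <= real (card B ^ i)"
  and spec: "!!w. w \<in> words l ==> 4*card {t \<in> pw B r1. \<not> sp w t} <= card B ^ r1"
  and sp: "!!w t. w \<in> words l ==> t \<in> pw B r1 ==> sp w t ==> \<exists>u\<in>pw B r2. \<exists>v. v ~= [] & p (w @ t @ u @ v) om
    & g (w @ t @ u @ v) <= g (w @ t @ u) + real (l + (r1 + r2)*b)*(\<rho> + ze)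
    & (\<forall>i. 0 < i & i <= r2 --> \<not> bad (\<rho> - ze) om (w @ t @ take (i*b) u))"
 shows "step om h \<rho> ze s l"
proof -
 define J where "J = l + (r1 + r2)*b"
 have fB: "finite B" using B(1) finite_words finite_subset by blast
 define n where "n = card B ^ r1"
 have cB: "card B > 0"
 proof -
  have "0 < 2 powr (b*a)" by simp
  hence "real (card B) > 0" using B(6) by linarith
  thus ?thesis by simp
 qed
 have n0: "n > 0" using cB by (simp add: n_def)
 have cpw: "card (pw B i) = card B ^ i" for i by (rule card_pw[OF B(1)])
 have "\<exists>Ch. Ch \<subseteq> words J & Ch ~= {} \<and>
   (\<forall>y\<in>Ch. (\<exists>z. y = w @ ltr0 # ltr1 # z)
    & (\<forall>k. l <= k & k <= J --> \<bar>g (take k y) - g w - (real k - real l)*h\<bar> <= ze*k)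
    & (\<forall>k. (1 + 2*ze)*l <= k & k <= J --> (\<exists>k0\<le>k. (1 - ze)*k <= k0 & \<not> bad (\<rho> - ze) om (take k0 y)))
    & \<not> bad (\<rho> - ze) om y
    & (\<exists>v. v ~= [] & p (y @ v) om & g (y @ v) <= g y + J*(\<rho> + ze))) \<and>
   (\<forall>k v. l < k & k <= J & v \<in> words k -->
    real (card {y \<in> Ch. take k y = v}) <= real (card Ch)*2 powr (- s*(real k - real l) + ze*l))"
  if w: "w \<in> words l" for w
 proof -
  \<comment> \<open>Checkpoints among the free blocks that are far enough from \<open>w\<close> for
    \<open>few\<close> to apply.\<close>
  define I where "I = {i \<in> {1..r1}. ze*real l <= real (i*b)}"
  define Bd where "Bd i = {t \<in> pw B r1. bad (\<rho> - ze) om (w @ take (i*b) t)}" for i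
  define Tg where "Tg = {t \<in> pw B r1. sp w t & (\<forall>i\<in>I. \<not> bad (\<rho> - ze) om (w @ take (i*b) t))}"
  have fpw: "finite (pw B r1)" by (rule finite_pw[OF fB])
  have lw: "length w = l" using w by (simp add: words_def)
  have cBd: "real (card (Bd i)) <= n*(1/(real (l + i))\<^sup>2)" if i: "i \<in> I" for i
  proof -
   define X where "X = {t \<in> pw B i. bad (\<rho> - ze) om (w @ t)}"
   have ir: "r1 = i + (r1 - i)" using i by (simp add: I_def)
   have "Bd i \<subseteq> {t \<in> pw B (i + (r1 - i)). take (i*b) t \<in> X}"
   proof
    fix t assume t: "t \<in> Bd i"
    hence t1: "t \<in> pw B (i + (r1 - i))" using ir by (simp add: Bd_def)
    thus "t \<in> {t \<in> pw B (i + (r1 - i)). take (i*b) t \<in> X}" using t pw_split[OF B(1) t1] by (simp add: X_def Bd_def)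
   qed
   hence "card (Bd i) <= card {t \<in> pw B (i + (r1 - i)). take (i*b) t \<in> X}"
    by (intro card_mono) (auto intro: finite_subset[OF _ finite_pw[OF fB]])
   also have "... <= card X*card B ^ (r1 - i)" by (rule card_pw_prefix[OF B(1) fB]) (auto simp: X_def)
   finally have "real (card (Bd i)) <= real (card X)*real (card B ^ (r1 - i))" by (metis of_nat_le_iff of_nat_mult)
   hence "(real (l + i*b))\<^sup>2*real (card (Bd i)) <= (real (l + i*b))\<^sup>2*real (card X)*real (card B ^ (r1 - i))"
    by (simp add: mult.assoc mult_left_mono)
   also have "... <= real (card B ^ i)*real (card B ^ (r1 - i))"
    using few[OF _ w, of i] i by (intro mult_right_mono) (auto simp: X_def I_def)
   also have "... = n" using ir unfolding n_def by (metis of_nat_mult power_add)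
   finally have 1: "(real (l + i*b))\<^sup>2*real (card (Bd i)) <= n" .
   have "l + i <= l + i*b" using B(2) by simp
   hence "real (l + i) <= real (l + i*b)" by (simp only: of_nat_le_iff)
   hence "(real (l + i))\<^sup>2 <= (real (l + i*b))\<^sup>2" by (rule power_mono) simp
   hence "(real (l + i))\<^sup>2*real (card (Bd i)) <= n" using 1 by (meson mult_right_mono of_nat_0_le_iff order.trans)
   moreover have "(real (l + i))\<^sup>2 > 0" using l(4) by simp
   ultimately show ?thesis by (simp add: pos_le_divide_eq mult.commute)
  qed
  \<comment> \<open>A quarter of the choices may lack a suitable continuation, and the bad
    checkpoints remove at most a proportion \<open>1/l <= 1/4\<close>; half remain.\<close>
  have cT: "real n/2 <= card Tg"
  proof -
   have "pw B r1 \<subseteq> Tg \<union> ({t \<in> pw B r1. \<not> sp w t} \<union> (\<Union>i\<in>I. Bd i))" by (auto simp: Tg_def Bd_def)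
   hence "n <= card (Tg \<union> ({t \<in> pw B r1. \<not> sp w t} \<union> (\<Union>i\<in>I. Bd i)))"
    unfolding n_def cpw[symmetric] using fpw by (intro card_mono) (auto simp: Tg_def Bd_def I_def)
   also have "... <= card Tg + (card {t \<in> pw B r1. \<not> sp w t} + card (\<Union>i\<in>I. Bd i))"
    by (rule order_trans[OF card_Un_le add_left_mono[OF card_Un_le]])
   also have "... <= card Tg + (card {t \<in> pw B r1. \<not> sp w t} + (\<Sum>i\<in>I. card (Bd i)))"
    by (intro add_left_mono card_UN_le) (simp add: I_def)
   finally have "n <= card Tg + (card {t \<in> pw B r1. \<not> sp w t} + (\<Sum>i\<in>I. card (Bd i)))" .
   hence "real n <= real (card Tg + (card {t \<in> pw B r1. \<not> sp w t} + (\<Sum>i\<in>I. card (Bd i))))" by (simp only: of_nat_le_iff)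
   hence "real n <= real (card Tg) + real (card {t \<in> pw B r1. \<not> sp w t}) + (\<Sum>i\<in>I. real (card (Bd i)))"
    by (simp only: of_nat_add of_nat_sum add.assoc)
   moreover have "4*real (card {t \<in> pw B r1. \<not> sp w t}) <= n"
   proof -
    have "real (4*card {t \<in> pw B r1. \<not> sp w t}) <= real (card B ^ r1)" using spec[OF w] by (simp only: of_nat_le_iff)
    thus ?thesis unfolding n_def by simp
   qed
   moreover have "(\<Sum>i\<in>I. real (card (Bd i))) <= n/4"
   proof -
    have "(\<Sum>i\<in>I. real (card (Bd i))) <= (\<Sum>i\<in>I. n*(1/(real (l + i))\<^sup>2))" by (intro sum_mono cBd)
    also have "... <= (\<Sum>i\<in>{1..r1}. n*(1/(real (l + i))\<^sup>2))" by (intro sum_mono2) (auto simp: I_def)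
    also have "... = n*(\<Sum>i\<in>{1..r1}. 1/(real (l + i))\<^sup>2)" by (simp add: sum_distrib_left)
    also have "... <= n*(1/real l)" using l(4) by (intro mult_left_mono sum_inverse_squares) auto
    also have "... <= n*(1/4)" using l(4) by (intro mult_left_mono divide_left_mono) auto
    finally show ?thesis by simp
   qed
   ultimately show ?thesis by linarith
  qed
  have "\<forall>t\<in>Tg. \<exists>u. u \<in> pw B r2 & (\<exists>v. v ~= [] & p (w @ t @ u @ v) om
    & g (w @ t @ u @ v) <= g (w @ t @ u) + real J*(\<rho> + ze))
    & (\<forall>i. 0 < i & i <= r2 --> \<not> bad (\<rho> - ze) om (w @ t @ take (i*b) u))"
  proof
   fix t assume "t \<in> Tg"
   hence t: "t \<in> pw B r1" "sp w t" by (auto simp: Tg_def)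
   show "\<exists>u. u \<in> pw B r2 & (\<exists>v. v ~= [] & p (w @ t @ u @ v) om
    & g (w @ t @ u @ v) <= g (w @ t @ u) + real J*(\<rho> + ze))
    & (\<forall>i. 0 < i & i <= r2 --> \<not> bad (\<rho> - ze) om (w @ t @ take (i*b) u))"
    using sp[OF w t] unfolding J_def by blast
  qed
  then obtain U where U: "!!t. t \<in> Tg ==> U t \<in> pw B r2"
   "!!t. t \<in> Tg ==> \<exists>v. v ~= [] & p (w @ t @ U t @ v) om & g (w @ t @ U t @ v) <= g (w @ t @ U t) + real J*(\<rho> + ze)"
   "!!t i. t \<in> Tg ==> 0 < i ==> i <= r2 ==> \<not> bad (\<rho> - ze) om (w @ t @ take (i*b) (U t))"
   by metis
  define f where "f t = w @ t @ U t" for t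
  have Tpw: "t \<in> Tg ==> t \<in> pw B r1" for t by (simp add: Tg_def)
  have lt: "t \<in> Tg ==> length t = r1*b" for t using pw_length[OF B(1) Tpw] .
  have lU: "t \<in> Tg ==> length (U t) = r2*b" for t using pw_length[OF B(1) U(1)] .
  have lf: "t \<in> Tg ==> length (f t) = J" for t using lt lU lw by (simp add: f_def J_def algebra_simps)
  have tf: "t \<in> Tg ==> take (r1*b) (drop l (f t)) = t" for t using lt lw by (simp add: f_def)
  have inj: "inj_on f Tg" by (rule inj_onI) (metis tf)
  have fT: "finite Tg" using fpw by (simp add: Tg_def)
  have nbad: "\<not> bad (\<rho> - ze) om (take (l + i*b) (f t))" if t: "t \<in> Tg" and i: "0 < i" "i <= r1 + r2" "ze*real l <= real (i*b)" for t i
  proof (cases "i <= r1")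
   case True
   have "i*b <= r1*b" using True by simp
   hence "take (l + i*b) (f t) = w @ take (i*b) t" using lt[OF t] lw by (simp add: f_def)
   moreover have "i \<in> I" using True i by (simp add: I_def)
   ultimately show ?thesis using t by (simp add: Tg_def)
  next
   case False
   define i' where "i' = i - r1"
   have i': "i = r1 + i'" "0 < i'" "i' <= r2" using False i by (auto simp: i'_def)
   have "take (l + i*b) (f t) = w @ t @ take (i'*b) (U t)" using lt[OF t] lw unfolding i'(1) by (simp add: f_def distrib_right)
   thus ?thesis using U(3)[OF t i'(2,3)] by simp
  qed
  have path: "\<bar>g (take k (f t)) - g w - (real k - real l)*h\<bar> <= ze*k" if t: "t \<in> Tg" and k: "l <= k" "k <= J" for t k
  proof -
   have "t @ U t \<in> pw B (r1 + r2)" using pw_append[OF Tpw[OF t] U(1)[OF t]] .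
   moreover have "k - l <= (r1 + r2)*b" using k by (simp add: J_def)
   ultimately have "\<bar>g (take (k - l) (t @ U t)) - real (k - l)*h\<bar> <= 2*e*real (k - l) + (3*c0 + 2*G*b)"
    by (intro pw_path_prefix[OF B(1,4,5,2) z(2) h])
   moreover have "take k (f t) = w @ take (k - l) (t @ U t)" using k lw by (simp add: f_def)
   moreover have "real (k - l) = real k - real l" using k by simp
   moreover have "2*e*(real k - real l) <= ze/2*(real k - real l)" using z k by (intro mult_right_mono) auto
   moreover have "ze/2*(real k - real l) + ze/2*l = ze/2*k" unfolding distrib_left[symmetric] by simp
   moreover have "ze/2*k <= ze*k" using z by (intro mult_right_mono) auto
   ultimately show ?thesis using qa[of w "take (k - l) (t @ U t)"] l(1) by (simp only:; linarith)
  qed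
  have start: "\<exists>z. f t = w @ ltr0 # ltr1 # z" if t: "t \<in> Tg" for t
  proof -
   have "t \<in> pw B (1 + (r1 - 1))" using Tpw[OF t] r by simp
   hence "take (1*b) t \<in> pw B 1" using pw_split[OF B(1)] by blast
   hence "take b t \<in> B" by auto
   then obtain z where "take b t = ltr0 # ltr1 # z" using B(3) by blast
   hence "f t = w @ ltr0 # ltr1 # (z @ drop b t @ U t)" unfolding f_def by (metis append_Cons append_assoc append_take_drop_id)
   thus ?thesis by blast
  qed
  have chk: "\<exists>k0\<le>k. (1 - ze)*k <= k0 & \<not> bad (\<rho> - ze) om (take k0 (f t))"
   if t: "t \<in> Tg" and k: "(1 + 2*ze)*l <= k" "k <= J" for t k
  proof -
   \<comment> \<open>\<open>l + i*b\<close> is the last block end up to \<open>k\<close>. It is a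
     checkpoint because \<open>k\<close> is beyond \<open>(1 + 2*ze)*l\<close>, and it lags by less
     than one block, at most \<open>ze*l\<close>.\<close>
   define i where "i = (k - l) div b"
   have "real l*1 <= real l*(1 + 2*ze)" using z by (intro mult_left_mono) auto
   hence "real l <= real k" using k(1) by (simp add: mult.commute)
   hence lk: "l <= k" by simp
   have ib: "i*b <= k - l" "k - l < i*b + b" using B(2) dividend_less_div_times[of b "k - l"] by (simp_all add: i_def)
   have "real (k - l) < real (i*b) + b" using ib(2) by (metis of_nat_add of_nat_less_iff)
   hence ib': "real k - real l < real (i*b) + b" using lk by simp
   hence zi: "ze*l <= real (i*b)" using k(1) l(3) by (simp add: algebra_simps)
   have "0 < ze*l" using z l(4) by simp
   hence "0 < real (i*b)" using zi by linarith
   hence i0: "0 < i" by (cases i) auto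
   have "i*b <= (r1 + r2)*b" using ib(1) k(2) unfolding J_def by linarith
   hence ir: "i <= r1 + r2" using B(2) by simp
   have "\<not> bad (\<rho> - ze) om (take (l + i*b) (f t))" by (rule nbad[OF t i0 ir zi])
   moreover have "l + i*b <= k" using ib lk by simp
   moreover have "(1 - ze)*k <= real (l + i*b)"
   proof -
    have "ze*l <= ze*k" using z lk by (intro mult_left_mono) auto
    thus ?thesis using ib' l(3) by (simp add: algebra_simps)
   qed
   ultimately show ?thesis by blast
  qed
  have fin: "\<not> bad (\<rho> - ze) om (f t)" if t: "t \<in> Tg" for t
  proof -
   have "r1*b <= (r1 + r2)*b" by simp
   hence "real (r1*b) <= real ((r1 + r2)*b)" by (simp only: of_nat_le_iff)
   hence "ze*l <= real ((r1 + r2)*b)" using l(6) by linarith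
   hence "\<not> bad (\<rho> - ze) om (take (l + (r1 + r2)*b) (f t))" using r by (intro nbad[OF t]) auto
   thus ?thesis using lf[OF t] by (simp add: J_def)
  qed
  \<comment> \<open>A prefix of length \<open>k\<close> fixes the first \<open>i\<close> free blocks
    and leaves at most \<open>card B ^ (r1 - i)\<close> children. Beyond the free part the count is
    at most one, and the inequality between \<open>s*(r1 + r2)\<close> and \<open>a*r1\<close> takes
    over.\<close>
  have frost: "real (card {y \<in> f ` Tg. take k y = v}) <= real (card (f ` Tg))*2 powr (- s*(real k - real l) + ze*l)"
   if k: "l < k" "k <= J" for k v
  proof -
   define i where "i = min ((k - l) div b) r1"
   define x where "x = take (i*b) (drop l v)"
   have ib: "i*b <= k - l"
   proof -
    have "i*b <= (k - l) div b*b" by (simp add: i_def)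
    also have "... <= k - l" by (rule div_times_less_eq_dividend)
    finally show ?thesis .
   qed
   have ir: "r1 = i + (r1 - i)" by (simp add: i_def)
   have "{y \<in> f ` Tg. take k y = v} \<subseteq> f ` {t \<in> pw B r1. take (i*b) t \<in> {x} \<inter> pw B i}"
   proof
    fix y assume "y \<in> {y \<in> f ` Tg. take k y = v}"
    then obtain t where t: "t \<in> Tg" "y = f t" "take k (f t) = v" by blast
    have "drop l v = take (k - l) (t @ U t)" using t(3) lw k by (auto simp: f_def drop_take)
    hence "x = take (i*b) (t @ U t)" unfolding x_def using ib by (simp only: take_take min_absorb1)
    moreover have "i*b <= r1*b" by (simp add: i_def)
    ultimately have xt: "x = take (i*b) t" using lt[OF t(1)] by simp
    have "t \<in> pw B (i + (r1 - i))" using Tpw[OF t(1)] ir by simp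
    hence "take (i*b) t \<in> pw B i" using pw_split[OF B(1)] by blast
    thus "y \<in> f ` {t \<in> pw B r1. take (i*b) t \<in> {x} \<inter> pw B i}" using t(2) xt Tpw[OF t(1)] by blast
   qed
   hence "card {y \<in> f ` Tg. take k y = v} <= card (f ` {t \<in> pw B r1. take (i*b) t \<in> {x} \<inter> pw B i})"
    using fpw by (intro card_mono) auto
   also have "... <= card {t \<in> pw B r1. take (i*b) t \<in> {x} \<inter> pw B i}" using fpw by (intro card_image_le) auto
   also have "... <= card ({x} \<inter> pw B i)*card B ^ (r1 - i)"
    using card_pw_prefix[OF B(1) fB, of "{x} \<inter> pw B i" i "r1 - i"] ir by simp
   also have "... <= 1*card B ^ (r1 - i)"
   proof (rule mult_right_mono)
    have "card ({x} \<inter> pw B i) <= card {x}" by (rule card_mono) auto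
    thus "card ({x} \<inter> pw B i) <= 1" by simp
   qed simp
   finally have "real (card {y \<in> f ` Tg. take k y = v}) <= real (card B ^ (r1 - i))" by simp
   also have "real (card B ^ (r1 - i)) = n/real (card B) ^ i"
   proof -
    have "real n = real (card B) ^ i*real (card B) ^ (r1 - i)" using ir unfolding n_def by (metis of_nat_power power_add)
    thus ?thesis using cB by simp
   qed
   also have "... <= n/2 powr (a*(i*b))"
   proof -
    have "2 powr (a*(i*b)) = (2 powr (b*a)) ^ i" by (simp add: powr_power mult_ac)
    also have "... <= real (card B) ^ i" using B(6) by (intro power_mono) auto
    finally show ?thesis using cB by (intro divide_left_mono) auto
   qed
   also have "... = (real n/2)*2 powr (1 - a*(i*b))" by (simp add: powr_diff)
   also have "... <= card Tg*2 powr (1 - a*(i*b))" by (intro mult_right_mono cT) auto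
   also have "... <= card Tg*2 powr (- s*(real k - real l) + ze*l)"
   proof (intro mult_left_mono powr_mono)
    show "1 - a*(i*b) <= - s*(real k - real l) + ze*l"
    proof (cases "(k - l) div b < r1")
     case True
     hence i: "i = (k - l) div b" by (simp add: i_def)
     have "k - l < i*b + b" using B(2) dividend_less_div_times[of b "k - l"] by (simp add: i)
     hence "real (k - l) < real (i*b) + b" by (metis of_nat_add of_nat_less_iff)
     hence "real k - real l <= real (i*b) + b" using k by simp
     hence "s*(real k - real l) <= s*(real (i*b) + b)" using s by (intro mult_left_mono) auto
     also have "... <= a*(real (i*b) + b)" using s by (intro mult_right_mono) auto
     finally show ?thesis using l(2) by (simp add: algebra_simps)
    next
     case False
     hence i: "i = r1" by (simp add: i_def)
     have "real k <= real J" using k by simp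
     hence "real k - real l <= real (r1 + r2)*b" by (simp add: J_def)
     hence "s*(real k - real l) <= s*(real (r1 + r2)*b)" using s by (intro mult_left_mono) auto
     also have "... = s*real (r1 + r2)*b" by simp
     also have "... <= a*r1*b" using s(3) by (intro mult_right_mono) auto
     finally have "s*(real k - real l) <= a*(i*b)" by (simp add: i)
     moreover have "1 <= ze*l"
     proof -
      have "0 <= a*b" using s by simp
      thus ?thesis using l(2) by linarith
     qed
     ultimately show ?thesis by simp
    qed
   qed auto
   also have "real (card Tg) = real (card (f ` Tg))" by (simp add: card_image[OF inj])
   finally show ?thesis .
  qed
  show ?thesis
  proof (rule exI[of _ "f ` Tg"], intro conjI ballI allI impI)
   show "f ` Tg \<subseteq> words J" using lf by (auto simp: words_def)
   have "real (card Tg) > 0" using cT n0 by linarith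
   thus "f ` Tg ~= {}" by auto
  next
   fix y assume "y \<in> f ` Tg"
   then obtain t where t: "t \<in> Tg" "y = f t" by blast
   show "\<exists>z. y = w @ ltr0 # ltr1 # z" using start[OF t(1)] t(2) by simp
   show "\<not> bad (\<rho> - ze) om y" using fin[OF t(1)] t(2) by simp
   show "\<exists>v. v ~= [] & p (y @ v) om & g (y @ v) <= g y + J*(\<rho> + ze)" using U(2)[OF t(1)] t(2) by (simp add: f_def)
   show "\<bar>g (take k y) - g w - (real k - real l)*h\<bar> <= ze*k" if "l <= k & k <= J" for k
    using path[OF t(1)] that t(2) by simp
   show "\<exists>k0\<le>k. (1 - ze)*k <= k0 & \<not> bad (\<rho> - ze) om (take k0 y)" if "(1 + 2*ze)*l <= k & k <= J" for k
    using chk[OF t(1)] that t(2) by simp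
  next
   fix k and v :: "'n word" assume "l < k & k <= J & v \<in> words k"
   thus "real (card {y \<in> f ` Tg. take k y = v}) <= real (card (f ` Tg))*2 powr (- s*(real k - real l) + ze*l)"
    using frost by blast
  qed
 qed
 moreover have "J >= 2*l" "l < J" unfolding J_def using l(4,5) by linarith+
 ultimately show ?thesis unfolding step_def by blast
qed

text \<open>The entropy budget. A proportion \<open>\<theta> = s1/Dq\<close> of the blocks stays
  free and yields dimension \<open>s1 > s\<close>. The remaining blocks offer about
  \<open>2 powr ((Dq - s1)*j)\<close> words, and tails of type \<open>qt\<close> and length
  \<open>j*\<rho>/Ht\<close>, which cost \<open>\<rho>*j\<close>, contribute
  \<open>\<rho>*qt*j\<close> to the exponent beyond their own sampling penalty. Against the penalty
  \<open>c*j\<close> the surplus is \<open>\<gamma>*j > 0\<close>, so for most free parts some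
  candidate survives.\<close>

lemma AE_step:
 fixes q \<rho> ze s :: real
 assumes z: "0 < ze" "ze <= 1/4" and rho: "0 <= \<rho>" "\<rho> <= HHt" and s: "0 <= s" "s < en q + \<rho>*qt - c"
 shows "AE om in P. \<exists>l0. \<forall>l\<ge>l0. step om (T' q) \<rho> ze s l"
proof -
 define h where "h = T' q"
 define Dq where "Dq = en q"
 define v0 where "v0 = Dq + \<rho>*qt - c"
 have rq: "\<rho>*qt <= c" using mult_right_mono[OF rho(2), of qt] qt HHt_qt by simp
 define s1 where "s1 = (s + v0)/2"
 have sv: "s < v0" using s(2) by (simp add: v0_def Dq_def)
 have s1: "s < s1" "s1 < v0" "0 < s1" using s sv by (auto simp: s1_def)
 have Dq: "Dq > 0" "v0 <= Dq" using rq s1 by (auto simp: v0_def)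
 define \<theta> where "\<theta> = s1/Dq"
 have th: "0 < \<theta>" "\<theta> < 1" "\<theta>*Dq = s1" using s1 Dq by (auto simp: \<theta>_def)
 define \<gamma> where "\<gamma> = v0 - s1"
 have ga: "\<gamma> > 0" using s1 by (simp add: \<gamma>_def)
 have Ht0: "Ht > 0" unfolding Ht_def using hmin_less[of qt] hmin_pos by linarith
 define x where "x = HHt/Ht"
 have x0: "x > 0" unfolding x_def using HHt_pos Ht0 by simp
 have rx: "0 <= \<rho>/Ht" "\<rho>/Ht <= x" unfolding x_def using rho Ht0 by (auto intro!: divide_right_mono)
 define e' where "e' = min ((s1 - s)/2) (min (\<gamma>/(2*(1 + x))) (Dq/2))"
 have e': "0 < e'" "e' < Dq" "e' <= s1 - s" "e'*(1 + \<rho>/Ht) <= \<gamma>/2"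
 proof -
  show p: "0 < e'" using s1 ga x0 Dq by (simp add: e'_def)
  have a: "e' <= (s1 - s)/2" "e' <= \<gamma>/(2*(1 + x))" "e' <= Dq/2" by (simp_all only: e'_def min.cobounded1 min.coboundedI2 min.coboundedI1 order_refl)
  show "e' < Dq" using a(3) Dq by linarith
  show "e' <= s1 - s"
  proof -
   have "(s1 - s)/2 <= s1 - s" using s1(1) by simp
   thus ?thesis by (rule order_trans[OF a(1)])
  qed
  have "e'*(1 + \<rho>/Ht) <= \<gamma>/(2*(1 + x))*(1 + x)" using a(2) rx p x0 ga by (intro mult_mono) auto
  also have "... = \<gamma>/2"
  proof -
   have "1 + x ~= 0" using x0 by linarith
   thus ?thesis by (simp add: divide_simps)
  qed
  finally show "e'*(1 + \<rho>/Ht) <= \<gamma>/2" .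
 qed
 define et where "et = min (e'/(\<bar>qt\<bar> + 1)) (ze*\<theta>/(4*(1 + x)))"
 have et: "0 < et" "(\<bar>qt\<bar> + 1)*et <= e'" "et*(\<rho>/Ht) <= ze*\<theta>/4"
 proof -
  show p: "0 < et" using e' z th x0 by (simp add: et_def add_nonneg_pos)
  have a: "et <= e'/(\<bar>qt\<bar> + 1)" "et <= ze*\<theta>/(4*(1 + x))" by (simp_all only: et_def min.cobounded1 min.cobounded2)
  have qp: "\<bar>qt\<bar> + 1 > 0" by linarith
  show "(\<bar>qt\<bar> + 1)*et <= e'" using a(1) qp by (simp add: pos_le_divide_eq mult.commute)
  have "et*(\<rho>/Ht) <= ze*\<theta>/(4*(1 + x))*(1 + x)" using a(2) rx p z th x0 by (intro mult_mono) auto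
  also have "... = ze*\<theta>/4"
  proof -
   have "1 + x ~= 0" using x0 by linarith
   thus ?thesis by (simp add: divide_simps)
  qed
  finally show "et*(\<rho>/Ht) <= ze*\<theta>/4" .
 qed
 have z4: "ze/4 > 0" using z by simp
 obtain b B where B: "b > 0" "B \<subseteq> words b" "!!u. u \<in> B ==> \<exists>z. u = ltr0 # ltr1 # z"
  "!!u. u \<in> B ==> \<bar>g u - b*T' q\<bar> <= ze/4*b" "c0 <= ze/4*b" "real (card B) >= 2 powr (b*(en q - e'))" "card B >= 2"
  using block_exists[OF z4 e'(1) e'(2)[unfolded Dq_def]] by metis
 define a where "a = Dq - e'"
 have sa: "s <= a" "0 <= a" using e' Dq s1 by (auto simp: a_def)
 have fB: "finite B" using B(2) finite_words finite_subset by blast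
 obtain m0 where m0: "!!n. n >= m0 ==> real (card (typed n (T' qt) et)) >= 2 powr (n*(en qt - (\<bar>qt\<bar> + 1)*et))"
  using card_typed[OF et(1), of qt] unfolding eventually_sequentially ent_eq_en by blast
 \<comment> \<open>Slightly beyond \<open>qt\<close>, so that \<open>c - q'*(\<rho> - ze)\<close>
   stays at least \<open>ka\<close> even for \<open>\<rho> = HHt\<close>; the margin comes from
   \<open>ze\<close>.\<close>
 define q' where "q' = qt + qt*ze/(2*(HHt + 1))"
 define ka where "ka = qt*ze/2"
 have H1: "HHt + 1 > 0" using HHt_pos by linarith
 have q': "q' > qt" unfolding q'_def using qt z H1 by simp
 have kp: "ka > 0" using qt z by (simp add: ka_def)
 have kle: "ka <= c - q'*(\<rho> - ze)"
 proof -
  define t where "t = qt*ze/(2*(HHt + 1))"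
  have t0: "t > 0" unfolding t_def using qt z H1 by simp
  have "t*(\<rho> - ze) <= t*(HHt + 1)" using t0 rho z by (intro mult_left_mono) auto
  also have "... = ka"
  proof -
   have "HHt + 1 ~= 0" using H1 by linarith
   thus ?thesis unfolding t_def ka_def by (simp add: divide_simps)
  qed
  finally have "t*(\<rho> - ze) <= ka" .
  moreover have "q'*(\<rho> - ze) = \<rho>*qt - qt*ze + t*(\<rho> - ze)" by (simp add: q'_def t_def algebra_simps)
  moreover have "qt*ze = 2*ka" by (simp add: ka_def)
  ultimately show ?thesis using rq by linarith
 qed
 obtain K where K: "K > 0" "!!x. (\<Sum>v\<in>bv (\<rho> - ze) x. pr (x @ v)) <= K*2 powr (- ka*length x)"
  using bad_sum[OF q' kle] by metis
 \<comment> \<open>The expected number of surviving candidates will be about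
   \<open>2 powr (e2*j)\<close>: growing, yet by \<open>2*e2 <= ka*\<theta>\<close> too small for
   one of them to have a bad prefix with noticeable probability.\<close>
 define e2 where "e2 = min (\<gamma>/4) (ka*\<theta>/2)"
 have e2: "e2 > 0" "e2 <= \<gamma>/4" "2*e2 <= ka*\<theta>"
 proof -
  show "e2 > 0" using ga kp th by (simp add: e2_def)
  have "e2 <= \<gamma>/4" "e2 <= ka*\<theta>/2" by (simp_all only: e2_def min.cobounded1 min.cobounded2)
  thus "e2 <= \<gamma>/4" "2*e2 <= ka*\<theta>" by linarith+
 qed
 \<comment> \<open>A step from length \<open>l\<close> has \<open>l*l\<close> blocks, so the past is
   negligible. \<open>m\<close> is the length of the tail of type \<open>qt\<close>, at least
   \<open>m0\<close> so that typed words can be counted, and positive so that the descendant is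
   proper. \<open>nY\<close> truncates the candidates to the number prescribed by
   \<open>e2\<close>.\<close>
 define R r1 r2 j j' m L nY where "R l = l*l" and "r1 l = nat \<lceil>\<theta>*real (R l)\<rceil>" and "r2 l = R l - r1 l"
  and "j l = l + R l*b" and "j' l = l + r1 l*b" and "m l = nat \<lceil>real (j l)*(\<rho>/Ht)\<rceil> + m0 + 1"
  and "L l = j l + m l" and "nY l = nat \<lceil>2 powr (c*L l + e2*j l)\<rceil>" for l :: nat
 have r1: "\<theta>*real (R l) <= r1 l" "real (r1 l) <= \<theta>*real (R l) + 1" "r1 l <= R l" for l
 proof -
  have nn: "0 <= \<theta>*real (R l)" using th by simp
  show "\<theta>*real (R l) <= r1 l" unfolding r1_def by linarith
  show "real (r1 l) <= \<theta>*real (R l) + 1" unfolding r1_def using nn by linarith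
  have "\<theta>*real (R l) <= 1*real (R l)" using th by (intro mult_right_mono) auto
  thus "r1 l <= R l" unfolding r1_def by linarith
 qed
 have r12: "r1 l + r2 l = R l" for l using r1(3)[of l] by (simp add: r2_def)
 have jj: "j' l + r2 l*b = j l" for l unfolding j'_def j_def r12[symmetric] by (simp add: distrib_right)
 have ml: "real (j l)*(\<rho>/Ht) <= m l" "real (m l) <= real (j l)*(\<rho>/Ht) + (m0 + 2)" "m0 <= m l" "m l > 0" for l
 proof -
  have nn: "0 <= real (j l)*(\<rho>/Ht)" by (intro mult_nonneg_nonneg rx(1)) simp
  show "real (j l)*(\<rho>/Ht) <= m l" unfolding m_def by linarith
  show "real (m l) <= real (j l)*(\<rho>/Ht) + (m0 + 2)" unfolding m_def using nn by linarith
 qed (auto simp: m_def)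
 have jl2: "real l*real l <= j l" for l
 proof -
  have "l*l <= l*l*b" using B(1) by simp
  hence "l*l <= j l" unfolding j_def R_def by linarith
  hence "real (l*l) <= real (j l)" by (simp only: of_nat_le_iff)
  thus ?thesis by simp
 qed
 have j'l: "\<theta>*j l <= j' l" for l
 proof -
  have "\<theta>*real l <= 1*real l" using th by (intro mult_right_mono) auto
  moreover have "\<theta>*real (R l)*real b <= real (r1 l)*real b" using r1(1)[of l] by (intro mult_right_mono) auto
  ultimately show ?thesis by (simp add: j_def j'_def algebra_simps)
 qed
 define Cn where "Cn = a*b + e'*(m0 + 2)"
 have ev: "ev (%l. \<gamma>/4*(real l*real l) >= Dq*real l + Cn
   & ze*\<theta>/2*(real l*real l) >= et*(m0 + 2) + 3*c0
   & ze/2*(real l*real l) >= (m0 + 2)*Ht + et*(m0 + 2) + c0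
   & ze/2*real l >= 3*c0 + 2*G*b + c0 & ze*real l >= 1 + a*b & ze*real l >= b
   & real l >= 4 & \<theta>*(real l*real l) >= ze*real l & \<theta>*(real l*real l) > 0)"
 proof -
  have q1: "ev (%l. x*(real l*real l) >= y*real l + z)" if "x > 0" for x y z :: real
   using that by real_asymp
  have l1: "ev (%l. x*real l >= y)" if "x > 0" for x y :: real
   using that by real_asymp
  have g4: "\<gamma>/4 > 0" "ze*\<theta>/2 > 0" "ze/2 > 0" using ga z th by simp_all
  have a1: "ev (%l. \<gamma>/4*(real l*real l) >= Dq*real l + Cn)" by (rule q1[OF g4(1)])
  have a2: "ev (%l. ze*\<theta>/2*(real l*real l) >= et*(m0 + 2) + 3*c0)"
   using q1[OF g4(2), of 0 "et*(m0 + 2) + 3*c0"] by simp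
  have a3: "ev (%l. ze/2*(real l*real l) >= (m0 + 2)*Ht + et*(m0 + 2) + c0)"
   using q1[OF g4(3), of 0 "(m0 + 2)*Ht + et*(m0 + 2) + c0"] by simp
  have a4: "ev (%l. ze/2*real l >= 3*c0 + 2*G*b + c0)" by (rule l1[OF g4(3)])
  have a5: "ev (%l. ze*real l >= 1 + a*b)" by (rule l1[OF z(1)])
  have a6: "ev (%l. ze*real l >= b)" by (rule l1[OF z(1)])
  have a7: "ev (%l. real l >= 4)" by real_asymp
  have a8: "ev (%l. \<theta>*(real l*real l) >= ze*real l)"
   using q1[OF th(1), of ze 0] by simp
  have a9: "ev (%l. \<theta>*(real l*real l) > 0)"
   using a7 by eventually_elim (use th in auto)
  show ?thesis by (intro eventually_conj a1 a2 a3 a4 a5 a6 a7 a8 a9)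
 qed
 have count: "2 powr (c*L l + e2*j l) <= real (card (pw B (r2 l) \<times> typed (m l) (T' qt) et))"
  if l: "\<gamma>/4*(real l*real l) >= Dq*real l + Cn" for l
 proof -
  have 1: "2 powr (b*a*r2 l) <= real (card (pw B (r2 l)))"
  proof -
   have "2 powr (b*a*r2 l) = (2 powr (b*a)) ^ r2 l" by (simp add: powr_power mult_ac)
   also have "... <= real (card B) ^ r2 l" using B(6) by (intro power_mono) (auto simp: a_def Dq_def)
   finally show ?thesis by (simp add: card_pw[OF B(2)])
  qed
  have 2: "2 powr (m l*(en qt - e')) <= real (card (typed (m l) (T' qt) et))"
  proof -
   have "m l*(en qt - e') <= m l*(en qt - (\<bar>qt\<bar> + 1)*et)" using et by (intro mult_left_mono) auto
   hence "2 powr (m l*(en qt - e')) <= 2 powr (m l*(en qt - (\<bar>qt\<bar> + 1)*et))" by (intro powr_mono) auto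
   also have "... <= real (card (typed (m l) (T' qt) et))" by (rule m0[OF ml(3)])
   finally show ?thesis .
  qed
  have 3: "c*L l + e2*j l <= b*a*r2 l + m l*(en qt - e')"
  proof -
   define J where "J = real (j l)"
   have Jl: "real l*real l <= J" using jl2 by (simp add: J_def)
   have J0: "J >= 0" by (simp add: J_def)
   have Rb: "real (R l)*b = J - real l" by (simp add: J_def j_def)
   have "real (r2 l) = real (R l) - real (r1 l)" using r12[of l] by linarith
   hence "real (r2 l) >= (1 - \<theta>)*real (R l) - 1" using r1(2)[of l] by (simp add: algebra_simps)
   hence "a*b*real (r2 l) >= a*b*((1 - \<theta>)*real (R l) - 1)" using sa by (intro mult_left_mono) auto
   moreover have "a*b*((1 - \<theta>)*real (R l) - 1) = a*(1 - \<theta>)*(real (R l)*b) - a*b" by (simp add: algebra_simps)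
   ultimately have A1: "a*b*real (r2 l) >= a*(1 - \<theta>)*(J - real l) - a*b" unfolding Rb by linarith
   have "a*(1 - \<theta>)*real l <= Dq*1*real l" using sa th e' Dq by (intro mult_right_mono mult_mono) (auto simp: a_def)
   moreover have "a*(1 - \<theta>)*J >= (Dq - s1 - e')*J"
   proof (rule mult_right_mono[OF _ J0])
    have "e'*(1 - \<theta>) <= e'*1" using e' th by (intro mult_left_mono) auto
    thus "Dq - s1 - e' <= a*(1 - \<theta>)" using th(3) by (simp add: a_def algebra_simps)
   qed
   ultimately have A2: "a*b*real (r2 l) >= (Dq - s1 - e')*J - Dq*real l - a*b"
    using A1 by (simp add: algebra_simps)
   have "en qt - c = qt*Ht" using qt by (simp add: en_def Ht_def)
   hence "m l*(en qt - c) = m l*(qt*Ht)" by simp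
   also have "... >= J*(\<rho>/Ht)*(qt*Ht)" using ml(1)[of l] qt Ht0 by (intro mult_right_mono) (auto simp: J_def)
   finally have A3: "m l*(en qt - c) >= J*(\<rho>*qt)" using Ht0 by simp
   have "e'*m l <= e'*(J*(\<rho>/Ht) + (m0 + 2))" using ml(2)[of l] e' by (intro mult_left_mono) (auto simp: J_def)
   hence A4: "e'*m l <= J*(e'*(\<rho>/Ht)) + e'*(m0 + 2)" by (simp add: algebra_simps)
   have A5: "J*(e'*(1 + \<rho>/Ht)) <= J*(\<gamma>/2)" using e'(4) J0 by (intro mult_left_mono)
   have A6: "J*e2 <= J*(\<gamma>/4)" using e2(2) J0 by (intro mult_left_mono)
   have A7: "\<gamma>/4*(real l*real l) <= \<gamma>/4*J" using Jl ga by (intro mult_left_mono) auto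
   have "b*a*r2 l + m l*(en qt - e') - (c*L l + e2*j l)
     = a*b*real (r2 l) + m l*(en qt - c) - e'*m l - c*J - J*e2"
    by (simp add: L_def J_def algebra_simps)
   also have "... >= ((Dq - s1 - e')*J - Dq*real l - a*b) + J*(\<rho>*qt) - (J*(e'*(\<rho>/Ht)) + e'*(m0 + 2)) - c*J - J*(\<gamma>/4)"
    using A2 A3 A4 A6 by linarith
   also have "((Dq - s1 - e')*J - Dq*real l - a*b) + J*(\<rho>*qt) - (J*(e'*(\<rho>/Ht)) + e'*(m0 + 2)) - c*J - J*(\<gamma>/4)
     = J*\<gamma> - J*(e'*(1 + \<rho>/Ht)) - J*(\<gamma>/4) - Dq*real l - Cn"
    by (simp add: \<gamma>_def v0_def Cn_def algebra_simps)
   finally have "b*a*r2 l + m l*(en qt - e') - (c*L l + e2*j l) >= J*(\<gamma>/4) - Dq*real l - Cn"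
    using A5 by (simp add: algebra_simps)
   thus ?thesis using A7 l by (simp add: mult.commute)
  qed
  have "2 powr (c*L l + e2*j l) <= 2 powr (b*a*r2 l + m l*(en qt - e'))" using 3 by (intro powr_mono) auto
  also have "... = 2 powr (b*a*r2 l)*2 powr (m l*(en qt - e'))" by (rule powr_add)
  also have "... <= real (card (pw B (r2 l)))*real (card (typed (m l) (T' qt) et))" by (intro mult_mono 1 2) auto
  finally show ?thesis by (simp add: card_cartesian_product)
 qed
 obtain l1 where l1: "!!l. l >= l1 ==> \<gamma>/4*(real l*real l) >= Dq*real l + Cn
   & ze*\<theta>/2*(real l*real l) >= et*(m0 + 2) + 3*c0
   & ze/2*(real l*real l) >= (m0 + 2)*Ht + et*(m0 + 2) + c0
   & ze/2*real l >= 3*c0 + 2*G*b + c0 & ze*real l >= 1 + a*b & ze*real l >= b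
   & real l >= 4 & \<theta>*(real l*real l) >= ze*real l & \<theta>*(real l*real l) > 0"
  using ev unfolding eventually_sequentially by blast
 have "\<exists>Y. Y \<subseteq> pw B (r2 l) \<times> typed (m l) (T' qt) et & card Y = nY l" if l: "l >= l1" for l
 proof -
  have "nY l <= card (pw B (r2 l) \<times> typed (m l) (T' qt) et)"
   using count[of l] l1[OF l] unfolding nY_def by linarith
  then obtain Y where "Y \<subseteq> pw B (r2 l) \<times> typed (m l) (T' qt) et" "card Y = nY l" by (rule obtain_subset_with_card_n)
  thus ?thesis by blast
 qed
 then obtain Y where Y: "!!l. l >= l1 ==> Y l \<subseteq> pw B (r2 l) \<times> typed (m l) (T' qt) et" "!!l. l >= l1 ==> card (Y l) = nY l"
  by metis
 have fY: "finite (Y l)" if "l >= l1" for l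
  by (rule finite_subset[OF Y(1)[OF that]]) (simp add: finite_pw[OF fB])
 define sp where "sp l om w t \<longleftrightarrow> (\<exists>(u, v)\<in>Y l. p ((w @ t) @ u @ v) om \<and>
   (\<forall>i. 0 < i & i <= r2 l --> \<not> bad (\<rho> - ze) om ((w @ t) @ take (i*b) u)))" for l om w t
 define Fa where "Fa l w t = {om \<in> space P. \<not> sp l om w t}" for l w t
 define \<pi> where "\<pi> l = exp (- (2 powr (e2*j l))) + 2*real (R l)*K*2 powr (- e2*j l)" for l
 have pnn: "\<pi> l >= 0" for l using K(1) by (simp add: \<pi>_def)
 have Fa: "Fa l w t \<in> sets P" "prob (Fa l w t) <= \<pi> l" if l: "l >= l1" and w: "w \<in> words l" and t: "t \<in> pw B (r1 l)" for l w t
 proof -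
  have xw: "w @ t \<in> words (j' l)" using w pw_length[OF B(2) t] by (simp add: words_def j'_def)
  have len: "length u = r2 l*b & length v = m l" if "(u, v) \<in> Y l" for u v
  proof -
   have "u \<in> pw B (r2 l)" "v \<in> typed (m l) (T' qt) et" using Y(1)[OF l] that by auto
   thus ?thesis using pw_length[OF B(2)] by (simp add: typed_def words_def)
  qed
  \<comment> \<open>The tail \<open>v\<close> alone adds about \<open>\<rho>*j\<close> to
    \<open>g\<close>, at least the cost tolerated at every prefix \<open>X\<close>. This is the gap
    that separates the candidates from the witnesses of badness.\<close>
  have gg: "g ((w @ t) @ u @ v) >= g ((w @ t) @ take (i*b) u) + (\<rho> - ze)*length ((w @ t) @ take (i*b) u)"
   if uv: "(u, v) \<in> Y l" and i: "0 < i" "i <= r2 l" for u v i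
  proof -
   define X where "X = (w @ t) @ take (i*b) u"
   define J where "J = real (j l)"
   have e: "(w @ t) @ u @ v = X @ drop (i*b) u @ v" by (simp add: X_def)
   have lX: "j' l <= length X" "length X <= j l" using xw len[OF uv] jj[of l] by (auto simp: X_def words_def)
   have lX': "\<theta>*J <= real (length X)" using j'l[of l] lX(1) unfolding J_def by linarith
   have lXJ: "real (length X) <= J" using lX(2) by (simp add: J_def)
   have v: "\<bar>g v - m l*Ht\<bar> <= et*m l" using Y(1)[OF l] uv by (auto simp: typed_def Ht_def)
   have d: "g (drop (i*b) u) >= - c0"
   proof -
    have "0 <= \<delta>*length (drop (i*b) u)" using \<delta>_pos by simp
    thus ?thesis using g_ge[of "drop (i*b) u"] by linarith
   qed
   have mH: "J*\<rho> <= m l*Ht"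
   proof -
    have "J*(\<rho>/Ht)*Ht <= m l*Ht" using ml(1)[of l] Ht0 by (intro mult_right_mono) (auto simp: J_def)
    thus ?thesis using Ht0 by simp
   qed
   have em: "et*m l <= J*(ze*\<theta>/4) + et*(m0 + 2)"
   proof -
    have "et*m l <= et*(J*(\<rho>/Ht) + (m0 + 2))" using ml(2)[of l] et by (intro mult_left_mono) (auto simp: J_def)
    also have "... = J*(et*(\<rho>/Ht)) + et*(m0 + 2)" by (simp add: algebra_simps)
    also have "J*(et*(\<rho>/Ht)) <= J*(ze*\<theta>/4)" using et(3) by (intro mult_left_mono) (auto simp: J_def)
    finally show ?thesis by simp
   qed
   have zz: "et*(m0 + 2) + 3*c0 <= ze*\<theta>/2*J"
   proof -
    have "ze*\<theta>/2*(real l*real l) <= ze*\<theta>/2*J" using jl2[of l] z th by (intro mult_left_mono) (auto simp: J_def)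
    thus ?thesis using l1[OF l] by linarith
   qed
   have "ze*(\<theta>*J) <= ze*length X" using lX' z by (intro mult_left_mono) auto
   moreover have "ze*(\<theta>*J) = J*(ze*\<theta>/4) + ze*\<theta>/2*J + J*(ze*\<theta>/4)" by (simp add: algebra_simps)
   moreover have "0 <= J*(ze*\<theta>/4)" using z th by (simp add: J_def)
   ultimately have zX: "et*m l + 3*c0 <= ze*length X" using em zz by linarith
   have rX: "\<rho>*length X <= J*\<rho>" using mult_left_mono[OF lXJ rho(1)] by (simp add: mult.commute)
   have "g (X @ drop (i*b) u @ v) >= g X + g (drop (i*b) u) + g v - 2*c0"
    using qa[of X "drop (i*b) u @ v"] qa[of "drop (i*b) u" v] by linarith
   hence "g (X @ drop (i*b) u @ v) >= g X + (\<rho>*length X - ze*length X)"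
    using d v mH zX rX by linarith
   thus ?thesis unfolding e X_def[symmetric] by (simp add: left_diff_distrib)
  qed
  note pf = prob_spec_fail[OF fY[OF l] len ml(4)[of l] xw K kp gg]
  show "Fa l w t \<in> sets P" unfolding Fa_def sp_def by (rule pf(1))
  have Lj: "j' l + r2 l*b + m l = L l" by (simp add: L_def jj)
  have nY1: "2 powr (e2*j l) <= real (card (Y l))*2 powr (- c*real (L l))"
  proof -
   have "2 powr (e2*j l) = 2 powr (c*L l + e2*j l)*2 powr (- c*real (L l))" by (simp flip: powr_add)
   also have "2 powr (c*L l + e2*j l) <= real (nY l)" unfolding nY_def by linarith
   finally show ?thesis using Y(2)[OF l] by simp
  qed
  have nY2: "real (card (Y l))*2 powr (- c*real (L l)) <= 2*2 powr (e2*j l)"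
  proof -
   have one: "1 <= 2 powr (c*L l + e2*j l)" using c_bounds e2 by (intro ge_one_powr_ge_zero) auto
   hence "real (nY l) <= 2*2 powr (c*L l + e2*j l)" unfolding nY_def by linarith
   hence "real (card (Y l))*2 powr (- c*real (L l)) <= 2*2 powr (c*L l + e2*j l)*2 powr (- c*real (L l))"
    using Y(2)[OF l] by (intro mult_right_mono) auto
   also have "... = 2*2 powr (e2*j l)" by (simp flip: powr_add)
   finally show ?thesis .
  qed
  have "prob (Fa l w t) <= exp (- (card (Y l)*2 powr (- c*real (L l))))
    + card (Y l)*2 powr (- c*real (L l))*(r2 l*(K*2 powr (- ka*real (j' l))))"
   using pf(2) unfolding Fa_def sp_def Lj .
  also have "... <= exp (- (2 powr (e2*j l))) + 2*2 powr (e2*j l)*(R l*(K*2 powr (- (2*e2)*j l)))"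
  proof (rule add_mono[OF _ mult_mono[OF nY2 mult_mono]])
   show "exp (- (card (Y l)*2 powr (- c*real (L l)))) <= exp (- (2 powr (e2*j l)))" using nY1 by simp
   show "real (r2 l) <= R l" by (simp add: r2_def)
   have "2*e2*j l <= ka*\<theta>*j l" using e2(3) by (intro mult_right_mono) auto
   also have "... = ka*(\<theta>*j l)" by simp
   also have "... <= ka*j' l" using j'l[of l] kp by (intro mult_left_mono) auto
   finally have "2 powr (- ka*real (j' l)) <= 2 powr (- (2*e2)*j l)" by (intro powr_mono) auto
   thus "K*2 powr (- ka*real (j' l)) <= K*2 powr (- (2*e2)*j l)" using K(1) by (intro mult_left_mono) auto
   show "0 <= K*2 powr (- ka*real (j' l))" using K(1) by simp
   show "0 <= real (r2 l)*(K*2 powr (- ka*real (j' l)))" using K(1) by simp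
  qed auto
  also have "2*2 powr (e2*j l)*(R l*(K*2 powr (- (2*e2)*j l))) = 2*real (R l)*K*(2 powr (e2*j l)*2 powr (- (2*e2)*j l))"
   by simp
  also have "2 powr (e2*j l)*2 powr (- (2*e2)*j l) = 2 powr (- e2*j l)" by (simp flip: powr_add)
  finally show "prob (Fa l w t) <= \<pi> l" by (simp add: \<pi>_def)
 qed
 define Ev where "Ev l = (if l < l1 then {} else (\<Union>w\<in>words l. {om \<in> space P. card (pw B (r1 l)) < 4*card {t \<in> pw B (r1 l). om \<in> Fa l w t}}))" for l
 define d where "d = real CARD('n)"
 obtain K2 where K2: "K2 > 0" "!!y. y >= 0 ==> 2 powr (0*y)*exp (- (2 powr (e2*y))) <= K2*2 powr (- y)"
  using superexponential_decay[OF e2(1), of 0] by metis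
 have dp: "d > 0" by (simp add: d_def)
 have "ev (%l. 2 powr (d*real l)*(4*(K2*2 powr (- (real l*real l)))) <= 1/2*2 powr (- real l))"
  using K2(1) dp by real_asymp
 moreover have "ev (%l. 2 powr (d*real l)*(4*(2*(real l*real l)*K*2 powr (- e2*(real l*real l)))) <= 1/2*2 powr (- real l))"
  using e2(1) K(1) dp by real_asymp
 ultimately have "ev (%l. 2 powr (d*real l)*(4*(K2*2 powr (- (real l*real l)) + 2*(real l*real l)*K*2 powr (- e2*(real l*real l)))) <= 1*2 powr (- real l))"
 proof eventually_elim
  case (elim l)
  have "x*(4*(a + b)) <= 1*y" if "x*(4*a) <= 1/2*y" "x*(4*b) <= 1/2*y" for x y a b :: real
  proof -
   have "x*(4*(a + b)) = x*(4*a) + x*(4*b)" by (simp add: algebra_simps)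
   thus ?thesis using that by linarith
  qed
  from this[OF elim] show ?case .
 qed
 then obtain l2 where l2: "!!l. l >= l2 ==> 2 powr (d*real l)*(4*(K2*2 powr (- (real l*real l)) + 2*(real l*real l)*K*2 powr (- e2*(real l*real l)))) <= 1*2 powr (- real l)"
  unfolding eventually_sequentially by blast
 have "AE om in P. \<exists>j0. \<forall>j\<ge>j0. om \<notin> Ev j"
 proof (rule AE_eventually_not)
  show "Ev l \<in> sets P" for l
  proof (cases "l < l1")
   case True thus ?thesis by (simp only: Ev_def if_True sets.empty_sets)
  next
   case False
   hence l: "l >= l1" by simp
   show ?thesis unfolding Ev_def if_not_P[OF False]
    by (intro sets.finite_UN finite_words card_markov(1)[OF finite_pw[OF fB] Fa(1)[OF l] Fa(2)[OF l] pnn])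
  qed
  show "prob (Ev l) <= 1*2 powr (- real l)" if l: "l >= max l1 l2" for l
  proof -
   have l': "l >= l1" "\<not> l < l1" using l by auto
   have "prob (Ev l) <= (\<Sum>w\<in>words l. prob {om \<in> space P. card (pw B (r1 l)) < 4*card {t \<in> pw B (r1 l). om \<in> Fa l w t}})"
    unfolding Ev_def if_not_P[OF l'(2)]
    by (intro finite_measure_subadditive_finite finite_words image_subsetI card_markov(1)[OF finite_pw[OF fB] Fa(1)[OF l'(1)] Fa(2)[OF l'(1)] pnn])
   also have "... <= (\<Sum>w\<in>(words l :: 'n word set). 4*\<pi> l)"
    by (intro sum_mono card_markov(2)[OF finite_pw[OF fB] Fa(1)[OF l'(1)] Fa(2)[OF l'(1)] pnn])
   also have "... = 2 powr (d*real l)*(4*\<pi> l)" by (simp add: card_words d_def flip: powr_realpow)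
   also have "... <= 2 powr (d*real l)*(4*(K2*2 powr (- (real l*real l)) + 2*(real l*real l)*K*2 powr (- e2*(real l*real l))))"
    unfolding \<pi>_def
   proof (intro mult_left_mono add_mono)
    have "exp (- (2 powr (e2*j l))) <= K2*2 powr (- real (j l))" using K2(2)[of "real (j l)"] by simp
    also have "... <= K2*2 powr (- (real l*real l))" using jl2[of l] K2(1) by (intro mult_left_mono powr_mono) auto
    finally show "exp (- (2 powr (e2*j l))) <= K2*2 powr (- (real l*real l))" .
    have "2 powr (- e2*j l) <= 2 powr (- e2*(real l*real l))" using jl2[of l] e2 by (intro powr_mono) auto
    thus "2*real (R l)*K*2 powr (- e2*j l) <= 2*(real l*real l)*K*2 powr (- e2*(real l*real l))"
     unfolding R_def using K(1) by (intro mult_mono) auto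
   qed auto
   also have "... <= 1*2 powr (- real l)" using l by (intro l2) simp
   finally show ?thesis .
  qed
  show "summable (%m. 1*2 powr (- real m))" by (rule summable_powr_minus)
 qed
 moreover have "AE om in P. \<exists>k0. \<forall>k\<ge>k0. \<forall>l i. k = l + i*b & ze*real l <= real (i*b) -->
  (\<forall>w\<in>words l. (real k)\<^sup>2*real (card {t \<in> pw B i. bad (\<rho> - ze) om (w @ t)}) <= real (card B ^ i))"
  by (rule AE_few_bad[OF B(2,7,1) z(1) q' kp kle])
 ultimately show ?thesis using AE_space
 proof eventually_elim
  case (elim om)
  obtain j0 where j0: "!!l. l >= j0 ==> om \<notin> Ev l" using elim(1) by blast
  obtain k0 where k0: "!!k l i w. k >= k0 ==> k = l + i*b & ze*real l <= real (i*b) ==> w \<in> words l ==>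
   (real k)\<^sup>2*real (card {t \<in> pw B i. bad (\<rho> - ze) om (w @ t)}) <= real (card B ^ i)" using elim(2) by blast
  have "step om (T' q) \<rho> ze s l" if l: "l >= max j0 (max k0 l1)" for l
  proof -
   have ll: "l >= j0" "l >= k0" "l >= l1" using l by auto
   note n = l1[OF ll(3)]
   have l4: "l >= 4" using n by simp
   show ?thesis
   proof (rule step_det[where a = a and e = "ze/4" and b = b and B = B and ?r1.0 = "r1 l" and ?r2.0 = "r2 l" and sp = "sp l om"])
    show "\<bar>g u - b*T' q\<bar> <= ze/4*b" if "u \<in> B" for u by (rule B(4)[OF that])
    show "\<exists>z. u = ltr0 # ltr1 # z" if "u \<in> B" for u by (rule B(3)[OF that])
    show "2 powr (b*a) <= real (card B)" using B(6) by (simp add: a_def Dq_def)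
    show "0 <= T' q" using T'_ge[of q] \<delta>_pos by linarith
    show "T' q <= G" by (rule T'_le)
    show "s*real (r1 l + r2 l) <= a*r1 l"
    proof -
     have "s <= a*\<theta>"
     proof -
      have "e'*\<theta> <= e'*1" using e' th by (intro mult_left_mono) auto
      moreover have "a*\<theta> = s1 - e'*\<theta>" using th(3) by (simp add: a_def algebra_simps)
      ultimately show ?thesis using e'(3) by linarith
     qed
     hence "s*real (R l) <= a*\<theta>*real (R l)" by (intro mult_right_mono) auto
     also have "... = a*(\<theta>*real (R l))" by simp
     also have "... <= a*r1 l" using r1(1)[of l] sa by (intro mult_left_mono) auto
     finally show ?thesis by (simp add: r12)
    qed
    show "3*c0 + 2*G*b + c0 <= ze/2*l" "1 + a*b <= ze*l" "b <= ze*l" using n by blast+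
    show "l <= (r1 l + r2 l)*b"
    proof -
     have "l*1 <= l*(l*b)" using l4 B(1) by (intro mult_left_mono) auto
     thus ?thesis by (simp add: r12 R_def mult.assoc)
    qed
    have tr: "\<theta>*(real l*real l) <= r1 l" using r1(1)[of l] by (simp add: R_def)
    have "real (r1 l)*1 <= real (r1 l)*b" using B(1) by (intro mult_left_mono) auto
    moreover have "ze*l <= \<theta>*(real l*real l)" using n by blast
    ultimately show "ze*l <= real (r1 l*b)" unfolding of_nat_mult using tr by linarith
    have "0 < real (r1 l)" using tr n by linarith
    thus "0 < r1 l" by simp
    show "(real (l + i*b))\<^sup>2*real (card {t \<in> pw B i. bad (\<rho> - ze) om (w @ t)}) <= real (card B ^ i)"
     if "ze*real l <= real (i*b)" "w \<in> words l" for i w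
     by (rule k0) (use that ll in auto)
    show "4*card {t \<in> pw B (r1 l). \<not> sp l om w t} <= card B ^ r1 l" if w: "w \<in> words l" for w
    proof -
     have nl: "\<not> l < l1" using ll(3) by simp
     have "om \<notin> {om \<in> space P. card (pw B (r1 l)) < 4*card {t \<in> pw B (r1 l). om \<in> Fa l w t}}"
      using j0[OF ll(1)] w unfolding Ev_def if_not_P[OF nl] by blast
     hence "4*card {t \<in> pw B (r1 l). om \<in> Fa l w t} <= card (pw B (r1 l))" using elim(3) by simp
     moreover have "{t \<in> pw B (r1 l). om \<in> Fa l w t} = {t \<in> pw B (r1 l). \<not> sp l om w t}" using elim(3) by (simp add: Fa_def)
     ultimately show ?thesis by (simp add: card_pw[OF B(2)])
    qed
    show "\<exists>u\<in>pw B (r2 l). \<exists>v. v ~= [] & p (w @ t @ u @ v) om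
     & g (w @ t @ u @ v) <= g (w @ t @ u) + real (l + (r1 l + r2 l)*b)*(\<rho> + ze)
     & (\<forall>i. 0 < i & i <= r2 l --> \<not> bad (\<rho> - ze) om (w @ t @ take (i*b) u))"
     if "w \<in> words l" "t \<in> pw B (r1 l)" and spt: "sp l om w t" for w t
    proof -
     obtain u v where uv: "(u, v) \<in> Y l" "p ((w @ t) @ u @ v) om"
      "!!i. 0 < i ==> i <= r2 l ==> \<not> bad (\<rho> - ze) om ((w @ t) @ take (i*b) u)"
      using spt unfolding sp_def by blast
     have u: "u \<in> pw B (r2 l)" and v: "v \<in> typed (m l) (T' qt) et" using Y(1)[OF ll(3)] uv(1) by auto
     have vne: "v ~= []" using v ml(4)[of l] by (auto simp: typed_def words_def)
     define J where "J = real (j l)"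
     have Je: "real (l + (r1 l + r2 l)*b) = J" by (simp add: J_def j_def r12)
     have gv: "g v <= m l*Ht + et*m l" using v by (auto simp: typed_def Ht_def abs_le_iff)
     have "m l*Ht <= (J*(\<rho>/Ht) + (m0 + 2))*Ht" using ml(2)[of l] Ht0 by (intro mult_right_mono) (auto simp: J_def)
     also have "... = J*\<rho> + (m0 + 2)*Ht" using Ht0 by (simp add: algebra_simps)
     finally have 1: "m l*Ht <= J*\<rho> + (m0 + 2)*Ht" .
     have "et*m l <= et*(J*(\<rho>/Ht) + (m0 + 2))" using ml(2)[of l] et by (intro mult_left_mono) (auto simp: J_def)
     also have "... = J*(et*(\<rho>/Ht)) + et*(m0 + 2)" by (simp add: algebra_simps)
     also have "J*(et*(\<rho>/Ht)) <= J*(ze/2)"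
     proof (rule mult_left_mono)
      have "ze*\<theta> <= ze*1" using z th by (intro mult_left_mono) auto
      thus "et*(\<rho>/Ht) <= ze/2" using et(3) z by linarith
     qed (simp add: J_def)
     finally have 2: "et*m l <= J*(ze/2) + et*(m0 + 2)" by simp
     have "ze/2*(real l*real l) <= ze/2*J" using jl2[of l] z by (intro mult_left_mono) (auto simp: J_def)
     hence 3: "(m0 + 2)*Ht + et*(m0 + 2) + c0 <= J*(ze/2)" using n by (simp add: mult.commute)
     have 4: "J*(\<rho> + ze) = J*\<rho> + J*(ze/2) + J*(ze/2)" by (simp add: algebra_simps)
     have "g ((w @ t @ u) @ v) <= g (w @ t @ u) + J*(\<rho> + ze)"
      using qa[of "w @ t @ u" v] gv 1 2 3 4 by linarith
     thus ?thesis unfolding Je using u vne uv(2,3) by (intro bexI[of _ u] exI[of _ v]) auto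
    qed
   qed (use B z s sa l4 in auto)
  qed
  thus ?case by blast
 qed
qed

end

section \<open>Gibbs capacities are quasi-multiplicative\<close>

definition cat :: "'a list => (nat => 'a) => nat => 'a" where
 "cat w x = (%k. if k < length w then w ! k else x (k - length w))"

lemma funpow_shift: "(shift ^^ i) t = (%k. t (k + i))"
proof (induction i)
 case (Suc i)
 have "(shift ^^ Suc i) t = shift ((shift ^^ i) t)" by simp
 thus ?case unfolding Suc shift_def by simp
qed simp

lemma funpow_shift_cat: "(shift ^^ length w) (cat w x) = x"
 by (simp add: funpow_shift cat_def)

lemma cat_in_cyl: "cat w x \<in> cyl w"
 by (simp add: cat_def cyl_def)

lemma cat_append: "cat (u @ v) x = cat u (cat v x)"
 by (rule ext) (auto simp: cat_def nth_append)

lemma sym_dist_le: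
 assumes "!!k. k < m ==> s k = t k"
 shows "sym_dist s t <= 2 powr (- real m)"
proof (cases "s = t")
 case False
 hence "\<exists>n. s n ~= t n" by auto
 hence "s (LEAST n. s n ~= t n) ~= t (LEAST n. s n ~= t n)" by (rule LeastI_ex)
 hence "m <= (LEAST n. s n ~= t n)" using assms by (metis not_le)
 thus ?thesis using False by (simp add: sym_dist_def)
qed (simp add: sym_dist_def)

lemma sym_dist_less:
 assumes "sym_dist s t < 2 powr (- real m)" "k < m"
 shows "s k = t k"
proof (rule ccontr)
 assume k: "s k ~= t k"
 hence "(LEAST n. s n ~= t n) <= k" by (rule Least_le)
 hence "2 powr (- real m) <= 2 powr (- real (LEAST n. s n ~= t n))" using assms(2) by (intro powr_mono) auto
 moreover have "s ~= t" using k by auto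
 ultimately show False using assms(1) by (simp add: sym_dist_def)
qed

lemma sym_dist_nonneg: "sym_dist s t >= 0"
 by (simp add: sym_dist_def)

section \<open>Bounded distortion of Birkhoff sums\<close>

locale holder_potential =
 fixes \<psi> :: "'n::finite iword => real" and Cp \<gamma> :: real
 assumes \<gamma>: "\<gamma> > 0" and Cp: "Cp >= 0" and hld: "\<bar>\<psi> s - \<psi> t\<bar> <= Cp * sym_dist s t powr \<gamma>"
begin

text \<open>The factor gained in the Hoelder bound by one more common letter; \<open>B\<close> is
  the sum of the resulting geometric series, the distortion constant.\<close>

definition r :: real where "r = 2 powr (- \<gamma>)"
definition B :: real where "B = Cp/(1 - r)"
definition S :: "nat => 'n iword => real" where "S n t = (\<Sum>i<n. \<psi> ((shift ^^ i) t))"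

lemma r: "0 < r" "r < 1"
 using powr_less_mono[of "- \<gamma>" 0 2] \<gamma> by (auto simp: r_def)

lemma B: "B >= 0" "B*(1 - r) = Cp"
 using r Cp by (auto simp: B_def)

lemma \<psi>_close:
 assumes "!!k. k < m ==> s k = t k"
 shows "\<bar>\<psi> s - \<psi> t\<bar> <= Cp*r ^ m"
proof -
 have "sym_dist s t powr \<gamma> <= (2 powr (- real m)) powr \<gamma>"
  using sym_dist_le[OF assms] \<gamma> sym_dist_nonneg by (intro powr_mono2) auto
 also have "... = r ^ m" by (simp add: r_def powr_powr mult.commute flip: powr_realpow)
 finally have "Cp * sym_dist s t powr \<gamma> <= Cp*r ^ m" using Cp by (intro mult_left_mono)
 thus ?thesis using hld[of s t] by linarith
qed

lemma S_add: "S (m + n) t = S m t + S n ((shift ^^ m) t)"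
proof -
 have "S (m + n) t = (\<Sum>i<m. \<psi> ((shift ^^ i) t)) + (\<Sum>i<n. \<psi> ((shift ^^ (i + m)) t))"
  unfolding S_def
 proof (induction n)
  case (Suc n)
  thus ?case by (simp add: add.commute)
 qed simp
 thus ?thesis unfolding S_def by (simp only: funpow_add o_apply)
qed

lemma S_Suc: "S (Suc n) t = S n t + \<psi> ((shift ^^ n) t)"
 by (simp add: S_def)

text \<open>With \<open>m\<close> common letters beyond the window, the terms differ by at most
  \<open>Cp*r ^ k\<close> for successive \<open>k > m\<close>, a series with sum below
  \<open>B*r ^ m\<close>. The induction lets \<open>m\<close> grow as \<open>n\<close>
  shrinks.\<close>

lemma S_close:
 assumes "!!k. k < n + m ==> s k = t k"
 shows "\<bar>S n s - S n t\<bar> <= B*r ^ m"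
 using assms
proof (induction n arbitrary: m)
 case 0
 thus ?case using B(1) r by (simp add: S_def)
next
 case (Suc n)
 have "\<bar>S n s - S n t\<bar> <= B*r ^ Suc m" by (rule Suc.IH) (use Suc.prems in auto)
 moreover have "\<bar>\<psi> ((shift ^^ n) s) - \<psi> ((shift ^^ n) t)\<bar> <= Cp*r ^ Suc m"
  by (rule \<psi>_close) (use Suc.prems in \<open>auto simp: funpow_shift\<close>)
 ultimately have "\<bar>S (Suc n) s - S (Suc n) t\<bar> <= B*r ^ Suc m + B*(1 - r)*r ^ Suc m"
  unfolding S_Suc B(2) by linarith
 also have "... = B*r ^ m - B*r ^ m*(1 - r)\<^sup>2" by (simp add: power2_eq_square algebra_simps)
 also have "... <= B*r ^ m" using B(1) r by simp
 finally show ?case .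
qed

lemma S_cyl: "s \<in> cyl w ==> t \<in> cyl w ==> \<bar>S (length w) s - S (length w) t\<bar> <= B"
 using S_close[of "length w" 0 s t] by (simp add: cyl_def)

lemma Psi_close:
 assumes t: "t \<in> cyl w"
 shows "\<bar>Psi \<psi> w - S (length w) t\<bar> <= B"
proof -
 have P: "Psi \<psi> w = (SUP s\<in>cyl w. S (length w) s)" by (simp add: Psi_def S_def)
 have le: "S (length w) s <= S (length w) t + B" if "s \<in> cyl w" for s using S_cyl[OF that t] by linarith
 have "Psi \<psi> w <= S (length w) t + B" unfolding P using t le by (intro cSUP_least) auto
 moreover have "S (length w) t <= Psi \<psi> w" unfolding P using le by (intro cSUP_upper t bdd_aboveI2) auto
 ultimately show ?thesis using B(1) by linarith
qed

definition M :: real where "M = \<bar>\<psi> (%_. ltr0)\<bar> + Cp"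

lemma \<psi>_bound: "\<bar>\<psi> t\<bar> <= M"
 using \<psi>_close[of 0 t "\<lambda>_. ltr0"] by (simp add: M_def)

lemma S_bound: "\<bar>S n t\<bar> <= real n*M"
proof -
 have "\<bar>S n t\<bar> <= (\<Sum>i<n. \<bar>\<psi> ((shift ^^ i) t)\<bar>)" unfolding S_def by (rule sum_abs)
 also have "... <= (\<Sum>i<n. M)" by (intro sum_mono \<psi>_bound)
 finally show ?thesis by simp
qed

lemma Psi_append: "\<bar>Psi \<psi> (u @ v) - Psi \<psi> u - Psi \<psi> v\<bar> <= 3*B"
proof -
 define x where "x = cat (u @ v) (%_. ltr0)"
 have x: "x = cat u (cat v (%_. ltr0))" by (simp add: x_def cat_append)
 have "S (length (u @ v)) x = S (length u) x + S (length v) (cat v (%_. ltr0))"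
  using S_add[of "length u" "length v" x] funpow_shift_cat[of u] by (simp add: x)
 moreover have "\<bar>Psi \<psi> (u @ v) - S (length (u @ v)) x\<bar> <= B" unfolding x_def by (intro Psi_close cat_in_cyl)
 moreover have "\<bar>Psi \<psi> u - S (length u) x\<bar> <= B" unfolding x by (intro Psi_close cat_in_cyl)
 moreover have "\<bar>Psi \<psi> v - S (length v) (cat v (%_. ltr0))\<bar> <= B" by (intro Psi_close cat_in_cyl)
 ultimately show ?thesis by linarith
qed

lemma Psi_Nil: "Psi \<psi> [] = 0"
 by (simp add: Psi_def cyl_def)

lemma Psi_bound: "\<bar>Psi \<psi> w\<bar> <= real (length w)*M + B"
 using Psi_close[OF cat_in_cyl[of w "\<lambda>_. ltr0"]] S_bound[of "length w" "cat w (%_. ltr0)"] by linarith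

section \<open>Livsic argument: bounded deviations of Birkhoff sums give a coboundary\<close>

context
 fixes cc Bd :: real
 assumes bd: "\<bar>S n t - real n*cc\<bar> <= Bd"
begin

definition per :: "'n word => 'n iword" where "per w = (%k. w ! (k mod length w))"

text \<open>Along a periodic point the deviation is multiplied by the number of periods, so
  boundedness forces it to vanish.\<close>

lemma S_per: "S (length w) (per w) = real (length w)*cc"
proof -
 define a where "a = S (length w) (per w) - real (length w)*cc"
 have sp: "(shift ^^ length w) (per w) = per w" by (rule ext) (simp add: funpow_shift per_def)
 have S: "S (k*length w) (per w) = k*S (length w) (per w)" for k
 proof (induction k)
  case 0
  thus ?case by (simp add: S_def)
 next
  case (Suc k)
  have "S (Suc k*length w) (per w) = S (length w + k*length w) (per w)" by simp
  also have "... = S (length w) (per w) + S (k*length w) (per w)" unfolding S_add sp ..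
  finally show ?case using Suc by (simp add: algebra_simps)
 qed
 have "real k*\<bar>a\<bar> <= Bd" for k
 proof -
  have "real k*a = S (k*length w) (per w) - real (k*length w)*cc" by (simp add: S a_def algebra_simps)
  hence "\<bar>real k*a\<bar> <= Bd" using bd[of "k*length w" "per w"] by simp
  thus ?thesis by (simp add: abs_mult)
 qed
 moreover have "\<exists>k. Bd < real k*\<bar>a\<bar>" if "a ~= 0" using reals_Archimedean3[of "\<bar>a\<bar>"] that by auto
 ultimately have "a = 0" by (meson not_le)
 thus ?thesis by (simp add: a_def)
qed

definition pre :: "nat => 'n iword => 'n word" where "pre m x = map x [0..<m]"
text \<open>Approximates the transfer function: the deviation along \<open>x\<close>, with
  \<open>x\<close> cut off at \<open>m\<close> letters and continued by the reference
  letter.\<close>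

definition Phi :: "nat => 'n iword => real" where
 "Phi m x = S m (cat (pre m x) (%_. ltr0)) - real m*cc"

text \<open>On the periodic point with period \<open>replicate n ltr0 @ pre m x\<close> the total
  deviation is zero, and it splits, up to distortion, into the deviation along reference letters
  placed before \<open>x\<close> and \<open>Phi m x\<close>. The first part does not depend on
  \<open>m\<close>, which makes \<open>Phi m x\<close> Cauchy.\<close>

lemma Phi_close: "\<bar>(S n (cat (replicate n ltr0) x) - real n*cc) + Phi m x\<bar> <= B*r ^ m + B*r ^ n"
proof -
 define w where "w = replicate n ltr0 @ pre m x"
 have lw: "length w = n + m" by (simp add: w_def pre_def)
 have "S n (per w) + S m ((shift ^^ n) (per w)) = real (n + m)*cc"
  using S_per[of w] unfolding lw S_add .
 moreover have "\<bar>S n (per w) - S n (cat (replicate n ltr0) x)\<bar> <= B*r ^ m"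
  by (rule S_close) (auto simp: per_def lw, auto simp: w_def cat_def nth_append pre_def)
 moreover have "\<bar>S m ((shift ^^ n) (per w)) - S m (cat (pre m x) (%_. ltr0))\<bar> <= B*r ^ n"
 proof (rule S_close)
  fix k assume k: "k < m + n"
  show "(shift ^^ n) (per w) k = cat (pre m x) (%_. ltr0) k"
  proof (cases "k < m")
   case True
   thus ?thesis by (simp add: funpow_shift per_def lw) (simp add: w_def cat_def nth_append pre_def)
  next
   case False
   have "k + n = (k - m) + (n + m)" using False by simp
   hence "(k + n) mod (n + m) = k - m" using k False by (metis mod_add_self2 mod_less add.commute less_diff_conv2 not_less trans_less_add2)
   moreover have "k - m < n" using k False by linarith
   ultimately show ?thesis using k False by (simp add: funpow_shift per_def lw) (simp add: w_def cat_def nth_append pre_def)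
  qed
 qed
 ultimately show ?thesis unfolding Phi_def by (simp add: distrib_right)
qed

lemma Phi_Cauchy: "\<bar>Phi m x - Phi m' x\<bar> <= B*r ^ m + B*r ^ m'"
proof (rule field_le_epsilon)
 fix e :: real assume e: "e > 0"
 have "(%n. 2*(B*r ^ n)) \<longlonglongrightarrow> 2*(B*0)" using r by (intro tendsto_intros LIMSEQ_power_zero) auto
 hence "ev (%n. 2*(B*r ^ n) < e)" using e by (intro order_tendstoD) auto
 then obtain n where "2*(B*r ^ n) < e" by (auto simp: eventually_sequentially)
 thus "\<bar>Phi m x - Phi m' x\<bar> <= B*r ^ m + B*r ^ m' + e"
  using Phi_close[of n x m] Phi_close[of n x m'] by linarith
qed

lemma Phi_lim: "\<exists>l. (%m. Phi m x) \<longlonglongrightarrow> l"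
proof -
 have "Cauchy (%m. Phi m x)"
 proof (rule metric_CauchyI)
  fix e :: real assume e: "e > 0"
  have "(%n. 2*(B*r ^ n)) \<longlonglongrightarrow> 2*(B*0)" using r by (intro tendsto_intros LIMSEQ_power_zero) auto
  hence "ev (%n. 2*(B*r ^ n) < e)" using e by (intro order_tendstoD) auto
  then obtain N where N: "2*(B*r ^ N) < e" by (auto simp: eventually_sequentially)
  have le: "B*r ^ m <= B*r ^ N" if "m >= N" for m
   using that r B(1) by (intro mult_left_mono power_decreasing) auto
  have "dist (Phi m x) (Phi n x) < e" if "m >= N" "n >= N" for m n
   using Phi_Cauchy[of m x n] le[OF that(1)] le[OF that(2)] N unfolding dist_real_def by linarith
  thus "\<exists>N. \<forall>m\<ge>N. \<forall>n\<ge>N. dist (Phi m x) (Phi n x) < e" by blast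
 qed
 thus ?thesis using Cauchy_convergent convergent_def by blast
qed

lemma bounded_sums_imp_cohomologous: "cohomologous_to_const \<psi>"
proof -
 obtain \<phi> where \<phi>: "!!x. (%m. Phi m x) \<longlonglongrightarrow> \<phi> x" using Phi_lim by metis
 have close: "\<bar>Phi m x - \<phi> x\<bar> <= B*r ^ m" for m x
 proof (rule LIMSEQ_le)
  show "(%n. \<bar>Phi m x - Phi n x\<bar>) \<longlonglongrightarrow> \<bar>Phi m x - \<phi> x\<bar>" by (intro tendsto_intros \<phi>)
  have "(%n. B*r ^ m + B*r ^ n) \<longlonglongrightarrow> B*r ^ m + B*0" using r by (intro tendsto_intros LIMSEQ_power_zero) auto
  thus "(%n. B*r ^ m + B*r ^ n) \<longlonglongrightarrow> B*r ^ m" by simp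
  show "\<exists>N. \<forall>n\<ge>N. \<bar>Phi m x - Phi n x\<bar> <= B*r ^ m + B*r ^ n" using Phi_Cauchy by blast
 qed
 have rlim: "(%n. K*r ^ n) \<longlonglongrightarrow> 0" for K :: real
 proof -
  have "(%n. K*r ^ n) \<longlonglongrightarrow> K*0" using r by (intro tendsto_intros LIMSEQ_power_zero) auto
  thus ?thesis by simp
 qed
 have "sym_continuous \<phi>" unfolding sym_continuous_def
 proof (intro allI impI)
  fix t :: "'n iword" and e :: real assume e: "e > 0"
  have "ev (%n. (2*B)*r ^ n < e)" using e by (intro order_tendstoD[OF rlim]) auto
  then obtain m where m: "(2*B)*r ^ m < e" by (auto simp: eventually_sequentially)
  have "\<bar>\<phi> s - \<phi> t\<bar> < e" if "sym_dist s t < 2 powr (- real m)" for s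
  proof -
   have "pre m s = pre m t" using sym_dist_less[OF that] by (simp add: pre_def)
   hence "Phi m s = Phi m t" by (simp add: Phi_def)
   thus ?thesis using close[of m s] close[of m t] m by linarith
  qed
  thus "\<exists>d>0. \<forall>s. sym_dist s t < d --> \<bar>\<phi> s - \<phi> t\<bar> < e" by (intro exI[of _ "2 powr (- real m)"]) auto
 qed
 moreover have "\<psi> t = cc + \<phi> t - \<phi> (shift t)" for t
 proof -
  \<comment> \<open>Removing the first letter changes \<open>Phi\<close> by exactly one term of the
    Birkhoff sum; the limit of this identity is the cohomological equation.\<close>
  have eq: "Phi (Suc m) t = \<psi> (cat (pre (Suc m) t) (%_. ltr0)) - cc + Phi m (shift t)" for m
  proof -
   have "shift (cat (pre (Suc m) t) (%_. ltr0)) = cat (pre m (shift t)) (%_. ltr0)"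
    by (rule ext) (auto simp: shift_def cat_def pre_def simp del: upt_Suc)
   thus ?thesis unfolding Phi_def using S_add[of 1 m "cat (pre (Suc m) t) (%_. ltr0)"]
    by (simp add: S_def algebra_simps)
  qed
  have "(%m. \<psi> (cat (pre (Suc m) t) (%_. ltr0)) - \<psi> t) \<longlonglongrightarrow> 0"
  proof (rule Lim_null_comparison)
   have "\<bar>\<psi> (cat (pre (Suc m) t) (%_. ltr0)) - \<psi> t\<bar> <= Cp*r ^ m" for m
    by (rule \<psi>_close) (auto simp: cat_def pre_def simp del: upt_Suc)
   thus "ev (%m. norm (\<psi> (cat (pre (Suc m) t) (%_. ltr0)) - \<psi> t) <= Cp*r ^ m)" by simp
  qed (rule rlim)
  hence "(%m. \<psi> (cat (pre (Suc m) t) (%_. ltr0)) - \<psi> t + \<psi> t) \<longlonglongrightarrow> 0 + \<psi> t" by (rule tendsto_add[OF _ tendsto_const])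
  hence "(%m. \<psi> (cat (pre (Suc m) t) (%_. ltr0))) \<longlonglongrightarrow> \<psi> t" by simp
  hence "(%m. Phi (Suc m) t) \<longlonglongrightarrow> \<psi> t - cc + \<phi> (shift t)" unfolding eq by (intro tendsto_intros \<phi>)
  moreover have "(%m. Phi (Suc m) t) \<longlonglongrightarrow> \<phi> t" using LIMSEQ_Suc[OF \<phi>] .
  ultimately have "\<phi> t = \<psi> t - cc + \<phi> (shift t)" using LIMSEQ_unique by blast
  thus ?thesis by simp
 qed
 ultimately show ?thesis unfolding cohomologous_to_const_def by blast
qed

end

end

text \<open>Quasi-additivity is bounded distortion plus the Gibbs bounds. Growth of \<open>g\<close>
  from below comes from branching: a word has at least two children, each with a fixed share of its
  mass, so every child loses a factor \<open>1 - ka\<close>. Unboundedness of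
  \<open>g w - H*length w\<close> is the contrapositive of the coboundary argument.\<close>

lemma gibbs_quasi_additive:
 fixes \<psi> :: "'n::finite iword => real" and K \<alpha> \<beta> :: real
 assumes holder: "holder_continuous \<psi>" and gibbs: "gibbs_measure \<psi> \<nu>"
  and K: "K > 0" and al: "\<alpha> > 0" and be: "\<beta> >= 0" and nonhom: "\<not> cohomologous_to_const \<psi>"
 obtains g :: "'n word => real" and c0 \<delta> G :: real where "quasi_additive g c0 \<delta> G" "!!(H::real) B. \<exists>w. \<bar>g w - H*length w\<bar> > B"
  "gibbs_cap \<nu> K \<alpha> \<beta> = (%w. 2 powr (- g w))"
proof -
 obtain C \<gamma> where C: "\<gamma> > 0" "!!s t. \<bar>\<psi> s - \<psi> t\<bar> <= C * sym_dist s t powr \<gamma>"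
  using holder unfolding holder_continuous_def by blast
 have hp: "holder_potential \<psi> \<bar>C\<bar> \<gamma>"
 proof
  show "\<bar>\<psi> s - \<psi> t\<bar> <= \<bar>C\<bar> * sym_dist s t powr \<gamma>" for s t
  proof -
   have "C * sym_dist s t powr \<gamma> <= \<bar>C\<bar> * sym_dist s t powr \<gamma>" by (intro mult_right_mono) auto
   thus ?thesis using C(2)[of s t] by linarith
  qed
 qed (use C in auto)
 interpret holder_potential \<psi> "\<bar>C\<bar>" \<gamma> by (rule hp)
 define Pp where "Pp = pressure \<psi>"
 obtain C2 where C2: "C2 > 0" "!!w. w ~= [] ==> (1/C2)*exp (Psi \<psi> w - real (length w)*Pp) <= measure \<nu> (cyl w)"
  "!!w. w ~= [] ==> measure \<nu> (cyl w) <= C2*exp (Psi \<psi> w - real (length w)*Pp)"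
  using gibbs unfolding gibbs_measure_def Pp_def by blast
 interpret nu: prob_space \<nu> using gibbs by (simp add: gibbs_measure_def)
 have sp: "space \<nu> = UNIV" using gibbs by (simp add: gibbs_measure_def)
 define m where "m w = measure \<nu> (cyl w)" for w
 have cyl_sets: "cyl w \<in> sets \<nu>" for w
 proof (cases "w = []")
  case True
  hence "cyl w = space \<nu>" by (simp add: cyl_def sp)
  thus ?thesis by simp
 next
  case False
  thus ?thesis using gibbs unfolding gibbs_measure_def by (auto intro: sigma_sets.Basic)
 qed
 have m_Nil: "m [] = 1" using nu.prob_space by (simp add: m_def cyl_def sp)
 have m_pos: "m w > 0" for w
 proof (cases "w = []")
  case False
  have "0 < (1/C2)*exp (Psi \<psi> w - real (length w)*Pp)" using C2(1) by simp
  thus ?thesis using C2(2)[OF False] by (simp add: m_def)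
 qed (simp add: m_Nil)
 define L where "L = \<bar>ln C2\<bar>"
 have L0: "L >= 0" by (simp add: L_def)
 define N where "N w = ln (m w)" for w
 have N: "\<bar>N w - (Psi \<psi> w - real (length w)*Pp)\<bar> <= L" for w
 proof (cases "w = []")
  case True
  thus ?thesis using L0 by (simp add: N_def m_Nil Psi_Nil)
 next
  case False
  define E where "E = Psi \<psi> w - real (length w)*Pp"
  have "ln (m w) <= ln (C2*exp E)" using C2(3)[OF False] m_pos[of w] by (simp add: m_def E_def)
  moreover have "ln (C2*exp E) = ln C2 + E" using C2(1) by (simp add: ln_mult)
  moreover have "ln ((1/C2)*exp E) <= ln (m w)"
  proof -
   have "0 < (1/C2)*exp E" using C2(1) by simp
   thus ?thesis using C2(2)[OF False] m_pos[of w] by (simp add: m_def E_def)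
  qed
  moreover have "ln ((1/C2)*exp E) = - ln C2 + E" using C2(1) by (simp add: ln_mult ln_div)
  ultimately show ?thesis unfolding N_def E_def[symmetric] L_def by linarith
 qed
 have Nqa: "\<bar>N (u @ v) - N u - N v\<bar> <= 3*B + 3*L" for u v
  using N[of "u @ v"] N[of u] N[of v] Psi_append[of u v] by (simp add: distrib_right)
 have Nb: "\<bar>N w\<bar> <= L + B + real (length w)*(M + \<bar>Pp\<bar>)" for w
 proof -
  have "\<bar>real (length w)*Pp\<bar> = real (length w)*\<bar>Pp\<bar>" by (simp add: abs_mult)
  thus ?thesis using N[of w] Psi_bound[of w] by (simp add: distrib_left) linarith
 qed
 define ka where "ka = exp (- (3*B + 3*L) - (L + B + (M + \<bar>Pp\<bar>)))"
 have kap: "ka > 0" by (simp add: ka_def)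
 have dec: "m (w @ [a]) <= (1 - ka)*m w" for w a
 proof -
  define b :: "'n letter" where "b = (if a = ltr0 then ltr1 else ltr0)"
  have ab: "a ~= b" by (auto simp: b_def ltr0_def ltr1_def fun_eq_iff)
  have "cyl (w @ [a]) \<inter> cyl (w @ [b]) = {}"
  proof -
   have "t (length w) = a" if "t \<in> cyl (w @ [a])" for t a
    using that unfolding cyl_def by (auto dest: spec[of _ "length w"])
   thus ?thesis using ab by blast
  qed
  hence "m (w @ [a]) + m (w @ [b]) = measure \<nu> (cyl (w @ [a]) \<union> cyl (w @ [b]))"
   unfolding m_def by (intro nu.finite_measure_Union[symmetric] cyl_sets)
  also have "... <= m w" unfolding m_def
   by (intro nu.finite_measure_mono cyl_sets) (auto simp: cyl_def nth_append less_Suc_eq)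
  finally have 1: "m (w @ [a]) + m (w @ [b]) <= m w" .
  have "N (w @ [b]) >= N w + (- (3*B + 3*L) - (L + B + (M + \<bar>Pp\<bar>)))"
   using Nqa[of w "[b]"] Nb[of "[b]"] by simp
  hence "exp (N w + (- (3*B + 3*L) - (L + B + (M + \<bar>Pp\<bar>)))) <= exp (N (w @ [b]))" by simp
  hence "m w*ka <= m (w @ [b])" unfolding exp_add ka_def[symmetric] N_def using m_pos by simp
  thus ?thesis using 1 by (simp add: algebra_simps)
 qed
 have k1: "1 - ka > 0"
 proof -
  have "0 < (1 - ka)*m []" using dec[of "[]" ltr0] m_pos[of "[] @ [ltr0]"] by linarith
  thus ?thesis by (simp add: m_Nil)
 qed
 have mdec: "m w <= (1 - ka) ^ length w" for w
 proof (induction w rule: rev_induct)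
  case (snoc a w)
  have "m (w @ [a]) <= (1 - ka)*m w" by (rule dec)
  also have "... <= (1 - ka)*(1 - ka) ^ length w" using snoc k1 by (intro mult_left_mono) auto
  finally show ?case by simp
 qed (simp add: m_Nil)
 define \<delta>' where "\<delta>' = - ln (1 - ka)"
 have d': "\<delta>' > 0" using kap k1 by (simp add: \<delta>'_def)
 have Ndec: "N w <= - \<delta>'*length w" for w
 proof -
  have "N w <= ln ((1 - ka) ^ length w)" unfolding N_def using mdec[of w] m_pos[of w] k1 by (subst ln_le_cancel_iff) auto
  also have "... = - \<delta>'*length w" using k1 by (simp add: ln_realpow \<delta>'_def)
  finally show ?thesis .
 qed
 define k0 where "k0 = - log 2 K"
 define g where "g w = k0 + (\<beta>*real (length w) - \<alpha>*N w)/ln 2" for w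
 define c0 where "c0 = \<bar>k0\<bar> + \<alpha>*(3*B + 3*L)/ln 2"
 have l2: "ln 2 > (0::real)" by simp
 have BL: "0 <= B" "0 <= M" using B(1) Cp by (simp_all add: M_def)
 show ?thesis
 proof (rule that[of g c0 "\<alpha>*\<delta>'/ln 2" "(\<alpha>*(M + \<bar>Pp\<bar>) + \<beta>)/ln 2"])
  show "quasi_additive g c0 (\<alpha>*\<delta>'/ln 2) ((\<alpha>*(M + \<bar>Pp\<bar>) + \<beta>)/ln 2)"
  proof (rule quasi_additive.intro)
   fix u v w :: "'n word"
   have "\<bar>\<alpha>*(N (u @ v) - N u - N v)\<bar> <= \<alpha>*(3*B + 3*L)"
    using Nqa[of u v] al by (simp add: abs_mult)
   hence "\<bar>- (\<alpha>*(N (u @ v) - N u - N v))/ln 2\<bar> <= \<alpha>*(3*B + 3*L)/ln 2"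
    by (simp add: abs_divide divide_right_mono)
   moreover have "g (u @ v) - g u - g v = - k0 + - (\<alpha>*(N (u @ v) - N u - N v))/ln 2"
    by (simp add: g_def algebra_simps add_divide_distrib diff_divide_distrib)
   ultimately show "\<bar>g (u @ v) - g u - g v\<bar> <= c0" unfolding c0_def by linarith
   have cn: "\<alpha>*(3*B + 3*L)/ln 2 >= 0" using BL L0 al by simp
   have "\<alpha>*N w <= \<alpha>*(- \<delta>'*length w)" using Ndec[of w] al by (intro mult_left_mono) auto
   have "\<alpha>*\<delta>'*length w <= \<beta>*real (length w) - \<alpha>*N w"
   proof -
    have "0 <= \<beta>*real (length w)" using be by simp
    moreover have "\<alpha>*(- \<delta>'*length w) = - (\<alpha>*\<delta>'*length w)" by simp
    ultimately show ?thesis using \<open>\<alpha>*N w <= \<alpha>*(- \<delta>'*length w)\<close> by linarith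
   qed
   hence "\<alpha>*\<delta>'*length w/ln 2 <= (\<beta>*real (length w) - \<alpha>*N w)/ln 2" by (intro divide_right_mono) auto
   thus "\<alpha>*\<delta>'/ln 2*real (length w) - c0 <= g w" using cn unfolding g_def c0_def by simp
   have "\<alpha>*(- N w) <= \<alpha>*(L + B + real (length w)*(M + \<bar>Pp\<bar>))" using Nb[of w] al by (intro mult_left_mono) auto
   also have "... <= \<alpha>*(3*B + 3*L + real (length w)*(M + \<bar>Pp\<bar>))" using BL L0 al by (intro mult_left_mono) auto
   finally have "\<beta>*real (length w) - \<alpha>*N w <= (\<alpha>*(M + \<bar>Pp\<bar>) + \<beta>)*length w + \<alpha>*(3*B + 3*L)"
    by (simp add: algebra_simps)
   hence "(\<beta>*real (length w) - \<alpha>*N w)/ln 2 <= ((\<alpha>*(M + \<bar>Pp\<bar>) + \<beta>)*length w + \<alpha>*(3*B + 3*L))/ln 2"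
    by (intro divide_right_mono) auto
   show "g w <= (\<alpha>*(M + \<bar>Pp\<bar>) + \<beta>)/ln 2*real (length w) + c0"
   proof -
    have "(a*n + b)/ln 2 = a/ln 2*n + b/ln 2" for a b n :: real by (simp add: add_divide_distrib)
    hence "((\<alpha>*(M + \<bar>Pp\<bar>) + \<beta>)*length w + \<alpha>*(3*B + 3*L))/ln 2
     = (\<alpha>*(M + \<bar>Pp\<bar>) + \<beta>)/ln 2*length w + \<alpha>*(3*B + 3*L)/ln 2" .
    with \<open>(\<beta>*real (length w) - \<alpha>*N w)/ln 2 <= _\<close> show ?thesis unfolding g_def c0_def by linarith
   qed
  qed (use al d' in auto)
  show "\<exists>w. \<bar>g w - H*real (length w)\<bar> > Bd" for H Bd :: real
  proof (rule ccontr)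
   assume "\<not> (\<exists>w. \<bar>g w - H*real (length w)\<bar> > Bd)"
   hence gb: "\<bar>g w - H*real (length w)\<bar> <= Bd" for w by (meson not_le)
   \<comment> \<open>The constant around which the Birkhoff sums would stay, obtained by converting
     \<open>g\<close> back to \<open>\<psi>\<close> through \<open>\<alpha>\<close>,
     \<open>\<beta>\<close>, \<open>ln 2\<close> and the pressure.\<close>
   define cc where "cc = (\<beta> - ln 2*H)/\<alpha> + Pp"
   have "\<bar>S n t - real n*cc\<bar> <= ln 2*(Bd + \<bar>k0\<bar>)/\<alpha> + L + B" for n and t :: "'n iword"
   proof -
    define w where "w = map t [0..<n]"
    have tw: "t \<in> cyl w" by (simp add: w_def cyl_def)
    have lw: "length w = n" by (simp add: w_def)
    have "\<beta>*n - \<alpha>*N w = ln 2*(g w - k0)" by (simp add: g_def lw)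
    hence "\<alpha>*N w - n*(\<beta> - ln 2*H) = - (ln 2*((g w - H*n) - k0))" by (simp add: algebra_simps)
    moreover have "\<alpha>*(N w - n*((\<beta> - ln 2*H)/\<alpha>)) = \<alpha>*N w - n*(\<beta> - ln 2*H)"
    proof -
     have "x*(y - n*(t/x)) = x*y - n*t" if "x > 0" for x y t :: real using that by (simp add: right_diff_distrib)
     thus ?thesis using al by blast
    qed
    ultimately have "N w - n*((\<beta> - ln 2*H)/\<alpha>) = - (ln 2*((g w - H*n) - k0))/\<alpha>"
     using al by (metis nonzero_mult_div_cancel_left less_numeral_extra(3))
    hence "\<bar>N w - n*((\<beta> - ln 2*H)/\<alpha>)\<bar> = ln 2*\<bar>(g w - H*n) - k0\<bar>/\<alpha>"
     using al by (simp add: abs_mult abs_divide)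
    also have "... <= ln 2*(Bd + \<bar>k0\<bar>)/\<alpha>"
     using gb[of w] al unfolding lw by (intro divide_right_mono mult_left_mono) auto
    finally have "\<bar>N w - n*((\<beta> - ln 2*H)/\<alpha>)\<bar> <= ln 2*(Bd + \<bar>k0\<bar>)/\<alpha>" .
    moreover have "real n*cc = n*((\<beta> - ln 2*H)/\<alpha>) + n*Pp" by (simp add: cc_def distrib_left)
    ultimately show ?thesis using N[of w] Psi_close[OF tw] unfolding lw by linarith
   qed
   hence "cohomologous_to_const \<psi>" by (rule bounded_sums_imp_cohomologous)
   thus False using nonhom by simp
  qed
  show "gibbs_cap \<nu> K \<alpha> \<beta> = (%w. 2 powr (- g w))"
  proof
   fix w
   have "2 powr (- g w) = exp (- g w*ln 2)" by (simp add: powr_def)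
   also have "- g w*ln 2 = ln K + \<alpha>*N w + - \<beta>*real (length w)"
   proof -
    have "g w*ln 2 = k0*ln 2 + (\<beta>*real (length w) - \<alpha>*N w)" by (simp add: g_def distrib_right)
    moreover have "k0*ln 2 = - ln K" by (simp add: k0_def log_def)
    ultimately show ?thesis by simp
   qed
   also have "exp \<dots> = exp (ln K)*exp (\<alpha>*N w)*exp (- \<beta>*real (length w))" by (simp only: exp_add)
   also have "... = gibbs_cap \<nu> K \<alpha> \<beta> w"
    using K m_pos[of w] by (simp add: gibbs_cap_def powr_def N_def m_def)
   finally show "gibbs_cap \<nu> K \<alpha> \<beta> w = 2 powr (- g w)" by simp
  qed
 qed
qed

lemma rational_left:
 fixes \<phi> :: "real => real"
 assumes "isCont \<phi> x" "a < \<phi> x" "lo < x"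
 obtains q where "q \<in> \<rat>" "lo < q" "q < x" "a < \<phi> q"
proof -
 have "(\<phi> \<longlongrightarrow> \<phi> x) (at x)" using assms(1) by (simp add: isCont_def)
 from order_tendstoD(1)[OF this assms(2)] obtain d where d: "d > 0" "!!y. y ~= x ==> dist y x < d ==> a < \<phi> y"
  unfolding eventually_at by auto
 have "max lo (x - d) < x" using assms(3) d by simp
 then obtain q where q: "q \<in> \<rat>" "max lo (x - d) < q" "q < x" using Rats_dense_in_real by blast
 show ?thesis by (rule that[OF q(1)]) (use q d(2)[of q] in \<open>auto simp: dist_real_def\<close>)
qed

lemma rational_right:
 fixes \<phi> :: "real => real"
 assumes "isCont \<phi> x" "a < \<phi> x" "x < hi"
 obtains q where "q \<in> \<rat>" "x < q" "q < hi" "a < \<phi> q"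
proof -
 have "(\<phi> \<longlongrightarrow> \<phi> x) (at x)" using assms(1) by (simp add: isCont_def)
 from order_tendstoD(1)[OF this assms(2)] obtain d where d: "d > 0" "!!y. y ~= x ==> dist y x < d ==> a < \<phi> y"
  unfolding eventually_at by auto
 have "x < min hi (x + d)" using assms(3) d by simp
 then obtain q where q: "q \<in> \<rat>" "x < q" "q < min hi (x + d)" using Rats_dense_in_real by blast
 show ?thesis by (rule that[OF q(1)]) (use q d(2)[of q] in \<open>auto simp: dist_real_def\<close>)
qed

section \<open>Typical samples\<close>

context sampled_tree
begin

text \<open>Three families of almost sure properties over countable parameter sets: moments,
  descendants of a given type, and steps of the construction. \<open>qt\<close> is added to the
  rationals since it may be irrational and gives the optimal cost; \<open>n + 4\<close> keeps the
  tolerance of \<open>step\<close> at most \<open>1/4\<close>.\<close>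

definition good :: "'w => bool" where
 "good om \<longleftrightarrow>
  (\<forall>q\<in>\<rat>. \<forall>q'\<in>\<rat>. \<forall>n::nat. q' > qt --> (\<exists>j0. \<forall>j\<ge>j0. \<forall>V. (\<forall>u\<in>words j. V u ~= [] & p (u @ V u) om) -->
    (\<Sum>u\<in>words j. 2 powr (- (q - q')*g u - q'*g (u @ V u))) <= 2 powr (- real j*(T q + c - inverse (real (Suc n)))))) \<and>
  (\<forall>q\<in>insert qt \<rat>. \<forall>y\<in>\<rat>. \<forall>n::nat. y > 0 & y*(en q - (\<bar>q\<bar> + 1)*inverse (real (Suc n)) - c) > c -->
    (\<exists>m0. \<forall>m\<ge>m0. \<forall>w. y*length w <= m --> (\<exists>v\<in>typed m (T' q) (inverse (real (Suc n))). p (w @ v) om))) \<and>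
  (\<forall>q\<in>\<rat>. \<forall>\<rho>\<in>\<rat>. \<forall>s\<in>\<rat>. \<forall>n::nat. 0 <= \<rho> & \<rho> <= HHt & 0 <= s & s < en q + \<rho>*qt - c -->
    (\<exists>l0. \<forall>l\<ge>l0. step om (T' q) \<rho> (inverse (real (n + 4))) s l))"

lemma AE_good: "AE om in P. good om"
 unfolding good_def
proof (intro AE_conjI)
 show "AE om in P. \<forall>q\<in>\<rat>. \<forall>q'\<in>\<rat>. \<forall>n::nat. q' > qt --> (\<exists>j0. \<forall>j\<ge>j0. \<forall>V. (\<forall>u\<in>words j. V u ~= [] & p (u @ V u) om) -->
    (\<Sum>u\<in>words j. 2 powr (- (q - q')*g u - q'*g (u @ V u))) <= 2 powr (- real j*(T q + c - inverse (real (Suc n)))))"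
  by (intro AE_ball_countable' countable_rat AE_all_countable[THEN iffD2] allI AE_impI AE_moments) auto
 show "AE om in P. \<forall>q\<in>insert qt \<rat>. \<forall>y\<in>\<rat>. \<forall>n::nat. y > 0 & y*(en q - (\<bar>q\<bar> + 1)*inverse (real (Suc n)) - c) > c -->
    (\<exists>m0. \<forall>m\<ge>m0. \<forall>w. y*length w <= m --> (\<exists>v\<in>typed m (T' q) (inverse (real (Suc n))). p (w @ v) om))"
  by (intro AE_ball_countable' countable_insert countable_rat AE_all_countable[THEN iffD2] allI AE_impI AE_descendants) auto
 show "AE om in P. \<forall>q\<in>\<rat>. \<forall>\<rho>\<in>\<rat>. \<forall>s\<in>\<rat>. \<forall>n::nat. 0 <= \<rho> & \<rho> <= HHt & 0 <= s & s < en q + \<rho>*qt - c -->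
    (\<exists>l0. \<forall>l\<ge>l0. step om (T' q) \<rho> (inverse (real (n + 4))) s l)"
  by (intro AE_ball_countable' countable_rat AE_all_countable[THEN iffD2] allI AE_impI AE_step) (auto simp: field_simps)
qed

lemma eventually_linear: "(d::real) > 0 ==> ev (%n. K <= real n*d)"
 by (rule eventually_mult_ge)

section \<open>Consequences for a fixed typical sample\<close>

context
 fixes om
 assumes good: "good om"
begin

text \<open>\<open>c/(en q - c)\<close> is the critical relative depth of survivors of type
  \<open>T' q\<close>. Just beyond it a rational \<open>y\<close> and a tolerance \<open>e\<close>
  can be chosen that satisfy the strict inequality required in \<open>good\<close>.\<close>

lemma descend:
 assumes q: "q = qt \<or> q \<in> \<rat>" and en: "en q > c" and e: "ep > 0"
 obtains y e m0 where "c/(en q - c) < y" "y < c/(en q - c) + ep" "0 < e" "e < ep"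
  "!!m w. m >= m0 ==> y*length w <= real m ==> \<exists>v\<in>typed m (T' q) e. p (w @ v) om"
proof -
 have "c/(en q - c) < c/(en q - c) + ep" using e by simp
 then obtain y where y: "y \<in> \<rat>" "c/(en q - c) < y" "y < c/(en q - c) + ep" using Rats_dense_in_real by blast
 have "0 < c/(en q - c)" using en c_bounds by simp
 hence y0: "y > 0" using y by linarith
 have yc: "y*(en q - c) > c" using y(2) en by (simp add: pos_divide_less_eq)
 define e1 where "e1 = min ep ((y*(en q - c) - c)/(y*(\<bar>q\<bar> + 1)))"
 have yq: "y*(\<bar>q\<bar> + 1) > 0" using y0 by (intro mult_pos_pos) auto
 have e1: "e1 > 0" using e yc yq by (simp add: e1_def)
 obtain n where n: "inverse (real (Suc n)) < e1" using reals_Archimedean[OF e1] by blast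
 define e2 where "e2 = inverse (real (Suc n))"
 have e2: "0 < e2" "e2 < ep" using n by (simp_all add: e2_def e1_def del: of_nat_Suc)
 have "e2 < (y*(en q - c) - c)/(y*(\<bar>q\<bar> + 1))" using n by (simp add: e2_def e1_def del: of_nat_Suc)
 hence "e2*(y*(\<bar>q\<bar> + 1)) < y*(en q - c) - c" using yq by (simp add: pos_less_divide_eq)
 hence "y*(en q - (\<bar>q\<bar> + 1)*e2 - c) > c" by (simp add: algebra_simps)
 moreover have "\<forall>q\<in>insert qt \<rat>. \<forall>y\<in>\<rat>. \<forall>n::nat. y > 0 & y*(en q - (\<bar>q\<bar> + 1)*inverse (real (Suc n)) - c) > c -->
    (\<exists>m0. \<forall>m\<ge>m0. \<forall>w. y*length w <= m --> (\<exists>v\<in>typed m (T' q) (inverse (real (Suc n))). p (w @ v) om))"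
  using good unfolding good_def by blast
 moreover have "q \<in> insert qt \<rat>" using q by blast
 ultimately have "\<exists>m0. \<forall>m\<ge>m0. \<forall>w. y*length w <= m --> (\<exists>v\<in>typed m (T' q) e2. p (w @ v) om)"
  using y(1) y0 unfolding e2_def by blast
 thus ?thesis using that[OF y(2,3) e2] by blast
qed

lemma survivor: "\<exists>v. v ~= [] & p (w @ v) om"
proof -
 obtain y e m0 where *: "c/(en qt - c) < y" "!!m w. m >= m0 ==> y*length w <= real m ==> \<exists>v\<in>typed m (T' qt) e. p (w @ v) om"
  by (rule descend[of qt 1]) (use en_qt in auto)
 define m where "m = max (max m0 1) (nat \<lceil>y*length w\<rceil>)"
 have "y*length w <= real (nat \<lceil>y*length w\<rceil>)" by linarith
 also have "... <= real m" by (simp add: m_def)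
 finally obtain v where v: "v \<in> typed m (T' qt) e" "p (w @ v) om" using *(2)[of m w] unfolding m_def by fastforce
 have "v ~= []" using v(1) by (auto simp: typed_def words_def m_def)
 thus ?thesis using v(2) by blast
qed

lemma best_survivor: "\<exists>v. (v ~= [] & p (w @ v) om) & (\<forall>v'. v' ~= [] & p (w @ v') om --> g (w @ v) <= g (w @ v'))"
proof -
 obtain v0 where v0: "v0 ~= []" "p (w @ v0) om" using survivor by blast
 define X where "X = {v. v ~= [] & p (w @ v) om & g (w @ v) <= g (w @ v0)}"
 have fX: "finite X" by (rule finite_subset[OF _ finite_g_less[of w "g (w @ v0)"]]) (auto simp: X_def)
 have "v0 \<in> X" using v0 by (simp add: X_def)
 hence "Min ((%v. g (w @ v)) ` X) \<in> (%v. g (w @ v)) ` X" using fX by (intro Min_in) auto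
 then obtain v where v1: "v \<in> X" "Min ((%v. g (w @ v)) ` X) = g (w @ v)" by blast
 have v: "v \<in> X" "!!v'. v' \<in> X ==> g (w @ v) <= g (w @ v')"
  using v1(1) fX unfolding v1(2)[symmetric] by (auto intro: Min_le)
 have "g (w @ v) <= g (w @ v')" if "v' ~= []" "p (w @ v') om" for v'
 proof (cases "g (w @ v') <= g (w @ v0)")
  case True
  thus ?thesis using v(2)[of v'] that by (simp add: X_def)
 next
  case False
  thus ?thesis using v(1) by (simp add: X_def)
 qed
 thus ?thesis using v(1) unfolding X_def by blast
qed

definition opt :: "'n word => 'n word" where
 "opt w = (SOME v. (v ~= [] & p (w @ v) om) & (\<forall>v'. v' ~= [] & p (w @ v') om --> g (w @ v) <= g (w @ v')))"

text \<open>Minus the binary logarithm of the sampled capacity, by \<open>Mcap_eq\<close>.\<close>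

definition fm :: "'n word => real" where "fm w = g (w @ opt w)"

lemma opt: "opt w ~= []" "p (w @ opt w) om" "v' ~= [] ==> p (w @ v') om ==> fm w <= g (w @ v')"
 using someI_ex[OF best_survivor[of w]] unfolding opt_def[symmetric] fm_def by blast+

lemma Mcap_eq: "Mcap (%w. 2 powr (- g w)) (%w. p w om) w = 2 powr (- fm w)"
 unfolding Mcap_def
proof (rule cSup_eq_maximum)
 show "2 powr (- fm w) \<in> {2 powr (- g (w @ v)) |v. v ~= [] & p (w @ v) om}" using opt(1,2)[of w] unfolding fm_def by blast
 show "x <= 2 powr (- fm w)" if "x \<in> {2 powr (- g (w @ v)) |v. v ~= [] & p (w @ v) om}" for x
  using that opt(3)[of _ w] by auto
qed

lemma fm_ge: "g w - 2*c0 <= fm w" "\<delta>*length w - c0 <= fm w"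
proof -
 have "0 <= \<delta>*length (opt w)" using \<delta>_pos by simp
 hence "g (opt w) >= - c0" using g_ge[of "opt w"] by linarith
 thus "g w - 2*c0 <= fm w" using qa[of w "opt w"] unfolding fm_def by linarith
 have "\<delta>*length w <= \<delta>*length (w @ opt w)" using \<delta>_pos by (intro mult_left_mono) auto
 thus "\<delta>*length w - c0 <= fm w" using g_ge[of "w @ opt w"] unfolding fm_def by linarith
qed

lemma moments:
 assumes "q \<in> \<rat>" "q' \<in> \<rat>" "q' > qt" "e > 0"
 shows "ev (%j. (\<Sum>u\<in>words j. 2 powr (- (q - q')*g u - q'*fm u)) <= 2 powr (- real j*(T q + c - e)))"
proof -
 obtain n where n: "inverse (real (Suc n)) < e" using reals_Archimedean[OF assms(4)] by blast
 have "\<exists>j0. \<forall>j\<ge>j0. \<forall>V. (\<forall>u\<in>words j. V u ~= [] & p (u @ V u) om) -->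
    (\<Sum>u\<in>words j. 2 powr (- (q - q')*g u - q'*g (u @ V u))) <= 2 powr (- real j*(T q + c - inverse (real (Suc n))))"
  using good assms(1-3) unfolding good_def by blast
 then obtain j0 where j0: "!!j V. j >= j0 ==> (\<forall>u\<in>words j. V u ~= [] & p (u @ V u) om) ==>
    (\<Sum>u\<in>words j. 2 powr (- (q - q')*g u - q'*g (u @ V u))) <= 2 powr (- real j*(T q + c - inverse (real (Suc n))))" by blast
 have "(\<Sum>u\<in>words j. 2 powr (- (q - q')*g u - q'*fm u)) <= 2 powr (- real j*(T q + c - e))" if "j >= j0" for j
 proof -
  have "(\<Sum>u\<in>words j. 2 powr (- (q - q')*g u - q'*fm u)) <= 2 powr (- real j*(T q + c - inverse (real (Suc n))))"
   using j0[OF that, of opt] opt(1,2) unfolding fm_def by blast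
  also have "... <= 2 powr (- real j*(T q + c - e))"
  proof (rule powr_mono)
   have "real j*(T q + c - e) <= real j*(T q + c - inverse (real (Suc n)))" using n by (intro mult_left_mono) auto
   thus "- real j*(T q + c - inverse (real (Suc n))) <= - real j*(T q + c - e)" by simp
  qed simp
  finally show ?thesis .
 qed
 thus ?thesis unfolding eventually_sequentially by blast
qed

text \<open>Survivors of type \<open>Ht\<close> at relative depth close to \<open>HHt/Ht\<close>
  exist below every word and cost about \<open>HHt\<close> per letter, so asymptotically no word
  pays more.\<close>

lemma fm_upper:
 assumes e: "ep > 0"
 shows "ev (%j. \<forall>w\<in>words j. fm w <= g w + real j*(HHt + ep))"
proof -
 have Ht0: "Ht > 0" using hmin_less[of qt] hmin_pos by (simp add: Ht_def)
 have en0: "en qt - c = qt*Ht" using qt by (simp add: en_def Ht_def)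
 have y0: "c/(en qt - c) = HHt/Ht" using en0 qt by (simp add: HHt_def)
 define x where "x = HHt/Ht"
 have x0: "x > 0" using HHt_pos Ht0 by (simp add: x_def)
 have xH: "x*Ht = HHt" using Ht0 by (simp add: x_def)
 define e1 where "e1 = min 1 (ep/(3*(Ht + x + 1)))"
 have den: "Ht + x + 1 > 0" using Ht0 x0 by linarith
 have e1: "e1 > 0" "e1 <= 1" using e den by (simp_all add: e1_def)
 have "e1*(3*(Ht + x + 1)) <= ep"
 proof -
  have "e1 <= ep/(3*(Ht + x + 1))" by (simp add: e1_def)
  thus ?thesis using den by (simp add: pos_le_divide_eq)
 qed
 hence e1': "e1*(Ht + x + 1) <= ep/3" by linarith
 obtain y e m0 where ye: "c/(en qt - c) < y" "y < c/(en qt - c) + e1" "0 < e" "e < e1"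
  "!!m w. m >= m0 ==> y*length w <= real m ==> \<exists>v\<in>typed m (T' qt) e. p (w @ v) om"
  by (rule descend[OF disjI1[OF refl] en_qt e1(1)]) blast
 have y: "x < y" "y < x + e1" using ye(1,2) unfolding y0 x_def by auto
 have yH: "y*(Ht + e) <= HHt + ep/3"
 proof -
  have "y*(Ht + e) <= (x + e1)*(Ht + e1)" using y ye(3,4) x0 Ht0 by (intro mult_mono) auto
  also have "... = HHt + e1*(Ht + x + e1)" using xH by (simp add: algebra_simps)
  also have "e1*(Ht + x + e1) <= e1*(Ht + x + 1)" using e1 by (intro mult_left_mono) auto
  finally show ?thesis using e1' by linarith
 qed
 have "ev (%j. c0 + (Ht + 1) <= real j*(ep/3))" using e by (intro eventually_linear) simp
 moreover have "ev (%j. real (m0 + 1) <= real j*y)" using y x0 by (intro eventually_linear) simp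
 ultimately show ?thesis
 proof eventually_elim
  case (elim j)
  show ?case
  proof
   fix w :: "'n word" assume w: "w \<in> words j"
   define m where "m = nat \<lceil>y*real j\<rceil>"
   have yj: "0 <= y*real j" using y x0 by simp
   have m: "y*real j <= real m" "real m <= y*real j + 1" unfolding m_def using yj by linarith+
   have "real (m0 + 1) <= real m" using m(1) elim(2) by (simp add: mult.commute)
   hence mm: "m >= m0" "m >= 1" by linarith+
   obtain v where v: "v \<in> typed m (T' qt) e" "p (w @ v) om" using ye(5)[OF mm(1), of w] m(1) w by (auto simp: words_def)
   have vne: "v ~= []" using v(1) mm by (auto simp: typed_def words_def)
   have "\<bar>g v - real m*Ht\<bar> <= e*real m" using v(1) by (simp add: typed_def Ht_def)
   hence "g v <= real m*(Ht + e)" by (simp add: abs_le_iff algebra_simps)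
   also have "... <= (y*real j + 1)*(Ht + e)" using m(2) Ht0 ye(3) by (intro mult_right_mono) auto
   also have "... = real j*(y*(Ht + e)) + (Ht + e)" by (simp add: algebra_simps)
   also have "... <= real j*(HHt + ep/3) + (Ht + 1)" using yH ye(4) e1(2) by (intro add_mono mult_left_mono) auto
   finally have "g v <= real j*(HHt + ep/3) + (Ht + 1)" .
   moreover have "fm w <= g (w @ v)" by (rule opt(3)[OF vne v(2)])
   moreover have "g (w @ v) <= g w + g v + c0" using qa[of w v] by linarith
   moreover have "real j*(HHt + ep/3) + real j*(ep/3) <= real j*(HHt + ep)"
    using e by (simp add: algebra_simps)
   ultimately show "fm w <= g w + real j*(HHt + ep)" using elim(1) by linarith
  qed
 qed
qed

text \<open>Typed words of length \<open>l\<close> near \<open>j/(1 + y)\<close> each have a sampled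
  descendant of the same type, and cutting it at length \<open>j\<close> gives a word with
  \<open>fm\<close> at most about \<open>j*T' q\<close>. There are about
  \<open>2 powr (l*en q)\<close> of them, and \<open>1/(1 + y)\<close> is close to
  \<open>(en q - c)/en q\<close>.\<close>

lemma many_light:
 assumes q: "q \<in> \<rat>" "en q > c" and e: "ep > 0"
 shows "ev (%j. 2 powr (real j*(en q - c - ep)) <= real (card {x \<in> words j. fm x <= real j*(T' q + ep)}))"
proof -
 define h where "h = T' q"
 define E where "E = en q"
 define a where "a = E - c"
 have a0: "a > 0" using q by (simp add: a_def E_def)
 have E0: "E > 0" using a0 c_bounds by (simp add: a_def)
 define e1 where "e1 = min (ep/3) (ep/(3*(E + \<bar>q\<bar> + 2)))"
 have den: "E + \<bar>q\<bar> + 2 > 0" using E0 by linarith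
 have e1: "e1 > 0" "e1 <= ep/3"
  using e den unfolding e1_def by (simp, intro min.cobounded1)
 have "e1 <= ep/(3*(E + \<bar>q\<bar> + 2))" by (simp add: e1_def)
 hence "e1*(3*(E + \<bar>q\<bar> + 2)) <= ep" using den by (simp add: pos_le_divide_eq)
 hence e1': "e1*E + e1*(\<bar>q\<bar> + 1) + e1 <= ep/3" by (simp add: algebra_simps)
 obtain y e m0 where ye: "c/(en q - c) < y" "y < c/(en q - c) + e1" "0 < e" "e < e1"
  "!!m w. m >= m0 ==> y*length w <= real m ==> \<exists>v\<in>typed m (T' q) e. p (w @ v) om"
  by (rule descend[OF disjI2[OF q(1)] q(2) e1(1)]) blast
 have y: "c/a < y" "y < c/a + e1" using ye(1,2) by (simp_all add: a_def E_def)
 have ca: "c/a > 0" using a0 c_bounds by simp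
 have y0: "y > 0" using y ca by linarith
 have frac: "E/(1 + y) >= a - e1*E"
 proof -
  have "(a - e1*E)*(1 + y) <= E"
  proof (cases "a - e1*E <= 0")
   case True
   hence "(a - e1*E)*(1 + y) <= 0" using y0 by (intro mult_nonpos_nonneg) auto
   thus ?thesis using E0 by linarith
  next
   case False
   hence "(a - e1*E)*(1 + y) <= (a - e1*E)*(1 + (c/a + e1))" using y by (intro mult_left_mono) auto
   also have "... = (a + c) + a*e1 - e1*E*(1 + c/a + e1)"
   proof -
    have "(a - e1*E)*(1 + (k + e1)) = (a + a*k) + a*e1 - e1*E*(1 + k + e1)" for k by (simp add: algebra_simps)
    moreover have "a*(c/a) = c" using a0 by simp
    ultimately show ?thesis by metis
   qed
   also have "... <= E"
   proof -
    have "a*e1 <= E*e1" using c_bounds e1 by (intro mult_right_mono) (auto simp: a_def)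
    moreover have "e1*E*1 <= e1*E*(1 + c/a + e1)" using e1 E0 ca by (intro mult_left_mono) auto
    ultimately show ?thesis by (simp add: a_def mult.commute)
   qed
   finally show ?thesis .
  qed
  thus ?thesis using y0 by (simp add: pos_le_divide_eq)
 qed
 obtain n0 where n0: "!!n. n >= n0 ==> real (card (typed n (T' q) e1)) >= 2 powr (n*(en q - (\<bar>q\<bar> + 1)*e1))"
  using card_typed[OF e1(1), of q] unfolding eventually_sequentially ent_eq_en by blast
 have y1: "1/(1 + y) > 0" using y0 by simp
 have h0: "h > 0" using T'_ge[of q] \<delta>_pos by (simp add: h_def)
 have "ev (%j. real (n0 + 1) <= real j*(1/(1 + y)))" by (rule eventually_linear[OF y1])
 moreover have "ev (%j. real m0 <= real j*(y/(1 + y)))" using y0 by (intro eventually_linear) simp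
 moreover have "ev (%j. E <= real j*(ep/3))" using e by (intro eventually_linear) simp
 moreover have "ev (%j. h + ep + c0 <= real j*(ep/3))" using e by (intro eventually_linear) simp
 ultimately show ?thesis
 proof eventually_elim
  case (elim j)
  define l where "l = nat \<lfloor>real j*(1/(1 + y))\<rfloor>"
  have l: "real l <= real j*(1/(1 + y))" "real j*(1/(1 + y)) <= real l + 1"
   using y1 unfolding l_def by (auto simp: of_nat_nat)
  have ln: "l >= n0" using l(2) elim(1) by linarith
  have lj: "real l*(1 + y) <= real j"
   using l(1) y0 by (simp add: pos_le_divide_eq)
  have "real l*1 <= real l*(1 + y)" using y0 by (intro mult_left_mono) auto
  hence lj': "l <= j" using lj by simp
  \<comment> \<open>The survivor is one letter longer than \<open>j\<close>, since the sampled
    descendant has to be proper.\<close>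
  define m where "m = j + 1 - l"
  have m: "real m = real j + 1 - real l" using lj' by (simp add: m_def)
  have ylm: "y*real l <= real m" using lj m by (simp add: algebra_simps)
  have "real j*(y/(1 + y)) = real j - real j*(1/(1 + y))"
  proof -
   have "1 + y ~= 0" using y0 by linarith
   hence "y/(1 + y) = 1 - 1/(1 + y)" by (simp add: field_simps)
   thus ?thesis by (simp add: right_diff_distrib)
  qed
  hence mm: "m >= m0" using l(1) elim(2) m by linarith
  have "\<exists>v. v \<in> typed m (T' q) e & p (w @ v) om" if "w \<in> typed l (T' q) e1" for w
   using ye(5)[OF mm, of w] ylm that by (auto simp: typed_def words_def)
  then obtain v where v: "!!w. w \<in> typed l (T' q) e1 ==> v w \<in> typed m (T' q) e"
   "!!w. w \<in> typed l (T' q) e1 ==> p (w @ v w) om" by metis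
  define \<phi> where "\<phi> w = take j (w @ v w)" for w
  have len: "length w = l" "length (v w) = m" if "w \<in> typed l (T' q) e1" for w
   using that v(1)[OF that] by (auto simp: typed_def words_def)
  have inj: "inj_on \<phi> (typed l (T' q) e1)"
  proof (rule inj_onI)
   fix w w' assume w: "w \<in> typed l (T' q) e1" "w' \<in> typed l (T' q) e1" "\<phi> w = \<phi> w'"
   have a: "take l (\<phi> w) = w" "take l (\<phi> w') = w'" using len[OF w(1)] len[OF w(2)] lj' by (simp_all add: \<phi>_def)
   have "take l (\<phi> w) = take l (\<phi> w')" by (simp only: w(3))
   thus "w = w'" by (simp only: a)
  qed
  have "\<phi> ` typed l (T' q) e1 \<subseteq> {x \<in> words j. fm x <= real j*(T' q + ep)}"
  proof
   fix x assume "x \<in> \<phi> ` typed l (T' q) e1"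
   then obtain w where w: "w \<in> typed l (T' q) e1" "x = \<phi> w" by blast
   have lx: "length (w @ v w) = j + 1" using len[OF w(1)] lj' by (simp add: m_def)
   have xs: "x @ drop j (w @ v w) = w @ v w" unfolding w(2) \<phi>_def by (rule append_take_drop_id)
   have "length (drop j (w @ v w)) = 1" unfolding length_drop lx by simp
   hence "drop j (w @ v w) ~= []" by (metis list.size(3) zero_neq_one)
   hence "fm x <= g (w @ v w)" using opt(3)[of "drop j (w @ v w)" x] v(2)[OF w(1)] unfolding xs by simp
   also have "... <= g w + g (v w) + c0" using qa[of w "v w"] by linarith
   also have "... <= real l*(h + e1) + real m*(h + e1) + c0"
   proof -
    have "\<bar>g w - real l*h\<bar> <= e1*real l" using w(1) by (simp add: typed_def h_def)
    moreover have "\<bar>g (v w) - real m*h\<bar> <= e*real m" using v(1)[OF w(1)] by (simp add: typed_def h_def)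
    moreover have "e*real m <= e1*real m" using ye(4) by (intro mult_right_mono) auto
    ultimately show ?thesis by (simp add: algebra_simps abs_le_iff)
   qed
   also have "... = real j*(h + e1) + (h + e1) + c0" unfolding m by (simp add: algebra_simps)
   also have "... <= real j*(h + ep/3) + real j*(ep/3)"
   proof -
    have "real j*(h + e1) <= real j*(h + ep/3)" using e1 by (intro mult_left_mono) auto
    thus ?thesis using elim(4) e1 e by linarith
   qed
   also have "... <= real j*(T' q + ep)" using e by (simp add: h_def algebra_simps)
   finally have "fm x <= real j*(T' q + ep)" .
   moreover have "x \<in> words j" using lx by (simp add: w(2) \<phi>_def words_def)
   ultimately show "x \<in> {x \<in> words j. fm x <= real j*(T' q + ep)}" by simp
  qed
  hence "card (\<phi> ` typed l (T' q) e1) <= card {x \<in> words j. fm x <= real j*(T' q + ep)}" by (intro card_mono) auto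
  hence "real (card (typed l (T' q) e1)) <= real (card {x \<in> words j. fm x <= real j*(T' q + ep)})"
   unfolding card_image[OF inj] by simp
  moreover have "2 powr (real j*(en q - c - ep)) <= 2 powr (real l*(en q - (\<bar>q\<bar> + 1)*e1))"
  proof (rule powr_mono)
   have "E*(real j*(1/(1 + y))) <= E*(real l + 1)" using l(2) E0 by (intro mult_left_mono) auto
   moreover have "E*(real j*(1/(1 + y))) = real j*(E/(1 + y))" by simp
   moreover have "real j*(a - e1*E) <= real j*(E/(1 + y))" using frac by (intro mult_left_mono) auto
   moreover have "real l*((\<bar>q\<bar> + 1)*e1) <= real j*((\<bar>q\<bar> + 1)*e1)" using lj' e1 by (intro mult_right_mono) auto
   moreover have "real j*(e1*E + e1*(\<bar>q\<bar> + 1) + e1) <= real j*(ep/3)" using e1' by (intro mult_left_mono) auto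
   moreover have "0 <= real j*e1" "0 <= real j*ep" using e e1 by simp_all
   ultimately show "real j*(en q - c - ep) <= real l*(en q - (\<bar>q\<bar> + 1)*e1)"
    using elim(3) unfolding a_def E_def by (simp add: algebra_simps)
  qed simp
  ultimately show ?case using n0[OF ln] by linarith
 qed
qed

section \<open>The \<open>L\<^sup>q\<close> spectrum\<close>

definition Zm :: "real => nat => real" where "Zm q j = (\<Sum>w\<in>words j. 2 powr (- q*fm w))"

lemma powr_log_C: "2 powr log 2 (C q) = C q" "2 powr (- log 2 (C q)) = 1/C q"
 by (simp_all add: powr_minus divide_inverse)

lemma powr_minus_one: "2 powr (- 1) = (1/2 :: real)"
 by (simp add: powr_minus)

lemma Zm_pos: "Zm q j > 0"
 unfolding Zm_def by (intro sum_pos) auto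

lemma eventually_fm_nonneg: "ev (%j. \<forall>w\<in>words j. 0 <= fm w)"
proof -
 have "ev (%j. c0 <= real j*\<delta>)" using \<delta>_pos by (rule eventually_linear)
 thus ?thesis
 proof eventually_elim
  case (elim j)
  show ?case
  proof
   fix w :: "'n word" assume "w \<in> words j"
   hence "\<delta>*real j - c0 <= fm w" using fm_ge(2)[of w] by (simp add: words_def)
   thus "0 <= fm w" using elim by (simp add: mult.commute)
  qed
 qed
qed

text \<open>Together with the continuity of \<open>F\<close> this extends the estimates from
  rational to real \<open>q\<close>.\<close>

lemma Zm_antimono: "ev (%j. \<forall>q r. q <= r --> Zm r j <= Zm q j)"
 using eventually_fm_nonneg
proof eventually_elim
 case (elim j)
 show ?case
 proof (intro allI impI)
  fix q r :: real assume qr: "q <= r"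
  show "Zm r j <= Zm q j" unfolding Zm_def
  proof (intro sum_mono powr_mono)
   fix w :: "'n word" assume "w \<in> words j"
   hence "q*fm w <= r*fm w" using elim qr by (intro mult_right_mono) auto
   thus "- r*fm w <= - q*fm w" by simp
  qed simp
 qed
qed

lemma Zm_le_beyond_qt:
 assumes "q \<in> \<rat>" "q > qt" "e > 0"
 shows "ev (%j. Zm q j <= 2 powr (- real j*(T q + c - e)))"
 using moments[OF assms(1) assms(1) assms(2) assms(3)] by (simp add: Zm_def)

lemma Zm_le_neg:
 assumes q: "q <= 0" and e: "e > 0"
 shows "ev (%j. Zm q j <= 2 powr (- real j*(T q + HHt*q - e)))"
proof -
 define ep where "ep = e/(2*(\<bar>q\<bar> + 1))"
 have ep: "ep > 0" using e by (simp add: ep_def add_nonneg_pos)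
 have "(\<bar>q\<bar> + 1)*ep = e/2"
 proof -
  have "\<bar>q\<bar> + 1 ~= 0" by linarith
  thus ?thesis by (simp add: ep_def divide_simps)
 qed
 hence qe: "- q*ep <= e/2" using ep q by (simp add: algebra_simps)
 have "ev (%j. log 2 (C q) <= real j*(e/2))" using e by (intro eventually_linear) simp
 with fm_upper[OF ep] show ?thesis
 proof eventually_elim
  case (elim j)
  have "Zm q j <= (\<Sum>w\<in>words j. 2 powr (- q*(real j*(HHt + ep)))*W q w)" unfolding Zm_def
  proof (rule sum_mono)
   fix w :: "'n word" assume "w \<in> words j"
   hence "- q*fm w <= - q*(g w + real j*(HHt + ep))" using elim(1) q by (intro mult_left_mono) auto
   also have "... = - q*(real j*(HHt + ep)) + - q*g w" by (simp add: algebra_simps)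
   finally have "2 powr (- q*fm w) <= 2 powr (- q*(real j*(HHt + ep)) + - q*g w)" by (intro powr_mono) auto
   thus "2 powr (- q*fm w) <= 2 powr (- q*(real j*(HHt + ep)))*W q w" by (simp only: powr_add W_def)
  qed
  also have "... = 2 powr (- q*(real j*(HHt + ep)))*Z q j" by (simp add: Z_def sum_distrib_left)
  also have "... <= 2 powr (- q*(real j*(HHt + ep)))*(C q*2 powr (- real j*T q))"
   by (intro mult_left_mono Z_upper) simp
  also have "... = 2 powr (- q*(real j*(HHt + ep)) + (log 2 (C q) + - real j*T q))"
   by (simp only: powr_add powr_log_C)
  also have "... <= 2 powr (- real j*(T q + HHt*q - e))"
  proof (rule powr_mono)
   have "real j*(- q*ep) <= real j*(e/2)" using qe by (intro mult_left_mono) auto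
   thus "- q*(real j*(HHt + ep)) + (log 2 (C q) + - real j*T q) <= - real j*(T q + HHt*q - e)"
    using elim(2) by (simp add: algebra_simps)
  qed simp
  finally show ?case .
 qed
qed

text \<open>Interpolation between \<open>W q\<close> and the moment at \<open>q' > qt\<close>, with
  \<open>\<theta> = q/q'\<close>. Words with \<open>q'*(fm w - g w)\<close> at least
  \<open>c*j\<close> are bounded by their weight, the others by the moment. Both parts give the
  exponent \<open>T q + c*\<theta>\<close>, and \<open>c*\<theta>\<close> tends to
  \<open>HHt*q\<close> as \<open>q'\<close> decreases to \<open>qt\<close>.\<close>

lemma Zm_le_below_qt:
 assumes q: "q \<in> \<rat>" "0 <= q" "q <= qt" and e: "e > 0"
 shows "ev (%j. Zm q j <= 2 powr (- real j*(T q + HHt*q - e)))"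
proof -
 have "isCont (%x. c*q/x) qt" using qt by (intro continuous_intros) auto
 moreover have "HHt*q - e/3 < c*q/qt" using e by (simp add: HHt_def)
 moreover have "qt < qt + 1" by simp
 ultimately obtain q' where q': "q' \<in> \<rat>" "qt < q'" "HHt*q - e/3 < c*q/q'" by (rule rational_right)
 have q'0: "q' > 0" using q' qt by linarith
 define \<theta> where "\<theta> = q/q'"
 have th: "0 <= \<theta>" "\<theta> <= 1" "\<theta>*q' = q" using q q' q'0 by (auto simp: \<theta>_def)
 have cth: "HHt*q - e/3 <= c*\<theta>" using q'(3) by (simp add: \<theta>_def)
 have e3: "e/3 > 0" using e by simp
 have "ev (%j. K + 2 powr (real j*(e/3)) <= 2 powr (real j*(2*e/3)))" for K :: real
  using e by real_asymp
 hence "ev (%j. C q + 2 powr (real j*(e/3)) <= 2 powr (real j*(2*e/3)))" .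
 with moments[OF q(1) q'(1,2) e3] show ?thesis
 proof eventually_elim
  case (elim j)
  have "Zm q j <= (\<Sum>w\<in>words j. 2 powr (- c*\<theta>*real j)*W q w
    + 2 powr (c*(1 - \<theta>)*real j)*2 powr (- (q - q')*g w - q'*fm w))" unfolding Zm_def
  proof (rule sum_mono)
   fix w :: "'n word" assume "w \<in> words j"
   define f where "f = fm w"
   define z where "z = q'*(f - g w)"
   have qf: "- q*f = - q*g w - \<theta>*z" unfolding z_def th(3)[symmetric] by (simp add: algebra_simps)
   have pos: "0 <= 2 powr (- c*\<theta>*real j)*W q w" "0 <= 2 powr (c*(1 - \<theta>)*real j)*2 powr (- (q - q')*g w - q'*f)"
    by simp_all
   show "2 powr (- q*fm w) <= 2 powr (- c*\<theta>*real j)*W q w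
    + 2 powr (c*(1 - \<theta>)*real j)*2 powr (- (q - q')*g w - q'*fm w)" unfolding f_def[symmetric]
   proof (cases "c*real j <= z")
    case True
    hence "\<theta>*(c*real j) <= \<theta>*z" using th by (intro mult_left_mono)
    hence "- q*f <= - c*\<theta>*real j + - q*g w" unfolding qf by (simp add: mult_ac)
    hence "2 powr (- q*f) <= 2 powr (- c*\<theta>*real j + - q*g w)" by (intro powr_mono) auto
    also have "... = 2 powr (- c*\<theta>*real j)*W q w" by (simp only: powr_add W_def)
    finally show "2 powr (- q*f) <= 2 powr (- c*\<theta>*real j)*W q w
    + 2 powr (c*(1 - \<theta>)*real j)*2 powr (- (q - q')*g w - q'*f)" using pos(2) by linarith
   next
    case False
    hence "(1 - \<theta>)*z <= (1 - \<theta>)*(c*real j)" using th by (intro mult_left_mono) auto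
    moreover have "- (q - q')*g w - q'*f = - q*g w - z" by (simp add: z_def algebra_simps)
    ultimately have "- q*f <= c*(1 - \<theta>)*real j + (- (q - q')*g w - q'*f)" unfolding qf by (simp add: algebra_simps)
    hence "2 powr (- q*f) <= 2 powr (c*(1 - \<theta>)*real j + (- (q - q')*g w - q'*f))" by (intro powr_mono) auto
    also have "... = 2 powr (c*(1 - \<theta>)*real j)*2 powr (- (q - q')*g w - q'*f)" by (rule powr_add)
    finally show "2 powr (- q*f) <= 2 powr (- c*\<theta>*real j)*W q w
    + 2 powr (c*(1 - \<theta>)*real j)*2 powr (- (q - q')*g w - q'*f)" using pos(1) by linarith
   qed
  qed
  also have "... = 2 powr (- c*\<theta>*real j)*Z q j
   + 2 powr (c*(1 - \<theta>)*real j)*(\<Sum>w\<in>words j. 2 powr (- (q - q')*g w - q'*fm w))"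
   by (simp add: Z_def sum.distrib sum_distrib_left)
  also have "... <= 2 powr (- c*\<theta>*real j)*(C q*2 powr (- real j*T q))
   + 2 powr (c*(1 - \<theta>)*real j)*2 powr (- real j*(T q + c - e/3))"
   by (intro add_mono mult_left_mono Z_upper elim(1)) auto
  also have "... = 2 powr (- real j*(T q + c*\<theta>))*(C q + 2 powr (real j*(e/3)))"
  proof -
   have "2 powr (- c*\<theta>*real j)*2 powr (- real j*T q) = 2 powr (- real j*(T q + c*\<theta>))"
    unfolding powr_add[symmetric] by (simp add: algebra_simps)
   moreover have "2 powr (c*(1 - \<theta>)*real j)*2 powr (- real j*(T q + c - e/3)) = 2 powr (- real j*(T q + c*\<theta>))*2 powr (real j*(e/3))"
    unfolding powr_add[symmetric] by (simp add: algebra_simps)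
   ultimately show ?thesis by (simp add: distrib_left)
  qed
  also have "... <= 2 powr (- real j*(T q + c*\<theta>))*2 powr (real j*(2*e/3))"
   using elim(2) by (intro mult_left_mono) auto
  also have "... = 2 powr (- real j*(T q + c*\<theta>) + real j*(2*e/3))" by (rule powr_add[symmetric])
  also have "... <= 2 powr (- real j*(T q + HHt*q - e))"
  proof (rule powr_mono)
   have "real j*(HHt*q - e/3) <= real j*(c*\<theta>)" using cth by (intro mult_left_mono) auto
   thus "- real j*(T q + c*\<theta>) + real j*(2*e/3) <= - real j*(T q + HHt*q - e)" by (simp add: algebra_simps)
  qed simp
  finally show ?case .
 qed
qed

text \<open>A single term of the sum at a parameter \<open>x < r\<close> is at most the whole, so
  every word satisfies \<open>fm w >= j*\<beta>\<close> with \<open>\<beta>\<close> close to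
  \<open>Hl\<close>. The remaining power \<open>q - x\<close> is then bounded termwise.\<close>

lemma Zm_le_beyond_ql:
 assumes r: "qt < r" "T r + c = Hl*r" and q: "r <= q" and e: "e > 0"
 shows "ev (%j. Zm q j <= 2 powr (- real j*(Hl*q - e)))"
proof -
 have r0: "r > 0" and q0: "q > 0" using r q qt by linarith+
 have "isCont (%x. (T x + c)/x) r" using r0 isCont_T[of r] by (intro continuous_intros) auto
 moreover have "Hl - e/(2*q) < (T r + c)/r" using r0 q0 e r(2) by simp
 ultimately obtain x where x: "x \<in> \<rat>" "qt < x" "x < r" "Hl - e/(2*q) < (T x + c)/x" using r(1) by (rule rational_left)
 have x0: "x > 0" using x qt by linarith
 define e1 where "e1 = e*x/(2*q)"
 have e1: "e1 > 0" using e x0 q0 by (simp add: e1_def)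
 define \<beta> where "\<beta> = (T x + c - e1)/x"
 have bx: "x*\<beta> = T x + c - e1" using x0 by (simp add: \<beta>_def)
 have "\<beta> = (T x + c)/x - e/(2*q)" using x0 by (simp add: \<beta>_def e1_def diff_divide_distrib)
 hence "q*(Hl - e/(2*q) - e/(2*q)) <= q*\<beta>" using x(4) q0 by (intro mult_left_mono) auto
 moreover have "q*(Hl - e/(2*q) - e/(2*q)) = Hl*q - e"
 proof -
  have "q ~= 0" using q0 by simp
  hence "q*(e/(2*q)) = e/2" by simp
  thus ?thesis unfolding right_diff_distrib by (simp add: mult.commute)
 qed
 ultimately have qb: "Hl*q - e <= q*\<beta>" by simp
 have qx: "q - x >= 0" using q x by linarith
 from Zm_le_beyond_qt[OF x(1,2) e1] show ?thesis
 proof eventually_elim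
  case (elim j)
  have Zx: "Zm x j <= 2 powr (- (x*(real j*\<beta>)))"
  proof -
   have eq: "- real j*(T x + c - e1) = - (x*(real j*\<beta>))" unfolding bx[symmetric] by (simp add: mult_ac)
   show ?thesis using elim by (simp only: eq)
  qed
  have "Zm q j <= (\<Sum>w\<in>words j. 2 powr (- x*fm w)*2 powr (- (q - x)*(real j*\<beta>)))" unfolding Zm_def
  proof (rule sum_mono)
   fix w :: "'n word" assume w: "w \<in> words j"
   have "2 powr (- x*fm w) <= Zm x j" unfolding Zm_def using w by (intro member_le_sum) auto
   hence "2 powr (- x*fm w) <= 2 powr (- (x*(real j*\<beta>)))" using Zx by linarith
   hence "x*(real j*\<beta>) <= x*fm w" by simp
   hence "real j*\<beta> <= fm w" using x0 by simp
   hence "(q - x)*(real j*\<beta>) <= (q - x)*fm w" using qx by (intro mult_left_mono)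
   hence "- q*fm w <= - x*fm w + - (q - x)*(real j*\<beta>)" by (simp add: algebra_simps)
   hence "2 powr (- q*fm w) <= 2 powr (- x*fm w + - (q - x)*(real j*\<beta>))" by (intro powr_mono) auto
   thus "2 powr (- q*fm w) <= 2 powr (- x*fm w)*2 powr (- (q - x)*(real j*\<beta>))" by (simp only: powr_add)
  qed
  also have "... = Zm x j*2 powr (- (q - x)*(real j*\<beta>))" by (simp add: Zm_def sum_distrib_right)
  also have "... <= 2 powr (- (x*(real j*\<beta>)))*2 powr (- (q - x)*(real j*\<beta>))" using Zx by (intro mult_right_mono) auto
  also have "... = 2 powr (- (real j*(q*\<beta>)))" unfolding powr_add[symmetric] by (simp add: algebra_simps)
  also have "... <= 2 powr (- real j*(Hl*q - e))"
  proof (rule powr_mono)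
   have "real j*(Hl*q - e) <= real j*(q*\<beta>)" using qb by (intro mult_left_mono) auto
   thus "- (real j*(q*\<beta>)) <= - real j*(Hl*q - e)" by simp
  qed simp
  finally show ?case .
 qed
qed

lemma Zm_ge_mid:
 assumes q: "0 <= q" and e: "e > 0"
 shows "ev (%j. 2 powr (- real j*(T q + HHt*q + e)) <= Zm q j)"
proof -
 define ep where "ep = e/(2*(q + 1))"
 have ep: "ep > 0" using e q by (simp add: ep_def)
 have qe: "q*ep <= e/2"
 proof -
  have "(q + 1)*ep = e/2"
  proof -
   have "q + 1 ~= 0" using q by linarith
   thus ?thesis by (simp add: ep_def divide_simps)
  qed
  thus ?thesis using ep by (simp add: algebra_simps)
 qed
 have "ev (%j. log 2 (C q) <= real j*(e/2))" using e by (intro eventually_linear) simp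
 with fm_upper[OF ep] show ?thesis
 proof eventually_elim
  case (elim j)
  have "2 powr (- real j*(T q + HHt*q + e)) <= 2 powr (- q*(real j*(HHt + ep)) + - log 2 (C q) + - real j*T q)"
  proof (rule powr_mono)
   have "real j*(q*ep) <= real j*(e/2)" using qe by (intro mult_left_mono) auto
   thus "- real j*(T q + HHt*q + e) <= - q*(real j*(HHt + ep)) + - log 2 (C q) + - real j*T q"
    using elim(2) by (simp add: algebra_simps)
  qed simp
  also have "... = 2 powr (- q*(real j*(HHt + ep)))*(2 powr (- real j*T q)/C q)"
   by (simp only: powr_add powr_log_C powr_minus_one) simp
  also have "... <= 2 powr (- q*(real j*(HHt + ep)))*Z q j"
  proof (rule mult_left_mono)
   show "2 powr (- real j*T q)/C q <= Z q j"
    using Z_bounds(2)[where q = q and n = j] by (simp add: pos_divide_le_eq mult.commute)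
  qed simp
  also have "... = (\<Sum>w\<in>words j. 2 powr (- q*(real j*(HHt + ep)))*W q w)" by (simp add: Z_def sum_distrib_left)
  also have "... <= Zm q j" unfolding Zm_def
  proof (rule sum_mono)
   fix w :: "'n word" assume "w \<in> words j"
   hence "q*fm w <= q*(g w + real j*(HHt + ep))" using elim(1) q by (intro mult_left_mono) auto
   hence "- q*(real j*(HHt + ep)) + - q*g w <= - q*fm w" by (simp add: algebra_simps)
   hence "2 powr (- q*(real j*(HHt + ep)) + - q*g w) <= 2 powr (- q*fm w)" by (intro powr_mono) auto
   thus "2 powr (- q*(real j*(HHt + ep)))*W q w <= 2 powr (- q*fm w)" by (simp only: powr_add W_def)
  qed
  finally show ?case .
 qed
qed

text \<open>For negative \<open>q\<close> a large cost helps. By the moment at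
  \<open>q' > qt\<close>, the words whose cost is at most \<open>HHt - ep\<close> per letter carry
  at most half of the lower bound for \<open>Z q j\<close>, and the other words give the
  estimate.\<close>

lemma Zm_ge_neg:
 assumes q: "q \<in> \<rat>" "q <= 0" and e: "e > 0"
 shows "ev (%j. 2 powr (- real j*(T q + HHt*q + e)) <= Zm q j)"
proof -
 define ep where "ep = e/(2*(\<bar>q\<bar> + 1))"
 have ep: "ep > 0" using e by (simp add: ep_def add_nonneg_pos)
 have "(\<bar>q\<bar> + 1)*ep = e/2"
 proof -
  have "\<bar>q\<bar> + 1 ~= 0" by linarith
  thus ?thesis by (simp add: ep_def divide_simps)
 qed
 hence qe: "- q*ep <= e/2" using ep q by (simp add: algebra_simps)
 define ka where "ka = qt*ep/3"
 have k: "ka > 0" using qt ep by (simp add: ka_def)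
 have "qt < qt + ka/(HHt + 1)" using k HHt_pos by simp
 then obtain q' where q': "q' \<in> \<rat>" "qt < q'" "q' < qt + ka/(HHt + 1)" using Rats_dense_in_real by blast
 have q'0: "q' > 0" using q' qt by linarith
 have "(q' - qt)*HHt <= ka/(HHt + 1)*(HHt + 1)" using q' HHt_pos k by (intro mult_mono) auto
 also have "... = ka" using HHt_pos by simp
 finally have "(q' - qt)*HHt <= ka" .
 moreover have "qt*ep <= q'*ep" using q' ep by (intro mult_right_mono) auto
 moreover have "qt*ep = 3*ka" by (simp add: ka_def)
 ultimately have ex: "q'*(HHt - ep) <= c - 2*ka" using HHt_qt by (simp add: algebra_simps)
 have "ev (%j. log 2 (C q) + 1 <= real j*ka)" using k by (rule eventually_linear)
 moreover have "ev (%j. log 2 (C q) + 1 <= real j*(e/2))" using e by (intro eventually_linear) simp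
 ultimately show ?thesis using moments[OF q(1) q'(1,2) k]
 proof eventually_elim
  case (elim j)
  define Bd where "Bd = {w \<in> words j. fm w - g w <= real j*(HHt - ep)}"
  have "(\<Sum>w\<in>Bd. W q w) <= (\<Sum>w\<in>Bd. 2 powr (q'*(real j*(HHt - ep)))*2 powr (- (q - q')*g w - q'*fm w))"
  proof (rule sum_mono)
   fix w assume "w \<in> Bd"
   hence "q'*(fm w - g w) <= q'*(real j*(HHt - ep))" using q'0 by (intro mult_left_mono) (auto simp: Bd_def)
   hence "- q*g w <= q'*(real j*(HHt - ep)) + (- (q - q')*g w - q'*fm w)" by (simp add: algebra_simps)
   hence "2 powr (- q*g w) <= 2 powr (q'*(real j*(HHt - ep)) + (- (q - q')*g w - q'*fm w))" by (intro powr_mono) auto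
   thus "W q w <= 2 powr (q'*(real j*(HHt - ep)))*2 powr (- (q - q')*g w - q'*fm w)" by (simp only: powr_add W_def)
  qed
  also have "... <= (\<Sum>w\<in>words j. 2 powr (q'*(real j*(HHt - ep)))*2 powr (- (q - q')*g w - q'*fm w))"
   by (intro sum_mono2) (auto simp: Bd_def)
  also have "... = 2 powr (q'*(real j*(HHt - ep)))*(\<Sum>w\<in>words j. 2 powr (- (q - q')*g w - q'*fm w))"
   by (simp add: sum_distrib_left)
  also have "... <= 2 powr (q'*(real j*(HHt - ep)))*2 powr (- real j*(T q + c - ka))"
   using elim(3) by (intro mult_left_mono) auto
  also have "... = 2 powr (q'*(real j*(HHt - ep)) + - real j*(T q + c - ka))" by (rule powr_add[symmetric])
  also have "... <= 2 powr (- log 2 (C q) + - real j*T q + - 1)"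
  proof (rule powr_mono)
   have "real j*(q'*(HHt - ep)) <= real j*(c - 2*ka)" using ex by (intro mult_left_mono) auto
   thus "q'*(real j*(HHt - ep)) + - real j*(T q + c - ka) <= - log 2 (C q) + - real j*T q + - 1"
    using elim(1) by (simp add: algebra_simps)
  qed simp
  also have "... = (2 powr (- real j*T q)/C q)/2"
   by (simp only: powr_add powr_log_C powr_minus_one) simp
  finally have B1: "(\<Sum>w\<in>Bd. W q w) <= (2 powr (- real j*T q)/C q)/2" .
  have Zl: "2 powr (- real j*T q)/C q <= Z q j"
   using Z_bounds(2)[where q = q and n = j] by (simp add: pos_divide_le_eq mult.commute)
  have "Z q j = (\<Sum>w\<in>Bd. W q w) + (\<Sum>w\<in>words j - Bd. W q w)"
   unfolding Z_def by (subst sum.subset_diff[of Bd]) (auto simp: Bd_def)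
  hence B2: "(2 powr (- real j*T q)/C q)/2 <= (\<Sum>w\<in>words j - Bd. W q w)" using B1 Zl by linarith
  have "2 powr (- real j*(T q + HHt*q + e)) <= 2 powr (- q*(real j*(HHt - ep)) + (- log 2 (C q) + - real j*T q + - 1))"
  proof (rule powr_mono)
   have "real j*(- q*ep) <= real j*(e/2)" using qe by (intro mult_left_mono) auto
   thus "- real j*(T q + HHt*q + e) <= - q*(real j*(HHt - ep)) + (- log 2 (C q) + - real j*T q + - 1)"
    using elim(2) by (simp add: algebra_simps)
  qed simp
  also have "... = 2 powr (- q*(real j*(HHt - ep)))*((2 powr (- real j*T q)/C q)/2)"
   by (simp only: powr_add powr_log_C powr_minus_one) simp
  also have "... <= 2 powr (- q*(real j*(HHt - ep)))*(\<Sum>w\<in>words j - Bd. W q w)" by (intro mult_left_mono B2) simp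
  also have "... = (\<Sum>w\<in>words j - Bd. 2 powr (- q*(real j*(HHt - ep)))*W q w)" by (simp add: sum_distrib_left)
  also have "... <= (\<Sum>w\<in>words j - Bd. 2 powr (- q*fm w))"
  proof (rule sum_mono)
   fix w assume "w \<in> words j - Bd"
   hence "- q*(g w + real j*(HHt - ep)) <= - q*fm w" using q by (intro mult_left_mono) (auto simp: Bd_def)
   hence "- q*(real j*(HHt - ep)) + - q*g w <= - q*fm w" by (simp add: algebra_simps)
   hence "2 powr (- q*(real j*(HHt - ep)) + - q*g w) <= 2 powr (- q*fm w)" by (intro powr_mono) auto
   thus "2 powr (- q*(real j*(HHt - ep)))*W q w <= 2 powr (- q*fm w)" by (simp only: powr_add W_def)
  qed
  also have "... <= Zm q j" unfolding Zm_def by (intro sum_mono2) auto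
  finally show ?case .
 qed
qed

lemma Zm_ge_light:
 assumes q: "q \<in> \<rat>" "en q > c" and x: "x >= 0" and e: "e > 0"
 shows "ev (%j. 2 powr (- real j*(x*T' q - (en q - c) + e)) <= Zm x j)"
proof -
 define ep where "ep = e/(x + 1)"
 have x1: "x + 1 > 0" using x by linarith
 have ep: "ep > 0" using e x1 by (simp add: ep_def)
 have xe: "(x + 1)*ep = e" using x1 by (simp add: ep_def)
 from many_light[OF q ep] show ?thesis
 proof eventually_elim
  case (elim j)
  define L where "L = {w \<in> words j. fm w <= real j*(T' q + ep)}"
  have "2 powr (- real j*(x*T' q - (en q - c) + e)) = 2 powr (real j*(en q - c - ep))*2 powr (- x*(real j*(T' q + ep)))"
   unfolding powr_add[symmetric] xe[symmetric] by (simp add: algebra_simps)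
  also have "... <= real (card L)*2 powr (- x*(real j*(T' q + ep)))"
   using elim unfolding L_def by (intro mult_right_mono) auto
  also have "... = (\<Sum>w\<in>L. 2 powr (- x*(real j*(T' q + ep))))" by simp
  also have "... <= (\<Sum>w\<in>L. 2 powr (- x*fm w))"
  proof (intro sum_mono powr_mono)
   fix w assume "w \<in> L"
   hence "x*fm w <= x*(real j*(T' q + ep))" using x by (intro mult_left_mono) (auto simp: L_def)
   thus "- x*(real j*(T' q + ep)) <= - x*fm w" by simp
  qed simp
  also have "... <= Zm x j" unfolding Zm_def by (intro sum_mono2) (auto simp: L_def)
  finally show ?case .
 qed
qed

lemma Zm_le_rational:
 assumes q: "q \<in> \<rat>" and e: "e > 0"
 shows "ev (%j. Zm q j <= 2 powr (- real j*(F q - e)))"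
proof -
 consider "q <= 0" | "0 <= q" "q <= qt" | "qt < q" "ereal q < ql" | "qt < q" "ql <= ereal q" by (meson linorder_le_cases not_le)
 thus ?thesis
 proof cases
  case 1
  thus ?thesis using Zm_le_neg[OF 1 e] qt by (simp add: F_def)
 next
  case 2
  thus ?thesis using Zm_le_below_qt[OF q 2 e] by (simp add: F_def)
 next
  case 3
  thus ?thesis using Zm_le_beyond_qt[OF q 3(1) e] by (simp add: F_def)
 next
  case 4
  then obtain r where r: "qt < r" "r <= q" "F q = Hl*q" "T r + c = Hl*r" using F_beyond by blast
  show ?thesis unfolding r(3) by (rule Zm_le_beyond_ql[OF r(1,4,2) e])
 qed
qed

lemma Zm_ge_rational:
 assumes q: "q \<in> \<rat>" and e: "e > 0"
 shows "ev (%j. 2 powr (- real j*(F q + e)) <= Zm q j)"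
proof -
 consider "q <= 0" | "0 <= q" "q <= qt" | "qt < q" "ereal q < ql" | "qt < q" "ql <= ereal q" by (meson linorder_le_cases not_le)
 thus ?thesis
 proof cases
  case 1
  thus ?thesis using Zm_ge_neg[OF q 1 e] qt by (simp add: F_def)
 next
  case 2
  thus ?thesis using Zm_ge_mid[OF 2(1) e] by (simp add: F_def)
 next
  case 3
  have en: "en q > c"
  proof (rule Hl_cases)
   assume a: "ql = \<infinity>" "ereal c <= D hmin"
   have "ereal c <= ereal ((q + 1)*hmin - T (q + 1))" using a(2) D_le[of hmin "q + 1"] by (rule order_trans)
   also have "(q + 1)*hmin - T (q + 1) < (q + 1)*T' (q + 1) - T (q + 1)" using 3 qt hmin_less[of "q + 1"] by simp
   finally have "c < en (q + 1)" by (simp add: en_def)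
   also have "... < en q" using 3 qt by (intro en_strict) auto
   finally show ?thesis .
  next
   fix r assume r: "qt < r" "en r = c" "ql = ereal r"
   have "en r < en q" using 3 qt r by (intro en_strict) auto
   thus ?thesis using r by simp
  qed
  have "q >= 0" using 3 qt by linarith
  from Zm_ge_light[OF q en this e] 3 show ?thesis by (simp add: F_def en_def)
 next
  case 4
  then obtain r where r: "qt < r" "r <= q" "en r = c" "Hl = T' r" "F q = Hl*q" using F_beyond by blast
  have q0: "q > 0" using 4 qt by linarith
  \<comment> \<open>At \<open>r\<close> itself \<open>en r = c\<close>, where
    \<open>many_light\<close> does not apply; a rational \<open>x\<close> just below
    \<open>r\<close> has \<open>en x > c\<close> and \<open>T' x\<close> close to
    \<open>Hl\<close>.\<close>
  have "isCont (%x. - T' x) r" using isCont_T'[of r] by simp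
  moreover have "- (Hl + e/(2*q)) < - T' r" using r q0 e by simp
  ultimately obtain x where x: "x \<in> \<rat>" "qt < x" "x < r" "- (Hl + e/(2*q)) < - T' x" using r(1) by (rule rational_left)
  have enx: "en x > c" using en_strict[of x r] x qt r by simp
  have "q >= 0" "e/2 > 0" using q0 e by simp_all
  from Zm_ge_light[OF x(1) enx this] show ?thesis
  proof eventually_elim
   case (elim j)
   have "q*T' x <= q*(Hl + e/(2*q))" using x(4) q0 by (intro mult_left_mono) auto
   also have "... = Hl*q + e/2" using q0 by (simp add: field_simps)
   finally have "q*T' x - (en x - c) + e/2 <= F q + e" unfolding r(5) using enx by linarith
   hence "real j*(q*T' x - (en x - c) + e/2) <= real j*(F q + e)" by (intro mult_left_mono) auto
   hence "2 powr (- real j*(F q + e)) <= 2 powr (- real j*(q*T' x - (en x - c) + e/2))" by (intro powr_mono) auto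
   thus ?case using elim by linarith
  qed
 qed
qed

lemma Zm_le:
 assumes e: "e > 0"
 shows "ev (%j. Zm q j <= 2 powr (- real j*(F q - e)))"
proof -
 have "F q - e/2 < F q" "q - 1 < q" using e by simp_all
 then obtain x where x: "x \<in> \<rat>" "x < q" "F q - e/2 < F x" using rational_left[OF isCont_F] by metis
 have e2: "e/2 > 0" using e by simp
 from Zm_le_rational[OF x(1) e2] Zm_antimono show ?thesis
 proof eventually_elim
  case (elim j)
  have "Zm q j <= 2 powr (- real j*(F x - e/2))" using elim x(2) by (meson less_imp_le order_trans)
  also have "... <= 2 powr (- real j*(F q - e))"
  proof (rule powr_mono)
   have "real j*(F q - e) <= real j*(F x - e/2)" using x(3) by (intro mult_left_mono) auto
   thus "- real j*(F x - e/2) <= - real j*(F q - e)" by simp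
  qed simp
  finally show ?case .
 qed
qed

lemma Zm_ge:
 assumes e: "e > 0"
 shows "ev (%j. 2 powr (- real j*(F q + e)) <= Zm q j)"
proof -
 have c': "isCont (%x. - F x) q" using isCont_F[of q] by simp
 have "- (F q + e/2) < - F q" "q < q + 1" using e by simp_all
 then obtain x where x: "x \<in> \<rat>" "q < x" "- (F q + e/2) < - F x" using rational_right[OF c'] by metis
 have e2: "e/2 > 0" using e by simp
 from Zm_ge_rational[OF x(1) e2] Zm_antimono show ?thesis
 proof eventually_elim
  case (elim j)
  have "2 powr (- real j*(F q + e)) <= 2 powr (- real j*(F x + e/2))"
  proof (rule powr_mono)
   have "real j*(F x + e/2) <= real j*(F q + e)" using x(3) by (intro mult_left_mono) auto
   thus "- real j*(F q + e) <= - real j*(F x + e/2)" by simp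
  qed simp
  also have "... <= Zm q j" using elim x(2) by (meson less_imp_le order_trans)
  finally show ?case .
 qed
qed

abbreviation cap :: "'n word => real" where
 "cap \<equiv> Mcap (%w. 2 powr (- g w)) (%w. p w om)"

lemma tau_j_cap: "tau_j cap j q = - (1/real j)*log 2 (Zm q j)"
 unfolding tau_j_def Zm_def Mcap_eq by (simp add: powr_powr mult.commute)

lemma tau_j_lim: "(%j. tau_j cap j q) \<longlonglongrightarrow> F q"
proof (rule tendstoI)
 fix e :: real assume e: "e > 0"
 hence e2: "e/2 > 0" by simp
 from Zm_le[OF e2, of q] Zm_ge[OF e2, of q] eventually_gt_at_top[of 0]
 show "ev (%j. dist (tau_j cap j q) (F q) < e)"
 proof eventually_elim
  case (elim j)
  have j: "real j > 0" using elim by simp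
  have "log 2 (Zm q j) <= log 2 (2 powr (- real j*(F q - e/2)))" using elim(1) Zm_pos[of q j] by (subst log_le_cancel_iff) auto
  hence 1: "log 2 (Zm q j) <= - real j*(F q - e/2)" by simp
  have "log 2 (2 powr (- real j*(F q + e/2))) <= log 2 (Zm q j)" using elim(2) Zm_pos[of q j] by (subst log_le_cancel_iff) auto
  hence 2: "- real j*(F q + e/2) <= log 2 (Zm q j)" by simp
  define x where "x = - (1/real j)*log 2 (Zm q j)"
  have "log 2 (Zm q j) = - real j*x" using j by (simp add: x_def)
  hence "real j*(F q - e/2) <= real j*x" "real j*x <= real j*(F q + e/2)" using 1 2 by simp_all
  hence "F q - e/2 <= x" "x <= F q + e/2" using j by simp_all
  thus ?case unfolding tau_j_cap x_def[symmetric] dist_real_def using e by linarith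
 qed
qed

section \<open>Upper bounds for the Hausdorff dimensions\<close>

text \<open>The words with \<open>fm w\<close> near \<open>j*H\<close> are counted by
  \<open>Zm q j\<close> for every \<open>q\<close>, and the infimum over \<open>q\<close> is the
  Legendre transform. Closeness at infinitely many scales suffices, so the bound covers level sets
  of both local dimensions. A negative exponent leaves no such word at large \<open>j\<close>, so
  \<open>E\<close> is empty; this produces the value \<open>- \<infinity>\<close>.\<close>

lemma hdim_upper:
 assumes E: "E \<subseteq> unit_cube"
  and inf: "!!x e J. x \<in> E ==> e > 0 ==> \<exists>j\<ge>J. \<bar>fm (prefix_code x j) - real j*H\<bar> <= e*real j"
 shows "hdim E <= legendre F H"
proof (rule LF_ge)
 fix q
 define x where "x = q*H - F q"
 define V where "V e j = {w \<in> words j. \<bar>fm w - real j*H\<bar> <= e*real j}" for e j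
 have V: "ev (%j. real (card (V e j)) <= 2 powr (real j*(x + (\<bar>q\<bar> + 1)*e)))" if e: "e > 0" for e
  using Zm_le[OF e, of q]
 proof eventually_elim
  case (elim j)
  have "real (card (V e j))*2 powr (- real j*(q*H + \<bar>q\<bar>*e)) = (\<Sum>w\<in>V e j. 2 powr (- real j*(q*H + \<bar>q\<bar>*e)))" by simp
  also have "... <= (\<Sum>w\<in>V e j. 2 powr (- q*fm w))"
  proof (intro sum_mono powr_mono)
   fix w assume "w \<in> V e j"
   hence "\<bar>q\<bar>*\<bar>fm w - real j*H\<bar> <= \<bar>q\<bar>*(e*real j)" by (intro mult_left_mono) (auto simp: V_def)
   hence "\<bar>q*(fm w - real j*H)\<bar> <= \<bar>q\<bar>*(e*real j)" by (simp only: abs_mult)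
   hence "q*(fm w - real j*H) <= \<bar>q\<bar>*(e*real j)" by linarith
   thus "- real j*(q*H + \<bar>q\<bar>*e) <= - q*fm w" by (simp add: algebra_simps)
  qed simp
  also have "... <= Zm q j" unfolding Zm_def by (intro sum_mono2) (auto simp: V_def)
  also have "... <= 2 powr (- real j*(F q - e))" by (rule elim)
  finally have "real (card (V e j))*2 powr (- real j*(q*H + \<bar>q\<bar>*e))*2 powr (real j*(q*H + \<bar>q\<bar>*e))
   <= 2 powr (- real j*(F q - e))*2 powr (real j*(q*H + \<bar>q\<bar>*e))" by (intro mult_right_mono) auto
  note f1 = this
  have f2: "2 powr (- real j*(q*H + \<bar>q\<bar>*e))*2 powr (real j*(q*H + \<bar>q\<bar>*e)) = 1"
   unfolding powr_add[symmetric] by simp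
  have f3: "2 powr (- real j*(F q - e))*2 powr (real j*(q*H + \<bar>q\<bar>*e)) = 2 powr (real j*(x + (\<bar>q\<bar> + 1)*e))"
   unfolding powr_add[symmetric] by (simp add: x_def algebra_simps)
  show ?case using f1 unfolding mult.assoc f2 f3 by simp
 qed
 have inV: "\<exists>j\<ge>J. prefix_code y j \<in> V e j" if "y \<in> E" "e > 0" for y e J
  using inf[OF that, of J] prefix_code_words by (auto simp: V_def)
 have qp: "\<bar>q\<bar> + 1 > 0" by linarith
 have can: "(\<bar>q\<bar> + 1)*(y/(2*(\<bar>q\<bar> + 1))) = y/2" for y
 proof -
  have "a*(y/(2*a)) = y/2" if "a ~= 0" for a :: real using that by simp
  thus ?thesis using qp by (metis less_numeral_extra(3))
 qed
 show "hdim E <= ereal (q*H - F q)"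
 proof (cases "x < 0")
  case True
  have "E = {}"
  proof (rule ccontr)
   assume "E ~= {}"
   then obtain y where y: "y \<in> E" by blast
   define e where "e = - x/(2*(\<bar>q\<bar> + 1))"
   have e: "e > 0" using True qp by (simp add: e_def divide_less_0_iff)
   have xe: "x + (\<bar>q\<bar> + 1)*e = x/2" unfolding e_def can by simp
   obtain J where J: "!!j. j >= J ==> real (card (V e j)) <= 2 powr (real j*(x + (\<bar>q\<bar> + 1)*e))"
    using V[OF e] unfolding eventually_sequentially by blast
   obtain j where j: "j >= max J 1" "prefix_code y j \<in> V e j" using inV[OF y e] by blast
   have "finite (V e j)" by (simp add: V_def)
   moreover have "V e j ~= {}" using j(2) by blast
   ultimately have "card (V e j) > 0" by (simp add: card_gt_0_iff)
   hence "1 <= real (card (V e j))" by linarith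
   also have "... <= 2 powr (real j*(x/2))" using J[of j] j(1) xe by simp
   also have "... < 2 powr 0" using True j(1) by (intro powr_less_mono mult_pos_neg) auto
   finally show False by simp
  qed
  thus ?thesis by (simp add: hdim_def)
 next
  case False
  have "hdim E <= ereal (x + t)" if t: "t > 0" for t
  proof -
   define e where "e = t/(2*(\<bar>q\<bar> + 1))"
   have e: "e > 0" using t qp by (simp add: e_def)
   have qe: "(\<bar>q\<bar> + 1)*e = t/2" unfolding e_def by (rule can)
   obtain J where J: "!!j. j >= J ==> real (card (V e j)) <= 2 powr (real j*(x + (\<bar>q\<bar> + 1)*e))"
    using V[OF e] unfolding eventually_sequentially by blast
   show ?thesis
   proof (rule hdim_le[where V = "V e"])
    show "summable (%j. real (card (V e j))*2 powr (- (x + t)*real j))"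
    proof (rule summable_comparison_test')
     have "norm (2 powr (- (t/2)) :: real) < 1" using t powr_less_mono[of "- (t/2)" 0 2] by simp
     thus "summable (%j. (2 powr (- (t/2)) :: real) ^ j)" by (rule summable_geometric)
     fix j assume j: "j >= J"
     have "real (card (V e j))*2 powr (- (x + t)*real j) <= 2 powr (real j*(x + t/2))*2 powr (- (x + t)*real j)"
      using J[OF j] unfolding qe by (intro mult_right_mono) auto
     also have "... = 2 powr (- (t/2)*real j)" unfolding powr_add[symmetric] by (simp add: algebra_simps)
     also have "... = (2 powr (- (t/2))) ^ j" by (simp add: powr_powr flip: powr_realpow)
     finally show "norm (real (card (V e j))*2 powr (- (x + t)*real j)) <= (2 powr (- (t/2))) ^ j" by simp
    qed
    show "V e j \<subseteq> words j" for j by (auto simp: V_def)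
    show "\<exists>j\<ge>J. prefix_code y j \<in> V e j" if "y \<in> E" for y J by (rule inV[OF that e])
   qed (use False t E in auto)
  qed
  hence "hdim E <= ereal x + ereal t" if "t > 0" for t using that by simp
  hence "hdim E <= ereal x" by (rule ereal_le_epsilon2)
  thus ?thesis by (simp add: x_def)
 qed
qed

lemma local_quotient: "log 2 (cap w)/- real j = fm w/real j"
 unfolding Mcap_eq by simp

lemma lowerE_close:
 assumes x: "x \<in> lowerE cap H" and e: "e > 0"
 shows "\<exists>j\<ge>J. \<bar>fm (prefix_code x j) - real j*H\<bar> <= e*real j"
proof (rule ccontr)
 assume no: "\<not> ?thesis"
 define u where "u j = ereal (fm (prefix_code x j)/real j)" for j
 have ueq: "u = (%j. ereal (fm (prefix_code x j)/real j))" by (rule ext) (simp add: u_def)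
 have lim: "liminf u = ereal H" using x unfolding lowerE_def lower_dim_def local_quotient ueq by simp
 have "ereal (H - e) < liminf u" unfolding lim using e by simp
 hence "ev (%j. ereal (H - e) < u j)" by (rule less_LiminfD)
 hence "ev (%j. ereal (H + e) <= u j)" using eventually_ge_at_top[of "max J 1"]
 proof eventually_elim
  case (elim j)
  have j: "real j > 0" using elim by simp
  define a where "a = fm (prefix_code x j)/real j"
  have aj: "fm (prefix_code x j) = a*real j" using j by (simp add: a_def)
  have "\<not> \<bar>a*real j - real j*H\<bar> <= e*real j" using no elim(2) unfolding aj[symmetric] by auto
  moreover have "a*real j - real j*H = (a - H)*real j" by (simp add: algebra_simps)
  ultimately have "\<not> \<bar>a - H\<bar> <= e" using j by (simp add: abs_mult)
  moreover have "H - e < a" using elim(1) by (simp add: u_def a_def)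
  ultimately show ?case by (simp add: u_def a_def[symmetric])
 qed
 hence "ereal (H + e) <= liminf u" by (rule Liminf_bounded)
 thus False unfolding lim using e by simp
qed

lemma upperE_close:
 assumes x: "x \<in> upperE cap H" and e: "e > 0"
 shows "\<exists>j\<ge>J. \<bar>fm (prefix_code x j) - real j*H\<bar> <= e*real j"
proof (rule ccontr)
 assume no: "\<not> ?thesis"
 define u where "u j = ereal (fm (prefix_code x j)/real j)" for j
 have ueq: "u = (%j. ereal (fm (prefix_code x j)/real j))" by (rule ext) (simp add: u_def)
 have lim: "limsup u = ereal H" using x unfolding upperE_def upper_dim_def local_quotient ueq by simp
 have "limsup u < ereal (H + e)" unfolding lim using e by simp
 hence "ev (%j. u j < ereal (H + e))" by (rule Limsup_lessD)
 hence "ev (%j. u j <= ereal (H - e))" using eventually_ge_at_top[of "max J 1"]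
 proof eventually_elim
  case (elim j)
  have j: "real j > 0" using elim by simp
  define a where "a = fm (prefix_code x j)/real j"
  have aj: "fm (prefix_code x j) = a*real j" using j by (simp add: a_def)
  have "\<not> \<bar>a*real j - real j*H\<bar> <= e*real j" using no elim(2) unfolding aj[symmetric] by auto
  moreover have "a*real j - real j*H = (a - H)*real j" by (simp add: algebra_simps)
  ultimately have "\<not> \<bar>a - H\<bar> <= e" using j by (simp add: abs_mult)
  moreover have "a < H + e" using elim(1) by (simp add: u_def a_def)
  ultimately show ?case by (simp add: u_def a_def[symmetric])
 qed
 hence "limsup u <= ereal (H - e)" by (rule Limsup_bounded)
 thus False unfolding lim using e by simp
qed

end
end

section \<open>Lower bounds for the Hausdorff dimensions\<close>

text \<open>Lets the precision improve with the level \<open>l\<close> while staying in the range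
  where each precision is already valid.\<close>

lemma diagonal_choice:
 fixes Q :: "nat => nat => bool"
 assumes "!!a. \<exists>L. \<forall>l\<ge>L. Q a l"
 obtains f l1 where "!!l. l >= l1 ==> Q (f l) l" "filterlim f at_top sequentially"
proof -
 obtain L where L: "!!a l. l >= L a ==> Q a l" using assms by metis
 define S where "S l = {a. a <= l & (\<forall>b\<le>a. L b <= l)}" for l
 have fin: "finite (S l)" for l by (rule finite_subset[of _ "{..l}"]) (auto simp: S_def)
 have Sd: "L a <= l" if "a \<in> S l" for a l using that by (simp add: S_def)
 have 1: "Q (Max (S l)) l" if "l >= L 0" for l
 proof -
  have "0 \<in> S l" using that by (simp add: S_def)
  hence "Max (S l) \<in> S l" using fin by (intro Max_in) auto
  hence "L (Max (S l)) <= l" by (rule Sd)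
  thus ?thesis by (rule L)
 qed
 have 2: "filterlim (%l. Max (S l)) at_top sequentially"
  unfolding filterlim_at_top eventually_sequentially
 proof (intro allI exI impI)
  fix a l assume l: "max a (Max (L ` {..a})) <= l"
  have "L b <= l" if "b <= a" for b
  proof -
   have "L b <= Max (L ` {..a})" using that by (intro Max_ge) auto
   also have "... <= l" by (rule order_trans[OF max.cobounded2 l])
   finally show ?thesis .
  qed
  moreover have "a <= l" by (rule order_trans[OF max.cobounded1 l])
  ultimately have "a \<in> S l" by (simp add: S_def)
  thus "a <= Max (S l)" using fin by (intro Max_ge)
 qed
 show ?thesis by (rule that[OF 1 2])
qed

lemma liminf_ereal_eqI:
 fixes u :: "nat => real"
 assumes ge: "!!e::real. e > 0 ==> ev (%k. H - e <= u k)"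
  and le: "!!e K. e > 0 ==> \<exists>k\<ge>K. u k <= H + e"
 shows "liminf (%k. ereal (u k)) = ereal H"
proof (rule antisym)
 show "ereal H <= liminf (%k. ereal (u k))"
 proof (rule ereal_le_epsilon2)
  fix e :: real assume e: "e > 0"
  have "ereal (H - e) <= liminf (%k. ereal (u k))" by (rule Liminf_bounded) (use ge[OF e] in simp)
  hence "ereal (H - e) + ereal e <= liminf (%k. ereal (u k)) + ereal e" by (rule add_right_mono)
  thus "ereal H <= liminf (%k. ereal (u k)) + ereal e" by simp
 qed
 show "liminf (%k. ereal (u k)) <= ereal H"
 proof (rule ereal_le_epsilon2)
  fix e :: real assume e: "e > 0"
  have "liminf (%k. ereal (u k)) <= ereal (H + e)"
  proof (rule ccontr)
   assume "\<not> ?thesis"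
   hence "ereal (H + e) < liminf (%k. ereal (u k))" by simp
   hence "ev (%k. ereal (H + e) < ereal (u k))" by (rule less_LiminfD)
   then obtain K where "!!k. k >= K ==> H + e < u k" unfolding eventually_sequentially by auto
   thus False using le[OF e, of K] by (meson not_le)
  qed
  thus "liminf (%k. ereal (u k)) <= ereal H + ereal e" by simp
 qed
qed

section \<open>The Cantor set and the local behaviour of its points\<close>

context sampled_tree
begin

text \<open>What the code of a point retains from the steps it went through, with \<open>L n\<close>
  the length after \<open>n\<close> steps.\<close>

definition tracks :: "'w => (nat => real) => (nat => real) => (nat => real) => (nat => 'n word) => (nat => nat) => bool" where
 "tracks om h \<rho> ze cd L \<longleftrightarrow> (\<forall>n. 2*L n <= L (Suc n) & L n < L (Suc n)
   & (\<forall>k. L n <= k & k <= L (Suc n) --> \<bar>g (cd k) - g (cd (L n)) - (real k - real (L n))*h (L n)\<bar> <= ze (L n)*k)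
   & (\<forall>k::nat. (1 + 2*ze (L n))*real (L n) <= real k & k <= L (Suc n) -->
     (\<exists>k0\<le>k. (1 - ze (L n))*real k <= real k0 & \<not> bad (\<rho> (L n) - ze (L n)) om (cd k0)))
   & \<not> bad (\<rho> (L n) - ze (L n)) om (cd (L (Suc n)))
   & (\<exists>v. v ~= [] & p (cd (L (Suc n)) @ v) om
     & g (cd (L (Suc n)) @ v) <= g (cd (L (Suc n))) + L (Suc n)*(\<rho> (L n) + ze (L n))))"

text \<open>The children of a word share its mass equally, and the Frostman bounds of the single
  steps multiply. The loss \<open>ze l*l\<close> of a completed step is absorbed because
  \<open>L\<close> at least doubles and \<open>s l\<close> exceeds \<open>\<sigma> + ze0\<close> by
  \<open>ze l\<close>; the further \<open>ze0\<close> covers the step in progress.\<close>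

lemma construction:
 fixes h \<rho> ze s :: "nat => real" and \<sigma> ze0 :: real
 assumes st: "!!l. l >= l0 ==> step om (h l) (\<rho> l) (ze l) (s l) l"
  and z: "!!l. l >= l0 ==> 0 <= ze l" "!!l. l >= l0 ==> ze l <= ze0"
  and sl: "!!l. l >= l0 ==> \<sigma> + ze0 + ze l <= s l"
  and E: "!!x L. x \<in> unit_cube ==> L 0 = l0 ==> tracks om h \<rho> ze (prefix_code x) L ==> x \<in> E"
 shows "ereal \<sigma> <= hdim E"
proof -
 define R where "R l J w Ch \<longleftrightarrow> Ch \<subseteq> words J & Ch ~= {} \<and>
   (\<forall>y\<in>Ch. (\<exists>z. y = w @ ltr0 # ltr1 # z)
    & (\<forall>k. l <= k & k <= J --> \<bar>g (take k y) - g w - (real k - real l)*h l\<bar> <= ze l*k)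
    & (\<forall>k::nat. (1 + 2*ze l)*real l <= real k & k <= J --> (\<exists>k0\<le>k. (1 - ze l)*real k <= real k0 & \<not> bad (\<rho> l - ze l) om (take k0 y)))
    & \<not> bad (\<rho> l - ze l) om y
    & (\<exists>v. v ~= [] & p (y @ v) om & g (y @ v) <= g y + J*(\<rho> l + ze l))) \<and>
   (\<forall>k v. l < k & k <= J & v \<in> words k -->
    real (card {y \<in> Ch. take k y = v}) <= real (card Ch)*2 powr (- s l*(real k - real l) + ze l*l))"
  for l J w Ch
 have stR: "step om (h l) (\<rho> l) (ze l) (s l) l = (\<exists>J\<ge>2*l. l < J & (\<forall>w\<in>words l. \<exists>Ch. R l J w Ch))" for l
  unfolding step_def R_def by (rule refl)
 have "\<exists>J. l >= l0 --> 2*l <= J & l < J & (\<forall>w\<in>words l. \<exists>Ch. R l J w Ch)" for l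
  using st[of l] unfolding stR by blast
 then obtain J where J: "!!l. l >= l0 ==> 2*l <= J l" "!!l. l >= l0 ==> l < J l"
  "!!l w. l >= l0 ==> w \<in> words l ==> \<exists>Ch. R l (J l) w Ch" by metis
 have "\<exists>Ch. length w >= l0 --> R (length w) (J (length w)) w Ch" for w
  using J(3)[of "length w" w] by (auto simp: words_def)
 then obtain Ch where Ch0: "!!w. length w >= l0 ==> R (length w) (J (length w)) w (Ch w)" by metis
 define N where "N = rec_nat {replicate l0 ltr0 :: 'n word} (%n X. \<Union>w\<in>X. Ch w)"
 define L where "L = rec_nat l0 (%_. J)"
 define m where "m = rec_nat (%_. 1 :: real) (%n f y. f (take (L n) y)/real (card (Ch (take (L n) y))))"
 have N0: "N 0 = {replicate l0 ltr0}" and NS: "N (Suc n) = (\<Union>w\<in>N n. Ch w)" for n by (simp_all add: N_def)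
 have L0: "L 0 = l0" and LS: "L (Suc n) = J (L n)" for n by (simp_all add: L_def)
 have mS: "m (Suc n) y = m n (take (L n) y)/real (card (Ch (take (L n) y)))" and m_0: "m 0 y = 1" for n y by (simp_all add: m_def)
 have Lge: "L n >= l0" for n
 proof (induction n)
  case (Suc n)
  thus ?case using J(2)[OF Suc] by (simp add: LS)
 qed (simp add: L0)
 have Lless: "L n < L (Suc n)" "2*L n <= L (Suc n)" for n using J(1,2)[OF Lge] by (simp_all add: LS)
 have NW: "N n \<subseteq> words (L n)" for n
 proof (induction n)
  case (Suc n)
  have "Ch w \<subseteq> words (L (Suc n))" if "w \<in> N n" for w
  proof -
   have "length w = L n" using Suc that by (auto simp: words_def)
   thus ?thesis using Ch0[of w] Lge[of n] unfolding R_def LS by simp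
  qed
  thus ?case by (auto simp: NS)
 qed (simp add: N0 L0 words_def)
 have R: "R (L n) (L (Suc n)) w (Ch w)" if "w \<in> N n" for n w
 proof -
  have "length w = L n" using NW[of n] that by (auto simp: words_def)
  thus ?thesis using Ch0[of w] Lge[of n] by (simp add: LS)
 qed
 have ChW: "Ch w \<subseteq> words (L (Suc n))" "Ch w ~= {}" if "w \<in> N n" for n w using R[OF that] unfolding R_def by blast+
 have finCh: "finite (Ch w)" if "w \<in> N n" for n w using ChW(1)[OF that] finite_words finite_subset by blast
 have cCh: "real (card (Ch w)) > 0" if "w \<in> N n" for n w
  using finCh[OF that] ChW(2)[OF that] by (simp add: card_gt_0_iff)
 have finN: "finite (N n)" for n using NW finite_words finite_subset by blast
 have start: "\<exists>z. y = w @ ltr0 # ltr1 # z" if "w \<in> N n" "y \<in> Ch w" for n w y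
  using R[OF that(1)] that(2) unfolding R_def by blast
 have tk: "take (L n) y = w" if "w \<in> N n" "y \<in> Ch w" for n w y
  using start[OF that] NW[of n] that(1) by (auto simp: words_def)
 have child: "take (L n) y \<in> N n" "y \<in> Ch (take (L n) y)" if "y \<in> N (Suc n)" for n y
 proof -
  obtain w where w: "w \<in> N n" "y \<in> Ch w" using \<open>y \<in> N (Suc n)\<close> unfolding NS by blast
  show "take (L n) y \<in> N n" "y \<in> Ch (take (L n) y)" using tk[OF w] w by simp_all
 qed
 have dec: "(\<Sum>y\<in>{y \<in> N (Suc n). Q y}. m (Suc n) y) = (\<Sum>w\<in>N n. real (card {y \<in> Ch w. Q y})*(m n w/real (card (Ch w))))" for n Q
 proof -
  have "{y \<in> N (Suc n). Q y} = (\<Union>w\<in>N n. {y \<in> Ch w. Q y})" by (auto simp: NS)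
  hence "(\<Sum>y\<in>{y \<in> N (Suc n). Q y}. m (Suc n) y) = (\<Sum>y\<in>(\<Union>w\<in>N n. {y \<in> Ch w. Q y}). m (Suc n) y)" by simp
  also have "... = (\<Sum>w\<in>N n. \<Sum>y\<in>{y \<in> Ch w. Q y}. m (Suc n) y)"
  proof (rule sum.UNION_disjoint)
   show "\<forall>w\<in>N n. finite {y \<in> Ch w. Q y}" using finCh by simp
   show "\<forall>w\<in>N n. \<forall>w'\<in>N n. w ~= w' --> {y \<in> Ch w. Q y} \<inter> {y \<in> Ch w'. Q y} = {}"
   proof (intro ballI impI equals0I)
    fix w w' y assume a: "w \<in> N n" "w' \<in> N n" "w ~= w'" "y \<in> {y \<in> Ch w. Q y} \<inter> {y \<in> Ch w'. Q y}"
    hence y: "y \<in> Ch w" "y \<in> Ch w'" by blast+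
    show False using tk[OF a(1) y(1)] tk[OF a(2) y(2)] a(3) by simp
   qed
  qed (rule finN)
  also have "... = (\<Sum>w\<in>N n. \<Sum>y\<in>{y \<in> Ch w. Q y}. m n w/real (card (Ch w)))"
   by (intro sum.cong refl) (auto simp: mS tk)
  finally show ?thesis by simp
 qed
 have m0: "m n w >= 0" for n w
 proof (induction n arbitrary: w)
  case (Suc n)
  thus ?case by (simp add: mS)
 qed (simp add: m_0)
 have m1: "(\<Sum>w\<in>N n. m n w) = 1" for n
 proof (induction n)
  case (Suc n)
  have "(\<Sum>w\<in>N (Suc n). m (Suc n) w) = (\<Sum>w\<in>N n. real (card (Ch w))*(m n w/real (card (Ch w))))"
   using dec[of n "\<lambda>_. True"] by simp
  also have "... = (\<Sum>w\<in>N n. m n w)"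
  proof (rule sum.cong[OF refl])
   fix w assume "w \<in> N n"
   thus "real (card (Ch w))*(m n w/real (card (Ch w))) = m n w" using cCh[of w n] by simp
  qed
  finally show ?case using Suc by simp
 qed (simp add: N0 m_0)
 define s1 where "s1 = \<sigma> + ze0"
 have fr: "real (card {y \<in> Ch w. take k y = v}) <= real (card (Ch w))*2 powr (- s (L n)*(real k - real (L n)) + ze (L n)*L n)"
  if "w \<in> N n" "L n < k" "k <= L (Suc n)" "v \<in> words k" for w n k v
  using R[OF that(1)] that(2-4) unfolding R_def by blast
 have mle: "m n w <= 2 powr (- s1*(real (L n) - real l0))" if "w \<in> N n" for n w
  using that
 proof (induction n arbitrary: w)
  case (Suc n)
  define l where "l = L n"
  define x where "x = take (L n) w"
  have x: "x \<in> N n" "w \<in> Ch x" using child[OF Suc.prems] by (simp_all add: x_def)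
  have lw: "w \<in> words (L (Suc n))" using NW[of "Suc n"] Suc.prems by blast
  have "w \<in> {y \<in> Ch x. take (L (Suc n)) y = w}" using x(2) lw by (simp add: words_def)
  hence "{y \<in> Ch x. take (L (Suc n)) y = w} ~= {}" by blast
  moreover have "finite {y \<in> Ch x. take (L (Suc n)) y = w}" using finCh[OF x(1)] by simp
  ultimately have "0 < card {y \<in> Ch x. take (L (Suc n)) y = w}" by (simp add: card_gt_0_iff)
  hence "1 <= real (card {y \<in> Ch x. take (L (Suc n)) y = w})" by linarith
  also have "... <= real (card (Ch x))*2 powr (- s l*(real (L (Suc n)) - real l) + ze l*l)"
   unfolding l_def by (rule fr[OF x(1) Lless(1) order_refl lw])
  also have "... <= real (card (Ch x))*2 powr (- s1*(real (L (Suc n)) - real l))"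
  proof (intro mult_left_mono powr_mono)
   have d: "real l <= real (L (Suc n)) - real l" using Lless(2)[of n] by (simp add: l_def)
   have zl: "0 <= ze l" using z(1)[OF Lge[of n]] by (simp add: l_def)
   have "ze l*real l <= ze l*(real (L (Suc n)) - real l)" using d zl by (intro mult_left_mono)
   also have "... <= (s l - s1)*(real (L (Suc n)) - real l)"
    using sl[OF Lge[of n]] d by (intro mult_right_mono) (auto simp: l_def s1_def)
   finally show "- s l*(real (L (Suc n)) - real l) + ze l*l <= - s1*(real (L (Suc n)) - real l)"
    by (simp add: algebra_simps)
  qed auto
  finally have "1/real (card (Ch x)) <= 2 powr (- s1*(real (L (Suc n)) - real l))"
   using cCh[OF x(1)] by (simp add: pos_divide_le_eq mult.commute)
  hence "m n x*(1/real (card (Ch x))) <= 2 powr (- s1*(real l - real l0))*2 powr (- s1*(real (L (Suc n)) - real l))"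
   using Suc.IH[OF x(1)] m0 unfolding l_def by (intro mult_mono) auto
  also have "... = 2 powr (- s1*(real (L (Suc n)) - real l0))" unfolding powr_add[symmetric] by (simp add: algebra_simps)
  finally show ?case by (simp add: mS x_def)
 qed (simp add: L0 m_0)
 \<comment> \<open>Pays for the initial segment of length \<open>l0\<close>, where the tree does not
   branch.\<close>
 define Cc where "Cc = 2 powr (\<bar>s1\<bar>*l0)"
 have z00: "0 <= ze0" using z[of l0] by linarith
 have frost: "(\<Sum>w\<in>{w \<in> N n. take k w = v}. m n w) <= Cc*2 powr (- \<sigma>*k)"
  if "k <= L n" "v \<in> words k" for n k v
  using that
 proof (induction n)
  case 0
  have "(\<Sum>w\<in>{w \<in> N 0. take k w = v}. m 0 w) <= (\<Sum>w\<in>N 0. m 0 w)" using m0 finN by (intro sum_mono2) auto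
  also have "... = 2 powr 0" by (simp add: m1)
  also have "... <= 2 powr (\<bar>s1\<bar>*l0 + - \<sigma>*k)"
  proof (rule powr_mono)
   have "\<sigma>*real k <= s1*real k" using z00 by (intro mult_right_mono) (auto simp: s1_def)
   also have "... <= \<bar>s1\<bar>*real k" by (intro mult_right_mono) auto
   also have "... <= \<bar>s1\<bar>*real l0" using 0 by (intro mult_left_mono) (auto simp: L0)
   finally show "0 <= \<bar>s1\<bar>*real l0 + - \<sigma>*real k" by simp
  qed simp
  finally show ?case by (simp only: powr_add Cc_def)
 next
  case (Suc n)
  show ?case
  proof (cases "k <= L n")
   case True
   have "real (card {y \<in> Ch w. take k y = v})*(m n w/real (card (Ch w))) = (if take k w = v then m n w else 0)" if w: "w \<in> N n" for w
   proof -
    have "take k y = take k w" if "y \<in> Ch w" for y using tk[OF w that] True by (metis min.absorb1 take_take)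
    hence "{y \<in> Ch w. take k y = v} = (if take k w = v then Ch w else {})" by auto
    thus ?thesis using cCh[OF w] by simp
   qed
   hence "(\<Sum>w\<in>{w \<in> N (Suc n). take k w = v}. m (Suc n) w) = (\<Sum>w\<in>N n. if take k w = v then m n w else 0)"
    unfolding dec by (intro sum.cong) auto
   also have "... = (\<Sum>w\<in>{w \<in> N n. take k w = v}. m n w)" by (rule sum.inter_filter[symmetric, OF finN])
   also have "... <= Cc*2 powr (- \<sigma>*k)" by (rule Suc.IH[OF True Suc.prems(2)])
   finally show ?thesis .
  next
   \<comment> \<open>A prefix longer than \<open>L n\<close> determines the parent
     \<open>w1\<close>, so the sum has at most one nonzero term, and within the step the bound
     \<open>fr\<close> applies.\<close>
   case False
   define l where "l = L n"
   define w1 where "w1 = take l v"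
   define \<phi> where "\<phi> w = real (card {y \<in> Ch w. take k y = v})*(m n w/real (card (Ch w)))" for w
   have lk: "l < k" using False by (simp add: l_def)
   have Bnd: "\<phi> w <= Cc*2 powr (- \<sigma>*k)" if w: "w \<in> N n" for w
   proof -
    have "\<phi> w <= real (card (Ch w))*2 powr (- s l*(real k - real l) + ze l*l)*(m n w/real (card (Ch w)))"
     unfolding \<phi>_def l_def using fr[OF w _ Suc.prems] False m0 by (intro mult_right_mono) auto
    also have "... = 2 powr (- s l*(real k - real l) + ze l*l)*m n w" using cCh[OF w] by simp
    also have "... <= 2 powr (- s l*(real k - real l) + ze l*l)*2 powr (- s1*(real l - real l0))"
     using mle[OF w] by (intro mult_left_mono) (auto simp: l_def)
    also have "... = 2 powr (- s l*(real k - real l) + ze l*l + - s1*(real l - real l0))" by (rule powr_add[symmetric])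
    also have "... <= 2 powr (\<bar>s1\<bar>*l0 + - \<sigma>*k)"
    proof (rule powr_mono)
     have zl: "0 <= ze l" "ze l <= ze0" "s1 + ze l <= s l" using z[OF Lge[of n]] sl[OF Lge[of n]] by (simp_all add: l_def s1_def)
     have "s1*(real k - real l) <= s l*(real k - real l)" using zl lk by (intro mult_right_mono) auto
     moreover have "ze l*real l <= ze0*real k" using zl lk z00 by (intro mult_mono) auto
     moreover have "s1*real l0 <= \<bar>s1\<bar>*real l0" by (intro mult_right_mono) auto
     moreover have "s1*real k = \<sigma>*real k + ze0*real k" by (simp add: s1_def distrib_right)
     ultimately show "- s l*(real k - real l) + ze l*l + - s1*(real l - real l0) <= \<bar>s1\<bar>*l0 + - \<sigma>*k"
      by (simp add: right_diff_distrib)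
    qed simp
    finally show ?thesis by (simp only: powr_add Cc_def)
   qed
   have "(\<Sum>w\<in>{w \<in> N (Suc n). take k w = v}. m (Suc n) w) = (\<Sum>w\<in>N n. \<phi> w)" unfolding dec \<phi>_def ..
   also have "... = (\<Sum>w\<in>{w \<in> N n. w = w1}. \<phi> w)"
   proof (rule sum.mono_neutral_right[OF finN])
    show "\<forall>w\<in>N n - {w \<in> N n. w = w1}. \<phi> w = 0"
    proof
     fix w assume w: "w \<in> N n - {w \<in> N n. w = w1}"
     have em: "{y \<in> Ch w. take k y = v} = {}"
     proof -
      have "w = w1" if y: "y \<in> Ch w" "take k y = v" for y
      proof -
       have "w = take l y" using tk[of w n y] w y(1) by (simp add: l_def)
       also have "... = take l (take k y)" using lk by (simp add: min_absorb1)
       finally show ?thesis using y(2) by (simp add: w1_def)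
      qed
      thus ?thesis using w by blast
     qed
     show "\<phi> w = 0" unfolding \<phi>_def em by simp
    qed
   qed auto
   also have "... <= (\<Sum>w\<in>{w \<in> N n. w = w1}. Cc*2 powr (- \<sigma>*k))" by (intro sum_mono Bnd) auto
   also have "... = real (card {w \<in> N n. w = w1})*(Cc*2 powr (- \<sigma>*k))" by simp
   also have "... <= 1*(Cc*2 powr (- \<sigma>*k))"
   proof (rule mult_right_mono)
    have "card {w \<in> N n. w = w1} <= card {w1}" by (intro card_mono) auto
    thus "real (card {w \<in> N n. w = w1}) <= 1" by simp
   qed (simp add: Cc_def)
   finally show ?thesis by simp
  qed
 qed
 have Ln: "n <= L n" for n
 proof (induction n)
  case (Suc n)
  thus ?case using Lless(1)[of n] by linarith
 qed simp
 show ?thesis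
 proof (rule hdim_ge[where N = N and m = m and l = L and C = Cc])
  show "filterlim L at_top sequentially"
   using Ln by (intro filterlim_at_top_mono[OF filterlim_ident]) (simp add: eventually_sequentially)
  show "(\<Inter>n. \<Union>w\<in>N n. cube w) \<subseteq> E"
  proof
   fix x assume "x \<in> (\<Inter>n. \<Union>w\<in>N n. cube w)"
   hence x: "\<exists>w\<in>N n. x \<in> cube w" for n by blast
   have xu: "x \<in> unit_cube" using x[of 0] cube_subset_unit_cube by blast
   have pre: "prefix_code x (L n) \<in> N n" for n
   proof -
    obtain y where y: "y \<in> N (Suc n)" "x \<in> cube y" using x by blast
    note c = child[OF y(1)]
    obtain z where "y = take (L n) y @ ltr0 # ltr1 # z" using start[OF c] by blast
    hence "prefix_code x (length (take (L n) y)) = take (L n) y" using prefix_code_inner y(2) by metis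
    moreover have "length (take (L n) y) = L n" using c(1) NW[of n] by (auto simp: words_def)
    ultimately show ?thesis using c(1) by simp
   qed
   have "tracks om h \<rho> ze (prefix_code x) L"
    unfolding tracks_def
   proof (rule allI)
    fix n
    define y where "y = prefix_code x (L (Suc n))"
    define w where "w = prefix_code x (L n)"
    have tx: "k <= L (Suc n) ==> take k y = prefix_code x k" for k by (simp add: y_def take_prefix_code)
    have w: "w \<in> N n" "y \<in> Ch w" using pre[of n] child(2)[OF pre[of "Suc n"]] tx[of "L n"] Lless(1)[of n]
     by (simp_all add: w_def y_def)
    from R[OF w(1)] w(2) have *:
     "\<forall>k. L n <= k & k <= L (Suc n) --> \<bar>g (take k y) - g w - (real k - real (L n))*h (L n)\<bar> <= ze (L n)*k"
     "\<forall>k::nat. (1 + 2*ze (L n))*real (L n) <= real k & k <= L (Suc n) --> (\<exists>k0\<le>k. (1 - ze (L n))*real k <= real k0 & \<not> bad (\<rho> (L n) - ze (L n)) om (take k0 y))"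
     "\<not> bad (\<rho> (L n) - ze (L n)) om y"
     "\<exists>v. v ~= [] & p (y @ v) om & g (y @ v) <= g y + L (Suc n)*(\<rho> (L n) + ze (L n))"
     unfolding R_def by blast+
    have 1: "\<forall>k. L n <= k & k <= L (Suc n) --> \<bar>g (prefix_code x k) - g w - (real k - real (L n))*h (L n)\<bar> <= ze (L n)*k"
     using *(1) tx by simp
    have 2: "\<forall>k::nat. (1 + 2*ze (L n))*real (L n) <= real k & k <= L (Suc n) --> (\<exists>k0\<le>k. (1 - ze (L n))*real k <= real k0 & \<not> bad (\<rho> (L n) - ze (L n)) om (prefix_code x k0))"
     using *(2) tx by (metis order_trans)
    show "2*L n <= L (Suc n) & L n < L (Suc n)
      & (\<forall>k. L n <= k & k <= L (Suc n) --> \<bar>g (prefix_code x k) - g (prefix_code x (L n)) - (real k - real (L n))*h (L n)\<bar> <= ze (L n)*k)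
      & (\<forall>k::nat. (1 + 2*ze (L n))*real (L n) <= real k & k <= L (Suc n) -->
        (\<exists>k0\<le>k. (1 - ze (L n))*real k <= real k0 & \<not> bad (\<rho> (L n) - ze (L n)) om (prefix_code x k0)))
      & \<not> bad (\<rho> (L n) - ze (L n)) om (prefix_code x (L (Suc n)))
      & (\<exists>v. v ~= [] & p (prefix_code x (L (Suc n)) @ v) om
        & g (prefix_code x (L (Suc n)) @ v) <= g (prefix_code x (L (Suc n))) + L (Suc n)*(\<rho> (L n) + ze (L n)))"
     using Lless 1 2 *(3,4) unfolding y_def w_def by (intro conjI)
   qed
   thus "x \<in> E" by (rule E[of x L, OF xu L0])
  qed
  show "Cc > 0" by (simp add: Cc_def)
 qed (use NW child m0 m1 frost in auto)
qed

lemma bad_mono: "bad r om x ==> r <= r' ==> bad r' om x"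
proof -
 assume b: "bad r om x" and r: "r <= r'"
 have "r*length x <= r'*length x" using r by (intro mult_right_mono) auto
 thus ?thesis using b unfolding bad_def by force
qed

text \<open>A survivor below the prefix of length \<open>k\<close> is also one below the shorter
  prefix of length \<open>k0\<close>, so a checkpoint that is not bad bounds \<open>fm\<close> from
  below at all later scales.\<close>

lemma fm_ge_not_bad:
 assumes good: "good om" and b: "\<not> bad r om (prefix_code x k0)" and k: "k0 <= k"
 shows "g (prefix_code x k0) + r*k0 <= fm om (prefix_code x k)"
proof -
 define z where "z = drop k0 (prefix_code x k)"
 have e: "prefix_code x k = prefix_code x k0 @ z"
  using take_prefix_code[OF k, of x] append_take_drop_id[of k0 "prefix_code x k"] by (simp add: z_def)
 have "z @ opt om (prefix_code x k) ~= []" using opt(1)[OF good] by simp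
 moreover have "p (prefix_code x k0 @ z @ opt om (prefix_code x k)) om"
  using opt(2)[OF good, of "prefix_code x k"] unfolding e by simp
 ultimately have "\<not> g (prefix_code x k0 @ z @ opt om (prefix_code x k)) < g (prefix_code x k0) + r*length (prefix_code x k0)"
  using b unfolding bad_def by blast
 thus ?thesis unfolding fm_def[OF good] using e by simp
qed

text \<open>The lower bound for \<open>fm\<close> holds at all large scales through the checkpoints,
  while the upper bound is reached at the ends of the steps; together they determine the lower local
  dimension.\<close>

lemma tracks_limits:
 fixes x :: "real ^ 'n" and h0 \<rho>0 e :: real
 assumes good: "good om" and tr: "tracks om h \<rho> ze (prefix_code x) L"
  and conv: "!!e::real. e > 0 ==> \<exists>n0. \<forall>n\<ge>n0. \<bar>h (L n) - h0\<bar> <= e & \<bar>\<rho> (L n) - \<rho>0\<bar> <= e & \<bar>ze (L n)\<bar> <= e"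
  and pos: "h0 > 0" "\<rho>0 >= 0" and e: "e > 0"
 shows "ev (%k. \<bar>g (prefix_code x k) - real k*h0\<bar> <= e*k)"
  "ev (%k. real k*(h0 + \<rho>0 - e) <= fm om (prefix_code x k))"
  "\<exists>k\<ge>K. fm om (prefix_code x k) <= real k*(h0 + \<rho>0 + e)"
proof -
 define cd where "cd = prefix_code x"
 have L2: "2*L n <= L (Suc n)" "L n < L (Suc n)" for n using tr unfolding tracks_def by blast+
 have ta: "\<bar>g (cd k) - g (cd (L n)) - (real k - real (L n))*h (L n)\<bar> <= ze (L n)*k" if "L n <= k" "k <= L (Suc n)" for n k
  using tr that unfolding tracks_def cd_def by blast
 have tb: "\<exists>k0\<le>k. (1 - ze (L n))*real k <= real k0 & \<not> bad (\<rho> (L n) - ze (L n)) om (cd k0)" if "(1 + 2*ze (L n))*real (L n) <= real k" "k <= L (Suc n)" for n k :: nat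
  using tr that unfolding tracks_def cd_def by blast
 have tc: "\<not> bad (\<rho> (L n) - ze (L n)) om (cd (L (Suc n)))" for n using tr unfolding tracks_def cd_def by blast
 have td: "\<exists>v. v ~= [] & p (cd (L (Suc n)) @ v) om & g (cd (L (Suc n)) @ v) <= g (cd (L (Suc n))) + L (Suc n)*(\<rho> (L n) + ze (L n))" for n
  using tr unfolding tracks_def cd_def by blast
 have smL: "strict_mono L" using L2(2) by (simp add: strict_mono_Suc_iff)
 have nL: "n <= L n" for n using smL by (rule strict_mono_imp_increasing)
 have loc: "\<exists>n\<ge>n0. L n <= k & k <= L (Suc n)" if k: "L n0 <= k" for n0 k
 proof -
  define n1 where "n1 = (LEAST n. k < L n)"
  have "k < L (Suc k)" using nL[of "Suc k"] by linarith
  hence 1: "k < L n1" unfolding n1_def by (rule LeastI)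
  have n1: "n0 < n1" using 1 k smL by (metis le_less_trans strict_mono_less)
  then obtain n where n: "n1 = Suc n" by (cases n1) auto
  have "\<not> k < L n" using not_less_Least[of n "\<lambda>n. k < L n"] n by (simp add: n1_def)
  thus ?thesis using 1 n1 n by (intro exI[of _ n]) auto
 qed
 have growth: "ev (%k. \<bar>g (cd k) - real k*h0\<bar> <= e*k)" if e: "e > 0" for e :: real
 proof -
  define ep where "ep = e/8"
  have ep: "ep > 0" using e by (simp add: ep_def)
  obtain n0 where n0: "!!n. n >= n0 ==> \<bar>h (L n) - h0\<bar> <= ep & \<bar>\<rho> (L n) - \<rho>0\<bar> <= ep & \<bar>ze (L n)\<bar> <= ep" using conv[OF ep] by blast
  define d where "d n = \<bar>g (cd (L n)) - real (L n)*h0\<bar>" for n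
  have st: "\<bar>g (cd k) - real k*h0\<bar> <= d n + 2*ep*k" if n: "n >= n0" and k: "L n <= k" "k <= L (Suc n)" for n k
  proof -
   have "\<bar>(real k - real (L n))*(h (L n) - h0)\<bar> <= real k*ep"
    unfolding abs_mult using n0[OF n] k by (intro mult_mono) auto
   moreover have "ze (L n)*real k <= ep*real k" using n0[OF n] by (intro mult_right_mono) auto
   moreover have "g (cd k) - real k*h0 = (g (cd k) - g (cd (L n)) - (real k - real (L n))*h (L n))
     + (g (cd (L n)) - real (L n)*h0) + (real k - real (L n))*(h (L n) - h0)" by (simp add: algebra_simps)
   moreover have "2*ep*real k = real k*ep + ep*real k" by simp
   ultimately show ?thesis using ta[OF k] unfolding d_def by linarith
  qed
  \<comment> \<open>The errors of earlier steps form a geometric sum because \<open>L\<close> at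
    least doubles, so the total deviation stays proportional to \<open>L n\<close>.\<close>
  have dn: "d n <= 4*ep*L n + d n0" if "n >= n0" for n
   using that
  proof (induction n rule: dec_induct)
   case base
   thus ?case using ep by simp
  next
   case (step n)
   have "d (Suc n) <= d n + 2*ep*L (Suc n)"
    using st[OF step(1) less_imp_le[OF L2(2)] order_refl] by (simp add: d_def)
   moreover have "4*ep*L n <= 2*ep*L (Suc n)"
   proof -
    have "2*ep*real (2*L n) <= 2*ep*real (L (Suc n))" using L2(1)[of n] ep by (intro mult_left_mono) auto
    thus ?thesis by simp
   qed
   moreover have "4*ep*L (Suc n) = 2*ep*L (Suc n) + 2*ep*L (Suc n)" by simp
   ultimately show ?case using step.IH by linarith
  qed
  have "ev (%k. d n0 <= real k*(2*ep))" using ep by (intro eventually_linear) simp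
  thus ?thesis using eventually_ge_at_top[of "L n0"]
  proof eventually_elim
   case (elim k)
   obtain n where n: "n >= n0" "L n <= k" "k <= L (Suc n)" using loc[OF elim(2)] by blast
   have "4*ep*real (L n) <= 4*ep*real k" using n(2) ep by (intro mult_left_mono) auto
   moreover have "e*real k = 4*ep*real k + 2*ep*real k + real k*(2*ep)" by (simp add: ep_def)
   ultimately show ?case using st[OF n] dn[OF n(1)] elim(1) by linarith
  qed
 qed
 show "ev (%k. \<bar>g (prefix_code x k) - real k*h0\<bar> <= e*k)"
  using growth[OF e] by (simp add: cd_def)
 define H where "H = h0 + \<rho>0"
 have H: "H > 0" using pos by (simp add: H_def)
 show "ev (%k. real k*(h0 + \<rho>0 - e) <= fm om (prefix_code x k))"
 proof -
  \<comment> \<open>The bounds give \<open>(1 - 2*ep)*(H - 3*ep) >= H - e\<close>, which accounts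
    for a checkpoint that is earlier than \<open>k\<close> by a factor
    \<open>1 - 2*ep\<close>.\<close>
  define ep where "ep = min (min (1/4) (H/3)) (e/(3 + 2*H))"
  have ep: "ep > 0" using e H by (simp add: ep_def)
  have ep1: "ep <= 1/4" "3*ep <= H" "ep*(3 + 2*H) <= e"
  proof -
   have a: "ep <= 1/4" "ep <= H/3" "ep <= e/(3 + 2*H)" unfolding ep_def by linarith+
   have "3 + 2*H > 0" using H by linarith
   thus "ep <= 1/4" "3*ep <= H" "ep*(3 + 2*H) <= e" using a by (simp_all add: pos_le_divide_eq)
  qed
  obtain n0 where n0: "!!n. n >= n0 ==> \<bar>h (L n) - h0\<bar> <= ep & \<bar>\<rho> (L n) - \<rho>0\<bar> <= ep & \<bar>ze (L n)\<bar> <= ep" using conv[OF ep] by blast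
  obtain K where K: "!!k. k >= K ==> \<bar>g (cd k) - real k*h0\<bar> <= ep*k" using growth[OF ep] unfolding eventually_sequentially by blast
  have "real k*(H - e) <= fm om (cd k)" if k: "k >= max (L (Suc n0)) (2*K)" for k
  proof -
   have "L (Suc n0) <= k" using k by simp
   then obtain n where n: "n >= Suc n0" "L n <= k" "k <= L (Suc n)" using loc by blast
   have "\<exists>k0\<le>k. (1 - 2*ep)*real k <= real k0 & \<not> bad (\<rho>0 - 2*ep) om (cd k0)"
   proof (cases "(1 + 2*ze (L n))*real (L n) <= real k")
    case True
    have nn: "n >= n0" using n(1) by simp
    obtain k0 where k0: "k0 <= k" "(1 - ze (L n))*real k <= real k0" "\<not> bad (\<rho> (L n) - ze (L n)) om (cd k0)" using tb[OF True n(3)] by blast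
    have "(1 - 2*ep)*real k <= (1 - ze (L n))*real k" using n0[OF nn] ep by (intro mult_right_mono) auto
    hence "(1 - 2*ep)*real k <= real k0" using k0(2) by linarith
    moreover have "\<rho>0 - 2*ep <= \<rho> (L n) - ze (L n)" using n0[OF nn] by linarith
    ultimately show ?thesis using k0(1,3) bad_mono by blast
   next
    \<comment> \<open>Right after \<open>L n\<close> the current step offers no checkpoint; the
      endpoint \<open>L n\<close>, certified by the previous step, is close enough to
      \<open>k\<close>.\<close>
    case False
    obtain n' where n': "n = Suc n'" "n' >= n0" using n(1) by (cases n) auto
    have nn: "n >= n0" using n(1) by simp
    have "(1 + 2*ze (L n))*real (L n) <= (1 + 2*ep)*real (L n)" using n0[OF nn] by (intro mult_right_mono) auto
    hence "real k <= (1 + 2*ep)*real (L n)" using False by linarith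
    hence "(1 - 2*ep)*real k <= (1 - 2*ep)*((1 + 2*ep)*real (L n))" using ep1 by (intro mult_left_mono) auto
    also have "... = real (L n) - 4*(ep*ep*real (L n))" by (simp add: algebra_simps)
    also have "... <= real (L n)" using ep by simp
    finally have "(1 - 2*ep)*real k <= real (L n)" .
    moreover have "\<rho>0 - 2*ep <= \<rho> (L n') - ze (L n')" using n0[OF n'(2)] by linarith
    ultimately show ?thesis using n(2) tc[of n'] bad_mono unfolding n'(1) by blast
   qed
   then obtain k0 where k0: "k0 <= k" "(1 - 2*ep)*real k <= real k0" "\<not> bad (\<rho>0 - 2*ep) om (cd k0)" by blast
   have "1/2*real k <= (1 - 2*ep)*real k" using ep1 by (intro mult_right_mono) auto
   hence "real K <= real k0" using k0(2) k by simp
   hence gk: "real k0*(h0 - ep) <= g (cd k0)" using K[of k0] by (simp add: algebra_simps abs_le_iff)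
   have "g (cd k0) + (\<rho>0 - 2*ep)*real k0 <= fm om (cd k)"
    using fm_ge_not_bad[OF good _ k0(1)] k0(3) unfolding cd_def by blast
   hence "real k0*(H - 3*ep) <= fm om (cd k)" using gk by (simp add: H_def algebra_simps)
   moreover have "(1 - 2*ep)*real k*(H - 3*ep) <= real k0*(H - 3*ep)" using k0(2) ep1 by (intro mult_right_mono) auto
   moreover have "real k*(H - e) <= (1 - 2*ep)*real k*(H - 3*ep)"
   proof -
    have "H - e <= H - ep*(3 + 2*H)" using ep1 by simp
    also have "... <= (1 - 2*ep)*(H - 3*ep)" using ep by (simp add: algebra_simps)
    finally have "real k*(H - e) <= real k*((1 - 2*ep)*(H - 3*ep))" by (intro mult_left_mono) auto
    thus ?thesis by (simp add: mult_ac)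
   qed
   ultimately show ?thesis by linarith
  qed
  thus ?thesis unfolding eventually_sequentially H_def cd_def by blast
 qed
 show "\<exists>k\<ge>K. fm om (prefix_code x k) <= real k*(h0 + \<rho>0 + e)"
 proof -
  define ep where "ep = e/3"
  have ep: "ep > 0" using e by (simp add: ep_def)
  obtain n0 where n0: "!!n. n >= n0 ==> \<bar>h (L n) - h0\<bar> <= ep & \<bar>\<rho> (L n) - \<rho>0\<bar> <= ep & \<bar>ze (L n)\<bar> <= ep" using conv[OF ep] by blast
  obtain K1 where K1: "!!k. k >= K1 ==> \<bar>g (cd k) - real k*h0\<bar> <= ep*k" using growth[OF ep] unfolding eventually_sequentially by blast
  define n where "n = max n0 (max K K1)"
  define k where "k = L (Suc n)"
  have k: "k >= K" "k >= K1" using nL[of "Suc n"] by (auto simp: k_def n_def)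
  obtain v where v: "v ~= []" "p (cd k @ v) om" "g (cd k @ v) <= g (cd k) + k*(\<rho> (L n) + ze (L n))" using td[of n] unfolding k_def by blast
  have nn: "n >= n0" by (simp add: n_def)
  have "real k*(\<rho> (L n) + ze (L n)) <= real k*(\<rho>0 + 2*ep)" using n0[OF nn] by (intro mult_left_mono) auto
  moreover have "g (cd k) <= real k*h0 + ep*k" using K1[OF k(2)] by linarith
  moreover have "fm om (cd k) <= g (cd k @ v)" by (rule opt(3)[OF good v(1,2)])
  moreover have "real k*(h0 + \<rho>0 + e) = real k*h0 + ep*k + real k*(\<rho>0 + 2*ep)" by (simp add: ep_def algebra_simps)
  ultimately have "fm om (cd k) <= real k*(h0 + \<rho>0 + e)" using v(3) by linarith
  thus ?thesis using k(1) unfolding cd_def by blast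
 qed
qed

text \<open>Rational parameters approaching \<open>(h, \<rho>)\<close> are used in a diagonal order,
  so the exponents along the Cantor set converge to \<open>h\<close> and \<open>\<rho>\<close>
  exactly. For \<open>\<sigma>\<close> below the target dimension the construction starts so late
  that all tolerances are small against the gap.\<close>

lemma hdim_lower:
 fixes h \<rho> :: real
 assumes good: "good om" and h: "hmin <= h" "h <= hmax" and r: "0 <= \<rho>" "\<rho> <= HHt" and s: "0 <= Dr h + \<rho>*qt - c"
  and E: "!!x. x \<in> unit_cube ==> (!!e::real. e > 0 ==> ev (%k. \<bar>g (prefix_code x k) - real k*h\<bar> <= e*k)) ==>
   (!!e::real. e > 0 ==> ev (%k. real k*(h + \<rho> - e) <= fm om (prefix_code x k))) ==>
   (!!(e::real) K. e > 0 ==> \<exists>k\<ge>K. fm om (prefix_code x k) <= real k*(h + \<rho> + e)) ==> x \<in> E"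
 shows "ereal (Dr h + \<rho>*qt - c) <= hdim E"
proof -
 define s0 where "s0 = Dr h + \<rho>*qt - c"
 define z where "z a = inverse (real (a + 4))" for a :: nat
 have zp: "z a > 0" for a by (simp add: z_def)
 have "\<exists>q r s. q \<in> \<rat> & r \<in> \<rat> & s \<in> \<rat> & 0 <= r & r <= HHt & \<bar>T' q - h\<bar> < z a & \<bar>r - \<rho>\<bar> < z a
  & 0 <= s & s < en q + r*qt - c & s0 - 2*z a <= s" for a
 proof -
  obtain q r' where *: "q \<in> \<rat>" "r' \<in> \<rat>" "0 <= r'" "r' <= HHt" "\<bar>T' q - h\<bar> < z a" "\<bar>r' - \<rho>\<bar> < z a"
   "0 < en q + r'*qt - c" "s0 - z a < en q + r'*qt - c"
   using rational_approximation[OF h r s zp[of a]] unfolding s0_def by blast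
  have "max 0 (en q + r'*qt - c - z a) < en q + r'*qt - c" using *(7) zp[of a] by simp
  then obtain s where s: "s \<in> \<rat>" "max 0 (en q + r'*qt - c - z a) < s" "s < en q + r'*qt - c" using Rats_dense_in_real by blast
  have "0 <= s" "s0 - 2*z a <= s" using s(2) *(8) by linarith+
  thus ?thesis using * s by blast
 qed
 then obtain qa ra sa where a: "!!a. qa a \<in> \<rat>" "!!a. ra a \<in> \<rat>" "!!a. sa a \<in> \<rat>" "!!a. 0 <= ra a" "!!a. ra a <= HHt"
  "!!a. \<bar>T' (qa a) - h\<bar> < z a" "!!a. \<bar>ra a - \<rho>\<bar> < z a" "!!a. 0 <= sa a" "!!a. sa a < en (qa a) + ra a*qt - c"
  "!!a. s0 - 2*z a <= sa a" by metis
 have "\<exists>l0. \<forall>l\<ge>l0. step om (T' (qa b)) (ra b) (z b) (sa b) l" for b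
 proof -
  have "\<forall>q\<in>\<rat>. \<forall>\<rho>\<in>\<rat>. \<forall>s\<in>\<rat>. \<forall>n::nat. 0 <= \<rho> & \<rho> <= HHt & 0 <= s & s < en q + \<rho>*qt - c -->
    (\<exists>l0. \<forall>l\<ge>l0. step om (T' q) \<rho> (inverse (real (n + 4))) s l)" using good unfolding good_def by blast
  thus ?thesis using a(1-5,8,9)[of b] unfolding z_def by blast
 qed
 from diagonal_choice[of "\<lambda>b l. step om (T' (qa b)) (ra b) (z b) (sa b) l", OF this]
 obtain f l1 where f: "!!l. l >= l1 ==> step om (T' (qa (f l))) (ra (f l)) (z (f l)) (sa (f l)) l" "filterlim f at_top sequentially" by blast
 have zf: "\<exists>l2. \<forall>l\<ge>l2. z (f l) <= e" if e: "e > 0" for e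
 proof -
  obtain b where b: "inverse (real (Suc b)) < e" using reals_Archimedean[OF e] by blast
  have "ev (%l. b <= f l)" using f(2) unfolding filterlim_at_top by blast
  then obtain l2 where l2: "!!l. l >= l2 ==> b <= f l" unfolding eventually_sequentially by blast
  have "z (f l) <= e" if "l >= l2" for l
  proof -
   have "real (Suc b) <= real (f l + 4)" using l2[OF that] by linarith
   hence "z (f l) <= inverse (real (Suc b))" unfolding z_def by (intro le_imp_inverse_le) auto
   thus ?thesis using b by linarith
  qed
  thus ?thesis by blast
 qed
 have h0: "h > 0" using h(1) hmin_pos by linarith
 have main: "ereal \<sigma> <= hdim E" if sg: "\<sigma> < s0" for \<sigma> :: real
 proof -
  define ze0 :: real where "ze0 = (s0 - \<sigma>)/4"
  have z0: "ze0 > 0" using sg by (simp add: ze0_def)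
  obtain l2 where l2: "!!l. l >= l2 ==> z (f l) <= ze0" using zf[OF z0] by blast
  show ?thesis
  proof (rule construction[where ?l0.0 = "max l1 l2" and h = "\<lambda>l. T' (qa (f l))" and \<rho> = "\<lambda>l. ra (f l)" and ze = "\<lambda>l. z (f l)" and s = "\<lambda>l. sa (f l)" and ?ze0.0 = ze0 and om = om])
   show "step om (T' (qa (f l))) (ra (f l)) (z (f l)) (sa (f l)) l" if "l >= max l1 l2" for l using f(1) that by simp
   show "0 <= z (f l)" for l using zp[of "f l"] by simp
   show zl: "z (f l) <= ze0" if "l >= max l1 l2" for l using l2 that by simp
   show "\<sigma> + ze0 + z (f l) <= sa (f l)" if "l >= max l1 l2" for l
   proof -
    have "s0 = \<sigma> + 4*ze0" by (simp add: ze0_def field_simps)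
    thus ?thesis using zl[OF that] a(10)[of "f l"] by linarith
   qed
   fix x :: "real ^ 'n" and L
   assume x: "x \<in> unit_cube" and tr: "tracks om (%l. T' (qa (f l))) (%l. ra (f l)) (%l. z (f l)) (prefix_code x) L"
   have "L n < L (Suc n)" for n using tr unfolding tracks_def by blast
   hence "strict_mono L" by (simp add: strict_mono_Suc_iff)
   hence nL: "n <= L n" for n by (rule strict_mono_imp_increasing)
   have conv: "\<exists>n0. \<forall>n\<ge>n0. \<bar>T' (qa (f (L n))) - h\<bar> <= e & \<bar>ra (f (L n)) - \<rho>\<bar> <= e & \<bar>z (f (L n))\<bar> <= e" if e: "e > 0" for e
   proof -
    obtain l3 where l3: "!!l. l >= l3 ==> z (f l) <= e" using zf[OF e] by blast
    have "\<bar>T' (qa (f (L n))) - h\<bar> <= e & \<bar>ra (f (L n)) - \<rho>\<bar> <= e & \<bar>z (f (L n))\<bar> <= e" if "n >= l3" for n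
    proof -
     have "z (f (L n)) <= e" using l3 nL[of n] that by simp
     thus ?thesis using a(6,7)[of "f (L n)"] zp[of "f (L n)"] by linarith
    qed
    thus ?thesis by blast
   qed
   note tl = tracks_limits[OF good tr conv h0 r(1)]
   show "x \<in> E" by (rule E[OF x tl(1) tl(2) tl(3)])
  qed
 qed
 have "ereal s0 <= hdim E"
 proof (rule ccontr)
  assume "\<not> ?thesis"
  hence "hdim E < ereal s0" by simp
  then obtain y where y: "hdim E < y" "y < ereal s0" using dense by blast
  then obtain \<sigma> where "y = ereal \<sigma>" by (cases y) auto
  thus False using main[of \<sigma>] y by simp
 qed
 thus ?thesis by (simp add: s0_def)
qed

section \<open>The spectra of the random capacity\<close>

lemma hdim_lowerE:
 assumes good: "good om"
 shows "hdim (lowerE (cap om) H) = legendre F H"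
proof (rule antisym)
 show "hdim (lowerE (cap om) H) <= legendre F H"
  using lowerE_close[OF good] by (intro hdim_upper[OF good]) (auto simp: lowerE_def)
 show "legendre F H <= hdim (lowerE (cap om) H)"
 proof (cases "Hl <= H & H <= hmax + HHt")
  case True
  obtain h r where hr: "H = h + r" "hmin <= h" "h <= hmax" "0 <= r" "r <= HHt" "0 <= Dr h + r*qt - c"
   "legendre F H = ereal (Dr h + r*qt - c)"
   using level_split[OF conjunct1[OF True] conjunct2[OF True]] by metis
  show ?thesis unfolding hr(7)
  proof (rule hdim_lower[OF good hr(2-6)])
   fix x :: "real ^ 'n"
   assume x: "x \<in> unit_cube"
    and ge: "!!e::real. e > 0 ==> ev (%k. real k*(h + r - e) <= fm om (prefix_code x k))"
    and le: "!!(e::real) K. e > 0 ==> \<exists>k\<ge>K. fm om (prefix_code x k) <= real k*(h + r + e)"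
   have "liminf (%k. ereal (fm om (prefix_code x k)/real k)) = ereal H"
   proof (rule liminf_ereal_eqI)
    fix e :: real assume e: "e > 0"
    show "ev (%k. H - e <= fm om (prefix_code x k)/real k)"
     using ge[OF e] eventually_gt_at_top[of 0]
     by eventually_elim (simp add: hr(1) pos_le_divide_eq mult.commute)
    fix K
    obtain k where k: "k >= max K 1" "fm om (prefix_code x k) <= real k*(h + r + e)" using le[OF e] by blast
    hence "fm om (prefix_code x k)/real k <= H + e" by (simp add: hr(1) pos_divide_le_eq mult.commute)
    thus "\<exists>k\<ge>K. fm om (prefix_code x k)/real k <= H + e" using k(1) by (intro exI[of _ k]) auto
   qed
   thus "x \<in> lowerE (cap om) H" using x unfolding lowerE_def lower_dim_def local_quotient[OF good] by simp
  qed
 next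
  case False
  thus ?thesis using LF_below[of H] LF_above[of H] by auto
 qed
qed

text \<open>In this range the split has \<open>r = HHt\<close>, the largest cost, and
  \<open>fm_upper\<close> bounds \<open>fm\<close> from above at every large scale. So on the same
  Cantor sets the limit exists, and lower and upper local dimensions agree.\<close>

lemma hdim_levelE:
 assumes good: "good om" and H: "H >= Ht + HHt"
 shows "hdim (levelE (cap om) H) = legendre F H" "hdim (upperE (cap om) H) = legendre F H"
proof -
 have u: "hdim (levelE (cap om) H) <= legendre F H" "hdim (upperE (cap om) H) <= legendre F H"
  using upperE_close[OF good] by (intro hdim_upper[OF good]; auto simp: levelE_def upperE_def lowerE_def)+
 have l: "legendre F H <= hdim S" if S: "S = levelE (cap om) H \<or> S = upperE (cap om) H" for S
 proof (cases "H <= hmax + HHt")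
  case True
  have "Hl <= H" using H Hl_less_Ht HHt_pos by linarith
  then obtain h r where hr: "H = h + r" "hmin <= h" "h <= hmax" "0 <= r" "r <= HHt" "0 <= Dr h + r*qt - c"
   "legendre F H = ereal (Dr h + r*qt - c)" "r = HHt"
   using level_split[of H] True H by metis
  show ?thesis unfolding hr(7)
  proof (rule hdim_lower[OF good hr(2-6)])
   fix x :: "real ^ 'n"
   assume x: "x \<in> unit_cube"
    and gh: "!!e::real. e > 0 ==> ev (%k. \<bar>g (prefix_code x k) - real k*h\<bar> <= e*k)"
    and ge: "!!e::real. e > 0 ==> ev (%k. real k*(h + r - e) <= fm om (prefix_code x k))"
   have "(%k. fm om (prefix_code x k)/real k) \<longlonglongrightarrow> H"
   proof (rule tendstoI)
    fix e :: real assume e: "e > 0"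
    hence e3: "e/3 > 0" by simp
    show "ev (%k. dist (fm om (prefix_code x k)/real k) H < e)"
     using gh[OF e3] ge[OF e3] fm_upper[OF good e3] eventually_gt_at_top[of 0]
    proof eventually_elim
     case (elim k)
     have k: "real k > 0" using elim(4) by simp
     have "fm om (prefix_code x k) <= g (prefix_code x k) + real k*(HHt + e/3)" using elim(3) prefix_code_words by blast
     moreover have "g (prefix_code x k) <= real k*h + e/3*k" using elim(1) by linarith
     moreover have "real k*(H + 2*(e/3)) = real k*h + e/3*k + real k*(HHt + e/3)" by (simp add: hr(1,8) algebra_simps)
     ultimately have "fm om (prefix_code x k) <= real k*(H + 2*(e/3))" by linarith
     moreover have "real k*(H - e/3) <= fm om (prefix_code x k)" using elim(2) by (simp add: hr(1))
     ultimately have "fm om (prefix_code x k)/real k <= H + 2*(e/3)" "H - e/3 <= fm om (prefix_code x k)/real k"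
      using k by (simp_all add: pos_divide_le_eq pos_le_divide_eq mult.commute)
     thus ?case unfolding dist_real_def using e by linarith
    qed
   qed
   hence lim: "(%k. ereal (fm om (prefix_code x k)/real k)) \<longlonglongrightarrow> ereal H" by (rule tendsto_ereal)
   have "lower_dim (cap om) x = ereal H" "upper_dim (cap om) x = ereal H"
    unfolding lower_dim_def upper_dim_def local_quotient[OF good]
    by (rule lim_imp_Liminf[OF _ lim] lim_imp_Limsup[OF _ lim]; simp)+
   thus "x \<in> S" using x S by (auto simp: levelE_def lowerE_def upperE_def)
  qed
 next
  case False
  thus ?thesis using LF_above[of H] by simp
 qed
 show "hdim (levelE (cap om) H) = legendre F H" "hdim (upperE (cap om) H) = legendre F H"
  using u l by (simp_all add: antisym)
qed

section \<open>Translation into the quantities of the statement\<close>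

abbreviation mu :: "'n word => real" where "mu \<equiv> (%w. 2 powr (- g w))"

lemma tau_cap_mu: "tau_cap mu = T"
proof
 fix q
 have "tau_j mu j q = - (log 2 (Z q j)/real j)" for j
  unfolding tau_j_def Z_def W_def by (simp add: powr_powr mult.commute)
 moreover have "(%j. - (log 2 (Z q j)/real j)) \<longlonglongrightarrow> - (- T q)" by (intro tendsto_minus log_Z(1))
 ultimately have "(%j. tau_j mu j q) \<longlonglongrightarrow> T q" by simp
 hence "(%j. ereal (tau_j mu j q)) \<longlonglongrightarrow> ereal (T q)" by (rule tendsto_ereal)
 hence "liminf (%j. ereal (tau_j mu j q)) = ereal (T q)" by (intro lim_imp_Liminf) auto
 thus "tau_cap mu q = T q" by (simp add: tau_cap_def)
qed

lemma tau_cap_cap: "good om ==> tau_cap (cap om) = F"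
proof
 fix q assume good: "good om"
 have "(%j. ereal (tau_j (cap om) j q)) \<longlonglongrightarrow> ereal (F q)" by (rule tendsto_ereal[OF tau_j_lim[OF good]])
 hence "liminf (%j. ereal (tau_j (cap om) j q)) = ereal (F q)" by (intro lim_imp_Liminf) auto
 thus "tau_cap (cap om) q = F q" by (simp add: tau_cap_def)
qed

lemma Dspec_mu: "Dspec mu H = legendre T H"
 by (simp add: Dspec_def tau_cap_mu)

lemma Dreal_mu: "Dreal mu = Dr"
 by (rule ext) (simp add: Dreal_def Dspec_mu Dr_def)

lemma Hmin_mu: "Hmin mu = hmin"
 unfolding Hmin_def tau_cap_mu deriv_T by (rule tendsto_Lim[OF _ T'_lim_top]) simp

lemma Hmax_mu: "Hmax mu = hmax"
 unfolding Hmax_def tau_cap_mu deriv_T by (rule tendsto_Lim[OF _ T'_lim_bot]) simp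

lemma exponents_mu: "H_ell mu c = Hl" "q_ell mu c = ql" "H_tilde mu c = Ht" "q_tilde mu c = qt" "Htilde_tilde mu c = HHt"
proof -
 show 1: "H_ell mu c = Hl" unfolding H_ell_def Dspec_mu Hl_def ..
 show "q_ell mu c = ql" unfolding q_ell_def 1 Hmin_mu Dreal_mu ql_def ..
 show 2: "H_tilde mu c = Ht" unfolding H_tilde_def Hmin_mu Hmax_mu Dreal_mu by (rule Ht_the)
 show 3: "q_tilde mu c = qt" unfolding q_tilde_def 2 Dreal_mu by (rule deriv_Dr_Ht)
 show "Htilde_tilde mu c = HHt" unfolding Htilde_tilde_def 3 tau_cap_mu HHt_def using qt by simp
qed

lemma AE_spectra:
 "AE om in P.
  (let M = Mcap mu (%w. p w om);
     Hl = H_ell mu c; ql = q_ell mu c;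
     Ht = H_tilde mu c; qt = q_tilde mu c; HHt = Htilde_tilde mu c
   in
   (\<forall>H::real.
     (Hl <= H & H <= Ht --> hdim (lowerE M H) = Dspec mu H - ereal c) \<and>
     (Ht <= H & H <= Ht + HHt --> hdim (lowerE M H) = ereal (qt*H)) \<and>
     (Ht + HHt <= H & H <= Hmax mu + HHt --> hdim (lowerE M H) = Dspec mu (H - HHt)) \<and>
     (\<not> (Hl <= H & H <= Ht) & \<not> (Ht <= H & H <= Ht + HHt) \<and>
     \<not> (Ht + HHt <= H & H <= Hmax mu + HHt) --> hdim (lowerE M H) = - \<infinity>))
   \<and>
   (\<forall>q::real. (%j. tau_j M j q) \<longlonglongrightarrow> tau_cap M q)
   & (\<forall>H::real. hdim (lowerE M H) = legendre (tau_cap M) H)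
   & (\<forall>q::real.
      (q <= qt --> tau_cap M q = tau_cap mu q + HHt*q) \<and>
      (ereal qt < ereal q & ereal q < ql --> tau_cap M q = tau_cap mu q + c) \<and>
      (ql < \<infinity> & ereal q >= ql --> tau_cap M q = Hl*q))
   \<and>
   (\<forall>H::real. H >= Ht + HHt -->
     hdim (levelE M H) = hdim (upperE M H) \<and>
     hdim (levelE M H) = (if H <= Hmax mu + HHt then Dspec mu (H - HHt) else - \<infinity>)))"
 using AE_good
proof eventually_elim
 case (elim om)
 have F3: "F q = Hl*q" if "ql <= ereal q" for q
 proof -
  have "ereal qt < ereal q" using qt_less_ql that by (rule less_le_trans)
  moreover have "\<not> ereal q < ql" using that by (simp only: not_less)
  ultimately show ?thesis by (simp add: F_def)
 qed
 show ?case
  unfolding Let_def exponents_mu Hmax_mu Dspec_mu tau_cap_mu tau_cap_cap[OF elim] hdim_lowerE[OF elim]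
 proof (intro conjI allI impI; (elim conjE)?)
  fix H
  show "legendre F H = legendre T H - ereal c" if "Hl <= H" "H <= Ht" using LF_1[OF that] .
  show "legendre F H = ereal (qt*H)" if "Ht <= H" "H <= Ht + HHt" using LF_2[OF that] .
  show "legendre F H = legendre T (H - HHt)" if "Ht + HHt <= H" "H <= hmax + HHt" using LF_3[OF that] .
  show "legendre F H = - \<infinity>" if "\<not> (Hl <= H & H <= Ht)" "\<not> (Ht <= H & H <= Ht + HHt)" "\<not> (Ht + HHt <= H & H <= hmax + HHt)"
  proof -
   have "H < Hl \<or> hmax + HHt < H" using that Hl_less_Ht HHt_pos by linarith
   thus ?thesis using LF_below LF_above by blast
  qed
  show "hdim (levelE (cap om) H) = hdim (upperE (cap om) H)" if "Ht + HHt <= H"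
   using hdim_levelE[OF elim that] by simp
  show "hdim (levelE (cap om) H) = (if H <= hmax + HHt then legendre T (H - HHt) else - \<infinity>)" if "Ht + HHt <= H"
   using hdim_levelE(1)[OF elim that] LF_3[OF that] LF_above[of H] by simp
 next
  fix q
  show "(%j. tau_j (cap om) j q) \<longlonglongrightarrow> F q" by (rule tau_j_lim[OF elim])
  show "F q = T q + HHt*q" if "q <= qt" using that by (simp add: F_def)
  show "F q = T q + c" if "ereal qt < ereal q" "ereal q < ql" using that by (simp add: F_def)
  show "F q = Hl*q" if "ql <= ereal q" using F3[OF that] .
 qed (rule refl)
qed

end

theorem theorem2:
  fixes \<psi> :: "'n::finite iword \<Rightarrow> real"
    and \<nu> :: "'n iword measure"
    and K \<alpha> \<beta> \<eta> :: real
    and P :: "'w measure"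
    and p :: "'n word \<Rightarrow> 'w \<Rightarrow> bool"
  defines "\<mu> \<equiv> gibbs_cap \<nu> K \<alpha> \<beta>"
    and "c \<equiv> real CARD('n) * (1 - \<eta>)"
  assumes holder: "holder_continuous \<psi>"
    and gibbs: "gibbs_measure \<psi> \<nu>"
    and K_pos: "K > 0"
    and ab: "\<alpha> \<ge> 0" "\<beta> \<ge> 0" "(\<alpha>, \<beta>) \<noteq> (0, 0)"
    and nonhom: "\<alpha> > 0" "\<not> cohomologous_to_const \<psi>"
    and eta: "0 < \<eta>" "\<eta> < 1"
    and samp: "sampling P p \<eta>"
  shows "AE \<omega> in P.
    (let M = Mcap \<mu> (\<lambda>w. p w \<omega>);
         Hl = H_ell \<mu> c; ql = q_ell \<mu> c;
         Ht = H_tilde \<mu> c; qt = q_tilde \<mu> c; HHt = Htilde_tilde \<mu> c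
     in
      (\<forall>H::real.
         (Hl \<le> H \<and> H \<le> Ht \<longrightarrow> hdim (lowerE M H) = Dspec \<mu> H - ereal c) \<and>
         (Ht \<le> H \<and> H \<le> Ht + HHt \<longrightarrow> hdim (lowerE M H) = ereal (qt * H)) \<and>
         (Ht + HHt \<le> H \<and> H \<le> Hmax \<mu> + HHt \<longrightarrow> hdim (lowerE M H) = Dspec \<mu> (H - HHt)) \<and>
         (\<not> (Hl \<le> H \<and> H \<le> Ht) \<and> \<not> (Ht \<le> H \<and> H \<le> Ht + HHt) \<and>
          \<not> (Ht + HHt \<le> H \<and> H \<le> Hmax \<mu> + HHt) \<longrightarrow> hdim (lowerE M H) = - \<infinity>))
      \<and>
      (\<forall>q::real. (\<lambda>j. tau_j M j q) \<longlonglongrightarrow> tau_cap M q)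
      \<and> (\<forall>H::real. hdim (lowerE M H) = legendre (tau_cap M) H)
      \<and> (\<forall>q::real.
           (q \<le> qt \<longrightarrow> tau_cap M q = tau_cap \<mu> q + HHt * q) \<and>
           (ereal qt < ereal q \<and> ereal q < ql \<longrightarrow> tau_cap M q = tau_cap \<mu> q + c) \<and>
           (ql < \<infinity> \<and> ereal q \<ge> ql \<longrightarrow> tau_cap M q = Hl * q))
      \<and>
      (\<forall>H::real. H \<ge> Ht + HHt \<longrightarrow>
         hdim (levelE M H) = hdim (upperE M H) \<and>
         hdim (levelE M H) = (if H \<le> Hmax \<mu> + HHt then Dspec \<mu> (H - HHt) else - \<infinity>)))"
proof -
 obtain g :: "'n word => real" and c0 \<delta> G :: real where g: "quasi_additive g c0 \<delta> G"
  "!!(H::real) B. \<exists>w. \<bar>g w - H*length w\<bar> > B" "gibbs_cap \<nu> K \<alpha> \<beta> = (%w. 2 powr (- g w))"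
  using gibbs_quasi_additive[OF holder gibbs K_pos nonhom(1) ab(2) nonhom(2)] by blast
 interpret st: sampled_tree g c0 \<delta> G P p \<eta>
  using g(1,2) eta samp by (intro sampled_tree.intro sampled_tree_axioms.intro)
 show ?thesis
  unfolding \<mu>_def c_def g(3) st.c_def[symmetric] by (rule st.AE_spectra)
qed

end
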